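(* Let $m\ge 2$ be an integer. Let $f:Y\to\mathbb{P}^2$ be the blow up at the $3m+3$ points of the set $Z(F_{m,3})$, let $H=f^*\mathcal{O}_{\mathbb{P}^2}(1)$, and let $\mathbb{E}$ be the union (sum) of all exceptional divisors of $f$. Then the linear system $L=(m+2)H-\mathbb{E}$ is base point free and defines a morphism birational onto its image $$\varphi_L:Y\to X\subset\mathbb{P}^N,\qquad N=\tfrac12(m^2+m)+2,$$ which is an isomorphism away from the proper transforms of the coordinate lines $x=0$, $y=0$, $z=0$.
   Context: We work over $\mathbb{C}$. Let $F_{m,0}=(x^m-y^m)(y^m-z^m)(z^m-x^m)$ and $F_{m,3}=xyz\,F_{m,0}$. $Z(F_{m,3})\subset\mathbb{P}^2$ is the set of $3m+3$ points dual to the linear factors of $F_{m,3}$, where the point $(p:q:r)$ is dual to the line $px+qy+rz=0$. Explicitly, if $\varepsilon$ is a primitive $m$-th root of unity, $Z(F_{m,3})$ consists of the three coordinate points together with the points $(0:1:-\varepsilon^\alpha)$, $(1:0:-\varepsilon^\alpha)$, $(1:-\varepsilon^\alpha:0)$ for $\alpha=0,\dots,m-1$. *)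

theory Defs
  imports "HOL-Analysis.Analysis" "HOL-Library.Function_Algebras"
begin

section \<open>Projective spaces and homogeneous polynomials over the complex numbers\<close>

text \<open>A vector of \<open>\<complex>\<^sup>n\<^sup>+\<^sup>1\<close> is a function on \<open>nat\<close> that vanishes above \<open>n\<close>. A point of
  projective space is the set of its homogeneous coordinate vectors, so that
  \<open>v \<in> p\<close> reads ``\<open>v\<close> represents \<open>p\<close>''.\<close>

type_synonym cvec = "nat \<Rightarrow> complex"
type_synonym ppoint = "cvec set"

definition nonzero_vecs :: "nat \<Rightarrow> cvec set" where
  "nonzero_vecs n = {v. (\<forall>i>n. v i = 0) \<and> v \<noteq> (\<lambda>_. 0)}"

definition pt :: "cvec \<Rightarrow> ppoint" where
  "pt v = {(\<lambda>i. c * v i) | c. c \<noteq> 0}"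

definition PP :: "nat \<Rightarrow> ppoint set" where
  "PP n = pt ` nonzero_vecs n"

text \<open>Polynomials are represented by the functions they induce, which is harmless over the
  infinite field of complex numbers.\<close>

definition exponents :: "nat \<Rightarrow> nat \<Rightarrow> (nat \<Rightarrow> nat) set" where
  "exponents n d = {a. (\<forall>i>n. a i = 0) \<and> (\<Sum>i\<le>n. a i) = d}"

definition form :: "nat \<Rightarrow> nat \<Rightarrow> (cvec \<Rightarrow> complex) \<Rightarrow> bool" where
  "form n d F \<longleftrightarrow>
     (\<exists>c. F = (\<lambda>v. \<Sum>a\<in>exponents n d. c a * (\<Prod>i\<le>n. v i ^ a i)))"

text \<open>Multihomogeneous polynomials of multidegree \<open>d\<close> in blocks of variables indexed by \<open>I\<close>,
  the block \<open>i\<close> having \<open>n i + 1\<close> variables: elements of the tensor product of the spaces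
  of forms of degree \<open>d i\<close> in the block \<open>i\<close>.\<close>

definition multiform ::
  "'i set \<Rightarrow> ('i \<Rightarrow> nat) \<Rightarrow> ('i \<Rightarrow> nat) \<Rightarrow> (('i \<Rightarrow> cvec) \<Rightarrow> complex) \<Rightarrow> bool" where
  "multiform I n d F \<longleftrightarrow>
     (\<exists>(K::nat) A. (\<forall>k<K. \<forall>i\<in>I. form (n i) (d i) (A k i)) \<and>
                   F = (\<lambda>V. \<Sum>k<K. \<Prod>i\<in>I. A k i (V i)))"


section \<open>Subsets of products of projective spaces as spaces with regular functions\<close>

text \<open>A subset \<open>points X\<close> of the product of the projective spaces of dimension \<open>pdim X i\<close>
  for \<open>i \<in> blocks X\<close> (a finite set). All sets used below are locally closed, and they carry
  the induced reduced structure.\<close>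

record 'i variety =
  blocks :: "'i set"
  pdim :: "'i \<Rightarrow> nat"
  points :: "('i \<Rightarrow> ppoint) set"

definition proj_space :: "nat \<Rightarrow> unit variety" where
  "proj_space n = \<lparr>blocks = UNIV, pdim = (\<lambda>_. n), points = UNIV \<rightarrow>\<^sub>E PP n\<rparr>"

definition subvar :: "'i variety \<Rightarrow> ('i \<Rightarrow> ppoint) set \<Rightarrow> 'i variety" where
  "subvar X U = X\<lparr>points := U\<rparr>"

text \<open>The families of homogeneous coordinate vectors of the points of \<open>U\<close>.\<close>

definition cone :: "'i variety \<Rightarrow> ('i \<Rightarrow> ppoint) set \<Rightarrow> ('i \<Rightarrow> cvec) set" where
  "cone X U = (\<Union>x\<in>U. Pi\<^sub>E (blocks X) x)"

text \<open>The Zariski topology; the generating sets are closed under finite intersections, since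
  multihomogeneous polynomials can be multiplied.\<close>

definition zariski :: "'i variety \<Rightarrow> ('i \<Rightarrow> ppoint) topology" where
  "zariski X = topology_generated_by
     {{x \<in> points X. \<forall>V\<in>Pi\<^sub>E (blocks X) x. F V \<noteq> 0} | F d. multiform (blocks X) (pdim X) d F}"

definition regular ::
  "'i variety \<Rightarrow> ('i \<Rightarrow> ppoint) set \<Rightarrow> (('i \<Rightarrow> ppoint) \<Rightarrow> complex) \<Rightarrow> bool" where
  "regular X U f \<longleftrightarrow>
     (\<forall>x\<in>U. \<exists>W d F G. openin (zariski X) W \<and> x \<in> W \<and> W \<subseteq> U \<and>
        multiform (blocks X) (pdim X) d F \<and> multiform (blocks X) (pdim X) d G \<and>
        (\<forall>y\<in>W. \<forall>V\<in>Pi\<^sub>E (blocks X) y. G V \<noteq> 0 \<and> f y = F V / G V))"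

definition morphism ::
  "'i variety \<Rightarrow> 'j variety \<Rightarrow> (('i \<Rightarrow> ppoint) \<Rightarrow> ('j \<Rightarrow> ppoint)) \<Rightarrow> bool" where
  "morphism X X' \<phi> \<longleftrightarrow>
     continuous_map (zariski X) (zariski X') \<phi> \<and>
     (\<forall>x\<in>points X. \<phi> x \<in> points X') \<and>
     (\<forall>U f. openin (zariski X') U \<and> regular X' U f \<longrightarrow>
        regular X {x \<in> points X. \<phi> x \<in> U} (f \<circ> \<phi>))"

definition isomorphism ::
  "'i variety \<Rightarrow> 'j variety \<Rightarrow> (('i \<Rightarrow> ppoint) \<Rightarrow> ('j \<Rightarrow> ppoint)) \<Rightarrow> bool" where
  "isomorphism X X' \<phi> \<longleftrightarrow>
     morphism X X' \<phi> \<and>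
     (\<exists>\<psi>. morphism X' X \<psi> \<and>
        (\<forall>x\<in>points X. \<psi> (\<phi> x) = x) \<and> (\<forall>x\<in>points X'. \<phi> (\<psi> x) = x))"

definition image_var ::
  "'i variety \<Rightarrow> 'j variety \<Rightarrow> (('i \<Rightarrow> ppoint) \<Rightarrow> ('j \<Rightarrow> ppoint)) \<Rightarrow> 'j variety" where
  "image_var X P \<phi> = subvar P (\<phi> ` points X)"

definition dense_open :: "'i variety \<Rightarrow> ('i \<Rightarrow> ppoint) set \<Rightarrow> bool" where
  "dense_open X U \<longleftrightarrow> openin (zariski X) U \<and> zariski X closure_of U = points X"

definition birational_morphism ::
  "'i variety \<Rightarrow> 'j variety \<Rightarrow> (('i \<Rightarrow> ppoint) \<Rightarrow> ('j \<Rightarrow> ppoint)) \<Rightarrow> bool" where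
  "birational_morphism X X' \<phi> \<longleftrightarrow>
     morphism X X' \<phi> \<and>
     (\<exists>U U'. dense_open X U \<and> dense_open X' U' \<and>
        isomorphism (subvar X U) (subvar X' U') \<phi>)"

definition isomorphism_away_from ::
  "'i variety \<Rightarrow> 'j variety \<Rightarrow> (('i \<Rightarrow> ppoint) \<Rightarrow> ('j \<Rightarrow> ppoint)) \<Rightarrow> ('i \<Rightarrow> ppoint) set \<Rightarrow> bool" where
  "isomorphism_away_from X X' \<phi> C \<longleftrightarrow>
     openin (zariski X) (points X - C) \<and> openin (zariski X') (points X' - \<phi> ` C) \<and>
     isomorphism (subvar X (points X - C)) (subvar X' (points X' - \<phi> ` C)) \<phi>"


section \<open>Line bundles, linear systems and their maps\<close>

text \<open>Sections over \<open>U\<close> of the restriction to \<open>X\<close> of the line bundle \<open>\<O>(e)\<close> of multidegree \<open>e\<close>: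
  functions of the homogeneous coordinates that are locally quotients of multihomogeneous
  polynomials whose multidegrees differ by \<open>e\<close>. They are set to \<open>0\<close> off the cone over \<open>U\<close>
  so that a section is determined as a function.\<close>

type_synonym 'i sect = "('i \<Rightarrow> cvec) \<Rightarrow> complex"

definition twist ::
  "'i variety \<Rightarrow> ('i \<Rightarrow> nat) \<Rightarrow> ('i \<Rightarrow> ppoint) set \<Rightarrow> 'i sect set" where
  "twist X e U = {s. (\<forall>V. V \<notin> cone X U \<longrightarrow> s V = 0) \<and>
     (\<forall>x\<in>U. \<exists>W d F G. openin (zariski X) W \<and> x \<in> W \<and> W \<subseteq> U \<and>
        multiform (blocks X) (pdim X) (\<lambda>i. d i + e i) F \<and> multiform (blocks X) (pdim X) d G \<and>
        (\<forall>V\<in>cone X W. G V \<noteq> 0 \<and> s V = F V / G V))}"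

text \<open>In the following, \<open>L\<close> assigns to each open set the sections of a line bundle (a subsheaf
  of a twisted sheaf). The relation \<open>quotient_on X W s e g\<close> says \<open>s = g e\<close> on \<open>W\<close> with \<open>g\<close> regular.\<close>

definition quotient_on ::
  "'i variety \<Rightarrow> ('i \<Rightarrow> ppoint) set \<Rightarrow> 'i sect \<Rightarrow> 'i sect \<Rightarrow> (('i \<Rightarrow> ppoint) \<Rightarrow> complex) \<Rightarrow> bool" where
  "quotient_on X W s e g \<longleftrightarrow>
     regular X W g \<and> (\<forall>y\<in>W. \<forall>V\<in>Pi\<^sub>E (blocks X) y. s V = g y * e V)"

text \<open>A local frame: multiplication by \<open>e\<close> is an isomorphism from the structure sheaf of \<open>W\<close> to the
  restriction of \<open>L\<close> to \<open>W\<close>.\<close>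

definition frame ::
  "'i variety \<Rightarrow> (('i \<Rightarrow> ppoint) set \<Rightarrow> 'i sect set) \<Rightarrow> ('i \<Rightarrow> ppoint) set \<Rightarrow> 'i sect \<Rightarrow> bool" where
  "frame X L W e \<longleftrightarrow> openin (zariski X) W \<and> e \<in> L W \<and>
     (\<forall>W'. openin (zariski X) W' \<and> W' \<subseteq> W \<longrightarrow>
        (\<forall>t\<in>L W'. \<exists>g. quotient_on X W' t e g) \<and>
        (\<forall>g. quotient_on X W' (\<lambda>_. 0) e g \<longrightarrow> (\<forall>y\<in>W'. g y = 0)))"

definition base_point_free ::
  "'i variety \<Rightarrow> (('i \<Rightarrow> ppoint) set \<Rightarrow> 'i sect set) \<Rightarrow> bool" where
  "base_point_free X L \<longleftrightarrow>
     (\<forall>x\<in>points X. \<exists>s\<in>L (points X). \<exists>W e g.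
        x \<in> W \<and> frame X L W e \<and> quotient_on X W s e g \<and> g x \<noteq> 0)"

global_interpretation cfun: vector_space "\<lambda>(c::complex) (s::'a \<Rightarrow> complex) V. c * s V"
  by unfold_locales (auto simp: algebra_simps)

definition section_basis ::
  "'i variety \<Rightarrow> (('i \<Rightarrow> ppoint) set \<Rightarrow> 'i sect set) \<Rightarrow> nat \<Rightarrow> (nat \<Rightarrow> 'i sect) \<Rightarrow> bool" where
  "section_basis X L N s \<longleftrightarrow> inj_on s {..N} \<and> cfun.independent (s ` {..N}) \<and>
     cfun.span (s ` {..N}) = L (points X)"

text \<open>The map \<open>x \<mapsto> (s\<^sub>0(x) : \<dots> : s\<^sub>N(x))\<close>, the values being taken with respect to a frame of \<open>L\<close>
  near \<open>x\<close>. Letting the frame vary produces exactly all homogeneous coordinate vectors of one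
  point, provided that not all \<open>s\<^sub>j\<close> vanish at \<open>x\<close>.\<close>

definition linear_system_map ::
  "'i variety \<Rightarrow> (('i \<Rightarrow> ppoint) set \<Rightarrow> 'i sect set) \<Rightarrow> nat \<Rightarrow> (nat \<Rightarrow> 'i sect) \<Rightarrow>
     ('i \<Rightarrow> ppoint) \<Rightarrow> (unit \<Rightarrow> ppoint)" where
  "linear_system_map X L N s x = (\<lambda>_. {(\<lambda>j. if j \<le> N then g j x else 0) | W e g.
     x \<in> W \<and> frame X L W e \<and> (\<forall>j\<le>N. quotient_on X W (s j) e (g j))})"


section \<open>Blowing up the projective plane at finitely many points\<close>

text \<open>A line \<open>p x + q y + r z = 0\<close> is the point \<open>(p : q : r)\<close> of the dual plane, again written as an
  element of \<open>PP 2\<close>.\<close>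

definition on_line :: "ppoint \<Rightarrow> ppoint \<Rightarrow> bool" where
  "on_line p l \<longleftrightarrow> (\<forall>v\<in>p. \<forall>w\<in>l. (\<Sum>i\<le>2. w i * v i) = 0)"

text \<open>The blow-up of the plane at \<open>p\<close> is the variety of pairs of a point \<open>x\<close> and a line through \<open>p\<close>
  and \<open>x\<close>; the blow-up at a finite set \<open>S\<close> is the fibre product over the plane of the blow-ups
  at its elements. The block \<open>None\<close> holds the point of the plane, the block \<open>Some p\<close> the line
  through \<open>p\<close>.\<close>

definition blowup :: "ppoint set \<Rightarrow> ppoint option variety" where
  "blowup S = \<lparr>blocks = insert None (Some ` S), pdim = (\<lambda>_. 2),
     points = {y \<in> insert None (Some ` S) \<rightarrow>\<^sub>E PP 2.
                 \<forall>p\<in>S. on_line p (y (Some p)) \<and> on_line (y None) (y (Some p))}\<rparr>"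

definition blowdown :: "(ppoint option \<Rightarrow> ppoint) \<Rightarrow> ppoint" where
  "blowdown y = y None"

definition exceptional :: "ppoint set \<Rightarrow> (ppoint option \<Rightarrow> ppoint) set" where
  "exceptional S = {y \<in> points (blowup S). blowdown y \<in> S}"

definition proper_transform :: "ppoint set \<Rightarrow> ppoint set \<Rightarrow> (ppoint option \<Rightarrow> ppoint) set" where
  "proper_transform S C =
     zariski (blowup S) closure_of {y \<in> points (blowup S). blowdown y \<in> C - S}"

text \<open>The line bundle \<open>dH - E\<close>, where \<open>H\<close> is the pullback of \<open>\<O>(1)\<close> and \<open>E\<close> is the sum of the
  exceptional divisors. The pullback of \<open>\<O>(d)\<close> is the restriction of \<open>\<O>(d, 0, \<dots>, 0)\<close>; as \<open>E\<close> is
  reduced, twisting by the ideal sheaf \<open>\<O>(-E)\<close> means passing to the sections vanishing on \<open>E\<close>.\<close>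

definition dH_minus_E ::
  "ppoint set \<Rightarrow> nat \<Rightarrow> (ppoint option \<Rightarrow> ppoint) set \<Rightarrow> ppoint option sect set" where
  "dH_minus_E S d U =
     {s \<in> twist (blowup S) (\<lambda>i. if i = None then d else 0) U.
        \<forall>V\<in>cone (blowup S) (exceptional S \<inter> U). s V = 0}"


section \<open>The Fermat-type arrangements\<close>

definition F0 :: "nat \<Rightarrow> cvec \<Rightarrow> complex" where
  "F0 m v = (v 0 ^ m - v 1 ^ m) * (v 1 ^ m - v 2 ^ m) * (v 2 ^ m - v 0 ^ m)"

definition F3 :: "nat \<Rightarrow> cvec \<Rightarrow> complex" where
  "F3 m v = v 0 * v 1 * v 2 * F0 m v"

text \<open>The points dual to the linear factors of a homogeneous polynomial in three variables.\<close>

definition dual_points :: "(cvec \<Rightarrow> complex) \<Rightarrow> ppoint set" where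
  "dual_points F = {pt w | w. w \<in> nonzero_vecs 2 \<and>
     (\<exists>k G. form 2 k G \<and> F = (\<lambda>v. (\<Sum>i\<le>2. w i * v i) * G v))}"

definition coordinate_line :: "nat \<Rightarrow> ppoint set" where
  "coordinate_line i = {pt v | v. v \<in> nonzero_vecs 2 \<and> v i = 0}"

end

theory Submission
  imports Defs "HOL-Computational_Algebra.Fundamental_Theorem_Algebra"
begin

text \<open>Write \<open>E\<close> for the sum of the exceptional curves. Sections of \<open>dH - E\<close> are functions on the
  plane minus \<open>S\<close> that are regular, hence polynomial on every line missing \<open>S\<close>; interpolation makes
  them forms of degree \<open>d\<close> vanishing on \<open>S\<close>. For \<open>d = m + 2\<close>, every coordinate line contains
  \<open>m + 2\<close> points of \<open>S\<close>, so such a form restricts to it as a multiple of the product of the linear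
  forms vanishing at these points. Hence the system is spanned by \<open>xyz\<close> times the monomials of
  degree \<open>m - 1\<close> and three forms \<open>b\<^sub>0\<close>, \<open>b\<^sub>1\<close>, \<open>b\<^sub>2\<close>, where \<open>b\<^sub>2 = xy(x\<^sup>m - (-1)\<^sup>m y\<^sup>m)\<close> and the
  others arise by cyclic permutation. The ideal of a point \<open>p\<close> is generated by the components of
  \<open>p \<times> v\<close>, which on the blow-up are proportional to the coordinates of the line through \<open>p\<close>; this
  yields local frames and the values of sections on the exceptional curves. Off the coordinate
  lines and over the other points of \<open>S\<close>, a point is recovered from \<open>xyz\<close> times the monomials; over a
  coordinate point it is recovered from quadratic expressions in the sections.\<close>

section \<open>Polynomial functions of one variable\<close>

text \<open>The signs come from duality: a factor \<open>x - \<zeta> y\<close> with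
  \<open>\<zeta>^m = 1\<close> is dual to \<open>(1 : -\<zeta> : 0)\<close>, whose coordinate ratio
  has \<open>m\<close>-th power \<open>(-1)^m\<close>. As a coordinate line meets \<open>S\<close>
  in m + 2 points, the system has degree 0 on its proper transform, which is why these curves are
  contracted. The bound m >= 2 provides monomials of degree m - 1 >= 1, so that \<open>xyz\<close>
  times them separates points. The obstacle is that the blow-up sits in a product of 3m + 4 planes
  and sections are known only as local quotients of multihomogeneous polynomials in all of them.
  Away from a centre \<open>p\<close> its line block is a multiple of \<open>p \<times> v\<close>
  and can be eliminated; near a centre one line block remains. Identities are checked on the torus,
  where no coordinate vanishes: it avoids \<open>S\<close>, and its lift is dense because a
  polynomial arc through any point of the blow-up can be steered into it. Points are recovered by
  explicit forms on the target, checked on the torus up to a factor that may vanish; wherever one of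
  these forms is nonzero, they give the correct point.\<close>

definition is_poly :: "(complex \<Rightarrow> complex) \<Rightarrow> bool" where
  "is_poly f \<longleftrightarrow> (\<exists>p. \<forall>t. f t = poly p t)"

lemma is_polyI: "(\<And>t. f t = poly p t) \<Longrightarrow> is_poly f"
  by (auto simp: is_poly_def)

lemma is_poly_const [simp, intro]: "is_poly (\<lambda>t. c)"
  by (rule is_polyI[where p = "[:c:]"]) simp

lemma is_poly_ident [simp, intro]: "is_poly (\<lambda>t. t)"
  by (rule is_polyI[where p = "[:0, 1:]"]) simp

lemma is_poly_add [intro]:
  assumes "is_poly f" "is_poly g" shows "is_poly (\<lambda>t. f t + g t)"
proof -
  obtain p q where "\<And>t. f t = poly p t" "\<And>t. g t = poly q t"
    using assms by (auto simp: is_poly_def)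
  thus ?thesis by (intro is_polyI[where p = "p + q"]) simp
qed

lemma is_poly_mult [intro]:
  assumes "is_poly f" "is_poly g" shows "is_poly (\<lambda>t. f t * g t)"
proof -
  obtain p q where "\<And>t. f t = poly p t" "\<And>t. g t = poly q t"
    using assms by (auto simp: is_poly_def)
  thus ?thesis by (intro is_polyI[where p = "p * q"]) simp
qed

lemma is_poly_diff [intro]:
  assumes "is_poly f" "is_poly g" shows "is_poly (\<lambda>t. f t - g t)"
proof -
  obtain p q where "\<And>t. f t = poly p t" "\<And>t. g t = poly q t"
    using assms by (auto simp: is_poly_def)
  thus ?thesis by (intro is_polyI[where p = "p - q"]) simp
qed

lemma is_poly_power [intro]: "is_poly f \<Longrightarrow> is_poly (\<lambda>t. f t ^ k)"
  by (induction k) auto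

lemma is_poly_sum [intro]: "(\<And>x. x \<in> T \<Longrightarrow> is_poly (f x)) \<Longrightarrow> is_poly (\<lambda>t. \<Sum>x\<in>T. f x t)"
  by (induction T rule: infinite_finite_induct) auto

lemma is_poly_prod [intro]: "(\<And>x. x \<in> T \<Longrightarrow> is_poly (f x)) \<Longrightarrow> is_poly (\<lambda>t. \<Prod>x\<in>T. f x t)"
  by (induction T rule: infinite_finite_induct) auto

lemma is_poly_finite_zeros:
  assumes "is_poly f" "f a \<noteq> 0" shows "finite {t. f t = 0}"
proof -
  obtain p where p: "\<And>t. f t = poly p t" using assms(1) by (auto simp: is_poly_def)
  have "p \<noteq> 0" using assms(2) p by auto
  thus ?thesis using poly_roots_finite[of p] by (simp add: p)
qed

lemma is_poly_zeroI:
  assumes "is_poly f" "finite X" "\<And>t. t \<notin> X \<Longrightarrow> f t = 0" shows "f a = 0"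
proof (rule ccontr)
  assume "f a \<noteq> 0"
  from is_poly_finite_zeros[OF assms(1) this] have "finite ({t. f t = 0} \<union> X)" using assms(2) by simp
  moreover have "{t. f t = 0} \<union> X = UNIV" using assms(3) by auto
  ultimately show False using infinite_UNIV_char_0[where 'a = complex] by simp
qed

lemma finite_avoid:
  assumes "finite (X :: complex set)" obtains t where "t \<notin> X"
  using ex_new_if_finite[OF infinite_UNIV_char_0 assms] by auto


section \<open>Forms\<close>

lemma finite_exponents [simp, intro]: "finite (exponents n d)"
proof (rule finite_subset)
  show "exponents n d \<subseteq> {a. \<forall>i. (i \<in> {..n} \<longrightarrow> a i \<in> {..d}) \<and> (i \<notin> {..n} \<longrightarrow> a i = 0)}"
  proof (rule subsetI, rule CollectI, intro allI conjI impI)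
    fix a i assume a: "a \<in> exponents n d" and i: "i \<in> {..n}"
    have "a i \<le> (\<Sum>i\<le>n. a i)" by (rule member_le_sum) (use i in auto)
    thus "a i \<in> {..d}" using a by (simp add: exponents_def)
  next
    fix a i assume "a \<in> exponents n d" "i \<notin> {..n}"
    thus "a i = 0" by (auto simp: exponents_def)
  qed
  show "finite {a. \<forall>i. (i \<in> {..n} \<longrightarrow> a i \<in> {..d}) \<and> (i \<notin> {..n} \<longrightarrow> a i = (0::nat))}"
    by (rule finite_set_of_finite_funs) auto
qed

lemma formE:
  assumes "form n d F"
  obtains c where "\<And>v. F v = (\<Sum>a\<in>exponents n d. c a * (\<Prod>i\<le>n. v i ^ a i))"
  using assms unfolding form_def by auto

lemma formI: "(\<And>v. F v = (\<Sum>a\<in>exponents n d. c a * (\<Prod>i\<le>n. v i ^ a i))) \<Longrightarrow> form n d F"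
  unfolding form_def by (rule exI[of _ c]) auto

lemma form_zero [simp, intro]: "form n d (\<lambda>v. 0)"
  by (rule formI[where c = "\<lambda>_. 0"]) simp

lemma form_add [intro]:
  assumes "form n d F" "form n d G" shows "form n d (\<lambda>v. F v + G v)"
proof -
  obtain c where c: "\<And>v. F v = (\<Sum>a\<in>exponents n d. c a * (\<Prod>i\<le>n. v i ^ a i))"
    using formE[OF assms(1)] by blast
  obtain c' where c': "\<And>v. G v = (\<Sum>a\<in>exponents n d. c' a * (\<Prod>i\<le>n. v i ^ a i))"
    using formE[OF assms(2)] by blast
  show ?thesis
    by (rule formI[where c = "\<lambda>a. c a + c' a"]) (simp add: c c' ring_distribs sum.distrib)
qed

lemma form_cmult [intro]:
  assumes "form n d F" shows "form n d (\<lambda>v. k * F v)"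
proof -
  obtain c where c: "\<And>v. F v = (\<Sum>a\<in>exponents n d. c a * (\<Prod>i\<le>n. v i ^ a i))"
    using formE[OF assms(1)] by blast
  show ?thesis
    by (rule formI[where c = "\<lambda>a. k * c a"]) (simp add: c sum_distrib_left mult.assoc)
qed

lemma form_minus [intro]: "form n d F \<Longrightarrow> form n d (\<lambda>v. - F v)"
  using form_cmult[of n d F "-1"] by simp

lemma form_diff [intro]: "form n d F \<Longrightarrow> form n d G \<Longrightarrow> form n d (\<lambda>v. F v - G v)"
  using form_add[of n d F "\<lambda>v. - G v"] form_minus[of n d G] by simp

lemma form_sum [intro]: "(\<And>x. x \<in> T \<Longrightarrow> form n d (f x)) \<Longrightarrow> form n d (\<lambda>v. \<Sum>x\<in>T. f x v)"
  by (induction T rule: infinite_finite_induct) auto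

lemma form_monom:
  assumes "a \<in> exponents n d" shows "form n d (\<lambda>v. \<Prod>i\<le>n. v i ^ a i)"
  by (rule formI[where c = "\<lambda>b. if b = a then 1 else 0"])
     (simp add: if_distrib[of "\<lambda>x. x * _"] assms cong: if_cong)

lemma form_mult:
  assumes "form n d F" "form n e G" shows "form n (d + e) (\<lambda>v. F v * G v)"
proof -
  obtain c where c: "\<And>v. F v = (\<Sum>a\<in>exponents n d. c a * (\<Prod>i\<le>n. v i ^ a i))"
    using formE[OF assms(1)] by blast
  obtain c' where c': "\<And>v. G v = (\<Sum>a\<in>exponents n e. c' a * (\<Prod>i\<le>n. v i ^ a i))"
    using formE[OF assms(2)] by blast
  have eq: "F v * G v = (\<Sum>a\<in>exponents n d. \<Sum>b\<in>exponents n e. (c a * c' b) * (\<Prod>i\<le>n. v i ^ (a i + b i)))" for v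
    unfolding c c' sum_product by (simp add: power_add prod.distrib algebra_simps)
  have "form n (d + e) (\<lambda>v. \<Sum>a\<in>exponents n d. \<Sum>b\<in>exponents n e. (c a * c' b) * (\<Prod>i\<le>n. v i ^ (a i + b i)))"
  proof (intro form_sum form_cmult)
    fix a b assume "a \<in> exponents n d" "b \<in> exponents n e"
    hence "(\<lambda>i. a i + b i) \<in> exponents n (d + e)" by (auto simp: exponents_def sum.distrib)
    from form_monom[OF this] show "form n (d + e) (\<lambda>v. \<Prod>i\<le>n. v i ^ (a i + b i))" .
  qed
  thus ?thesis by (simp add: eq)
qed

lemma form_mult':
  "form n d F \<Longrightarrow> form n e G \<Longrightarrow> k = d + e \<Longrightarrow> form n k (\<lambda>v. F v * G v)"
  using form_mult by blast

lemma form_const [intro]: "form n 0 (\<lambda>v. c)"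
proof -
  have "(\<lambda>_. 0) \<in> exponents n 0" by (auto simp: exponents_def)
  from form_cmult[OF form_monom[OF this], of c] show ?thesis by simp
qed

lemma form_coord [intro]:
  assumes "i \<le> n" shows "form n 1 (\<lambda>v. v i)"
proof -
  have "(\<lambda>l. if l = i then 1 else 0) \<in> exponents n 1" using assms by (auto simp: exponents_def)
  from form_monom[OF this] have "form n 1 (\<lambda>v. \<Prod>l\<le>n. v l ^ (if l = i then 1 else 0))" .
  moreover have "(\<Prod>l\<le>n. v l ^ (if l = i then 1 else 0)) = v i" for v :: cvec
    using assms by (simp add: if_distrib[of "\<lambda>x. _ ^ x"] cong: if_cong)
  ultimately show ?thesis by simp
qed

lemma form_power: "form n d F \<Longrightarrow> form n (k * d) (\<lambda>v. F v ^ k)"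
  by (induction k) (auto intro: form_mult')

lemma form_power': "form n d F \<Longrightarrow> e = k * d \<Longrightarrow> form n e (\<lambda>v. F v ^ k)"
  using form_power by blast

lemma form_prod:
  "(\<And>x. x \<in> T \<Longrightarrow> form n (d x) (f x)) \<Longrightarrow> form n (\<Sum>x\<in>T. d x) (\<lambda>v. \<Prod>x\<in>T. f x v)"
proof (induction T rule: infinite_finite_induct)
  case (insert x T)
  have "form n (d x + (\<Sum>x\<in>T. d x)) (\<lambda>v. f x v * (\<Prod>x\<in>T. f x v))"
    by (rule form_mult) (use insert in auto)
  thus ?case using insert by simp
qed auto

lemma form_homog:
  assumes "form n d F" shows "F (\<lambda>i. k * v i) = k ^ d * F v"
proof -
  obtain c where c: "\<And>v. F v = (\<Sum>a\<in>exponents n d. c a * (\<Prod>i\<le>n. v i ^ a i))"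
    using formE[OF assms(1)] by blast
  have "(\<Prod>i\<le>n. (k * v i) ^ a i) = k ^ d * (\<Prod>i\<le>n. v i ^ a i)" if "a \<in> exponents n d" for a
    using that by (auto simp: power_mult_distrib prod.distrib exponents_def simp flip: power_sum)
  thus ?thesis by (simp add: c sum_distrib_left algebra_simps)
qed

lemma form_cong:
  assumes "form n d F" "\<And>i. i \<le> n \<Longrightarrow> v i = w i" shows "F v = F w"
proof -
  obtain c where c: "\<And>v. F v = (\<Sum>a\<in>exponents n d. c a * (\<Prod>i\<le>n. v i ^ a i))"
    using formE[OF assms(1)] by blast
  show ?thesis unfolding c using assms(2) by simp
qed

lemma form_zero_vec:
  assumes "form n d F" "d > 0" shows "F (\<lambda>_. 0) = 0"
  using form_homog[OF assms(1), of 0 "\<lambda>_. 0"] assms(2) by (auto simp: power_0_left split: if_splits)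

lemma form_is_poly:
  assumes "form n d F" "\<And>i. i \<le> n \<Longrightarrow> is_poly (\<lambda>t. v t i)" shows "is_poly (\<lambda>t. F (v t))"
proof -
  obtain c where c: "\<And>v. F v = (\<Sum>a\<in>exponents n d. c a * (\<Prod>i\<le>n. v i ^ a i))"
    using formE[OF assms(1)] by blast
  show ?thesis unfolding c
    by (intro is_poly_sum is_poly_mult is_poly_const is_poly_prod is_poly_power) (use assms(2) in auto)
qed


section \<open>Multihomogeneous polynomials\<close>

lemma multiformE:
  assumes "multiform I n d F"
  obtains K :: nat and A where "\<And>k i. k < K \<Longrightarrow> i \<in> I \<Longrightarrow> form (n i) (d i) (A k i)"
    "\<And>V. F V = (\<Sum>k<K. \<Prod>i\<in>I. A k i (V i))"
  using assms unfolding multiform_def by auto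

text \<open>Arbitrary finite index sets are convenient because sums of tensors are indexed by a
  disjoint union and products by a Cartesian product.\<close>

lemma multiformI:
  assumes "finite T" "\<And>k i. k \<in> T \<Longrightarrow> i \<in> I \<Longrightarrow> form (n i) (d i) (A k i)"
    "\<And>V. F V = (\<Sum>k\<in>T. \<Prod>i\<in>I. A k i (V i))"
  shows "multiform I n d F"
proof -
  obtain h where h: "bij_betw h {0..<card T} T" using ex_bij_betw_nat_finite[OF assms(1)] by blast
  have "F V = (\<Sum>k<card T. \<Prod>i\<in>I. A (h k) i (V i))" for V
    unfolding assms(3) sum.reindex_bij_betw[OF h, symmetric] by (simp add: atLeast0LessThan)
  moreover have "form (n i) (d i) (A (h k) i)" if "k < card T" "i \<in> I" for k i
    by (rule assms(2)) (use h that in \<open>auto simp: bij_betw_def\<close>)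
  ultimately show ?thesis unfolding multiform_def
    by (intro exI[of _ "card T"] exI[of _ "\<lambda>k. A (h k)"]) auto
qed

lemma multiform_degree_cong:
  "multiform I n d F \<Longrightarrow> (\<And>i. i \<in> I \<Longrightarrow> d i = d' i) \<Longrightarrow> multiform I n d' F"
  unfolding multiform_def by auto

lemma multiform_zero [simp, intro]: "multiform I n d (\<lambda>V. 0)"
  by (rule multiformI[where T = "{}"]) auto

lemma multiform_add [intro]:
  assumes "multiform I n d F" "multiform I n d G" shows "multiform I n d (\<lambda>V. F V + G V)"
proof -
  obtain K A where A: "\<And>k i. k < K \<Longrightarrow> i \<in> I \<Longrightarrow> form (n i) (d i) (A k i)"
    "\<And>V. F V = (\<Sum>k<(K::nat). \<Prod>i\<in>I. A k i (V i))" using multiformE[OF assms(1)] by metis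
  obtain L B where B: "\<And>k i. k < L \<Longrightarrow> i \<in> I \<Longrightarrow> form (n i) (d i) (B k i)"
    "\<And>V. G V = (\<Sum>k<(L::nat). \<Prod>i\<in>I. B k i (V i))" using multiformE[OF assms(2)] by metis
  show ?thesis
    by (rule multiformI[where T = "{..<K} <+> {..<L}" and A = "case_sum A B"])
       (auto simp: A B sum.Plus)
qed

lemma multiform_mult:
  assumes "multiform I n d F" "multiform I n e G"
  shows "multiform I n (\<lambda>i. d i + e i) (\<lambda>V. F V * G V)"
proof -
  obtain K A where A: "\<And>k i. k < K \<Longrightarrow> i \<in> I \<Longrightarrow> form (n i) (d i) (A k i)"
    "\<And>V. F V = (\<Sum>k<(K::nat). \<Prod>i\<in>I. A k i (V i))" using multiformE[OF assms(1)] by metis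
  obtain L B where B: "\<And>k i. k < L \<Longrightarrow> i \<in> I \<Longrightarrow> form (n i) (e i) (B k i)"
    "\<And>V. G V = (\<Sum>k<(L::nat). \<Prod>i\<in>I. B k i (V i))" using multiformE[OF assms(2)] by metis
  show ?thesis
    by (rule multiformI[where T = "{..<K} \<times> {..<L}" and A = "\<lambda>(k, l) i v. A k i v * B l i v"])
       (auto simp: A B sum_product sum.cartesian_product prod.distrib case_prod_unfold intro!: form_mult)
qed

lemma multiform_mult':
  assumes "multiform I n d F" "multiform I n e G" "\<And>i. i \<in> I \<Longrightarrow> k i = d i + e i"
  shows "multiform I n k (\<lambda>V. F V * G V)"
  using multiform_degree_cong[OF multiform_mult[OF assms(1,2)]] assms(3) by metis

lemma multiform_block:
  assumes "finite I" "i \<in> I" "form (n i) e A" "\<And>j. j \<in> I \<Longrightarrow> d j = (if j = i then e else 0)"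
  shows "multiform I n d (\<lambda>V. A (V i))"
proof (rule multiformI[where T = "{()}" and A = "\<lambda>_ j. if j = i then A else (\<lambda>_. 1)"])
  show "A (V i) = (\<Sum>k\<in>{()}. \<Prod>j\<in>I. (if j = i then A else (\<lambda>_. 1)) (V j))" for V
  proof -
    have "(\<Prod>j\<in>I. (if j = i then A else (\<lambda>_. 1)) (V j)) = (\<Prod>j\<in>I. if j = i then A (V j) else 1)"
      by (intro prod.cong) auto
    thus ?thesis using assms by simp
  qed
qed (use assms in auto)

lemma multiform_const:
  assumes "finite I" "I \<noteq> {}" "\<And>j. j \<in> I \<Longrightarrow> d j = 0" shows "multiform I n d (\<lambda>V. c)"
proof -
  obtain i where "i \<in> I" using assms by auto
  from multiform_block[OF assms(1) this form_const] show ?thesis using assms(3) by auto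
qed

lemma multiform_cmult:
  assumes "finite I" "I \<noteq> {}" "multiform I n d F" shows "multiform I n d (\<lambda>V. c * F V)"
  by (rule multiform_mult'[OF multiform_const[OF assms(1,2)] assms(3)]) auto

lemma multiform_diff:
  assumes "finite I" "I \<noteq> {}" "multiform I n d F" "multiform I n d G"
  shows "multiform I n d (\<lambda>V. F V - G V)"
  using multiform_add[OF assms(3) multiform_cmult[OF assms(1,2,4), of "-1"]] by simp

lemma multiform_sum:
  "(\<And>x. x \<in> T \<Longrightarrow> multiform I n d (f x)) \<Longrightarrow> multiform I n d (\<lambda>V. \<Sum>x\<in>T. f x V)"
  by (induction T rule: infinite_finite_induct) auto

lemma multiform_power:
  assumes "finite I" "I \<noteq> {}" "multiform I n d F"
  shows "multiform I n (\<lambda>i. k * d i) (\<lambda>V. F V ^ k)"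
  by (induction k) (auto intro: multiform_mult'[OF assms(3)] intro!: multiform_const[OF assms(1,2)])

lemma multiform_prod:
  assumes "finite I" "I \<noteq> {}" "\<And>x. x \<in> T \<Longrightarrow> multiform I n (d x) (f x)"
  shows "multiform I n (\<lambda>i. \<Sum>x\<in>T. d x i) (\<lambda>V. \<Prod>x\<in>T. f x V)"
  using assms(3)
proof (induction T rule: infinite_finite_induct)
  case (insert x T)
  have "multiform I n (\<lambda>i. d x i + (\<Sum>x\<in>T. d x i)) (\<lambda>V. f x V * (\<Prod>x\<in>T. f x V))"
    by (rule multiform_mult) (use insert in auto)
  thus ?case using insert by simp
qed (auto intro!: multiform_const[OF assms(1,2)])

lemma multiform_homog:
  assumes "multiform I n d F" "\<And>i l. i \<in> I \<Longrightarrow> l \<le> n i \<Longrightarrow> V' i l = c i * V i l"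
  shows "F V' = (\<Prod>i\<in>I. c i ^ d i) * F V"
proof -
  obtain K A where A: "\<And>k i. k < K \<Longrightarrow> i \<in> I \<Longrightarrow> form (n i) (d i) (A k i)"
    "\<And>V. F V = (\<Sum>k<(K::nat). \<Prod>i\<in>I. A k i (V i))" using multiformE[OF assms(1)] by metis
  have "A k i (V' i) = c i ^ d i * A k i (V i)" if "k < K" "i \<in> I" for k i
    unfolding form_homog[OF A(1)[OF that], symmetric]
    by (rule form_cong[OF A(1)[OF that]]) (use assms(2) that in auto)
  thus ?thesis by (simp add: A(2) sum_distrib_left prod.distrib)
qed

lemma multiform_cong:
  assumes "multiform I n d F" "\<And>i l. i \<in> I \<Longrightarrow> l \<le> n i \<Longrightarrow> V' i l = V i l"
  shows "F V' = F V"
  using multiform_homog[OF assms(1), of V' "\<lambda>_. 1" V] assms(2) by simp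

lemma multiform_is_poly:
  assumes "multiform I n d F" "\<And>i l. i \<in> I \<Longrightarrow> l \<le> n i \<Longrightarrow> is_poly (\<lambda>t. V t i l)"
  shows "is_poly (\<lambda>t. F (V t))"
proof -
  obtain K A where A: "\<And>k i. k < K \<Longrightarrow> i \<in> I \<Longrightarrow> form (n i) (d i) (A k i)"
    "\<And>V. F V = (\<Sum>k<(K::nat). \<Prod>i\<in>I. A k i (V i))" using multiformE[OF assms(1)] by metis
  have "is_poly (\<lambda>t. A k i (V t i))" if "k < K" "i \<in> I" for k i
    by (rule form_is_poly[OF A(1)[OF that]]) (use assms(2) that in auto)
  thus ?thesis unfolding A(2) by (intro is_poly_sum is_poly_prod) auto
qed

lemma multiform_form_comp:
  assumes I: "finite I" "I \<noteq> {}" and "form n' d F"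
    and H: "\<And>l. l \<le> n' \<Longrightarrow> multiform I n e (H l)"
  shows "multiform I n (\<lambda>i. d * e i) (\<lambda>V. F (\<lambda>l. H l V))"
proof -
  obtain c where c: "\<And>v. F v = (\<Sum>a\<in>exponents n' d. c a * (\<Prod>i\<le>n'. v i ^ a i))"
    using formE[OF assms(3)] by blast
  show ?thesis unfolding c
  proof (intro multiform_sum multiform_cmult[OF I])
    fix a assume "a \<in> exponents n' d"
    hence eq: "(\<Sum>l\<le>n'. a l * e i) = d * e i" for i by (auto simp: exponents_def sum_distrib_right)
    have "multiform I n (\<lambda>i. \<Sum>l\<le>n'. a l * e i) (\<lambda>V. \<Prod>l\<le>n'. H l V ^ a l)"
      by (intro multiform_prod[OF I] multiform_power[OF I] H) auto
    thus "multiform I n (\<lambda>i. d * e i) (\<lambda>V. \<Prod>l\<le>n'. H l V ^ a l)" by (simp add: eq)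
  qed
qed

text \<open>All polynomials substituted into block \<open>j\<close> share the multidegree
  \<open>e j\<close>, so a form of degree \<open>d j\<close> in that block contributes
  \<open>d j\<close> times \<open>e j\<close>.\<close>

lemma multiform_comp:
  assumes I: "finite I" "I \<noteq> {}" and "multiform J n' d F"
    and H: "\<And>j l. j \<in> J \<Longrightarrow> l \<le> n' j \<Longrightarrow> multiform I n (e j) (H j l)"
  shows "multiform I n (\<lambda>i. \<Sum>j\<in>J. d j * e j i) (\<lambda>V. F (\<lambda>j l. H j l V))"
proof -
  obtain K A where A: "\<And>k i. k < K \<Longrightarrow> i \<in> J \<Longrightarrow> form (n' i) (d i) (A k i)"
    "\<And>V. F V = (\<Sum>k<(K::nat). \<Prod>i\<in>J. A k i (V i))" using multiformE[OF assms(3)] by metis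
  show ?thesis unfolding A(2)
    by (intro multiform_sum multiform_prod[OF I] multiform_form_comp[OF I A(1)] H) auto
qed

section \<open>Zariski geometry of subsets of products of projective spaces\<close>

section \<open>Points and the Zariski topology\<close>

lemma pt_iff: "u \<in> pt v \<longleftrightarrow> (\<exists>c. c \<noteq> 0 \<and> u = (\<lambda>i. c * v i))"
  by (auto simp: pt_def)

lemma pt_self [simp, intro]: "v \<in> pt v"
  unfolding pt_iff by (rule exI[of _ 1]) simp

lemma pt_scale: assumes "c \<noteq> 0" shows "pt (\<lambda>i. c * v i) = pt v"
proof (intro set_eqI iffI)
  fix u assume "u \<in> pt (\<lambda>i. c * v i)"
  then obtain k where "k \<noteq> 0" "u = (\<lambda>i. k * (c * v i))" by (auto simp: pt_iff)
  thus "u \<in> pt v" unfolding pt_iff by (intro exI[of _ "k * c"]) (use assms in auto)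
next
  fix u assume "u \<in> pt v"
  then obtain k where "k \<noteq> 0" "u = (\<lambda>i. k * v i)" by (auto simp: pt_iff)
  thus "u \<in> pt (\<lambda>i. c * v i)" unfolding pt_iff by (intro exI[of _ "k / c"]) (use assms in auto)
qed

lemma pt_eqI: "u \<in> pt v \<Longrightarrow> pt u = pt v"
  using pt_scale by (auto simp: pt_iff)

lemma PP_rep:
  assumes "p \<in> PP n" "u \<in> p" shows "u \<in> nonzero_vecs n" "p = pt u"
proof -
  obtain v where v: "v \<in> nonzero_vecs n" "p = pt v" using assms(1) by (auto simp: PP_def)
  obtain c where c: "c \<noteq> 0" "u = (\<lambda>i. c * v i)" using assms(2) v by (auto simp: pt_iff)
  show "p = pt u" using pt_eqI[of u v] assms v by auto
  show "u \<in> nonzero_vecs n" using v c by (auto simp: nonzero_vecs_def fun_eq_iff)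
qed

lemma PP_nonempty: "p \<in> PP n \<Longrightarrow> \<exists>u. u \<in> p"
  unfolding PP_def by auto

lemma pt_in_PP [intro]: "v \<in> nonzero_vecs n \<Longrightarrow> pt v \<in> PP n"
  by (auto simp: PP_def)

lemma PP_eqI: "p \<in> PP n \<Longrightarrow> q \<in> PP n \<Longrightarrow> u \<in> p \<Longrightarrow> u \<in> q \<Longrightarrow> p = q"
  using PP_rep(2) by blast

text \<open>Nonempty blocks are demanded because over an empty block set the only multihomogeneous
  polynomials are the natural number constants.\<close>

definition wf_var :: "'i variety \<Rightarrow> bool" where
  "wf_var X \<longleftrightarrow> finite (blocks X) \<and> blocks X \<noteq> {} \<and>
     (\<forall>x\<in>points X. \<forall>i\<in>blocks X. x i \<in> PP (pdim X i))"

definition basic :: "'i variety \<Rightarrow> ('i sect) \<Rightarrow> ('i \<Rightarrow> ppoint) set" where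
  "basic X F = {x \<in> points X. \<forall>V\<in>Pi\<^sub>E (blocks X) x. F V \<noteq> 0}"

abbreviation mf :: "'i variety \<Rightarrow> ('i \<Rightarrow> nat) \<Rightarrow> 'i sect \<Rightarrow> bool" where
  "mf X \<equiv> multiform (blocks X) (pdim X)"

abbreviation reps :: "'i variety \<Rightarrow> ('i \<Rightarrow> ppoint) \<Rightarrow> ('i \<Rightarrow> cvec) set" where
  "reps X x \<equiv> Pi\<^sub>E (blocks X) x"

lemma subvar_simps [simp]:
  "blocks (subvar X U) = blocks X" "pdim (subvar X U) = pdim X" "points (subvar X U) = U"
  by (simp_all add: subvar_def)

lemma wf_subvar: "wf_var X \<Longrightarrow> U \<subseteq> points X \<Longrightarrow> wf_var (subvar X U)"
  by (auto simp: wf_var_def)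

lemma basic_subset: "basic X F \<subseteq> points X"
  by (auto simp: basic_def)

lemma basicD: "y \<in> basic X G \<Longrightarrow> V \<in> reps X y \<Longrightarrow> G V \<noteq> 0"
  by (auto simp: basic_def)

lemma cone_iff: "V \<in> cone X U \<longleftrightarrow> (\<exists>x\<in>U. V \<in> reps X x)"
  by (auto simp: cone_def)

lemma reps_nonempty:
  assumes "wf_var X" "x \<in> points X" obtains V where "V \<in> reps X x"
proof -
  have "x i \<noteq> {}" if "i \<in> blocks X" for i
    using PP_nonempty[of "x i" "pdim X i"] assms that by (auto simp: wf_var_def)
  hence "reps X x \<noteq> {}" by (simp add: PiE_eq_empty_iff)
  thus ?thesis using that by auto
qed

lemma reps_scale:
  assumes "wf_var X" "x \<in> points X" "V \<in> reps X x" "V' \<in> reps X x"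
  obtains c where "\<And>i. i \<in> blocks X \<Longrightarrow> c i \<noteq> 0" "\<And>i. i \<in> blocks X \<Longrightarrow> V' i = (\<lambda>l. c i * V i l)"
proof -
  have "\<exists>c. c \<noteq> 0 \<and> V' i = (\<lambda>l. c * V i l)" if "i \<in> blocks X" for i
  proof -
    have "x i = pt (V i)" by (rule PP_rep(2)) (use assms that in \<open>auto simp: wf_var_def\<close>)
    moreover have "V' i \<in> x i" using assms that by auto
    ultimately show ?thesis by (simp add: pt_iff)
  qed
  hence "\<forall>i. \<exists>c. i \<in> blocks X \<longrightarrow> c \<noteq> 0 \<and> V' i = (\<lambda>l. c * V i l)" by auto
  from choice[OF this] that show ?thesis by auto
qed

lemma mf_nonzero_reps:
  assumes "wf_var X" "mf X d F" "x \<in> points X" "V \<in> reps X x" "V' \<in> reps X x"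
  shows "F V' \<noteq> 0 \<longleftrightarrow> F V \<noteq> 0"
proof -
  obtain c where c: "\<And>i. i \<in> blocks X \<Longrightarrow> c i \<noteq> 0" "\<And>i. i \<in> blocks X \<Longrightarrow> V' i = (\<lambda>l. c i * V i l)"
    using reps_scale[OF assms(1,3,4,5)] by blast
  have "F V' = (\<Prod>i\<in>blocks X. c i ^ d i) * F V"
    by (rule multiform_homog[OF assms(2)]) (simp add: c)
  thus ?thesis using c assms(1) by (simp add: wf_var_def)
qed

lemma basic_iff:
  assumes "wf_var X" "mf X d F" "x \<in> points X" "V \<in> reps X x"
  shows "x \<in> basic X F \<longleftrightarrow> F V \<noteq> 0"
proof
  show "x \<in> basic X F \<Longrightarrow> F V \<noteq> 0" using assms(4) by (simp add: basic_def)
  assume "F V \<noteq> 0"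
  hence "F V' \<noteq> 0" if "V' \<in> reps X x" for V'
    using mf_nonzero_reps[OF assms(1,2,3,4) that] by simp
  thus "x \<in> basic X F" using assms(3) by (simp add: basic_def)
qed

lemma basic_mult:
  assumes "wf_var X" "mf X d F" "mf X e G"
  shows "basic X (\<lambda>V. F V * G V) = basic X F \<inter> basic X G"
proof (intro set_eqI)
  fix x
  show "x \<in> basic X (\<lambda>V. F V * G V) \<longleftrightarrow> x \<in> basic X F \<inter> basic X G"
  proof (cases "x \<in> points X")
    case True
    then obtain V where V: "V \<in> reps X x" using reps_nonempty[OF assms(1)] by blast
    show ?thesis
      using basic_iff[OF assms(1) multiform_mult[OF assms(2,3)] True V]
        basic_iff[OF assms(1,2) True V] basic_iff[OF assms(1,3) True V] by auto
  qed (auto simp: basic_def)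
qed

lemma mf_quotient_reps:
  assumes "wf_var X" "mf X d F" "mf X d G" "x \<in> points X" "V \<in> reps X x" "V' \<in> reps X x"
  shows "F V' / G V' = F V / G V"
proof -
  obtain c where c: "\<And>i. i \<in> blocks X \<Longrightarrow> c i \<noteq> 0" "\<And>i. i \<in> blocks X \<Longrightarrow> V' i = (\<lambda>l. c i * V i l)"
    using reps_scale[OF assms(1,4,5,6)] by blast
  have "F V' = (\<Prod>i\<in>blocks X. c i ^ d i) * F V" "G V' = (\<Prod>i\<in>blocks X. c i ^ d i) * G V"
    by (rule multiform_homog[OF assms(2)] multiform_homog[OF assms(3)]; simp add: c)+
  thus ?thesis using c assms(1) by (simp add: wf_var_def)
qed

lemma openin_zariski_basic [intro]: "mf X d F \<Longrightarrow> openin (zariski X) (basic X F)"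
  unfolding zariski_def basic_def by (rule topology_generated_by_Basis) auto

text \<open>The generating sets form a base and not merely a subbase, since by
  \<open>basic_mult\<close> intersections correspond to products of polynomials.\<close>

lemma openin_zariski_iff:
  assumes "wf_var X"
  shows "openin (zariski X) W \<longleftrightarrow> W \<subseteq> points X \<and>
    (\<forall>x\<in>W. \<exists>d F. mf X d F \<and> x \<in> basic X F \<and> basic X F \<subseteq> W)"
proof (intro iffI conjI)
  let ?B = "{basic X F | F d. mf X d F}"
  have Z: "zariski X = topology_generated_by ?B" by (simp add: zariski_def basic_def)
  assume "openin (zariski X) W"
  hence "generate_topology_on ?B W" by (simp add: Z openin_topology_generated_by_iff)
  hence "W \<subseteq> points X \<and> (\<forall>x\<in>W. \<exists>d F. mf X d F \<and> x \<in> basic X F \<and> basic X F \<subseteq> W)"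
  proof (induction rule: generate_topology_on.induct)
    case (Int a b)
    show ?case
    proof (intro conjI ballI)
      fix x assume "x \<in> a \<inter> b"
      then obtain d F e G where "mf X d F" "x \<in> basic X F" "basic X F \<subseteq> a"
        "mf X e G" "x \<in> basic X G" "basic X G \<subseteq> b" using Int.IH by blast
      thus "\<exists>d F. mf X d F \<and> x \<in> basic X F \<and> basic X F \<subseteq> a \<inter> b"
        by (intro exI[of _ "\<lambda>i. d i + e i"] exI[of _ "\<lambda>V. F V * G V"])
           (auto simp: basic_mult[OF assms] intro: multiform_mult)
    qed (use Int in auto)
  next
    case (UN K)
    show ?case
    proof (intro conjI ballI)
      fix x assume "x \<in> \<Union>K"
      then obtain k where k: "k \<in> K" "x \<in> k" by auto
      obtain d F where "mf X d F" "x \<in> basic X F" "basic X F \<subseteq> k"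
        using UN.IH[OF k(1)] k(2) by (elim conjE ballE[of _ _ x] exE) auto
      thus "\<exists>d F. mf X d F \<and> x \<in> basic X F \<and> basic X F \<subseteq> \<Union>K" using k by blast
    qed (use UN in auto)
  next
    case (Basis s)
    then obtain F d where "mf X d F" "s = basic X F" by auto
    thus ?case using basic_subset by auto
  qed auto
  thus "W \<subseteq> points X" "\<forall>x\<in>W. \<exists>d F. mf X d F \<and> x \<in> basic X F \<and> basic X F \<subseteq> W" by auto
next
  assume A: "W \<subseteq> points X \<and> (\<forall>x\<in>W. \<exists>d F. mf X d F \<and> x \<in> basic X F \<and> basic X F \<subseteq> W)"
  have "\<exists>T. openin (zariski X) T \<and> x \<in> T \<and> T \<subseteq> W" if "x \<in> W" for x
    using A that openin_zariski_basic by metis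
  thus "openin (zariski X) W" using openin_subopen by metis
qed

lemma openin_points [simp, intro]:
  assumes "wf_var X" shows "openin (zariski X) (points X)"
  unfolding openin_zariski_iff[OF assms]
proof (intro conjI ballI)
  fix x assume x: "x \<in> points X"
  have "mf X (\<lambda>_. 0) (\<lambda>_. 1)" using assms by (intro multiform_const) (auto simp: wf_var_def)
  thus "\<exists>d F. mf X d F \<and> x \<in> basic X F \<and> basic X F \<subseteq> points X"
    using x by (intro exI[of _ "\<lambda>_. 0"] exI[of _ "\<lambda>_. 1"]) (auto simp: basic_def)
qed auto

lemma openin_zariski_subset: "wf_var X \<Longrightarrow> openin (zariski X) W \<Longrightarrow> W \<subseteq> points X"
  by (simp add: openin_zariski_iff)

lemma topspace_zariski [simp]: "wf_var X \<Longrightarrow> topspace (zariski X) = points X"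
  by (meson openin_points openin_zariski_subset openin_subset openin_topspace subset_antisym)

lemma basic_subvar: "U \<subseteq> points X \<Longrightarrow> basic (subvar X U) F = basic X F \<inter> U"
  by (auto simp: basic_def)

lemma openin_subvar:
  assumes "wf_var X" "U \<subseteq> points X" "openin (zariski X) W"
  shows "openin (zariski (subvar X U)) (W \<inter> U)"
  unfolding openin_zariski_iff[OF wf_subvar[OF assms(1,2)]]
proof (intro conjI ballI)
  fix x assume "x \<in> W \<inter> U"
  then obtain d F where F: "mf X d F" "x \<in> basic X F" "basic X F \<subseteq> W"
    using assms by (auto simp: openin_zariski_iff[OF assms(1)])
  thus "\<exists>d F. mf (subvar X U) d F \<and> x \<in> basic (subvar X U) F \<and> basic (subvar X U) F \<subseteq> W \<inter> U"
    using \<open>x \<in> W \<inter> U\<close> by (intro exI[of _ d] exI[of _ F]) (auto simp: basic_subvar[OF assms(2)])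
qed auto


section \<open>Regular functions\<close>

definition rep_at :: "'i variety \<Rightarrow> ('i \<Rightarrow> ppoint) set \<Rightarrow> (('i \<Rightarrow> ppoint) \<Rightarrow> complex) \<Rightarrow>
    ('i \<Rightarrow> ppoint) \<Rightarrow> ('i \<Rightarrow> nat) \<Rightarrow> 'i sect \<Rightarrow> 'i sect \<Rightarrow> bool" where
  "rep_at X U f x d F G \<longleftrightarrow> mf X d F \<and> mf X d G \<and> x \<in> basic X G \<and> basic X G \<subseteq> U \<and>
     (\<forall>y\<in>basic X G. \<forall>V\<in>reps X y. f y = F V / G V)"

text \<open>Multiplying numerator and denominator by a polynomial whose principal open set lies in
  the given neighbourhood shrinks that neighbourhood to the nonvanishing locus of the new
  denominator.\<close>

lemma regular_iff:
  assumes wf: "wf_var X"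
  shows "regular X U f \<longleftrightarrow> (\<forall>x\<in>U. \<exists>d F G. rep_at X U f x d F G)"
proof
  assume L: "regular X U f"
  show "\<forall>x\<in>U. \<exists>d F G. rep_at X U f x d F G"
  proof
    fix x assume x: "x \<in> U"
    obtain W d F G where *: "openin (zariski X) W" "x \<in> W" "W \<subseteq> U" "mf X d F" "mf X d G"
        "\<forall>y\<in>W. \<forall>V\<in>reps X y. G V \<noteq> 0 \<and> f y = F V / G V"
      using bspec[OF L[unfolded regular_def] x] by (elim exE conjE) (rule that)
    obtain e H where H: "mf X e H" "x \<in> basic X H" "basic X H \<subseteq> W"
      using * by (auto simp: openin_zariski_iff[OF wf])
    have B: "basic X (\<lambda>V. G V * H V) = basic X G \<inter> basic X H" by (rule basic_mult[OF wf *(5) H(1)])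
    have "x \<in> basic X G" using *(2,6) H(2) by (auto simp: basic_def)
    hence "rep_at X U f x (\<lambda>i. d i + e i) (\<lambda>V. F V * H V) (\<lambda>V. G V * H V)"
      unfolding rep_at_def B using * H by (auto intro!: multiform_mult simp: basic_def)
    thus "\<exists>d F G. rep_at X U f x d F G" by blast
  qed
next
  assume R: "\<forall>x\<in>U. \<exists>d F G. rep_at X U f x d F G"
  show "regular X U f" unfolding regular_def
  proof
    fix x assume "x \<in> U"
    then obtain d F G where *: "rep_at X U f x d F G" using R by blast
    thus "\<exists>W d F G. openin (zariski X) W \<and> x \<in> W \<and> W \<subseteq> U \<and> mf X d F \<and> mf X d G \<and>
        (\<forall>y\<in>W. \<forall>V\<in>reps X y. G V \<noteq> 0 \<and> f y = F V / G V)"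
      unfolding rep_at_def
      by (intro exI[of _ "basic X G"] exI[of _ d] exI[of _ F] exI[of _ G] conjI ballI)
         (auto dest: basicD)
  qed
qed

lemma regular_open:
  assumes "wf_var X" "regular X U f" shows "openin (zariski X) U"
  unfolding openin_zariski_iff[OF assms(1)]
proof (intro conjI ballI)
  have R: "\<exists>d F G. rep_at X U f x d F G" if "x \<in> U" for x
    using assms that by (simp add: regular_iff)
  show "U \<subseteq> points X" using R basic_subset[of X] by (fastforce simp: rep_at_def)
  fix x assume "x \<in> U"
  from R[OF this] show "\<exists>d F. mf X d F \<and> x \<in> basic X F \<and> basic X F \<subseteq> U"
    by (auto simp: rep_at_def)
qed

lemma regularI:
  assumes wf: "wf_var X"
    and "\<And>x. x \<in> U \<Longrightarrow> \<exists>d F G. rep_at X U f x d F G" shows "regular X U f"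
  using assms by (simp add: regular_iff)

lemma regularE:
  assumes wf: "wf_var X" and "regular X U f" "x \<in> U"
  obtains d F G where "mf X d F" "mf X d G" "x \<in> basic X G" "basic X G \<subseteq> U"
    "\<And>y V. y \<in> basic X G \<Longrightarrow> V \<in> reps X y \<Longrightarrow> f y = F V / G V"
  using assms by (auto simp: regular_iff[OF wf] rep_at_def)

lemma regular_subset:
  assumes wf: "wf_var X" and "regular X U f" "openin (zariski X) W" "W \<subseteq> U"
  shows "regular X W f"
proof (rule regularI[OF wf])
  fix x assume x: "x \<in> W"
  then obtain d F G where *: "mf X d F" "mf X d G" "x \<in> basic X G" "basic X G \<subseteq> U"
    "\<And>y V. y \<in> basic X G \<Longrightarrow> V \<in> reps X y \<Longrightarrow> f y = F V / G V"
    using regularE[OF wf assms(2)] assms(4) by blast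
  obtain e H where H: "mf X e H" "x \<in> basic X H" "basic X H \<subseteq> W"
    using assms x by (auto simp: openin_zariski_iff[OF wf])
  have B: "basic X (\<lambda>V. G V * H V) = basic X G \<inter> basic X H" by (rule basic_mult[OF wf *(2) H(1)])
  have "rep_at X W f x (\<lambda>i. d i + e i) (\<lambda>V. F V * H V) (\<lambda>V. G V * H V)"
    unfolding rep_at_def B using * H by (auto intro!: multiform_mult dest: basicD)
  thus "\<exists>d F G. rep_at X W f x d F G" by blast
qed

lemma regular_glue:
  assumes wf: "wf_var X" and "\<And>x. x \<in> U \<Longrightarrow> \<exists>W. x \<in> W \<and> W \<subseteq> U \<and> regular X W f"
  shows "regular X U f"
proof (rule regularI[OF wf])
  fix x assume "x \<in> U"
  then obtain W where W: "x \<in> W" "W \<subseteq> U" "regular X W f" using assms(2) by blast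
  obtain d F G where "mf X d F" "mf X d G" "x \<in> basic X G" "basic X G \<subseteq> W"
    "\<And>y V. y \<in> basic X G \<Longrightarrow> V \<in> reps X y \<Longrightarrow> f y = F V / G V"
    using regularE[OF wf W(3,1)] by blast
  hence "rep_at X U f x d F G" using W by (auto simp: rep_at_def)
  thus "\<exists>d F G. rep_at X U f x d F G" by blast
qed

lemma regular_cong:
  assumes wf: "wf_var X" and "regular X U f" "\<And>x. x \<in> U \<Longrightarrow> f x = g x"
  shows "regular X U g"
proof (rule regularI[OF wf])
  fix x assume "x \<in> U"
  then obtain d F G where "mf X d F" "mf X d G" "x \<in> basic X G" "basic X G \<subseteq> U"
    "\<And>y V. y \<in> basic X G \<Longrightarrow> V \<in> reps X y \<Longrightarrow> f y = F V / G V"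
    using regularE[OF wf assms(2)] by blast
  hence "rep_at X U g x d F G" unfolding rep_at_def using assms(3) by (metis subsetD)
  thus "\<exists>d F G. rep_at X U g x d F G" by blast
qed

lemma wf_varD: "wf_var X \<Longrightarrow> finite (blocks X)" "wf_var X \<Longrightarrow> blocks X \<noteq> {}"
  by (auto simp: wf_var_def)

text \<open>The arbitrary choice of coordinate vectors is harmless for equal multidegrees, by
  \<open>qfun_eq\<close>.\<close>

definition qfun :: "'i variety \<Rightarrow> 'i sect \<Rightarrow> 'i sect \<Rightarrow> ('i \<Rightarrow> ppoint) \<Rightarrow> complex" where
  "qfun X F G y = F (SOME V. V \<in> reps X y) / G (SOME V. V \<in> reps X y)"

lemma qfun_eq:
  assumes "wf_var X" "mf X d F" "mf X d G" "y \<in> points X" "V \<in> reps X y"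
  shows "qfun X F G y = F V / G V"
  unfolding qfun_def
  by (rule mf_quotient_reps[OF assms]) (rule someI[of "\<lambda>V. V \<in> reps X y", OF assms(5)])

lemma regular_qfun:
  assumes wf: "wf_var X" and "mf X d F" "mf X d G" shows "regular X (basic X G) (qfun X F G)"
proof (rule regularI[OF wf])
  fix x assume "x \<in> basic X G"
  moreover have "qfun X F G y = F V / G V" if "y \<in> basic X G" "V \<in> reps X y" for y V
    by (rule qfun_eq[OF assms _ that(2)]) (use that basic_subset in auto)
  ultimately have "rep_at X (basic X G) (qfun X F G) x d F G"
    using assms by (simp add: rep_at_def)
  thus "\<exists>d F' G'. rep_at X (basic X G) (qfun X F G) x d F' G'" by blast
qed

lemma regular_const:
  assumes wf: "wf_var X" and "openin (zariski X) U" shows "regular X U (\<lambda>_. c)"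
proof (rule regularI[OF wf])
  fix x assume "x \<in> U"
  then obtain d H where H: "mf X d H" "x \<in> basic X H" "basic X H \<subseteq> U"
    using assms by (auto simp: openin_zariski_iff[OF wf])
  hence "rep_at X U (\<lambda>_. c) x d (\<lambda>V. c * H V) H"
    using multiform_cmult[OF wf_varD[OF wf] H(1)] by (auto simp: rep_at_def dest: basicD)
  thus "\<exists>d F G. rep_at X U (\<lambda>_. c) x d F G" by blast
qed

lemma regular_add:
  assumes wf: "wf_var X" and "regular X U f" "regular X U g" shows "regular X U (\<lambda>x. f x + g x)"
proof (rule regularI[OF wf])
  fix x assume x: "x \<in> U"
  obtain d F G where 1: "mf X d F" "mf X d G" "x \<in> basic X G" "basic X G \<subseteq> U"
    "\<And>y V. y \<in> basic X G \<Longrightarrow> V \<in> reps X y \<Longrightarrow> f y = F V / G V"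
    using regularE[OF wf assms(2) x] by blast
  obtain e F' G' where 2: "mf X e F'" "mf X e G'" "x \<in> basic X G'" "basic X G' \<subseteq> U"
    "\<And>y V. y \<in> basic X G' \<Longrightarrow> V \<in> reps X y \<Longrightarrow> g y = F' V / G' V"
    using regularE[OF wf assms(3) x] by blast
  have B: "basic X (\<lambda>V. G V * G' V) = basic X G \<inter> basic X G'" by (rule basic_mult[OF wf 1(2) 2(2)])
  have "rep_at X U (\<lambda>x. f x + g x) x (\<lambda>i. d i + e i) (\<lambda>V. F V * G' V + F' V * G V) (\<lambda>V. G V * G' V)"
    unfolding rep_at_def B
  proof (intro conjI ballI)
    show "mf X (\<lambda>i. d i + e i) (\<lambda>V. F V * G' V + F' V * G V)"
      by (intro multiform_add multiform_mult'[OF 1(1) 2(2)] multiform_mult'[OF 2(1) 1(2)]) auto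
    fix y V assume "y \<in> basic X G \<inter> basic X G'" "V \<in> reps X y"
    thus "f y + g y = (F V * G' V + F' V * G V) / (G V * G' V)"
      using 1(5) 2(5) basicD[of y X G V] basicD[of y X G' V] by (simp add: field_simps)
  qed (use 1 2 in \<open>auto intro: multiform_mult\<close>)
  thus "\<exists>d F G. rep_at X U (\<lambda>x. f x + g x) x d F G" by blast
qed

lemma regular_mult:
  assumes wf: "wf_var X" and "regular X U f" "regular X U g" shows "regular X U (\<lambda>x. f x * g x)"
proof (rule regularI[OF wf])
  fix x assume x: "x \<in> U"
  obtain d F G where 1: "mf X d F" "mf X d G" "x \<in> basic X G" "basic X G \<subseteq> U"
    "\<And>y V. y \<in> basic X G \<Longrightarrow> V \<in> reps X y \<Longrightarrow> f y = F V / G V"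
    using regularE[OF wf assms(2) x] by blast
  obtain e F' G' where 2: "mf X e F'" "mf X e G'" "x \<in> basic X G'" "basic X G' \<subseteq> U"
    "\<And>y V. y \<in> basic X G' \<Longrightarrow> V \<in> reps X y \<Longrightarrow> g y = F' V / G' V"
    using regularE[OF wf assms(3) x] by blast
  have B: "basic X (\<lambda>V. G V * G' V) = basic X G \<inter> basic X G'" by (rule basic_mult[OF wf 1(2) 2(2)])
  have "rep_at X U (\<lambda>x. f x * g x) x (\<lambda>i. d i + e i) (\<lambda>V. F V * F' V) (\<lambda>V. G V * G' V)"
    unfolding rep_at_def B using 1 2 by (auto intro: multiform_mult)
  thus "\<exists>d F G. rep_at X U (\<lambda>x. f x * g x) x d F G" by blast
qed

lemma regular_inverse:
  assumes wf: "wf_var X" and "regular X U f" "\<And>x. x \<in> U \<Longrightarrow> f x \<noteq> 0"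
  shows "regular X U (\<lambda>x. 1 / f x)"
proof (rule regularI[OF wf])
  fix x assume x: "x \<in> U"
  obtain d F G where 1: "mf X d F" "mf X d G" "x \<in> basic X G" "basic X G \<subseteq> U"
    "\<And>y V. y \<in> basic X G \<Longrightarrow> V \<in> reps X y \<Longrightarrow> f y = F V / G V"
    using regularE[OF wf assms(2) x] by blast
  have B: "basic X (\<lambda>V. F V * G V) = basic X F \<inter> basic X G" by (rule basic_mult[OF wf 1(1,2)])
  have "x \<in> basic X F" using 1 assms(3)[OF x] by (force simp: basic_def)
  hence "rep_at X U (\<lambda>x. 1 / f x) x (\<lambda>i. d i + d i) (\<lambda>V. G V * G V) (\<lambda>V. F V * G V)"
    unfolding rep_at_def B using 1 by (auto intro!: multiform_mult dest: basicD)
  thus "\<exists>d F G. rep_at X U (\<lambda>x. 1 / f x) x d F G" by blast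
qed

lemma regular_divide:
  assumes wf: "wf_var X" and "regular X U f" "regular X U g" "\<And>x. x \<in> U \<Longrightarrow> g x \<noteq> 0"
  shows "regular X U (\<lambda>x. f x / g x)"
  using regular_mult[OF wf assms(2) regular_inverse[OF wf assms(3,4)]] by simp

lemma regular_cmult:
  assumes wf: "wf_var X" and "regular X U f" shows "regular X U (\<lambda>x. c * f x)"
  by (rule regular_mult[OF wf regular_const[OF wf regular_open[OF assms]] assms(2)])

lemma regular_diff:
  assumes wf: "wf_var X" and "regular X U f" "regular X U g" shows "regular X U (\<lambda>x. f x - g x)"
  using regular_add[OF wf assms(2) regular_cmult[OF wf assms(3), of "-1"]] by simp

lemma regular_sum:
  assumes wf: "wf_var X" and "openin (zariski X) U" "\<And>k. k \<in> T \<Longrightarrow> regular X U (f k)"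
  shows "regular X U (\<lambda>x. \<Sum>k\<in>T. f k x)"
  using assms(3)
  by (induction T rule: infinite_finite_induct)
     (auto intro: regular_const[OF wf assms(2)] regular_add[OF wf])

lemma regular_prod:
  assumes wf: "wf_var X" and "openin (zariski X) U" "\<And>k. k \<in> T \<Longrightarrow> regular X U (f k)"
  shows "regular X U (\<lambda>x. \<Prod>k\<in>T. f k x)"
  using assms(3)
  by (induction T rule: infinite_finite_induct)
     (auto intro: regular_const[OF wf assms(2)] regular_mult[OF wf])

lemma regular_power:
  assumes wf: "wf_var X" and "regular X U f" shows "regular X U (\<lambda>x. f x ^ k)"
  by (induction k)
     (auto intro: regular_const[OF wf regular_open[OF assms]] regular_mult[OF wf assms(2)])

lemma regular_form_comp:
  assumes wf: "wf_var X" and U: "openin (zariski X) U" and "form n d A"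
    and h: "\<And>l. l \<le> n \<Longrightarrow> regular X U (h l)"
  shows "regular X U (\<lambda>y. A (\<lambda>l. h l y))"
proof -
  obtain c where c: "\<And>v. A v = (\<Sum>a\<in>exponents n d. c a * (\<Prod>i\<le>n. v i ^ a i))"
    using formE[OF assms(3)] by blast
  show ?thesis unfolding c
    by (intro regular_sum[OF wf U] regular_cmult[OF wf] regular_prod[OF wf U] regular_power[OF wf] h) auto
qed

lemma regular_multiform_comp:
  assumes wf: "wf_var X" and U: "openin (zariski X) U" and "multiform J n d F"
    and h: "\<And>j l. j \<in> J \<Longrightarrow> l \<le> n j \<Longrightarrow> regular X U (h j l)"
  shows "regular X U (\<lambda>y. F (\<lambda>j l. h j l y))"
proof -
  obtain K A where A: "\<And>k i. k < K \<Longrightarrow> i \<in> J \<Longrightarrow> form (n i) (d i) (A k i)"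
    "\<And>V. F V = (\<Sum>k<(K::nat). \<Prod>i\<in>J. A k i (V i))" using multiformE[OF assms(3)] by metis
  show ?thesis unfolding A(2)
    by (intro regular_sum[OF wf U] regular_prod[OF wf U] regular_form_comp[OF wf U A(1)] h) auto
qed

lemma regular_nonzero_open:
  assumes wf: "wf_var X" and "regular X U f"
  shows "openin (zariski X) {x \<in> U. f x \<noteq> 0}"
  unfolding openin_zariski_iff[OF wf]
proof (intro conjI ballI)
  show "{x \<in> U. f x \<noteq> 0} \<subseteq> points X"
    using openin_zariski_subset[OF wf regular_open[OF assms]] by auto
  fix x assume x: "x \<in> {x \<in> U. f x \<noteq> 0}"
  then obtain d F G where 1: "mf X d F" "mf X d G" "x \<in> basic X G" "basic X G \<subseteq> U"
    "\<And>y V. y \<in> basic X G \<Longrightarrow> V \<in> reps X y \<Longrightarrow> f y = F V / G V"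
    using regularE[OF wf assms(2)] by blast
  have B: "basic X (\<lambda>V. F V * G V) = basic X F \<inter> basic X G" by (rule basic_mult[OF wf 1(1,2)])
  have "x \<in> basic X F" using 1 x by (force simp: basic_def)
  moreover have "f y \<noteq> 0" if "y \<in> basic X F" "y \<in> basic X G" for y
  proof -
    have "y \<in> points X" using that basic_subset by auto
    then obtain V where "V \<in> reps X y" using reps_nonempty[OF wf] by blast
    thus ?thesis using that 1(5) basicD by fastforce
  qed
  ultimately show "\<exists>d F. mf X d F \<and> x \<in> basic X F \<and> basic X F \<subseteq> {x \<in> U. f x \<noteq> 0}"
    using 1 by (intro exI[of _ "\<lambda>i. d i + d i"] exI[of _ "\<lambda>V. F V * G V"])
               (auto simp: B intro: multiform_mult)
qed

lemma regular_subvar: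
  assumes wf: "wf_var X" and "U \<subseteq> points X" "regular X W f"
  shows "regular (subvar X U) (W \<inter> U) f"
proof (rule regularI[OF wf_subvar[OF assms(1,2)]])
  fix x assume x: "x \<in> W \<inter> U"
  obtain d F G where 1: "mf X d F" "mf X d G" "x \<in> basic X G" "basic X G \<subseteq> W"
    "\<And>y V. y \<in> basic X G \<Longrightarrow> V \<in> reps X y \<Longrightarrow> f y = F V / G V"
    using regularE[OF wf assms(3)] x by blast
  hence "rep_at (subvar X U) (W \<inter> U) f x d F G"
    using x by (auto simp: rep_at_def basic_subvar[OF assms(2)])
  thus "\<exists>d F G. rep_at (subvar X U) (W \<inter> U) f x d F G" by blast
qed


section \<open>Morphisms\<close>

text \<open>Homogeneous coordinates by regular functions. Absence of common zeros is implicit: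
  membership in a point of projective space excludes the zero vector.\<close>

definition given_by :: "'i variety \<Rightarrow> (('i \<Rightarrow> ppoint) \<Rightarrow> ppoint) \<Rightarrow> nat \<Rightarrow> ('i \<Rightarrow> ppoint) set \<Rightarrow>
    (nat \<Rightarrow> ('i \<Rightarrow> ppoint) \<Rightarrow> complex) \<Rightarrow> bool" where
  "given_by X \<phi> n W h \<longleftrightarrow> openin (zariski X) W \<and> (\<forall>l\<le>n. regular X W (h l)) \<and>
     (\<forall>y\<in>W. (\<lambda>l. if l \<le> n then h l y else 0) \<in> \<phi> y)"

lemma given_by_subset:
  assumes "wf_var X" "given_by X \<phi> n W h" "openin (zariski X) W'" "W' \<subseteq> W"
  shows "given_by X \<phi> n W' h"
  using assms regular_subset[OF assms(1) _ assms(3,4)] by (auto simp: given_by_def)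

text \<open>Regular homogeneous coordinates turn every polynomial on the target into a regular
  function on the source; open sets and quotients of polynomials are then pulled back through these
  functions.\<close>

lemma morphismI:
  assumes wf: "wf_var X" and wf': "wf_var X'"
    and maps: "\<And>x. x \<in> points X \<Longrightarrow> \<phi> x \<in> points X'"
    and loc: "\<And>x j. x \<in> points X \<Longrightarrow> j \<in> blocks X' \<Longrightarrow>
      \<exists>W h. x \<in> W \<and> given_by X (\<lambda>y. \<phi> y j) (pdim X' j) W h"
  shows "morphism X X' \<phi>"
proof -
  have loc': "\<exists>W h. x \<in> W \<and> (\<forall>j\<in>blocks X'. given_by X (\<lambda>y. \<phi> y j) (pdim X' j) W (h j))"
    if x: "x \<in> points X" for x
  proof -
    have "\<forall>j. \<exists>W h. j \<in> blocks X' \<longrightarrow> x \<in> W \<and> given_by X (\<lambda>y. \<phi> y j) (pdim X' j) W h"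
      using loc[OF x] by auto
    then obtain W h where W: "\<And>j. j \<in> blocks X' \<Longrightarrow> x \<in> W j \<and> given_by X (\<lambda>y. \<phi> y j) (pdim X' j) (W j) (h j)"
      by metis
    have op: "openin (zariski X) (\<Inter>j\<in>blocks X'. W j)"
      by (rule openin_INT2) (use wf' W in \<open>auto simp: wf_var_def given_by_def\<close>)
    have "given_by X (\<lambda>y. \<phi> y j) (pdim X' j) (\<Inter>j\<in>blocks X'. W j) (h j)" if "j \<in> blocks X'" for j
      using given_by_subset[OF wf _ op] W that by blast
    thus ?thesis using W by (intro exI[of _ "\<Inter>j\<in>blocks X'. W j"] exI[of _ h]) auto
  qed
  \<comment> \<open>The neighbourhood does not depend on the polynomial: \<open>f F\<close>
    evaluates \<open>F\<close> at the one coordinate family assembled from the functions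
    \<open>h\<close>, so numerator and denominator can be treated at the same
    representative.\<close>
  have pull: "\<exists>W f. x \<in> W \<and> openin (zariski X) W \<and>
      (\<forall>d F. mf X' d F \<longrightarrow> regular X W (f F)) \<and>
      (\<forall>y\<in>W. \<exists>V\<in>reps X' (\<phi> y). \<forall>d F. mf X' d F \<longrightarrow> f F y = F V)" if x: "x \<in> points X" for x
  proof -
    obtain W h where W: "x \<in> W" "\<And>j. j \<in> blocks X' \<Longrightarrow> given_by X (\<lambda>y. \<phi> y j) (pdim X' j) W (h j)"
      using loc'[OF x] by blast
    have op: "openin (zariski X) W" using W(2) wf_varD(2)[OF wf'] by (auto simp: given_by_def)
    define f where "f = (\<lambda>F y. F (\<lambda>j l. h j l y) :: complex)"
    have "regular X W (f F)" if "mf X' d F" for d F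
      unfolding f_def
      by (rule regular_multiform_comp[OF wf op that]) (use W in \<open>auto simp: given_by_def\<close>)
    moreover have "\<exists>V\<in>reps X' (\<phi> y). \<forall>d F. mf X' d F \<longrightarrow> f F y = F V" if "y \<in> W" for y
    proof (intro bexI[where x = "\<lambda>j\<in>blocks X'. \<lambda>l. if l \<le> pdim X' j then h j l y else 0"] allI impI)
      show "(\<lambda>j\<in>blocks X'. \<lambda>l. if l \<le> pdim X' j then h j l y else 0) \<in> reps X' (\<phi> y)"
        using W(2) that by (auto simp: given_by_def)
      fix d F assume "mf X' d F"
      thus "f F y = F (\<lambda>j\<in>blocks X'. \<lambda>l. if l \<le> pdim X' j then h j l y else 0)"
        unfolding f_def by (rule multiform_cong) auto
    qed
    ultimately show ?thesis using W(1) op by blast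
  qed
  have cont: "openin (zariski X) {x \<in> points X. \<phi> x \<in> U}" if U: "openin (zariski X') U" for U
  proof (subst openin_subopen, intro ballI)
    fix x assume x: "x \<in> {x \<in> points X. \<phi> x \<in> U}"
    obtain d F where F: "mf X' d F" "\<phi> x \<in> basic X' F" "basic X' F \<subseteq> U"
      using U x by (auto simp: openin_zariski_iff[OF wf'])
    obtain W f where W: "x \<in> W" "openin (zariski X) W"
      "\<And>d F. mf X' d F \<Longrightarrow> regular X W (f F)"
      "\<And>y. y \<in> W \<Longrightarrow> \<exists>V\<in>reps X' (\<phi> y). \<forall>d F. mf X' d F \<longrightarrow> f F y = F V"
      using pull x by (metis (no_types, lifting) mem_Collect_eq)
    let ?T = "{y \<in> W. f F y \<noteq> 0}"
    have "openin (zariski X) ?T" by (rule regular_nonzero_open[OF wf W(3)[OF F(1)]])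
    moreover have "x \<in> ?T" using W(1) W(4)[OF W(1)] F basicD by fastforce
    moreover have "?T \<subseteq> {x \<in> points X. \<phi> x \<in> U}"
    proof
      fix y assume y: "y \<in> ?T"
      hence yp: "y \<in> points X" using openin_zariski_subset[OF wf W(2)] by auto
      obtain V where V: "V \<in> reps X' (\<phi> y)" "f F y = F V" using W(4)[of y] y F(1) by blast
      hence "\<phi> y \<in> basic X' F" using basic_iff[OF wf' F(1) maps[OF yp] V(1)] y by auto
      thus "y \<in> {x \<in> points X. \<phi> x \<in> U}" using F yp by auto
    qed
    ultimately show "\<exists>T. openin (zariski X) T \<and> x \<in> T \<and> T \<subseteq> {x \<in> points X. \<phi> x \<in> U}" by blast
  qed
  have reg: "regular X {x \<in> points X. \<phi> x \<in> U} (g \<circ> \<phi>)"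
    if U: "openin (zariski X') U" and g: "regular X' U g" for U g
  proof (rule regular_glue[OF wf])
    fix x assume x: "x \<in> {x \<in> points X. \<phi> x \<in> U}"
    obtain d F G where 1: "mf X' d F" "mf X' d G" "\<phi> x \<in> basic X' G" "basic X' G \<subseteq> U"
      "\<And>y V. y \<in> basic X' G \<Longrightarrow> V \<in> reps X' y \<Longrightarrow> g y = F V / G V"
      using regularE[OF wf' g] x by blast
    obtain W f where W: "x \<in> W" "openin (zariski X) W"
      "\<And>d F. mf X' d F \<Longrightarrow> regular X W (f F)"
      "\<And>y. y \<in> W \<Longrightarrow> \<exists>V\<in>reps X' (\<phi> y). \<forall>d F. mf X' d F \<longrightarrow> f F y = F V"
      using pull x by (metis (no_types, lifting) mem_Collect_eq)
    let ?T = "{y \<in> W. f G y \<noteq> 0}"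
    have op: "openin (zariski X) ?T" by (rule regular_nonzero_open[OF wf W(3)[OF 1(2)]])
    have xT: "x \<in> ?T" using W(1) W(4)[OF W(1)] 1 basicD by fastforce
    have T: "y \<in> points X \<and> \<phi> y \<in> U \<and> g (\<phi> y) = f F y / f G y" if y: "y \<in> ?T" for y
    proof -
      have yp: "y \<in> points X" using openin_zariski_subset[OF wf W(2)] y by auto
      obtain V where V: "V \<in> reps X' (\<phi> y)" "f F y = F V" "f G y = G V" using W(4)[of y] y 1(1,2) by blast
      hence b: "\<phi> y \<in> basic X' G" using basic_iff[OF wf' 1(2) maps[OF yp] V(1)] y by auto
      thus ?thesis using 1(4) 1(5)[OF b V(1)] V yp by auto
    qed
    have "regular X ?T (\<lambda>y. f F y / f G y)"
      by (intro regular_divide[OF wf] regular_subset[OF wf W(3) op]) (use 1 in auto)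
    hence "regular X ?T (g \<circ> \<phi>)" by (rule regular_cong[OF wf]) (use T in auto)
    thus "\<exists>W. x \<in> W \<and> W \<subseteq> {x \<in> points X. \<phi> x \<in> U} \<and> regular X W (g \<circ> \<phi>)"
      using xT T by (intro exI[of _ ?T]) auto
  qed
  show ?thesis unfolding morphism_def
    by (intro conjI) (use maps cont reg wf wf' in \<open>auto simp: continuous_map_def\<close>)
qed

text \<open>Injectivity is automatic, since the forms \<open>H\<close> recover the point.\<close>

lemma isomorphismI:
  assumes wf: "wf_var X" and wf': "wf_var X'" and mor: "morphism X X' \<phi>"
    and surj: "\<phi> ` points X = points X'" and ext: "points X \<subseteq> extensional (blocks X)"
    and inv: "\<And>x0 i. x0 \<in> points X \<Longrightarrow> i \<in> blocks X \<Longrightarrow>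
      \<exists>d H r. (\<forall>l\<le>pdim X i. mf X' d (H l)) \<and> mf X' d r \<and> \<phi> x0 \<in> basic X' r \<and>
        (\<forall>x\<in>points X. \<forall>Z\<in>reps X' (\<phi> x). r Z \<noteq> 0 \<longrightarrow> (\<lambda>l. if l \<le> pdim X i then H l Z else 0) \<in> x i)"
  shows "isomorphism X X' \<phi>"
proof -
  have maps: "\<phi> x \<in> points X'" if "x \<in> points X" for x using surj that by auto
  have inj: "inj_on \<phi> (points X)"
  proof (rule inj_onI)
    fix x y assume xy: "x \<in> points X" "y \<in> points X" "\<phi> x = \<phi> y"
    have "x i = y i" if i: "i \<in> blocks X" for i
    proof -
      obtain d H r where H: "mf X' d r" "\<phi> x \<in> basic X' r"
        "\<And>x Z. x \<in> points X \<Longrightarrow> Z \<in> reps X' (\<phi> x) \<Longrightarrow> r Z \<noteq> 0 \<Longrightarrow>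
           (\<lambda>l. if l \<le> pdim X i then H l Z else 0) \<in> x i" using inv[OF xy(1) i] by blast
      obtain Z where Z: "Z \<in> reps X' (\<phi> x)" using reps_nonempty[OF wf' maps[OF xy(1)]] by blast
      have r0: "r Z \<noteq> 0" using H(2) Z basicD by blast
      have "(\<lambda>l. if l \<le> pdim X i then H l Z else 0) \<in> x i" by (rule H(3)[OF xy(1) Z r0])
      moreover have "(\<lambda>l. if l \<le> pdim X i then H l Z else 0) \<in> y i"
        by (rule H(3)[OF xy(2) _ r0]) (use Z xy(3) in simp)
      moreover have "x i \<in> PP (pdim X i)" "y i \<in> PP (pdim X i)"
        using wf xy i by (auto simp: wf_var_def)
      ultimately show ?thesis using PP_eqI[of "x i" "pdim X i" "y i"] by simp
    qed
    thus "x = y" using ext xy by (intro extensionalityI[of _ "blocks X"]) auto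
  qed
  define \<psi> where "\<psi> = inv_into (points X) \<phi>"
  have \<psi>: "\<psi> (\<phi> x) = x" if "x \<in> points X" for x using inj that by (simp add: \<psi>_def)
  have \<psi>': "\<psi> z \<in> points X" "\<phi> (\<psi> z) = z" if "z \<in> points X'" for z
    unfolding \<psi>_def using inv_into_into[of z \<phi> "points X"] f_inv_into_f[of z \<phi> "points X"]
      that surj by simp_all
  have "morphism X' X \<psi>"
  proof (rule morphismI[OF wf' wf])
    fix z i assume z: "z \<in> points X'" and i: "i \<in> blocks X"
    obtain d H r where H: "\<And>l. l \<le> pdim X i \<Longrightarrow> mf X' d (H l)" "mf X' d r" "\<phi> (\<psi> z) \<in> basic X' r"
        "\<And>x Z. x \<in> points X \<Longrightarrow> Z \<in> reps X' (\<phi> x) \<Longrightarrow> r Z \<noteq> 0 \<Longrightarrow>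
           (\<lambda>l. if l \<le> pdim X i then H l Z else 0) \<in> x i" using inv[OF \<psi>'(1)[OF z] i] by blast
    \<comment> \<open>Division by \<open>r\<close>, which has the same multidegree as the
      \<open>H l\<close>, turns these polynomials into functions on the target and only rescales the
      coordinate vector.\<close>
    have "given_by X' (\<lambda>y. \<psi> y i) (pdim X i) (basic X' r) (\<lambda>l. qfun X' (H l) r)"
      unfolding given_by_def
    proof (intro conjI ballI allI impI)
      show "openin (zariski X') (basic X' r)" using H(2) by auto
      show "regular X' (basic X' r) (qfun X' (H l) r)" if "l \<le> pdim X i" for l
        by (rule regular_qfun[OF wf' H(1)[OF that] H(2)])
      fix y assume y: "y \<in> basic X' r"
      hence yp: "y \<in> points X'" using basic_subset by auto
      obtain Z where Z: "Z \<in> reps X' y" using reps_nonempty[OF wf' yp] by blast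
      have r: "r Z \<noteq> 0" using y Z basicD by blast
      have mem: "(\<lambda>l. if l \<le> pdim X i then H l Z else 0) \<in> \<psi> y i"
        by (rule H(4)[OF \<psi>'(1)[OF yp] _ r]) (use Z \<psi>'(2)[OF yp] in simp)
      have "\<psi> y i \<in> PP (pdim X i)" using wf \<psi>'(1)[OF yp] i by (auto simp: wf_var_def)
      hence e1: "\<psi> y i = pt (\<lambda>l. if l \<le> pdim X i then H l Z else 0)" using PP_rep(2) mem by blast
      have e2: "(\<lambda>l. if l \<le> pdim X i then qfun X' (H l) r y else 0) =
          (\<lambda>l. (1 / r Z) * (if l \<le> pdim X i then H l Z else 0))"
        using qfun_eq[OF wf' H(1) H(2) yp Z] by auto
      show "(\<lambda>l. if l \<le> pdim X i then qfun X' (H l) r y else 0) \<in> \<psi> y i"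
        unfolding e1 e2 pt_iff using r by (intro exI[of _ "1 / r Z"] conjI refl) simp
    qed
    thus "\<exists>W h. z \<in> W \<and> given_by X' (\<lambda>y. \<psi> y i) (pdim X i) W h" using H(3) \<psi>'(2)[OF z] by auto
  qed (use \<psi>' in auto)
  thus ?thesis unfolding isomorphism_def using mor \<psi> \<psi>' by blast
qed

section \<open>Recognising polynomials from their restrictions to lines\<close>

section \<open>Interpolation\<close>

lemma poly_zeroI:
  fixes p :: "complex poly"
  assumes "finite X" "\<And>t. t \<notin> X \<Longrightarrow> poly p t = 0" shows "p = 0"
proof (rule ccontr)
  assume "p \<noteq> 0"
  hence "finite ({t. poly p t = 0} \<union> X)" using assms(1) poly_roots_finite by simp
  from finite_avoid[OF this] show False using assms(2) by auto
qed

text \<open>A representation with denominator of minimal degree cannot have a pole.\<close>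

lemma locally_rational_is_poly:
  fixes g :: "complex \<Rightarrow> complex"
  assumes loc: "\<And>t0. \<exists>A B. is_poly A \<and> is_poly B \<and> B t0 \<noteq> 0 \<and> (\<forall>t. B t \<noteq> 0 \<longrightarrow> g t = A t / B t)"
  shows "is_poly g"
proof -
  define Q where "Q = (\<lambda>A B :: complex poly. B \<noteq> 0 \<and> (\<forall>t. poly B t \<noteq> 0 \<longrightarrow> g t = poly A t / poly B t))"
  have loc': "\<exists>A B. Q A B \<and> poly B t \<noteq> 0" for t
  proof -
    obtain A B where "is_poly A" "is_poly B" "B t \<noteq> 0" "\<forall>t. B t \<noteq> 0 \<longrightarrow> g t = A t / B t"
      using loc[of t] by blast
    then obtain p q where "\<And>t. A t = poly p t" "\<And>t. B t = poly q t" by (auto simp: is_poly_def)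
    thus ?thesis using \<open>B t \<noteq> 0\<close> \<open>\<forall>t. B t \<noteq> 0 \<longrightarrow> g t = A t / B t\<close>
      by (intro exI[of _ p] exI[of _ q]) (auto simp: Q_def)
  qed
  \<comment> \<open>Multiplied by both denominators, the cross difference vanishes at every
    argument, so any two representations agree as fractions of polynomials.\<close>
  have cross: "A * B' = A' * B" if "Q A B" "Q A' B'" for A B A' B'
  proof -
    have "poly ((A * B' - A' * B) * (B * B')) t = 0" for t
    proof (cases "poly B t = 0 \<or> poly B' t = 0")
      case False
      hence "poly A t / poly B t = poly A' t / poly B' t" using that unfolding Q_def by metis
      thus ?thesis using False by (simp add: frac_eq_eq)
    qed auto
    hence "(A * B' - A' * B) * (B * B') = 0" using poly_all_0_iff_0 by blast
    thus ?thesis using that by (auto simp: Q_def)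
  qed
  define n where "n = (LEAST n. \<exists>A B. Q A B \<and> degree B = n)"
  have "\<exists>n A B. Q A B \<and> degree B = n" using loc' by blast
  then obtain A B where AB: "Q A B" "degree B = n" unfolding n_def
    using LeastI_ex[of "\<lambda>n. \<exists>A B. Q A B \<and> degree B = n"] by blast
  have least: "n \<le> degree B'" if "Q A' B'" for A' B'
    unfolding n_def by (rule Least_le) (use that in blast)
  have noroot: "poly B t1 \<noteq> 0" for t1
  proof
    \<comment> \<open>A second representation without pole at \<open>t1\<close> forces
      \<open>A\<close> to vanish there as well; cancelling the common linear factor contradicts the
      minimal degree.\<close>
    assume B0: "poly B t1 = 0"
    obtain A1 B1 where 1: "Q A1 B1" "poly B1 t1 \<noteq> 0" using loc' by blast
    have c: "A * B1 = A1 * B" by (rule cross[OF AB(1) 1(1)])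
    have "poly A t1 * poly B1 t1 = poly A1 t1 * poly B t1" using c by (metis poly_mult)
    hence "poly A t1 = 0" using B0 1(2) by auto
    then obtain A' B' where AB': "A = [:-t1, 1:] * A'" "B = [:-t1, 1:] * B'"
      using B0 unfolding poly_eq_0_iff_dvd by (auto elim!: dvdE)
    have "B' \<noteq> 0" using AB AB' by (auto simp: Q_def)
    have "[:-t1, 1:] * (A' * B1) = [:-t1, 1:] * (A1 * B')"
      using c unfolding AB' by (simp only: mult.assoc mult.left_commute)
    hence c': "A' * B1 = A1 * B'" by (subst (asm) mult_left_cancel) auto
    have "Q A' B'" unfolding Q_def
    proof (intro conjI allI impI)
      fix t assume t: "poly B' t \<noteq> 0"
      show "g t = poly A' t / poly B' t"
      proof (cases "t = t1")
        \<comment> \<open>At \<open>t1\<close> itself \<open>A / B\<close> carries no information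
          about \<open>g\<close>; the value comes from the second representation.\<close>
        case True
        have "poly A' t * poly B1 t = poly A1 t * poly B' t" using c' by (metis poly_mult)
        moreover have "g t = poly A1 t / poly B1 t" using 1 True by (simp add: Q_def)
        ultimately show ?thesis using 1(2) t True by (simp add: frac_eq_eq)
      next
        case False
        hence "poly B t \<noteq> 0" using t by (simp add: AB')
        hence "g t = poly A t / poly B t" using AB(1) by (simp add: Q_def)
        also have "\<dots> = ((t - t1) * poly A' t) / ((t - t1) * poly B' t)"
          by (simp add: AB' algebra_simps)
        finally show ?thesis using False by simp
      qed
    qed fact
    from least[OF this] AB(2) show False
      unfolding AB'(2) using \<open>B' \<noteq> 0\<close> by (subst (asm) degree_mult_eq) auto
  qed
  have "constant (poly B)"
    using fundamental_theorem_of_algebra[of B] noroot by blast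
  then obtain b where b: "\<And>t. poly B t = b" by (auto simp: constant_def)
  have "b \<noteq> 0" using noroot b by metis
  hence "g t = poly (smult (1 / b) A) t" for t using AB(1) b by (simp add: Q_def)
  thus ?thesis by (rule is_polyI)
qed

text \<open>\<open>g\<close> and \<open>h\<close> are the two affine charts of a homogeneous
  function of degree \<open>d\<close> on a projective line. Comparing \<open>g\<close> with the
  reflected polynomial of \<open>h\<close> bounds the degree.\<close>

lemma poly_degree_bound_reflect:
  fixes g h :: "complex \<Rightarrow> complex"
  assumes "is_poly g" "is_poly h" "\<And>t. t \<noteq> 0 \<Longrightarrow> g t = t ^ d * h (1 / t)"
  shows "\<exists>p. degree p \<le> d \<and> (\<forall>t. g t = poly p t)"
proof -
  obtain p q where p: "\<And>t. g t = poly p t" and q: "\<And>t. h t = poly q t"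
    using assms by (auto simp: is_poly_def)
  have "poly (monom 1 (degree q) * p - monom 1 d * reflect_poly q) t = 0" if "t \<notin> {0}" for t
    using that assms(3)[of t] poly_reflect_poly_nz[of t q]
    by (simp add: p q poly_monom field_simps)
  hence "monom 1 (degree q) * p - monom 1 d * reflect_poly q = 0"
    by (intro poly_zeroI[where X = "{0}"]) auto
  hence eq: "monom 1 (degree q) * p = monom 1 d * reflect_poly q" by simp
  have "degree p \<le> d"
  proof (cases "p = 0")
    case False
    have "degree q + degree p = degree (monom 1 (degree q) * p)"
      using False by (simp add: degree_mult_eq degree_monom_eq)
    also have "\<dots> \<le> d + degree (reflect_poly q)"
      unfolding eq using degree_mult_le[of "monom 1 d" "reflect_poly q"] by (simp add: degree_monom_eq)
    also have "\<dots> \<le> d + degree q" using degree_reflect_poly_le by simp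
    finally show ?thesis by simp
  qed simp
  thus ?thesis using p by blast
qed

lemma poly_sum_upto:
  fixes p :: "complex poly"
  assumes "degree p \<le> d" shows "poly p x = (\<Sum>i\<le>d. poly.coeff p i * x ^ i)"
  by (subst poly_as_sum_of_monoms'[OF assms, symmetric]) (simp add: poly_sum poly_monom)

text \<open>Lagrange interpolation in \<open>x\<close> at d + 1 nodes outside \<open>A\<close> has
  coefficients \<open>f r y\<close>, which are polynomials in \<open>y\<close>. It reproduces
  \<open>f\<close> on each line with \<open>y\<close> outside \<open>B\<close>, where
  \<open>f\<close> has degree at most \<open>d\<close> in \<open>x\<close>.\<close>

lemma lagrange_two_variables:
  fixes f :: "complex \<Rightarrow> complex \<Rightarrow> complex"
  assumes "finite A"
    and fA: "\<And>x. x \<notin> A \<Longrightarrow> \<exists>p. degree p \<le> d \<and> (\<forall>y. f x y = poly p y)"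
    and fB: "\<And>y. y \<notin> B \<Longrightarrow> \<exists>p. degree p \<le> d \<and> (\<forall>x. f x y = poly p x)"
  shows "\<exists>c. \<forall>x y. y \<notin> B \<longrightarrow> f x y = (\<Sum>i\<le>d. \<Sum>j\<le>d. c i j * x ^ i * y ^ j)"
proof -
  have "infinite (UNIV - A)" using assms(1) infinite_UNIV_char_0 by (rule Diff_infinite_finite)
  from infinite_arbitrarily_large[OF this, of "Suc d"]
  obtain T where T: "finite T" "card T = Suc d" "T \<subseteq> UNIV - A" by blast
  have "\<forall>x. \<exists>p. x \<notin> A \<longrightarrow> degree p \<le> d \<and> (\<forall>y. f x y = poly p y)" using fA by blast
  then obtain P where P: "\<And>x. x \<notin> A \<Longrightarrow> degree (P x) \<le> d" "\<And>x y. x \<notin> A \<Longrightarrow> f x y = poly (P x) y"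
    by metis
  define l where "l = (\<lambda>r. \<Prod>q\<in>T - {r}. smult (1 / (r - q)) [:- q, 1:])"
  have degl: "degree (l r) \<le> d" if "r \<in> T" for r
  proof -
    have "degree (l r) \<le> (\<Sum>q\<in>T - {r}. degree (smult (1 / (r - q)) [:- q, 1:]))"
      unfolding l_def
      using degree_prod_sum_le[of "T - {r}" "\<lambda>q. smult (1 / (r - q)) [:- q, 1:]"] T(1)
      unfolding o_def by blast
    also have "\<dots> \<le> (\<Sum>q\<in>T - {r}. 1)" by (intro sum_mono) auto
    also have "\<dots> = d" using T that by simp
    finally show ?thesis .
  qed
  have l1: "poly (l r) r = 1" for r
    unfolding l_def poly_prod
    by (intro prod.neutral) (auto simp: diff_divide_distrib[symmetric])
  have l0: "poly (l r) q = 0" if "q \<in> T" "q \<noteq> r" for r q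
    unfolding l_def poly_prod using that T by (intro prod_zero) auto
  have eq: "f x y = (\<Sum>r\<in>T. poly (l r) x * poly (P r) y)" if y: "y \<notin> B" for x y
  proof -
    obtain p where p: "degree p \<le> d" "\<And>x. f x y = poly p x" using fB[OF y] by blast
    define q where "q = (\<Sum>r\<in>T. smult (f r y) (l r))"
    have "p = q"
    proof (rule poly_eqI_degree)
      fix x assume x: "x \<in> T"
      have "poly q x = (\<Sum>r\<in>T. f r y * (if r = x then 1 else 0))"
        unfolding q_def poly_sum using l0 l1 x by (intro sum.cong) auto
      also have "\<dots> = f x y" using x T by (simp add: if_distrib cong: if_cong)
      finally show "poly p x = poly q x" using p by simp
    next
      show "card T > degree p" using p T by simp
      have "degree q \<le> d" unfolding q_def
        by (intro degree_sum_le) (use T degl degree_smult_le in \<open>auto intro: order_trans\<close>)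
      thus "card T > degree q" using T by simp
    qed
    hence "f x y = poly q x" using p(2) by simp
    hence "f x y = (\<Sum>r\<in>T. f r y * poly (l r) x)" by (simp only: q_def poly_sum poly_smult)
    also have "\<dots> = (\<Sum>r\<in>T. poly (l r) x * poly (P r) y)"
      using T P(2) by (intro sum.cong) auto
    finally show ?thesis .
  qed
  have "f x y = (\<Sum>i\<le>d. \<Sum>j\<le>d. (\<Sum>r\<in>T. poly.coeff (l r) i * poly.coeff (P r) j) * x ^ i * y ^ j)"
    if y: "y \<notin> B" for x y
  proof -
    have "f x y = (\<Sum>r\<in>T. \<Sum>i\<le>d. \<Sum>j\<le>d. poly.coeff (l r) i * x ^ i * (poly.coeff (P r) j * y ^ j))"
      unfolding eq[OF y]
    proof (rule sum.cong[OF refl])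
      fix r assume r: "r \<in> T"
      have "poly (P r) y = (\<Sum>j\<le>d. poly.coeff (P r) j * y ^ j)"
        by (rule poly_sum_upto) (use P(1) T r in auto)
      moreover have "poly (l r) x = (\<Sum>i\<le>d. poly.coeff (l r) i * x ^ i)"
        by (rule poly_sum_upto[OF degl[OF r]])
      ultimately show "poly (l r) x * poly (P r) y =
          (\<Sum>i\<le>d. \<Sum>j\<le>d. poly.coeff (l r) i * x ^ i * (poly.coeff (P r) j * y ^ j))"
        by (simp add: sum_product)
    qed
    also have "\<dots> = (\<Sum>i\<le>d. \<Sum>j\<le>d. \<Sum>r\<in>T. poly.coeff (l r) i * x ^ i * (poly.coeff (P r) j * y ^ j))"
      by (subst sum.swap, rule sum.cong[OF refl], rule sum.swap)
    finally show ?thesis by (simp add: sum_distrib_right sum_distrib_left mult_ac)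
  qed
  thus ?thesis by (intro exI[of _ "\<lambda>i j. \<Sum>r\<in>T. poly.coeff (l r) i * poly.coeff (P r) j"]) blast
qed

text \<open>The third family of lines bounds the total degree.\<close>

lemma homogeneous_interpolation:
  fixes h :: "complex \<Rightarrow> complex \<Rightarrow> complex \<Rightarrow> complex"
  assumes homog: "\<And>k x y z. k \<noteq> 0 \<Longrightarrow> h (k * x) (k * y) (k * z) = k ^ d * h x y z"
    and fin: "finite A" "finite B" "finite D"
    and hA: "\<And>x. x \<notin> A \<Longrightarrow> \<exists>p. degree p \<le> d \<and> (\<forall>y. h x y 1 = poly p y)"
    and hB: "\<And>y. y \<notin> B \<Longrightarrow> \<exists>p. degree p \<le> d \<and> (\<forall>x. h x y 1 = poly p x)"
    and hD: "\<And>y. y \<notin> D \<Longrightarrow> is_poly (\<lambda>z. h 1 y z)"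
  shows "\<exists>c. \<forall>x y. y \<notin> B \<longrightarrow> h x y 1 = (\<Sum>i\<le>d. \<Sum>j\<le>d. if i + j \<le> d then c i j * x ^ i * y ^ j else 0)"
proof -
  obtain c where c: "\<And>x y. y \<notin> B \<Longrightarrow> h x y 1 = (\<Sum>i\<le>d. \<Sum>j\<le>d. c i j * x ^ i * y ^ j)"
    using lagrange_two_variables[OF fin(1), of d "\<lambda>x y. h x y 1" B] hA hB by blast
  \<comment> \<open>By homogeneity \<open>h 1 y z\<close> is \<open>z^d\<close> times
    \<open>h (1 / z) (y / z) 1\<close>, to which the term with exponents \<open>i\<close>,
    \<open>j\<close> contributes \<open>z^(d - i - j)\<close>. After another factor
    \<open>z^d\<close> the terms of total degree \<open>k > d\<close> sit at
    \<open>z^(2d - k)\<close>, below \<open>z^d\<close>, whereas \<open>z^d\<close> times the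
    polynomial \<open>p\<close> has no such coefficients. The polynomial \<open>Q\<close> collects
    them as a function of \<open>y\<close>.\<close>
  have van: "c i j = 0" if ij: "i \<le> d" "j \<le> d" "i + j > d" for i j
  proof -
    define k where "k = i + j"
    define Q where "Q = (\<Sum>i\<le>d. \<Sum>j\<le>d. if i + j = k then monom (c i j) j else 0)"
    have "poly Q y = 0" if y: "y \<notin> insert 0 D" for y
    proof -
      have "is_poly (\<lambda>z. h 1 y z)" using hD y by auto
      then obtain p where p: "\<And>z. h 1 y z = poly p z" by (auto simp: is_poly_def)
      define q where "q = (\<Sum>i\<le>d. \<Sum>j\<le>d. monom (c i j * y ^ j) (2 * d - i - j))"
      have "poly (monom 1 d * p - q) z = 0" if z: "z \<notin> insert 0 ((\<lambda>b. y / b) ` B)" for z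
      proof -
        have z0: "z \<noteq> 0" using z by auto
        have yz: "y / z \<notin> B"
        proof
          assume "y / z \<in> B"
          hence "y / (y / z) \<in> (\<lambda>b. y / b) ` B" by blast
          thus False using z z0 y by simp
        qed
        have "h 1 y z = h (z * (1 / z)) (z * (y / z)) (z * 1)" using z0 by simp
        also have "\<dots> = z ^ d * h (1 / z) (y / z) 1" by (rule homog[OF z0])
        also have "\<dots> = z ^ d * (\<Sum>i\<le>d. \<Sum>j\<le>d. c i j * (1 / z) ^ i * (y / z) ^ j)" by (simp only: c[OF yz])
        finally have "z ^ d * h 1 y z = (\<Sum>i\<le>d. \<Sum>j\<le>d. c i j * y ^ j * (z ^ d * (1 / z) ^ i * (z ^ d * (1 / z) ^ j)))"
          by (simp add: sum_distrib_left power_divide algebra_simps)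
        also have "\<dots> = (\<Sum>i\<le>d. \<Sum>j\<le>d. c i j * y ^ j * z ^ (2 * d - i - j))"
        proof (intro sum.cong refl)
          fix i j assume "i \<in> {..d}" "j \<in> {..d}"
          hence "2 * d - i - j = (d - i) + (d - j)" "i \<le> d" "j \<le> d" by auto
          thus "c i j * y ^ j * (z ^ d * (1 / z) ^ i * (z ^ d * (1 / z) ^ j)) = c i j * y ^ j * z ^ (2 * d - i - j)"
            using z0 by (simp add: power_add power_diff power_divide)
        qed
        finally show ?thesis by (simp add: q_def p poly_sum poly_monom)
      qed
      hence "monom 1 d * p - q = 0"
        by (intro poly_zeroI[where X = "insert 0 ((\<lambda>b. y / b) ` B)"]) (use fin in auto)
      hence eq: "monom 1 d * p = q" by simp
      have "k \<le> 2 * d" "k > d" using ij by (auto simp: k_def)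
      hence "0 = poly.coeff (monom 1 d * p) (2 * d - k)" by (simp add: coeff_monom_mult)
      also have "\<dots> = (\<Sum>i\<le>d. \<Sum>j\<le>d. if i + j = k then c i j * y ^ j else 0)"
        unfolding eq q_def coeff_sum coeff_monom
        by (intro sum.cong refl) (use \<open>k \<le> 2 * d\<close> in auto)
      also have "\<dots> = poly Q y"
        unfolding Q_def poly_sum by (intro sum.cong refl) (auto simp: poly_monom)
      finally show ?thesis by simp
    qed
    hence "Q = 0" by (intro poly_zeroI[where X = "insert 0 D"]) (use fin in auto)
    hence "0 = poly.coeff Q j" by simp
    also have "\<dots> = (\<Sum>i'\<le>d. \<Sum>j'\<le>d. if j' = j then if i' = i then c i j else 0 else 0)"
      unfolding Q_def coeff_sum by (intro sum.cong refl) (auto simp: k_def)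
    also have "\<dots> = c i j" using ij by simp
    finally show ?thesis by simp
  qed
  show ?thesis
  proof (intro exI[of _ c] allI impI)
    fix x y assume "y \<notin> B"
    from c[OF this] show "h x y 1 = (\<Sum>i\<le>d. \<Sum>j\<le>d. if i + j \<le> d then c i j * x ^ i * y ^ j else 0)"
      using van by (auto intro!: sum.cong)
  qed
qed


section \<open>Cross products and monomials in three coordinates\<close>

section \<open>Vectors in three coordinates\<close>

lemma sum_le2 [simp]: "(\<Sum>i\<le>(2::nat). f i) = f 0 + f 1 + (f 2 :: 'a :: comm_monoid_add)"
  by (simp add: numeral_2_eq_2 add.assoc)

lemma prod_le2 [simp]: "(\<Prod>i\<le>(2::nat). f i) = f 0 * f 1 * (f 2 :: 'a :: comm_monoid_mult)"
  by (simp add: numeral_2_eq_2 mult.assoc)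

lemma le2_cases: "(l::nat) \<le> 2 \<longleftrightarrow> l = 0 \<or> l = 1 \<or> l = 2"
  by auto

text \<open>Cyclic labellings only, so that the signs in the cross product and in \<open>bq\<close>
  are the same for every labelling and one computation serves all three coordinates.\<close>

definition cyc :: "nat \<Rightarrow> nat \<Rightarrow> nat \<Rightarrow> bool" where
  "cyc i j k \<longleftrightarrow> (i, j, k) \<in> {(0, 1, 2), (1, 2, 0), (2, 0, 1)}"

lemma cyc_le: "cyc i j k \<Longrightarrow> i \<le> 2 \<and> j \<le> 2 \<and> k \<le> 2 \<and> i \<noteq> j \<and> j \<noteq> k \<and> i \<noteq> k"
  by (auto simp: cyc_def)

lemma cyc_rot: "cyc i j k \<Longrightarrow> cyc j k i"
  by (auto simp: cyc_def)

lemma cyc_ex: "i \<le> 2 \<Longrightarrow> \<exists>j k. cyc i j k"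
  by (auto simp: cyc_def le2_cases)

lemma cyc_cases: "cyc i j k \<Longrightarrow> l \<le> 2 \<Longrightarrow> l = i \<or> l = j \<or> l = k"
  by (auto simp: cyc_def)

lemma cyc_sum: "cyc i j k \<Longrightarrow> f 0 + f 1 + f 2 = f i + f j + (f k :: 'a :: comm_monoid_add)"
  by (auto simp: cyc_def ac_simps)

lemma cyc_prod: "cyc i j k \<Longrightarrow> f 0 * f 1 * f 2 = f i * f j * (f k :: 'a :: comm_monoid_mult)"
  by (auto simp: cyc_def ac_simps)

text \<open>The cross product: coordinates of the line joining two distinct points, and the
  equations of \<open>p\<close> when \<open>v\<close> varies.\<close>

definition crs :: "cvec \<Rightarrow> cvec \<Rightarrow> cvec" where
  "crs p v = (\<lambda>l. if l = 0 then p 1 * v 2 - p 2 * v 1 else if l = 1 then p 2 * v 0 - p 0 * v 2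
     else if l = 2 then p 0 * v 1 - p 1 * v 0 else 0)"

definition dot :: "cvec \<Rightarrow> cvec \<Rightarrow> complex" where
  "dot w v = (\<Sum>i\<le>2. w i * v i)"

definition vec2 :: "cvec \<Rightarrow> bool" where
  "vec2 v \<longleftrightarrow> (\<forall>i>2. v i = 0)"

lemma dot_eq: "dot w v = w 0 * v 0 + w 1 * v 1 + w 2 * v 2"
  by (simp add: dot_def)

lemma nonzero_vecs2: "v \<in> nonzero_vecs 2 \<longleftrightarrow> vec2 v \<and> (\<exists>l\<le>2. v l \<noteq> 0)"
  unfolding nonzero_vecs_def vec2_def fun_eq_iff by (auto simp: not_le) (meson leI)

lemma vec2_eqI: "vec2 u \<Longrightarrow> vec2 v \<Longrightarrow> (\<And>l. l \<le> 2 \<Longrightarrow> u l = v l) \<Longrightarrow> u = v"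
  unfolding vec2_def by (metis ext not_le)

lemma vec2_crs [simp, intro]: "vec2 (crs p v)"
  by (simp add: vec2_def crs_def)

lemma crs_cyc: "cyc i j k \<Longrightarrow> crs p v i = p j * v k - p k * v j"
  by (auto simp: cyc_def crs_def)

lemma dot_crs [simp]: "dot (crs p v) p = 0" "dot (crs p v) v = 0"
  by (simp_all add: dot_eq crs_def algebra_simps)

lemma crs_scale: "crs (\<lambda>i. a * p i) (\<lambda>i. b * v i) = (\<lambda>i. (a * b) * crs p v i)"
proof
  fix l
  show "crs (\<lambda>i. a * p i) (\<lambda>i. b * v i) l = (a * b) * crs p v l"
    by (cases "l = 0"; cases "l = 1"; cases "l = 2") (simp_all add: crs_def algebra_simps)
qed

lemma crs_self [simp]: "crs p p = (\<lambda>_. 0)"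
  by (auto simp: crs_def fun_eq_iff)

text \<open>Both \<open>w\<close> and \<open>p \<times> v\<close> are orthogonal to \<open>p\<close> and \<open>v\<close>, hence parallel.\<close>

lemma crs_parallel:
  assumes "dot w p = 0" "dot w v = 0" "l \<le> 2" "k \<le> 2"
  shows "crs p v l * w k = crs p v k * w l"
proof -
  have a: "w 0 * p 0 + w 1 * p 1 + w 2 * p 2 = 0" "w 0 * v 0 + w 1 * v 1 + w 2 * v 2 = 0"
    using assms by (simp_all add: dot_eq)
  have "crs p v 0 * w 1 = crs p v 1 * w 0" "crs p v 1 * w 2 = crs p v 2 * w 1"
    "crs p v 2 * w 0 = crs p v 0 * w 2"
    using a unfolding crs_def by simp_all algebra+
  thus ?thesis using assms(3,4) unfolding le2_cases by metis
qed

lemma parallel_scale: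
  assumes "vec2 u" "vec2 w" "w l0 \<noteq> 0" "l0 \<le> 2" "\<And>l. l \<le> 2 \<Longrightarrow> u l * w l0 = u l0 * w l"
  shows "u = (\<lambda>l. (u l0 / w l0) * w l)"
proof (rule vec2_eqI)
  fix l :: nat assume "l \<le> 2"
  from assms(5)[OF this] show "u l = (u l0 / w l0) * w l" using assms(3) by (simp add: field_simps)
qed (use assms in \<open>auto simp: vec2_def\<close>)

lemma crs_zero_imp:
  assumes "crs p v = (\<lambda>_. 0)" "vec2 p" "vec2 v" "p l0 \<noteq> 0" "l0 \<le> 2"
  shows "v = (\<lambda>l. (v l0 / p l0) * p l)"
proof (rule parallel_scale[OF assms(3,2,4,5)])
  fix l :: nat assume "l \<le> 2"
  have "crs p v 0 = 0" "crs p v 1 = 0" "crs p v 2 = 0" by (simp_all add: assms(1))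
  thus "v l * p l0 = v l0 * p l" using \<open>l \<le> 2\<close> assms(5) unfolding le2_cases
    by (auto simp: crs_def algebra_simps)
qed

text \<open>The vector triple product identity.\<close>

lemma crs_crs: "l \<le> 2 \<Longrightarrow> crs p (crs w e) l = w l * dot p e - e l * dot p w"
  unfolding le2_cases by (elim disjE; simp add: crs_def dot_eq algebra_simps)

text \<open>Every line through \<open>p\<close> joins \<open>p\<close> to some \<open>u\<close>. By
  the triple product identity, crossing \<open>w\<close> with the \<open>j\<close>-th unit vector
  and dividing by \<open>p j\<close> gives such a \<open>u\<close>, because \<open>w\<close> is
  orthogonal to \<open>p\<close>.\<close>

lemma crs_section:
  assumes "dot w p = 0" "p j \<noteq> 0" "j \<le> 2" "vec2 w"
  obtains u where "vec2 u" "crs p u = w"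
proof -
  define u where "u = (\<lambda>l. (1 / p j) * crs w (\<lambda>l. if l = j then 1 else 0) l)"
  have "vec2 u" using vec2_crs[of w "\<lambda>l. if l = j then 1 else 0"] by (auto simp: u_def vec2_def)
  moreover have "crs p u = w"
  proof (rule vec2_eqI)
    fix l :: nat assume l: "l \<le> 2"
    have a: "w 0 * p 0 + w 1 * p 1 + w 2 * p 2 = 0" using assms(1) by (simp add: dot_eq)
    have "crs p u l = (1 / p j) * crs p (crs w (\<lambda>l. if l = j then 1 else 0)) l"
      unfolding u_def using crs_scale[of 1 p "1 / p j"] by simp
    moreover have "crs p (crs w (\<lambda>l. if l = j then 1 else 0)) l = p j * w l"
      using crs_crs[OF l, of p w] a assms(3) by (auto simp: dot_eq le2_cases mult.commute)
    ultimately show "crs p u l = w l" using assms(2) by simp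
  qed (use assms in auto)
  ultimately show ?thesis using that by blast
qed


section \<open>Ternary monomials\<close>

lemma exponents2: "a \<in> exponents 2 d \<longleftrightarrow> (\<forall>i>2. a i = 0) \<and> a 0 + a 1 + a 2 = d"
  by (simp add: exponents_def)

lemma exponents2_eqI:
  assumes "a \<in> exponents 2 d" "b \<in> exponents 2 d" "cyc i j k" "a i = b i" "a j = b j"
  shows "a = b"
proof
  fix l
  have "a i + a j + a k = b i + b j + b k"
    using assms(1,2) cyc_sum[OF assms(3), of a] cyc_sum[OF assms(3), of b] by (simp add: exponents2)
  hence "a k = b k" using assms by simp
  thus "a l = b l" using assms cyc_cases[OF assms(3), of l] by (cases "l \<le> 2") (auto simp: exponents2)
qed

lemma power_sum_independent:
  fixes c :: "'a \<Rightarrow> complex"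
  assumes "finite T" "inj_on k T" "\<And>t. t \<noteq> 0 \<Longrightarrow> (\<Sum>a\<in>T. c a * t ^ k a) = 0" "b \<in> T"
  shows "c b = 0"
proof -
  define p where "p = (\<Sum>a\<in>T. monom (c a) (k a))"
  have "poly p t = 0" if "t \<notin> {0}" for t
    using assms(3) that by (simp add: p_def poly_sum poly_monom)
  hence "p = 0" by (intro poly_zeroI[where X = "{0}"]) auto
  hence "0 = poly.coeff p (k b)" by simp
  also have "\<dots> = (\<Sum>a\<in>T. if a = b then c b else 0)"
    unfolding p_def coeff_sum coeff_monom using assms(2,4) by (intro sum.cong) (auto dest: inj_onD)
  finally show ?thesis using assms by simp
qed

text \<open>Kronecker substitution along the curve \<open>(t, t^(d+1), 1)\<close>: the first two
  exponents become the digits of one exponent in base d + 1, so distinct monomials give distinct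
  powers of \<open>t\<close>.\<close>

lemma monomials_independent:
  assumes z: "\<And>v. vec2 v \<Longrightarrow> (\<And>l. l \<le> 2 \<Longrightarrow> v l \<noteq> 0) \<Longrightarrow>
      (\<Sum>a\<in>exponents 2 d. c a * (\<Prod>i\<le>2. v i ^ a i)) = 0"
    and b: "b \<in> exponents 2 d"
  shows "c b = 0"
proof (rule power_sum_independent[OF _ _ _ b, where k = "\<lambda>a. a 0 + (d + 1) * a 1"])
  show "inj_on (\<lambda>a. a 0 + (d + 1) * a 1) (exponents 2 d)"
  proof (rule inj_onI)
    fix a b assume ab: "a \<in> exponents 2 d" "b \<in> exponents 2 d" "a 0 + (d + 1) * a 1 = b 0 + (d + 1) * b 1"
    have lt: "a 0 < d + 1" "b 0 < d + 1" using ab by (auto simp: exponents2)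
    have "(a 0 + (d + 1) * a 1) mod (d + 1) = a 0" "(b 0 + (d + 1) * b 1) mod (d + 1) = b 0"
      using lt by (simp_all only: mod_mult_self2 mod_less)
    hence "a 0 = b 0" using ab(3) by metis
    moreover have "(d + 1) * a 1 = (d + 1) * b 1" using \<open>a 0 = b 0\<close> ab(3) by linarith
    hence "a 1 = b 1" by (simp only: mult_cancel1) simp
    ultimately show "a = b" by (intro exponents2_eqI[OF ab(1,2), of 0 1 2]) (auto simp: cyc_def)
  qed
  fix t :: complex assume "t \<noteq> 0"
  define v where "v = (\<lambda>l::nat. if l = 0 then t else if l = 1 then t ^ (d + 1) else if l = 2 then 1 else 0)"
  have "(\<Sum>a\<in>exponents 2 d. c a * (\<Prod>i\<le>2. v i ^ a i)) = 0"
    by (rule z) (use \<open>t \<noteq> 0\<close> in \<open>auto simp: v_def vec2_def le2_cases\<close>)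
  moreover have "(\<Prod>i\<le>2. v i ^ a i) = t ^ (a 0 + (d + 1) * a 1)" for a
    unfolding prod_le2 by (simp add: v_def power_add power_mult power_mult_distrib)
  ultimately show "(\<Sum>a\<in>exponents 2 d. c a * t ^ (a 0 + (d + 1) * a 1)) = 0" by simp
qed auto

text \<open>An affine parametrisation of the coordinate line through the \<open>j\<close>-th and
  \<open>k\<close>-th coordinate points; only the \<open>j\<close>-th one is missed, at
  infinity.\<close>

definition edge_vec :: "nat \<Rightarrow> nat \<Rightarrow> complex \<Rightarrow> cvec" where
  "edge_vec j k t = (\<lambda>l. if l = j then t else if l = k then 1 else 0)"

lemma edge_monomials_independent:
  assumes cyc: "cyc i j k"
    and z: "\<And>t. (\<Sum>a\<in>exponents 2 d. c a * (\<Prod>l\<le>2. edge_vec j k t l ^ a l)) = 0"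
    and b: "b \<in> exponents 2 d" "b i = 0"
  shows "c b = 0"
proof (rule power_sum_independent[where c = c and b = b and T = "{a \<in> exponents 2 d. a i = 0}" and k = "\<lambda>a. a j"])
  show "inj_on (\<lambda>a. a j) {a \<in> exponents 2 d. a i = 0}"
    by (rule inj_onI) (auto intro!: exponents2_eqI[OF _ _ cyc])
  fix t :: complex assume "t \<noteq> 0"
  have pr: "(\<Prod>l\<le>2. edge_vec j k t l ^ a l) = (if a i = 0 then t ^ a j else 0)" for a
    using cyc_prod[OF cyc, of "\<lambda>l. edge_vec j k t l ^ a l"] cyc_le[OF cyc] unfolding prod_le2
    by (simp add: edge_vec_def power_0_left)
  have "(\<Sum>a\<in>{a \<in> exponents 2 d. a i = 0}. c a * t ^ a j) =
      (\<Sum>a\<in>exponents 2 d. c a * (\<Prod>l\<le>2. edge_vec j k t l ^ a l))"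
    unfolding pr by (intro sum.mono_neutral_cong_left) auto
  thus "(\<Sum>a\<in>{a \<in> exponents 2 d. a i = 0}. c a * t ^ a j) = 0" using z by simp
qed (use b in auto)

lemma card_exponents2: "card (exponents 2 d) = (d + 1) * (d + 2) div 2"
proof -
  define g :: "nat \<times> nat \<Rightarrow> nat \<Rightarrow> nat" where
    "g = (\<lambda>p l. if l = 0 then fst p else if l = 1 then snd p else if l = 2 then d - fst p - snd p else 0)"
  have "bij_betw (\<lambda>a. (a 0, a 1)) (exponents 2 d) (SIGMA i:{..d}. {..d - i})"
  proof (rule bij_betwI[where g = g])
    show "g (a 0, a 1) = a" if "a \<in> exponents 2 d" for a
    proof
      fix l show "g (a 0, a 1) l = a l"
        using that by (cases "l \<le> 2") (auto simp: exponents2 le2_cases g_def)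
    qed
  qed (auto simp: exponents2 g_def)
  hence "card (exponents 2 d) = (\<Sum>i\<le>d. d - i + 1)"
    by (simp add: bij_betw_same_card)
  also have "\<dots> = (\<Sum>i\<le>d. i + 1)"
    by (rule sum.reindex_bij_witness[of _ "\<lambda>i. d - i" "\<lambda>i. d - i"]) auto
  also have "\<dots> = (d + 1) * (d + 2) div 2"
    by (induction d) auto
  finally show ?thesis .
qed

section \<open>The blow-up, polynomial arcs on it, and density of the torus\<close>

section \<open>Blow-ups of the plane\<close>

lemma on_line_pt: "on_line (pt v) (pt w) \<longleftrightarrow> dot w v = 0"
proof
  assume "on_line (pt v) (pt w)"
  thus "dot w v = 0" unfolding on_line_def dot_def using pt_self by blast
next
  assume a: "dot w v = 0"
  show "on_line (pt v) (pt w)" unfolding on_line_def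
  proof (intro ballI)
    fix v' w' assume "v' \<in> pt v" "w' \<in> pt w"
    then obtain c c' where "v' = (\<lambda>i. c * v i)" "w' = (\<lambda>i. c' * w i)" by (auto simp: pt_iff)
    hence "(\<Sum>i\<le>2. w' i * v' i) = c * c' * dot w v" by (simp add: dot_eq algebra_simps)
    thus "(\<Sum>i\<le>2. w' i * v' i) = 0" using a by simp
  qed
qed

text \<open>The last assumption places the centres on the coordinate triangle, so the complementary
  torus avoids them and can serve as the dense set on which identities are tested.\<close>

locale blown_up_plane =
  fixes S :: "ppoint set"
  assumes finite_S: "finite S" and S_PP: "S \<subseteq> PP 2"
    and S_axes: "\<And>v. v \<in> nonzero_vecs 2 \<Longrightarrow> v 0 * v 1 * v 2 \<noteq> 0 \<Longrightarrow> pt v \<notin> S"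
begin

abbreviation Y :: "ppoint option variety" where "Y \<equiv> blowup S"

definition R :: "ppoint \<Rightarrow> cvec" where "R p = (SOME v. v \<in> p)"

lemma R_in: assumes "p \<in> S" shows "R p \<in> p" "R p \<in> nonzero_vecs 2" "pt (R p) = p"
proof -
  have p: "p \<in> PP 2" using assms S_PP by auto
  show R: "R p \<in> p" unfolding R_def using PP_nonempty[OF p] by (rule someI_ex)
  show "R p \<in> nonzero_vecs 2" "pt (R p) = p" using PP_rep[OF p R] by auto
qed

lemma Y_simps [simp]: "blocks Y = insert None (Some ` S)" "pdim Y i = 2"
  by (simp_all add: blowup_def)

lemma wfY: "wf_var Y"
  unfolding wf_var_def by (auto simp: finite_S) (auto simp: blowup_def)

lemma finite_blocks [simp, intro]: "finite (Some ` S)"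
  using finite_S by simp

lemma points_extensional: "points Y \<subseteq> extensional (blocks Y)"
  by (auto simp: blowup_def PiE_def)

lemma reps_None:
  assumes "y \<in> points Y" "V \<in> reps Y y"
  shows "V None \<in> nonzero_vecs 2" "y None = pt (V None)"
proof -
  have "y None \<in> PP 2" "V None \<in> y None" using assms by (auto simp: blowup_def)
  thus "V None \<in> nonzero_vecs 2" "y None = pt (V None)" using PP_rep by auto
qed

lemma reps_Some:
  assumes "y \<in> points Y" "V \<in> reps Y y" "p \<in> S"
  shows "V (Some p) \<in> nonzero_vecs 2" "y (Some p) = pt (V (Some p))"
    "dot (V (Some p)) (R p) = 0" "dot (V (Some p)) (V None) = 0"
proof -
  have "y (Some p) \<in> PP 2" "V (Some p) \<in> y (Some p)" using assms by (auto simp: blowup_def)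
  thus w: "V (Some p) \<in> nonzero_vecs 2" "y (Some p) = pt (V (Some p))" using PP_rep by auto
  have "on_line (pt (R p)) (pt (V (Some p)))" "on_line (pt (V None)) (pt (V (Some p)))"
    using assms w R_in(3)[OF assms(3)] reps_None[OF assms(1,2)] by (auto simp: blowup_def)
  thus "dot (V (Some p)) (R p) = 0" "dot (V (Some p)) (V None) = 0" by (simp_all add: on_line_pt)
qed

definition pnt :: "(ppoint option \<Rightarrow> cvec) \<Rightarrow> ppoint option \<Rightarrow> ppoint" where
  "pnt V = (\<lambda>i\<in>blocks Y. pt (V i))"

lemma pntI:
  assumes "V None \<in> nonzero_vecs 2" "V \<in> extensional (blocks Y)"
    "\<And>p. p \<in> S \<Longrightarrow> V (Some p) \<in> nonzero_vecs 2"
    "\<And>p. p \<in> S \<Longrightarrow> dot (V (Some p)) (R p) = 0"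
    "\<And>p. p \<in> S \<Longrightarrow> dot (V (Some p)) (V None) = 0"
  shows "pnt V \<in> points Y" "V \<in> reps Y (pnt V)"
proof -
  show "V \<in> reps Y (pnt V)" using assms(2) by (auto simp: pnt_def PiE_def)
  have "on_line p (pnt V (Some p))" "on_line (pnt V None) (pnt V (Some p))" if p: "p \<in> S" for p
    using assms(4,5)[OF p] R_in(3)[OF p] p on_line_pt[of "R p" "V (Some p)"]
      on_line_pt[of "V None" "V (Some p)"] by (auto simp: pnt_def)
  thus "pnt V \<in> points Y" using assms(1,3) by (auto simp: blowup_def pnt_def)
qed

text \<open>Off the centres the fibre of the blow-down is a single point, as the line through
  \<open>p\<close> and \<open>v\<close> is then determined and given by the cross product.\<close>

definition lift_vec :: "cvec \<Rightarrow> ppoint option \<Rightarrow> cvec" where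
  "lift_vec v = (\<lambda>i\<in>blocks Y. case i of None \<Rightarrow> v | Some p \<Rightarrow> crs (R p) v)"

definition lift :: "cvec \<Rightarrow> ppoint option \<Rightarrow> ppoint" where
  "lift v = pnt (lift_vec v)"

lemma lift_vec_simps [simp]:
  "lift_vec v None = v" "p \<in> S \<Longrightarrow> lift_vec v (Some p) = crs (R p) v"
  by (simp_all add: lift_vec_def)

lemma crs_R_nonzero:
  assumes "v \<in> nonzero_vecs 2" "pt v \<noteq> p" "p \<in> S" shows "crs (R p) v \<in> nonzero_vecs 2"
proof -
  have R: "R p \<in> nonzero_vecs 2" "pt (R p) = p" using R_in[OF assms(3)] by auto
  obtain l0 where l0: "l0 \<le> 2" "R p l0 \<noteq> 0" using R(1) by (auto simp: nonzero_vecs2)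
  have "crs (R p) v \<noteq> (\<lambda>_. 0)"
  proof
    assume "crs (R p) v = (\<lambda>_. 0)"
    hence v: "v = (\<lambda>l. (v l0 / R p l0) * R p l)"
      using crs_zero_imp[of "R p" v l0] assms R l0 by (auto simp: nonzero_vecs2)
    have "v l0 / R p l0 \<noteq> 0"
    proof
      assume "v l0 / R p l0 = 0"
      hence "v = (\<lambda>_. 0)" using v by (metis mult_zero_left)
      thus False using assms(1) by (simp add: nonzero_vecs_def)
    qed
    hence "pt v = pt (R p)" using v pt_scale by metis
    thus False using assms R by simp
  qed
  thus ?thesis using vec2_crs[of "R p" v] by (simp add: nonzero_vecs_def vec2_def)
qed

lemma lift_in:
  assumes "v \<in> nonzero_vecs 2" "pt v \<notin> S"
  shows "lift v \<in> points Y" "lift_vec v \<in> reps Y (lift v)" "lift v None = pt v"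
proof -
  have c: "crs (R p) v \<in> nonzero_vecs 2" if "p \<in> S" for p
    by (rule crs_R_nonzero) (use assms that in auto)
  have e: "lift_vec v \<in> extensional (blocks Y)" by (simp add: lift_vec_def)
  show "lift v \<in> points Y" "lift_vec v \<in> reps Y (lift v)"
    unfolding lift_def by (rule pntI; use assms c e in simp)+
  show "lift v None = pt v" by (simp add: lift_def pnt_def)
qed

text \<open>Both vectors are orthogonal to \<open>R q\<close> and to \<open>V None\<close>, which
  are linearly independent because \<open>y\<close> does not lie over \<open>q\<close>. This makes
  the block of \<open>q\<close> redundant away from \<open>q\<close>.\<close>

lemma reps_Some_scale:
  assumes "y \<in> points Y" "V \<in> reps Y y" "q \<in> S" "y None \<noteq> q"
  shows "\<exists>c. c \<noteq> 0 \<and> V (Some q) = (\<lambda>l. c * crs (R q) (V None) l)"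
proof -
  have v: "V None \<in> nonzero_vecs 2" "y None = pt (V None)" using reps_None[OF assms(1,2)] by auto
  have w: "V (Some q) \<in> nonzero_vecs 2" "dot (V (Some q)) (R q) = 0" "dot (V (Some q)) (V None) = 0"
    using reps_Some[OF assms(1-3)] by auto
  have "crs (R q) (V None) \<in> nonzero_vecs 2" by (rule crs_R_nonzero) (use v assms in auto)
  then obtain l0 where l0: "l0 \<le> 2" "crs (R q) (V None) l0 \<noteq> 0" by (auto simp: nonzero_vecs2)
  have eq: "V (Some q) = (\<lambda>l. (V (Some q) l0 / crs (R q) (V None) l0) * crs (R q) (V None) l)"
  proof (rule parallel_scale[where w = "crs (R q) (V None)"])
    show "vec2 (V (Some q))" using w(1) by (simp add: nonzero_vecs2)
    show "V (Some q) l * crs (R q) (V None) l0 = V (Some q) l0 * crs (R q) (V None) l" if "l \<le> 2" for l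
      using crs_parallel[OF w(2,3) l0(1) that] by (simp add: mult.commute)
  qed (use l0 in auto)
  moreover have "V (Some q) l0 / crs (R q) (V None) l0 \<noteq> 0"
  proof
    assume "V (Some q) l0 / crs (R q) (V None) l0 = 0"
    hence "V (Some q) = (\<lambda>_. 0)" using eq by (metis mult_zero_left)
    thus False using w(1) by (simp add: nonzero_vecs_def)
  qed
  ultimately show ?thesis by blast
qed

subsection \<open>Arcs and density\<close>

text \<open>The term \<open>t\<^sup>2 n\<close> moves the arc off the coordinate lines without changing the tangent
  direction \<open>u\<close>, which is prescribed by the point of the exceptional divisor.\<close>

definition arc :: "cvec \<Rightarrow> cvec \<Rightarrow> cvec \<Rightarrow> complex \<Rightarrow> cvec" where
  "arc v u n t = (\<lambda>l. v l + t * u l + t\<^sup>2 * n l)"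

lemma vec2_arc: "vec2 v \<Longrightarrow> vec2 u \<Longrightarrow> vec2 n \<Longrightarrow> vec2 (arc v u n t)"
  by (simp add: vec2_def arc_def)

lemma is_poly_arc [intro]: "is_poly (\<lambda>t. arc v u n t l)"
  unfolding arc_def by (intro is_poly_add is_poly_mult is_poly_power) auto

lemma crs_arc: "crs p (arc v u n t) l = crs p v l + t * crs p u l + t\<^sup>2 * crs p n l"
  by (cases "l = 0"; cases "l = 1"; cases "l = 2") (simp_all add: crs_def arc_def algebra_simps)

text \<open>\<open>Vt\<close> continues the lift of the arc polynomially to \<open>t = 0\<close>,
  where the arc may sit at a centre and \<open>lift\<close> no longer describes the point.\<close>

definition lifted_arc where
  "lifted_arc V u n Vt \<longleftrightarrow> (\<forall>i\<in>blocks Y. \<forall>l. is_poly (\<lambda>t. Vt t i l)) \<and> Vt 0 = V \<and>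
       (\<forall>t. t \<noteq> 0 \<longrightarrow> arc (V None) u n t \<in> nonzero_vecs 2 \<longrightarrow> pt (arc (V None) u n t) \<notin> S \<longrightarrow>
          Vt t \<in> reps Y (lift (arc (V None) u n t)))"

lemma arc_lift:
  assumes y: "y \<in> points Y" and V: "V \<in> reps Y y"
  obtains u where "vec2 u" "y None \<in> S \<Longrightarrow> crs (R (y None)) u = V (Some (y None))"
    "y None \<notin> S \<Longrightarrow> u = (\<lambda>_. 0)"
    "\<And>n. vec2 n \<Longrightarrow> \<exists>Vt. lifted_arc V u n Vt"
proof -
  have v: "V None \<in> nonzero_vecs 2" "y None = pt (V None)" using reps_None[OF y V] by auto
  have "\<exists>u. vec2 u \<and> (y None \<in> S \<longrightarrow> crs (R (y None)) u = V (Some (y None))) \<and>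
    (y None \<notin> S \<longrightarrow> u = (\<lambda>_. 0))"
  proof (cases "y None \<in> S")
    case True
    have w: "V (Some (y None)) \<in> nonzero_vecs 2" "dot (V (Some (y None))) (R (y None)) = 0"
      using reps_Some[OF y V True] by auto
    obtain j where "j \<le> 2" "R (y None) j \<noteq> 0" using R_in(2)[OF True] by (auto simp: nonzero_vecs2)
    from crs_section[OF w(2) this(2,1)] w(1) True show ?thesis by (auto simp: nonzero_vecs2)
  qed (auto simp: vec2_def)
  then obtain u where u: "vec2 u" "y None \<in> S \<Longrightarrow> crs (R (y None)) u = V (Some (y None))"
    "y None \<notin> S \<Longrightarrow> u = (\<lambda>_. 0)" by blast
  have "\<forall>q. \<exists>c. q \<in> S \<and> y None \<noteq> q \<longrightarrow> c \<noteq> 0 \<and> V (Some q) = (\<lambda>l. c * crs (R q) (V None) l)"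
    using reps_Some_scale[OF y V] by blast
  then obtain c where c: "\<And>q. q \<in> S \<Longrightarrow> y None \<noteq> q \<Longrightarrow>
      c q \<noteq> 0 \<and> V (Some q) = (\<lambda>l. c q * crs (R q) (V None) l)" by metis
  have "\<exists>Vt. lifted_arc V u n Vt" if n: "vec2 n" for n
  proof -
    \<comment> \<open>In the block of the centre below \<open>y\<close> the common factor
      \<open>t\<close> has been divided out, leaving the term from \<open>n\<close> with a single
      \<open>t\<close>. In the other blocks the constant \<open>c q\<close> matches the given
      vectors at \<open>t = 0\<close>.\<close>
    define Vt where "Vt = (\<lambda>t. \<lambda>i\<in>blocks Y. case i of None \<Rightarrow> arc (V None) u n t
      | Some q \<Rightarrow> if q = y None then (\<lambda>l. V (Some q) l + t * crs (R q) n l)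
          else (\<lambda>l. c q * crs (R q) (arc (V None) u n t) l))"
    have "is_poly (\<lambda>t. Vt t i l)" if i: "i \<in> blocks Y" for i l
    proof (cases i)
      case None thus ?thesis by (auto simp: Vt_def)
    next
      case (Some q)
      have "is_poly (\<lambda>t. V (Some q) l + t * crs (R q) n l)"
        by (intro is_poly_add is_poly_mult) auto
      moreover have "is_poly (\<lambda>t. c q * crs (R q) (arc (V None) u n t) l)"
        unfolding crs_arc by (intro is_poly_add is_poly_mult is_poly_power) auto
      ultimately show ?thesis using Some i by (cases "q = y None") (auto simp: Vt_def)
    qed
    moreover have "Vt 0 = V"
    proof (rule extensionalityI[of _ "blocks Y"])
      show "V \<in> extensional (blocks Y)" using V by (simp add: PiE_def)
      fix i assume i: "i \<in> blocks Y"
      show "Vt 0 i = V i"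
      proof (cases i)
        case None thus ?thesis by (simp add: Vt_def arc_def)
      next
        case (Some q)
        have "(\<lambda>l. c q * crs (R q) (arc (V None) u n 0) l) = V (Some q)" if "q \<noteq> y None"
          using c[of q] that i Some by (auto simp: crs_arc)
        thus ?thesis using i Some by (auto simp: Vt_def)
      qed
    qed (simp add: Vt_def)
    moreover have "Vt t \<in> reps Y (lift (arc (V None) u n t))"
      if t: "t \<noteq> 0" and a: "arc (V None) u n t \<in> nonzero_vecs 2" "pt (arc (V None) u n t) \<notin> S" for t
    proof (rule PiE_I)
      fix i assume i: "i \<in> blocks Y"
      let ?a = "arc (V None) u n t"
      show "Vt t i \<in> lift ?a i"
      proof (cases i)
        case None thus ?thesis by (simp add: Vt_def lift_def pnt_def)
      next
        case (Some q)
        hence q: "q \<in> S" using i by auto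
        have L: "lift ?a i = pt (crs (R q) ?a)" using Some q by (simp add: lift_def pnt_def)
        show ?thesis
        proof (cases "q = y None")
          case True
          obtain k where "V None = (\<lambda>l. k * R q l)"
            using R_in(1)[OF q] v True pt_iff R_in(3)[OF q] pt_self by metis
          hence z: "crs (R q) (V None) = (\<lambda>_. 0)"
            using crs_scale[of 1 "R q" k "R q"] by simp
          have "Vt t i = (\<lambda>l. (1 / t) * crs (R q) ?a l)"
            using Some i True u(2) q t z
            by (auto simp: Vt_def crs_arc fun_eq_iff field_simps power2_eq_square)
          thus ?thesis unfolding L pt_iff using t by (intro exI[of _ "1 / t"]) simp
        next
          case False
          hence "Vt t i = (\<lambda>l. c q * crs (R q) ?a l)" using Some i by (simp add: Vt_def)
          thus ?thesis unfolding L pt_iff using c[of q] q False by (intro exI[of _ "c q"]) simp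
        qed
      qed
    qed (auto simp: Vt_def)
    ultimately show ?thesis unfolding lifted_arc_def by (intro exI[of _ Vt] conjI) auto
  qed
  thus ?thesis using that u by blast
qed

text \<open>The lifted arc stays in the open set for all but finitely many \<open>t\<close>, and
  \<open>P\<close> is not identically zero along it because its coefficient at \<open>t^(2D)\<close>
  is \<open>P n\<close>.\<close>

lemma dense_lift:
  assumes P: "form 2 D P" "D > 0" "vec2 n" "P n \<noteq> 0"
    and PS: "\<And>v. v \<in> nonzero_vecs 2 \<Longrightarrow> P v \<noteq> 0 \<Longrightarrow> pt v \<notin> S"
    and W: "openin (zariski Y) W" "y \<in> W"
  shows "\<exists>v. v \<in> nonzero_vecs 2 \<and> P v \<noteq> 0 \<and> lift v \<in> W"
proof -
  have y: "y \<in> points Y" using openin_zariski_subset[OF wfY W(1)] W(2) by auto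
  obtain V where V: "V \<in> reps Y y" using reps_nonempty[OF wfY y] by blast
  obtain d F where F: "mf Y d F" "y \<in> basic Y F" "basic Y F \<subseteq> W"
    using W by (auto simp: openin_zariski_iff[OF wfY])
  have v: "vec2 (V None)" using reps_None[OF y V] by (simp add: nonzero_vecs2)
  obtain u where u: "vec2 u"
    "\<And>n. vec2 n \<Longrightarrow> \<exists>Vt. lifted_arc V u n Vt"
    by (rule arc_lift[OF y V]) (rule that)
  obtain Vt where L: "lifted_arc V u n Vt" using u(2)[OF P(3)] by blast
  have Vt: "\<And>i l. i \<in> blocks Y \<Longrightarrow> is_poly (\<lambda>t. Vt t i l)" "Vt 0 = V"
    "\<And>t. t \<noteq> 0 \<Longrightarrow> arc (V None) u n t \<in> nonzero_vecs 2 \<Longrightarrow> pt (arc (V None) u n t) \<notin> S \<Longrightarrow>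
          Vt t \<in> reps Y (lift (arc (V None) u n t))" using L unfolding lifted_arc_def by blast+
  let ?a = "arc (V None) u n"
  \<comment> \<open>Exchanging \<open>n\<close> and \<open>V None\<close> reverses the arc under
    \<open>t = 1 / s\<close>, so the top coefficient in \<open>t\<close> is read off at
    \<open>s = 0\<close>.\<close>
  have "is_poly (\<lambda>s. P (arc n u (V None) s))" by (rule form_is_poly[OF P(1)]) auto
  moreover have "P (arc n u (V None) 0) \<noteq> 0" using P(4) by (simp add: arc_def)
  ultimately have "finite {s. P (arc n u (V None) s) = 0}" by (rule is_poly_finite_zeros)
  hence "finite (insert 0 {s. P (arc n u (V None) s) = 0})" by simp
  then obtain s where "s \<notin> insert 0 {s. P (arc n u (V None) s) = 0}" by (rule finite_avoid)
  hence s: "s \<noteq> 0" "P (arc n u (V None) s) \<noteq> 0" by auto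
  have "?a (1 / s) = (\<lambda>l. (1 / s)\<^sup>2 * arc n u (V None) s l)"
    using s by (auto simp: arc_def fun_eq_iff field_simps power2_eq_square)
  hence "P (?a (1 / s)) = ((1 / s)\<^sup>2) ^ D * P (arc n u (V None) s)"
    using form_homog[OF P(1)] by metis
  hence "P (?a (1 / s)) \<noteq> 0" using s by simp
  moreover have "is_poly (\<lambda>t. P (?a t))" by (rule form_is_poly[OF P(1)]) auto
  ultimately have f1: "finite {t. P (?a t) = 0}" using is_poly_finite_zeros[of "\<lambda>t. P (?a t)"] by blast
  have "is_poly (\<lambda>t. F (Vt t))" by (rule multiform_is_poly[OF F(1)]) (use Vt in auto)
  moreover have "F (Vt 0) \<noteq> 0" using Vt(2) F(2) V basicD by blast
  ultimately have f2: "finite {t. F (Vt t) = 0}" by (rule is_poly_finite_zeros)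
  have "finite (insert 0 ({t. P (?a t) = 0} \<union> {t. F (Vt t) = 0}))" using f1 f2 by simp
  then obtain t where "t \<notin> insert 0 ({t. P (?a t) = 0} \<union> {t. F (Vt t) = 0})" by (rule finite_avoid)
  hence t: "t \<noteq> 0" "P (?a t) \<noteq> 0" "F (Vt t) \<noteq> 0" by auto
  have "?a t \<noteq> (\<lambda>_. 0)" using t(2) form_zero_vec[OF P(1,2)] by auto
  hence a: "?a t \<in> nonzero_vecs 2"
    using vec2_arc[OF v u(1) P(3), of t] by (simp add: nonzero_vecs_def vec2_def)
  have aS: "pt (?a t) \<notin> S" by (rule PS[OF a t(2)])
  have "lift (?a t) \<in> basic Y F"
    using basic_iff[OF wfY F(1) lift_in(1)[OF a aS] Vt(3)[OF t(1) a aS]] t by simp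
  thus ?thesis using a t F(3) by auto
qed

lemma dense_torus:
  assumes "openin (zariski Y) W" "y \<in> W"
  shows "\<exists>v. v \<in> nonzero_vecs 2 \<and> v 0 * v 1 * v 2 \<noteq> 0 \<and> lift v \<in> W"
proof (rule dense_lift[OF _ _ _ _ S_axes assms, where D = 3 and n = "\<lambda>l. if l \<le> 2 then 1 else 0"])
  show "form 2 3 (\<lambda>v. v 0 * v 1 * v 2)"
    by (intro form_mult'[of _ 2 _ 1] form_mult'[of _ 1 _ 1] form_coord) auto
qed (auto simp: vec2_def)

text \<open>The principle by which all identities pass from the torus to the blow-up: a nonempty
  nonvanishing locus is open and would meet the lifted torus.\<close>

lemma regular_zero:
  assumes f: "regular Y W f" and y: "y \<in> W"
    and z: "\<And>v. v \<in> nonzero_vecs 2 \<Longrightarrow> v 0 * v 1 * v 2 \<noteq> 0 \<Longrightarrow> lift v \<in> W \<Longrightarrow> f (lift v) = 0"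
  shows "f y = 0"
proof (rule ccontr)
  assume "f y \<noteq> 0"
  hence "y \<in> {y \<in> W. f y \<noteq> 0}" using y by simp
  from dense_torus[OF regular_nonzero_open[OF wfY f] this] z show False by blast
qed


subsection \<open>Sections of the line bundle and local frames\<close>

abbreviation L :: "nat \<Rightarrow> (ppoint option \<Rightarrow> ppoint) set \<Rightarrow> ppoint option sect set" where
  "L \<equiv> dH_minus_E S"

definition sec :: "(cvec \<Rightarrow> complex) \<Rightarrow> (ppoint option \<Rightarrow> ppoint) set \<Rightarrow> ppoint option sect" where
  "sec A U = (\<lambda>V. if V \<in> cone Y U then A (V None) else 0)"

lemma sec_eq: "y \<in> U \<Longrightarrow> V \<in> reps Y y \<Longrightarrow> sec A U V = A (V None)"
  by (auto simp: sec_def cone_iff)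

lemma mf_None: "form 2 e A \<Longrightarrow> mf Y (\<lambda>i. if i = None then e else 0) (\<lambda>V. A (V None))"
  by (rule multiform_block) auto

lemma mf_Some: "p \<in> S \<Longrightarrow> form 2 e A \<Longrightarrow> mf Y (\<lambda>i. if i = Some p then e else 0) (\<lambda>V. A (V (Some p)))"
  by (rule multiform_block[where i = "Some p"]) auto

text \<open>The counterpart of \<open>regular_iff\<close> for twisted sections, by the same
  enlargement of the denominator.\<close>

lemma L_rep:
  assumes "t \<in> L d U" "y \<in> U"
  obtains \<delta> F G where "mf Y (\<lambda>i. \<delta> i + (if i = None then d else 0)) F" "mf Y \<delta> G"
    "y \<in> basic Y G" "basic Y G \<subseteq> U"
    "\<And>y' V. y' \<in> basic Y G \<Longrightarrow> V \<in> reps Y y' \<Longrightarrow> t V = F V / G V"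
proof -
  let ?e = "\<lambda>i::ppoint option. if i = None then d else 0"
  have "\<forall>x\<in>U. \<exists>W \<delta> F G. openin (zariski Y) W \<and> x \<in> W \<and> W \<subseteq> U \<and>
        mf Y (\<lambda>i. \<delta> i + ?e i) F \<and> mf Y \<delta> G \<and> (\<forall>V\<in>cone Y W. G V \<noteq> 0 \<and> t V = F V / G V)"
    using assms(1) unfolding dH_minus_E_def twist_def by blast
  from bspec[OF this assms(2)] obtain W \<delta> F G where *: "openin (zariski Y) W" "y \<in> W" "W \<subseteq> U"
      "mf Y (\<lambda>i. \<delta> i + ?e i) F" "mf Y \<delta> G" "\<forall>V\<in>cone Y W. G V \<noteq> 0 \<and> t V = F V / G V"
    by (elim exE conjE) (rule that)
  obtain e H where H: "mf Y e H" "y \<in> basic Y H" "basic Y H \<subseteq> W"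
    using * by (auto simp: openin_zariski_iff[OF wfY])
  have B: "basic Y (\<lambda>V. G V * H V) = basic Y G \<inter> basic Y H" by (rule basic_mult[OF wfY *(5) H(1)])
  have yp: "y \<in> points Y" using H(2) basic_subset by auto
  have yG: "y \<in> basic Y G" unfolding basic_def using yp *(2,6) by (auto simp: cone_iff)
  show ?thesis
  proof (rule that[of "\<lambda>i. \<delta> i + e i" "\<lambda>V. F V * H V" "\<lambda>V. G V * H V"])
    show "mf Y (\<lambda>i. \<delta> i + e i + ?e i) (\<lambda>V. F V * H V)"
      by (rule multiform_mult'[OF *(4) H(1)]) auto
    show "mf Y (\<lambda>i. \<delta> i + e i) (\<lambda>V. G V * H V)" by (rule multiform_mult[OF *(5) H(1)])
    show "y \<in> basic Y (\<lambda>V. G V * H V)" using B yG H by simp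
    show "basic Y (\<lambda>V. G V * H V) \<subseteq> U" using B H *(3) by auto
    fix y' V assume a: "y' \<in> basic Y (\<lambda>V. G V * H V)" "V \<in> reps Y y'"
    hence "y' \<in> W" "H V \<noteq> 0" using B H basicD[of y' Y H V] by auto
    thus "t V = F V * H V / (G V * H V)" using *(6) a by (auto simp: cone_iff)
  qed
qed

lemma L_exceptional: "t \<in> L d U \<Longrightarrow> y \<in> U \<Longrightarrow> y \<in> points Y \<Longrightarrow> y None \<in> S \<Longrightarrow> V \<in> reps Y y \<Longrightarrow> t V = 0"
  by (auto simp: dH_minus_E_def cone_iff exceptional_def blowdown_def)

lemma L_off_cone: "t \<in> L d U \<Longrightarrow> V \<notin> cone Y U \<Longrightarrow> t V = 0"
  by (auto simp: dH_minus_E_def twist_def)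

lemma L_memI:
  assumes "openin (zariski Y) U" "\<And>V. V \<notin> cone Y U \<Longrightarrow> s V = 0"
    "\<And>y V. y \<in> U \<Longrightarrow> V \<in> reps Y y \<Longrightarrow> y None \<in> S \<Longrightarrow> s V = 0"
    "\<And>y. y \<in> U \<Longrightarrow> \<exists>\<delta> F G. mf Y (\<lambda>i. \<delta> i + (if i = None then d else 0)) F \<and> mf Y \<delta> G \<and>
      y \<in> basic Y G \<and> basic Y G \<subseteq> U \<and> (\<forall>y'\<in>basic Y G. \<forall>V\<in>reps Y y'. s V = F V / G V)"
  shows "s \<in> L d U"
proof -
  let ?e = "\<lambda>i::ppoint option. if i = None then d else 0"
  have "\<exists>W \<delta> F G. openin (zariski Y) W \<and> y \<in> W \<and> W \<subseteq> U \<and>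
        mf Y (\<lambda>i. \<delta> i + ?e i) F \<and> mf Y \<delta> G \<and> (\<forall>V\<in>cone Y W. G V \<noteq> 0 \<and> s V = F V / G V)" if yU: "y \<in> U" for y
  proof -
    obtain \<delta> F G where *: "mf Y (\<lambda>i. \<delta> i + ?e i) F" "mf Y \<delta> G" "y \<in> basic Y G" "basic Y G \<subseteq> U"
      "\<forall>y'\<in>basic Y G. \<forall>V\<in>reps Y y'. s V = F V / G V" using assms(4)[OF yU] by blast
    show ?thesis
      by (intro exI[of _ "basic Y G"] exI[of _ \<delta>] exI[of _ F] exI[of _ G])
         (use * basicD[of _ Y G] in \<open>auto simp: cone_iff simp del: Y_simps\<close>)
  qed
  thus ?thesis using assms(2,3)
    by (auto simp: dH_minus_E_def twist_def cone_iff exceptional_def blowdown_def simp del: Y_simps)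
qed

lemma sec_in_L:
  assumes U: "openin (zariski Y) U" and A: "form 2 d A"
    and z: "\<And>y V. y \<in> U \<Longrightarrow> V \<in> reps Y y \<Longrightarrow> y None \<in> S \<Longrightarrow> A (V None) = 0"
  shows "sec A U \<in> L d U"
proof (rule L_memI[OF U])
  fix y assume y: "y \<in> U"
  obtain e H where H: "mf Y e H" "y \<in> basic Y H" "basic Y H \<subseteq> U"
    using U y by (auto simp: openin_zariski_iff[OF wfY])
  have "mf Y (\<lambda>i. e i + (if i = None then d else 0)) (\<lambda>V. A (V None) * H V)"
    by (rule multiform_mult'[OF mf_None[OF A] H(1)]) auto
  thus "\<exists>\<delta> F G. mf Y (\<lambda>i. \<delta> i + (if i = None then d else 0)) F \<and> mf Y \<delta> G \<and>
      y \<in> basic Y G \<and> basic Y G \<subseteq> U \<and> (\<forall>y'\<in>basic Y G. \<forall>V\<in>reps Y y'. sec A U V = F V / G V)"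
  proof (intro exI conjI ballI)
    fix y' V assume "y' \<in> basic Y H" "V \<in> reps Y y'"
    thus "sec A U V = A (V None) * H V / H V"
      using H(3) sec_eq[of y' U V A] basicD[of y' Y H V] by auto
  qed (use H in auto)
qed (use z sec_eq in \<open>auto simp: sec_def\<close>)

lemma L_restrict:
  assumes W: "openin (zariski Y) W" "W \<subseteq> U" and s: "s \<in> L d U"
  shows "(\<lambda>V. if V \<in> cone Y W then s V else 0) \<in> L d W"
proof (rule L_memI[OF W(1)])
  fix y assume y: "y \<in> W"
  hence yU: "y \<in> U" using W by auto
  obtain \<delta> F G where *: "mf Y (\<lambda>i. \<delta> i + (if i = None then d else 0)) F" "mf Y \<delta> G"
    "y \<in> basic Y G" "basic Y G \<subseteq> U"
    "\<And>y' V. y' \<in> basic Y G \<Longrightarrow> V \<in> reps Y y' \<Longrightarrow> s V = F V / G V"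
    using L_rep[OF s yU] by blast
  obtain e H where H: "mf Y e H" "y \<in> basic Y H" "basic Y H \<subseteq> W"
    using W y by (auto simp: openin_zariski_iff[OF wfY])
  have B: "basic Y (\<lambda>V. G V * H V) = basic Y G \<inter> basic Y H" by (rule basic_mult[OF wfY *(2) H(1)])
  show "\<exists>\<delta> F G. mf Y (\<lambda>i. \<delta> i + (if i = None then d else 0)) F \<and> mf Y \<delta> G \<and>
      y \<in> basic Y G \<and> basic Y G \<subseteq> W \<and> (\<forall>y'\<in>basic Y G. \<forall>V\<in>reps Y y'.
        (if V \<in> cone Y W then s V else 0) = F V / G V)"
  proof (intro exI conjI ballI)
    show "mf Y (\<lambda>i. (\<delta> i + e i) + (if i = None then d else 0)) (\<lambda>V. F V * H V)"
      by (rule multiform_mult'[OF *(1) H(1)]) auto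
    show "mf Y (\<lambda>i. \<delta> i + e i) (\<lambda>V. G V * H V)" by (rule multiform_mult[OF *(2) H(1)])
    show "y \<in> basic Y (\<lambda>V. G V * H V)" "basic Y (\<lambda>V. G V * H V) \<subseteq> W" using B * H by auto
    fix y' V assume a: "y' \<in> basic Y (\<lambda>V. G V * H V)" "V \<in> reps Y y'"
    hence "V \<in> cone Y W" "H V \<noteq> 0" "s V = F V / G V"
      using B H *(5) basicD[of y' Y H V] by (auto simp: cone_iff simp del: Y_simps)
    thus "(if V \<in> cone Y W then s V else 0) = F V * H V / (G V * H V)" by simp
  qed
next
  fix y V assume a: "y \<in> W" "V \<in> reps Y y" "y None \<in> S"
  have "s V = 0" by (rule L_exceptional[OF s _ _ a(3,2)]) (use a W openin_zariski_subset[OF wfY W(1)] in auto)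
  thus "(if V \<in> cone Y W then s V else 0) = 0" by simp
qed auto

text \<open>On the torus \<open>\<epsilon>\<close> can be cancelled, and density covers the points
  where it vanishes.\<close>

lemma quotient_on_unique:
  assumes "regular Y W g" "regular Y W g'"
    and "\<And>y V. y \<in> W \<Longrightarrow> V \<in> reps Y y \<Longrightarrow> g y * \<epsilon> (V None) = g' y * \<epsilon> (V None)"
    and nz: "\<And>v. v \<in> nonzero_vecs 2 \<Longrightarrow> v 0 * v 1 * v 2 \<noteq> 0 \<Longrightarrow> lift v \<in> W \<Longrightarrow> \<epsilon> v \<noteq> 0"
    and "y \<in> W"
  shows "g y = g' y"
proof -
  have "g y - g' y = 0"
  proof (rule regular_zero[OF regular_diff[OF wfY assms(1,2)] assms(5)])
    fix v assume v: "v \<in> nonzero_vecs 2" "v 0 * v 1 * v 2 \<noteq> 0" "lift v \<in> W"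
    have "lift_vec v \<in> reps Y (lift v)" by (rule lift_in[OF v(1) S_axes[OF v(1,2)]])
    from assms(3)[OF v(3) this] nz[OF v] show "g (lift v) - g' (lift v) = 0" by simp
  qed
  thus ?thesis by simp
qed

text \<open>Division by \<open>\<epsilon>\<close> has to be supplied only on the exceptional curves;
  elsewhere \<open>\<epsilon>\<close> is nonzero and may join the denominator. The local quotients
  agree on overlaps since they agree on the torus, and so they glue.\<close>

lemma frame_secI:
  assumes W: "openin (zariski Y) W" and \<epsilon>: "form 2 d \<epsilon>"
    and van: "\<And>y V. y \<in> W \<Longrightarrow> V \<in> reps Y y \<Longrightarrow> y None \<in> S \<Longrightarrow> \<epsilon> (V None) = 0"
    and nz: "\<And>y V. y \<in> W \<Longrightarrow> V \<in> reps Y y \<Longrightarrow> y None \<notin> S \<Longrightarrow> \<epsilon> (V None) \<noteq> 0"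
    and dv: "\<And>W' t y. openin (zariski Y) W' \<Longrightarrow> W' \<subseteq> W \<Longrightarrow> t \<in> L d W' \<Longrightarrow> y \<in> W' \<Longrightarrow> y None \<in> S \<Longrightarrow>
      \<exists>\<delta> F G. mf Y \<delta> F \<and> mf Y \<delta> G \<and> y \<in> basic Y G \<and> basic Y G \<subseteq> W' \<and>
        (\<forall>y'\<in>basic Y G. \<forall>V\<in>reps Y y'. t V = F V / G V * \<epsilon> (V None))"
  shows "frame Y (L d) W (sec \<epsilon> W)"
proof -
  have nzT: "\<epsilon> v \<noteq> 0" if v: "v \<in> nonzero_vecs 2" "v 0 * v 1 * v 2 \<noteq> 0" "lift v \<in> W" for v
    using nz[OF v(3) lift_in(2)[OF v(1) S_axes[OF v(1,2)]]] lift_in(3)[OF v(1) S_axes[OF v(1,2)]]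
      S_axes[OF v(1,2)] by simp
  have loc: "\<exists>\<delta> F G. mf Y \<delta> F \<and> mf Y \<delta> G \<and> y \<in> basic Y G \<and> basic Y G \<subseteq> W' \<and>
        (\<forall>y'\<in>basic Y G. \<forall>V\<in>reps Y y'. t V = F V / G V * \<epsilon> (V None))"
    if W': "openin (zariski Y) W'" "W' \<subseteq> W" and t: "t \<in> L d W'" and y: "y \<in> W'" for W' t y
  proof (cases "y None \<in> S")
    case True thus ?thesis using dv[OF W' t y] by simp
  next
    case False
    have yp: "y \<in> points Y" using openin_zariski_subset[OF wfY W'(1)] y by auto
    obtain V where V: "V \<in> reps Y y" using reps_nonempty[OF wfY yp] by blast
    obtain \<delta> F G where *: "mf Y (\<lambda>i. \<delta> i + (if i = None then d else 0)) F" "mf Y \<delta> G"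
      "y \<in> basic Y G" "basic Y G \<subseteq> W'"
      "\<And>y' V. y' \<in> basic Y G \<Longrightarrow> V \<in> reps Y y' \<Longrightarrow> t V = F V / G V"
      using L_rep[OF t y] by blast
    have B: "basic Y (\<lambda>V. G V * \<epsilon> (V None)) = basic Y G \<inter> basic Y (\<lambda>V. \<epsilon> (V None))"
      by (rule basic_mult[OF wfY *(2) mf_None[OF \<epsilon>]])
    have "y \<in> basic Y (\<lambda>V. \<epsilon> (V None))"
      using basic_iff[OF wfY mf_None[OF \<epsilon>] yp V] nz[OF _ V False] W' y by auto
    hence "y \<in> basic Y (\<lambda>V. G V * \<epsilon> (V None))" using B * by auto
    moreover have "mf Y (\<lambda>i. \<delta> i + (if i = None then d else 0)) (\<lambda>V. G V * \<epsilon> (V None))"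
      by (rule multiform_mult[OF *(2) mf_None[OF \<epsilon>]])
    moreover have "t V = F V / (G V * \<epsilon> (V None)) * \<epsilon> (V None)"
      if a: "y' \<in> basic Y (\<lambda>V. G V * \<epsilon> (V None))" "V \<in> reps Y y'" for y' V
    proof -
      have "\<epsilon> (V None) \<noteq> 0" using a B basicD[of y' Y "\<lambda>V. \<epsilon> (V None)" V] by auto
      thus ?thesis using *(5)[OF _ a(2)] a B by auto
    qed
    ultimately show ?thesis using *(1,4) B
      by (intro exI[of _ "\<lambda>i. \<delta> i + (if i = None then d else 0)"] exI[of _ F]
          exI[of _ "\<lambda>V. G V * \<epsilon> (V None)"]) (auto simp del: Y_simps)
  qed
  have quot: "\<exists>g. quotient_on Y W' t (sec \<epsilon> W) g"
    if W': "openin (zariski Y) W'" "W' \<subseteq> W" and t: "t \<in> L d W'" for W' t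
  proof -
    have "\<forall>y. \<exists>p. y \<in> W' \<longrightarrow> (\<exists>\<delta>. mf Y \<delta> (fst p) \<and> mf Y \<delta> (snd p)) \<and> y \<in> basic Y (snd p) \<and>
        basic Y (snd p) \<subseteq> W' \<and>
        (\<forall>y'\<in>basic Y (snd p). \<forall>V\<in>reps Y y'. t V = fst p V / snd p V * \<epsilon> (V None))"
    proof (rule allI)
      fix y
      show "\<exists>p. y \<in> W' \<longrightarrow> (\<exists>\<delta>. mf Y \<delta> (fst p) \<and> mf Y \<delta> (snd p)) \<and> y \<in> basic Y (snd p) \<and>
        basic Y (snd p) \<subseteq> W' \<and>
        (\<forall>y'\<in>basic Y (snd p). \<forall>V\<in>reps Y y'. t V = fst p V / snd p V * \<epsilon> (V None))"
      proof (cases "y \<in> W'")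
        case True
        from loc[OF W' t True] obtain \<delta> F G where "mf Y \<delta> F" "mf Y \<delta> G" "y \<in> basic Y G"
          "basic Y G \<subseteq> W'" "\<forall>y'\<in>basic Y G. \<forall>V\<in>reps Y y'. t V = F V / G V * \<epsilon> (V None)" by blast
        thus ?thesis by (intro exI[of _ "(F, G)"]) (auto simp del: Y_simps)
      qed auto
    qed
    from choice[OF this] obtain p where p: "\<And>y. y \<in> W' \<Longrightarrow> \<exists>\<delta>. mf Y \<delta> (fst (p y)) \<and> mf Y \<delta> (snd (p y))"
      "\<And>y. y \<in> W' \<Longrightarrow> y \<in> basic Y (snd (p y))" "\<And>y. y \<in> W' \<Longrightarrow> basic Y (snd (p y)) \<subseteq> W'"
      "\<And>y y' V. y \<in> W' \<Longrightarrow> y' \<in> basic Y (snd (p y)) \<Longrightarrow> V \<in> reps Y y' \<Longrightarrow>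
         t V = fst (p y) V / snd (p y) V * \<epsilon> (V None)" by blast
    define q where "q = (\<lambda>y. qfun Y (fst (p y)) (snd (p y)))"
    have reg: "regular Y (basic Y (snd (p y))) (q y)" if "y \<in> W'" for y
      using p(1)[OF that] regular_qfun[OF wfY] by (auto simp: q_def simp del: Y_simps)
    have val: "t V = q y y' * \<epsilon> (V None)"
      if a: "y \<in> W'" "y' \<in> basic Y (snd (p y))" "V \<in> reps Y y'" for y y' V
    proof -
      obtain \<delta> where "mf Y \<delta> (fst (p y))" "mf Y \<delta> (snd (p y))" using p(1)[OF a(1)] by blast
      from qfun_eq[OF wfY this _ a(3)] have "q y y' = fst (p y) V / snd (p y) V"
        using a(2) basic_subset by (auto simp: q_def simp del: Y_simps)
      thus ?thesis using p(4)[OF a] by simp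
    qed
    \<comment> \<open>Each local quotient is used at its own base point; this diagonal choice is
      regular because it coincides near \<open>y\<close> with the single quotient
      \<open>q y\<close>.\<close>
    define g where "g = (\<lambda>y. q y y)"
    have gq: "g y' = q y y'" if a: "y \<in> W'" "y' \<in> basic Y (snd (p y))" for y y'
    proof -
      have y': "y' \<in> W'" using p(3)[OF a(1)] a by auto
      let ?I = "basic Y (snd (p y)) \<inter> basic Y (snd (p y'))"
      have op: "openin (zariski Y) ?I" using p(1)[OF a(1)] p(1)[OF y'] by (auto simp del: Y_simps)
      have "q y' y' = q y y'"
      proof (rule quotient_on_unique[where W = ?I and g = "q y'" and g' = "q y" and \<epsilon> = \<epsilon>])
        show "regular Y ?I (q y')" "regular Y ?I (q y)"
          using regular_subset[OF wfY reg op] a y' by auto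
        show "q y' x * \<epsilon> (V None) = q y x * \<epsilon> (V None)" if "x \<in> ?I" "V \<in> reps Y x" for x V
          using val[OF a(1), of x V] val[OF y', of x V] that by auto
        show "\<epsilon> v \<noteq> 0" if "v \<in> nonzero_vecs 2" "v 0 * v 1 * v 2 \<noteq> 0" "lift v \<in> ?I" for v
          using nzT[OF that(1,2)] that(3) p(3)[OF a(1)] W'(2) by auto
        show "y' \<in> ?I" using a p(2)[OF y'] by auto
      qed
      thus ?thesis by (simp add: g_def)
    qed
    have "regular Y W' g"
    proof (rule regular_glue[OF wfY])
      fix y assume y: "y \<in> W'"
      have "regular Y (basic Y (snd (p y))) g"
        by (rule regular_cong[OF wfY reg[OF y]]) (use gq[OF y] in auto)
      thus "\<exists>W. y \<in> W \<and> W \<subseteq> W' \<and> regular Y W g" using p(2,3)[OF y] by blast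
    qed
    moreover have "t V = g y * sec \<epsilon> W V" if "y \<in> W'" "V \<in> reps Y y" for y V
    proof -
      have "sec \<epsilon> W V = \<epsilon> (V None)" by (rule sec_eq[OF _ that(2)]) (use that W' in auto)
      thus ?thesis using val[OF that(1) p(2)[OF that(1)] that(2)] by (simp add: g_def)
    qed
    ultimately show ?thesis unfolding quotient_on_def by (intro exI[of _ g]) blast
  qed
  have uniq: "g y = 0" if W': "openin (zariski Y) W'" "W' \<subseteq> W" and g: "quotient_on Y W' (\<lambda>_. 0) (sec \<epsilon> W) g"
    and y: "y \<in> W'" for W' g y
  proof (rule quotient_on_unique[where W = W' and g = g and g' = "\<lambda>_. 0" and \<epsilon> = \<epsilon>])
    show "regular Y W' g" using g by (simp add: quotient_on_def)
    show "regular Y W' (\<lambda>_. 0)" by (rule regular_const[OF wfY W'(1)])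
    fix y V assume that: "y \<in> W'" "V \<in> reps Y y"
    show "g y * \<epsilon> (V None) = 0 * \<epsilon> (V None)"
    proof -
      have "sec \<epsilon> W V = \<epsilon> (V None)" by (rule sec_eq[OF _ that(2)]) (use that W' in auto)
      moreover have "0 = g y * sec \<epsilon> W V" using g that unfolding quotient_on_def by blast
      ultimately show ?thesis by simp
    qed
  next
    fix v assume "v \<in> nonzero_vecs 2" "v 0 * v 1 * v 2 \<noteq> 0" "lift v \<in> W'"
    thus "\<epsilon> v \<noteq> 0" using nzT W'(2) by auto
  qed fact
  have "sec \<epsilon> W \<in> L d W" by (rule sec_in_L[OF W \<epsilon>]) (rule van)
  thus ?thesis unfolding frame_def using W quot uniq by blast
qed

end

section \<open>Division by the equation of an exceptional curve\<close>

section \<open>The ideal of a point in the plane\<close>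

text \<open>Forms of degree \<open>d - 1\<close>, with the case \<open>d = 0\<close> reduced to
  zero, where truncated subtraction would wrongly admit constants.\<close>

definition pform :: "nat \<Rightarrow> (cvec \<Rightarrow> complex) \<Rightarrow> bool" where
  "pform d B \<longleftrightarrow> (if d = 0 then B = (\<lambda>_. 0) else form 2 (d - 1) B)"

lemma pform_zero [simp, intro]: "pform d (\<lambda>_. 0)"
  by (auto simp: pform_def)

lemma pform_add [intro]: "pform d A \<Longrightarrow> pform d B \<Longrightarrow> pform d (\<lambda>v. A v + B v)"
  by (auto simp: pform_def split: if_splits)

lemma pform_cmult [intro]: "pform d A \<Longrightarrow> pform d (\<lambda>v. c * A v)"
  by (auto simp: pform_def split: if_splits)

lemma pform_mult: "pform d A \<Longrightarrow> form 2 e B \<Longrightarrow> pform (d + e) (\<lambda>v. A v * B v)"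
  by (auto simp: pform_def split: if_splits intro: form_mult')

text \<open>Modulo the ideal generated by the components of \<open>p \<times> v\<close>, the vector \<open>v\<close> is the multiple
  \<open>(v\<^sub>j / p\<^sub>j) p\<close> of \<open>p\<close>.\<close>

definition reduces :: "cvec \<Rightarrow> nat \<Rightarrow> nat \<Rightarrow> (cvec \<Rightarrow> complex) \<Rightarrow> bool" where
  "reduces p j d A \<longleftrightarrow> form 2 d A \<and> (\<exists>B. (\<forall>l. pform d (B l)) \<and>
     (\<forall>v. A v = A p * (v j / p j) ^ d + (\<Sum>l\<le>2. crs p v l * B l v)))"

lemma reduces_imp_form: "reduces p j d A \<Longrightarrow> form 2 d A"
  by (simp add: reduces_def)

lemma reducesE:
  assumes "reduces p j d A"
  obtains B where "\<And>l. pform d (B l)" "\<And>v. A v = A p * (v j / p j) ^ d + (\<Sum>l\<le>2. crs p v l * B l v)"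
  using assms unfolding reduces_def by blast

lemma reducesI:
  assumes "form 2 d A" "\<And>l. pform d (B l)"
    "\<And>v. A v = A p * (v j / p j) ^ d + (\<Sum>l\<le>2. crs p v l * B l v)"
  shows "reduces p j d A"
  using assms unfolding reduces_def by blast

lemma reduces_zero: "reduces p j d (\<lambda>_. 0)"
  unfolding reduces_def by (auto intro!: exI[of _ "\<lambda>_ _. 0"])

lemma reduces_const: "reduces p j 0 (\<lambda>_. c)"
  unfolding reduces_def by (auto intro!: exI[of _ "\<lambda>_ _. 0"])

lemma reduces_add:
  assumes "reduces p j d A" "reduces p j d A'" shows "reduces p j d (\<lambda>v. A v + A' v)"
proof -
  obtain B where B: "\<And>l. pform d (B l)"
    "\<And>v. A v = A p * (v j / p j) ^ d + (\<Sum>l\<le>2. crs p v l * B l v)" by (rule reducesE[OF assms(1)]) (rule that)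
  obtain B' where B': "\<And>l. pform d (B' l)"
    "\<And>v. A' v = A' p * (v j / p j) ^ d + (\<Sum>l\<le>2. crs p v l * B' l v)" by (rule reducesE[OF assms(2)]) (rule that)
  have "A v + A' v = (A p + A' p) * (v j / p j) ^ d + (\<Sum>l\<le>2. crs p v l * (B l v + B' l v))" for v
    using B(2)[of v] B'(2)[of v] by (simp add: algebra_simps)
  from reducesI[where p = p and j = j, OF _ _ this] show ?thesis
    using B(1) B'(1) reduces_imp_form[OF assms(1)] reduces_imp_form[OF assms(2)] by blast
qed

lemma reduces_cmult:
  assumes "reduces p j d A" shows "reduces p j d (\<lambda>v. c * A v)"
proof -
  obtain B where B: "\<And>l. pform d (B l)"
    "\<And>v. A v = A p * (v j / p j) ^ d + (\<Sum>l\<le>2. crs p v l * B l v)" by (rule reducesE[OF assms(1)]) (rule that)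
  have "c * A v = (c * A p) * (v j / p j) ^ d + (\<Sum>l\<le>2. crs p v l * (c * B l v))" for v
    using B(2)[of v] by (simp add: algebra_simps)
  from reducesI[where p = p and j = j, OF _ _ this] show ?thesis using B(1) reduces_imp_form[OF assms(1)] by blast
qed

lemma reduces_sum: "(\<And>x. x \<in> T \<Longrightarrow> reduces p j d (f x)) \<Longrightarrow> reduces p j d (\<lambda>v. \<Sum>x\<in>T. f x v)"
  by (induction T rule: infinite_finite_induct) (auto intro: reduces_zero reduces_add)

lemma reduces_mult:
  assumes "reduces p j d A" "reduces p j e A'" "j \<le> 2"
  shows "reduces p j (d + e) (\<lambda>v. A v * A' v)"
proof -
  obtain B where B: "\<And>l. pform d (B l)"
    "\<And>v. A v = A p * (v j / p j) ^ d + (\<Sum>l\<le>2. crs p v l * B l v)" by (rule reducesE[OF assms(1)]) (rule that)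
  obtain B' where B': "\<And>l. pform e (B' l)"
    "\<And>v. A' v = A' p * (v j / p j) ^ e + (\<Sum>l\<le>2. crs p v l * B' l v)" by (rule reducesE[OF assms(2)]) (rule that)
  have f: "form 2 d (\<lambda>v. (A p * (1 / p j) ^ d) * v j ^ d)"
    by (intro form_cmult form_power'[OF form_coord]) (use assms(3) in auto)
  \<comment> \<open>\<open>A\<close> is expanded with \<open>A'\<close> kept whole, and
    \<open>A'\<close> only in the main term, so each remainder carries one explicit component of
    \<open>p \<times> v\<close>.\<close>
  have eq: "A v * A' v = (A p * A' p) * (v j / p j) ^ (d + e) +
      (\<Sum>l\<le>2. crs p v l * (B l v * A' v + B' l v * ((A p * (1 / p j) ^ d) * v j ^ d)))" for v
  proof -
    let ?X = "\<Sum>l\<le>2. crs p v l * B l v" and ?X' = "\<Sum>l\<le>2. crs p v l * B' l v"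
    have "A v * A' v = A p * (v j / p j) ^ d * A' v + ?X * A' v"
      using B(2)[of v] by (metis distrib_right)
    also have "\<dots> = A p * (v j / p j) ^ d * (A' p * (v j / p j) ^ e + ?X') + ?X * A' v"
      using B'(2)[of v] by metis
    also have "\<dots> = (A p * A' p) * (v j / p j) ^ (d + e) + (?X * A' v + ?X' * ((A p * (1 / p j) ^ d) * v j ^ d))"
      by (simp add: power_add power_divide algebra_simps)
    finally show ?thesis by (simp add: algebra_simps)
  qed
  show ?thesis
  proof (rule reducesI[where p = p and j = j, OF _ _ eq])
    show "form 2 (d + e) (\<lambda>v. A v * A' v)"
      by (rule form_mult[OF reduces_imp_form[OF assms(1)] reduces_imp_form[OF assms(2)]])
    show "pform (d + e) (\<lambda>v. B l v * A' v + B' l v * ((A p * (1 / p j) ^ d) * v j ^ d))" for l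
      using pform_mult[OF B(1) reduces_imp_form[OF assms(2)], of l] pform_mult[OF B'(1) f, of l]
      unfolding add.commute[of e d] by (rule pform_add)
  qed
qed

text \<open>Up to sign, \<open>p j * v i - p i * v j\<close> is the component of the cross product
  at the third index; the cases distinguish the orientation of \<open>i\<close> and
  \<open>j\<close>.\<close>

lemma reduces_coord:
  assumes "p j \<noteq> 0" "j \<le> 2" "i \<le> 2" shows "reduces p j 1 (\<lambda>v. v i)"
proof -
  have "\<exists>b. \<forall>v. p j * v i = p i * v j + (\<Sum>l\<le>2. crs p v l * b l)"
  proof -
    consider "i = j" | k where "cyc i j k" | k where "cyc j i k" using assms(2,3) unfolding cyc_def le2_cases by auto
    thus ?thesis
    proof cases
      case 1 thus ?thesis by (intro exI[of _ "\<lambda>_. 0"]) simp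
    next
      case 2
      have "p j * v i = p i * v j + (\<Sum>l\<le>2. crs p v l * (if l = k then -1 else 0))" for v
        using cyc_sum[OF 2, of "\<lambda>l. crs p v l * (if l = k then -1 else 0)"]
          crs_cyc[OF cyc_rot[OF cyc_rot[OF 2]], of p v] cyc_le[OF 2] unfolding sum_le2 by simp
      thus ?thesis by (intro exI[of _ "\<lambda>l. if l = k then -1 else 0"] allI)
    next
      case 3
      have "p j * v i = p i * v j + (\<Sum>l\<le>2. crs p v l * (if l = k then 1 else 0))" for v
        using cyc_sum[OF 3, of "\<lambda>l. crs p v l * (if l = k then 1 else 0)"]
          crs_cyc[OF cyc_rot[OF cyc_rot[OF 3]], of p v] cyc_le[OF 3] unfolding sum_le2 by simp
      thus ?thesis by (intro exI[of _ "\<lambda>l. if l = k then 1 else 0"] allI)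
    qed
  qed
  then obtain b where b: "\<And>v. p j * v i = p i * v j + (\<Sum>l\<le>2. crs p v l * b l)" by blast
  have "v i = p i * (v j / p j) ^ 1 + (\<Sum>l\<le>2. crs p v l * (b l / p j))" for v
    using b[of v] assms(1) by (simp add: field_simps)
  from reducesI[where p = p and j = j, OF form_coord[OF assms(3)] _ this] show ?thesis
    by (simp add: pform_def form_const)
qed

lemma reduces_form:
  assumes "form 2 d A" "p j \<noteq> 0" "j \<le> 2" shows "reduces p j d A"
proof -
  obtain c where c: "\<And>v. A v = (\<Sum>a\<in>exponents 2 d. c a * (\<Prod>i\<le>2. v i ^ a i))"
    using formE[OF assms(1)] by blast
  have pow: "reduces p j k (\<lambda>v. v i ^ k)" if "i \<le> 2" for i k
  proof (induction k)
    case 0 thus ?case using reduces_const[of p j 1] by simp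
  next
    case (Suc k)
    from reduces_mult[OF reduces_coord[where p = p and j = j and i = i, OF assms(2,3) that] Suc assms(3)] show ?case by simp
  qed
  have "reduces p j d (\<lambda>v. \<Prod>i\<le>2. v i ^ a i)" if "a \<in> exponents 2 d" for a
  proof -
    have "reduces p j (a 0 + a 1 + a 2) (\<lambda>v. v 0 ^ a 0 * v 1 ^ a 1 * v 2 ^ a 2)"
      by (intro reduces_mult pow assms) auto
    moreover have "a 0 + a 1 + a 2 = d" using that by (simp add: exponents2)
    ultimately show ?thesis by simp
  qed
  hence "reduces p j d (\<lambda>v. \<Sum>a\<in>exponents 2 d. c a * (\<Prod>i\<le>2. v i ^ a i))"
    by (intro reduces_sum reduces_cmult)
  moreover have "A = (\<lambda>v. \<Sum>a\<in>exponents 2 d. c a * (\<Prod>i\<le>2. v i ^ a i))" using c by blast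
  ultimately show ?thesis by simp
qed

text \<open>The reduction is applied to the plane block of each tensor, the remaining blocks acting
  as coefficients. If the main term vanishes, the polynomial lies in the ideal of the
  centre.\<close>

lemma multiform_reduces:
  assumes F: "multiform I n \<delta> F" and I: "finite I" "None \<in> I" "n None = 2" and \<delta>: "\<delta> None \<ge> 1"
    and p: "p j \<noteq> 0" "j \<le> 2"
  obtains B where "\<And>l. multiform I n (\<delta>(None := \<delta> None - 1)) (B l)"
    "\<And>V. F V = (V None j / p j) ^ \<delta> None * F (V(None := p)) + (\<Sum>l\<le>2. crs p (V None) l * B l V)"
proof -
  obtain K A where A: "\<And>k i. k < K \<Longrightarrow> i \<in> I \<Longrightarrow> form (n i) (\<delta> i) (A k i)"
    "\<And>V. F V = (\<Sum>k<(K::nat). \<Prod>i\<in>I. A k i (V i))" by (rule multiformE[OF F]) blast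
  have "\<forall>k. \<exists>B. k < K \<longrightarrow> (\<forall>l. form 2 (\<delta> None - 1) (B l)) \<and>
      (\<forall>v. A k None v = A k None p * (v j / p j) ^ \<delta> None + (\<Sum>l\<le>2. crs p v l * B l v))"
  proof
    fix k
    show "\<exists>B. k < K \<longrightarrow> (\<forall>l. form 2 (\<delta> None - 1) (B l)) \<and>
      (\<forall>v. A k None v = A k None p * (v j / p j) ^ \<delta> None + (\<Sum>l\<le>2. crs p v l * B l v))"
    proof (cases "k < K")
      case True
      have "form 2 (\<delta> None) (A k None)" using A(1)[OF True I(2)] I(3) by simp
      from reduces_form[where p = p and j = j, OF this p]
      obtain B where B: "\<And>l. pform (\<delta> None) (B l)"
        "\<And>v. A k None v = A k None p * (v j / p j) ^ \<delta> None + (\<Sum>l\<le>2. crs p v l * B l v)"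
        by (rule reducesE) (rule that)
      have "form 2 (\<delta> None - 1) (B l)" for l using B(1)[of l] \<delta> by (simp add: pform_def)
      thus ?thesis using B(2) by blast
    qed auto
  qed
  from choice[OF this] obtain B where B: "\<And>k l. k < K \<Longrightarrow> form 2 (\<delta> None - 1) (B k l)"
    "\<And>k v. k < K \<Longrightarrow> A k None v = A k None p * (v j / p j) ^ \<delta> None + (\<Sum>l\<le>2. crs p v l * B k l v)"
    by blast
  have split: "(\<Prod>i\<in>I. f i) = f None * (\<Prod>i\<in>I - {None}. f i)" for f :: "_ \<Rightarrow> complex"
    using I by (simp add: prod.remove)
  show ?thesis
  proof (rule that[of "\<lambda>l V. \<Sum>k<K. \<Prod>i\<in>I. if i = None then B k l (V i) else A k i (V i)"])
    show "multiform I n (\<delta>(None := \<delta> None - 1))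
        (\<lambda>V. \<Sum>k<K. \<Prod>i\<in>I. if i = None then B k l (V i) else A k i (V i))" for l
    proof (rule multiformI[where T = "{..<K}" and A = "\<lambda>k i. if i = None then B k l else A k i"])
      show "form (n i) ((\<delta>(None := \<delta> None - 1)) i) (if i = None then B k l else A k i)"
        if "k \<in> {..<K}" "i \<in> I" for k i using A(1)[of k i] B(1)[of k l] that I(3) by auto
    qed (auto intro!: sum.cong prod.cong)
    fix V
    have "(\<Prod>i\<in>I. A k i (V i)) = (V None j / p j) ^ \<delta> None * (\<Prod>i\<in>I. A k i ((V(None := p)) i)) +
      (\<Sum>l\<le>2. crs p (V None) l * (\<Prod>i\<in>I. if i = None then B k l (V i) else A k i (V i)))" if k: "k < K" for k
    proof -
      let ?P = "\<Prod>i\<in>I - {None}. A k i (V i)"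
      have "(\<Prod>i\<in>I. A k i (V i)) = A k None (V None) * ?P" by (rule split)
      moreover have "(\<Prod>i\<in>I. A k i ((V(None := p)) i)) = A k None p * ?P"
      proof -
        have "(\<Prod>i\<in>I - {None}. A k i ((V(None := p)) i)) = ?P" by (rule prod.cong) auto
        thus ?thesis using split[of "\<lambda>i. A k i ((V(None := p)) i)"] by simp
      qed
      moreover have "(\<Prod>i\<in>I. if i = None then B k l (V i) else A k i (V i)) = B k l (V None) * ?P" for l
      proof -
        have "(\<Prod>i\<in>I - {None}. if i = None then B k l (V i) else A k i (V i)) = ?P"
          by (rule prod.cong) auto
        thus ?thesis using split[of "\<lambda>i. if i = None then B k l (V i) else A k i (V i)"] by simp
      qed
      ultimately show ?thesis using B(2)[OF k, of "V None"] by (simp add: algebra_simps)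
    qed
    thus "F V = (V None j / p j) ^ \<delta> None * F (V(None := p)) +
      (\<Sum>l\<le>2. crs p (V None) l * (\<Sum>k<K. \<Prod>i\<in>I. if i = None then B k l (V i) else A k i (V i)))"
      unfolding A(2) by (simp add: sum.distrib sum_distrib_left)
  qed
qed

section \<open>Frames on the blow-up\<close>

lemma form_crs: "l \<le> 2 \<Longrightarrow> form 2 1 (\<lambda>v. crs q v l)"
  using form_coord[of 0 2] form_coord[of 1 2] form_coord[of 2 2] unfolding crs_def le2_cases
  by (auto simp del: One_nat_def intro!: form_diff form_cmult)

context blown_up_plane
begin

text \<open>A centre is the common zero of the components of its cross product with
  \<open>v\<close>, so its complement is covered by their nonvanishing loci. This isolates a single
  centre when frames are built.\<close>

lemma open_avoid:
  assumes "T \<subseteq> S" shows "openin (zariski Y) {y \<in> points Y. y None \<notin> T}"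
proof -
  have one: "openin (zariski Y) {y \<in> points Y. y None \<noteq> q}" if q: "q \<in> S" for q
  proof (subst openin_subopen, intro ballI)
    fix y assume y: "y \<in> {y \<in> points Y. y None \<noteq> q}"
    obtain V where V: "V \<in> reps Y y" using reps_nonempty[OF wfY] y by blast
    have "crs (R q) (V None) \<in> nonzero_vecs 2"
      by (rule crs_R_nonzero) (use reps_None[OF _ V] y q in auto)
    then obtain l where l: "l \<le> 2" "crs (R q) (V None) l \<noteq> 0" by (auto simp: nonzero_vecs2)
    have f: "form 2 1 (\<lambda>v. crs (R q) v l)" by (rule form_crs[OF l(1)])
    have "y \<in> basic Y (\<lambda>V. crs (R q) (V None) l)"
      using basic_iff[OF wfY mf_None[OF f] _ V] y l by auto
    moreover have "basic Y (\<lambda>V. crs (R q) (V None) l) \<subseteq> {y \<in> points Y. y None \<noteq> q}"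
    proof
      fix y' assume y': "y' \<in> basic Y (\<lambda>V. crs (R q) (V None) l)"
      have y'p: "y' \<in> points Y" using y' basic_subset by auto
      obtain V' where V': "V' \<in> reps Y y'" using reps_nonempty[OF wfY y'p] by blast
      have "y' None \<noteq> q"
      proof
        assume "y' None = q"
        hence "V' None \<in> pt (R q)" using V' R_in(3)[OF q] by auto
        then obtain c where "V' None = (\<lambda>i. c * R q i)" by (auto simp: pt_iff)
        hence "crs (R q) (V' None) l = 0" using crs_scale[of 1 "R q" c "R q"] by simp
        thus False using basicD[OF y' V'] by simp
      qed
      thus "y' \<in> {y \<in> points Y. y None \<noteq> q}" using y'p by simp
    qed
    ultimately show "\<exists>T. openin (zariski Y) T \<and> y \<in> T \<and> T \<subseteq> {y \<in> points Y. y None \<noteq> q}"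
      using openin_zariski_basic[OF mf_None[OF f]] by blast
  qed
  have "finite T" using assms finite_S finite_subset by blast
  thus ?thesis using assms
  proof (induction T)
    case empty thus ?case using openin_points[OF wfY] by simp
  next
    case (insert q T)
    have "{y \<in> points Y. y None \<notin> insert q T} = {y \<in> points Y. y None \<noteq> q} \<inter> {y \<in> points Y. y None \<notin> T}"
      by auto
    thus ?case using insert one[of q] by auto
  qed
qed

lemma multiple_of_R:
  assumes "p \<in> S" "V \<in> reps Y y" "y None = p"
  shows "\<exists>c. c \<noteq> 0 \<and> V None = (\<lambda>l. c * R p l)"
proof -
  have "V None \<in> y None" using assms(2) by (rule PiE_mem) simp
  thus ?thesis using R_in(3)[OF assms(1)] assms(3) by (simp add: pt_iff[symmetric])
qed

lemma basic_None_iff: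
  "form 2 e A \<Longrightarrow> y \<in> points Y \<Longrightarrow> V \<in> reps Y y \<Longrightarrow> y \<in> basic Y (\<lambda>V. A (V None)) \<longleftrightarrow> A (V None) \<noteq> 0"
  using basic_iff[OF wfY mf_None] by blast

lemma basic_Some_iff:
  "p \<in> S \<Longrightarrow> form 2 e A \<Longrightarrow> y \<in> points Y \<Longrightarrow> V \<in> reps Y y \<Longrightarrow>
   y \<in> basic Y (\<lambda>V. A (V (Some p))) \<longleftrightarrow> A (V (Some p)) \<noteq> 0"
  using basic_iff[OF wfY mf_Some] by blast

lemma quotient_on_qfun:
  assumes "mf Y \<delta> F" "mf Y \<delta> G" and W: "openin (zariski Y) W"
    and "\<And>y V. y \<in> W \<Longrightarrow> V \<in> reps Y y \<Longrightarrow> G V \<noteq> 0 \<and> s V = F V / G V * e V"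
  shows "quotient_on Y W s e (qfun Y F G)"
  unfolding quotient_on_def
proof (intro conjI ballI)
  have Wp: "W \<subseteq> points Y" by (rule openin_zariski_subset[OF wfY W])
  have "W \<subseteq> basic Y G" unfolding basic_def using assms(4) Wp by blast
  thus "regular Y W (qfun Y F G)" by (rule regular_subset[OF wfY regular_qfun[OF wfY assms(1,2)] W])
  fix y V assume "y \<in> W" "V \<in> reps Y y"
  thus "s V = qfun Y F G y * e V"
    using qfun_eq[OF wfY assms(1,2) _ \<open>V \<in> reps Y y\<close>] assms(4) Wp by auto
qed

text \<open>Off the centres a power of a nonzero coordinate is a frame. The factor
  \<open>\<kappa>\<close> is the same for all forms, so sections take the values of their forms up
  to one common scalar.\<close>

lemma ordinary_frame:
  assumes y: "y \<in> points Y" "y None \<notin> S" and V: "V \<in> reps Y y"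
  shows "\<exists>W e \<kappa>. y \<in> W \<and> frame Y (L d) W e \<and> \<kappa> \<noteq> 0 \<and>
    (\<forall>A. form 2 d A \<longrightarrow> (\<exists>g. quotient_on Y W (sec A (points Y)) e g \<and> g y = \<kappa> * A (V None)))"
proof -
  obtain j where j: "j \<le> 2" "V None j \<noteq> 0" using reps_None[OF y(1) V] by (auto simp: nonzero_vecs2)
  define W where "W = {y \<in> points Y. y None \<notin> S} \<inter> basic Y (\<lambda>V. V None j)"
  have c1: "form 2 1 (\<lambda>v. v j)" by (rule form_coord[OF j(1)])
  have cd: "form 2 d (\<lambda>v. v j ^ d)" by (rule form_power'[OF c1]) simp
  have W: "openin (zariski Y) W"
    unfolding W_def by (intro openin_Int open_avoid order_refl openin_zariski_basic[OF mf_None[OF c1]])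
  have Wnz: "V' None j \<noteq> 0" if "y' \<in> W" "V' \<in> reps Y y'" for y' V'
    using that basicD[of y' Y "\<lambda>V. V None j" V'] by (auto simp: W_def)
  have yW: "y \<in> W" using y j basic_None_iff[OF c1 y(1) V] by (simp add: W_def)
  have fr: "frame Y (L d) W (sec (\<lambda>v. v j ^ d) W)"
    by (rule frame_secI[OF W cd]) (use Wnz in \<open>auto simp: W_def\<close>)
  have "\<exists>g. quotient_on Y W (sec A (points Y)) (sec (\<lambda>v. v j ^ d) W) g \<and>
      g y = (1 / V None j ^ d) * A (V None)" if A: "form 2 d A" for A
  proof (intro exI conjI)
    show "quotient_on Y W (sec A (points Y)) (sec (\<lambda>v. v j ^ d) W)
       (qfun Y (\<lambda>V. A (V None)) (\<lambda>V. V None j ^ d))"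
    proof (rule quotient_on_qfun[OF mf_None[OF A] mf_None[OF cd] W])
      fix y' V' assume a: "y' \<in> W" "V' \<in> reps Y y'"
      have "y' \<in> points Y" using a by (simp add: W_def)
      thus "V' None j ^ d \<noteq> 0 \<and> sec A (points Y) V' = A (V' None) / V' None j ^ d * sec (\<lambda>v. v j ^ d) W V'"
        using Wnz[OF a] sec_eq[OF _ a(2)] a(1) by simp
    qed
    show "qfun Y (\<lambda>V. A (V None)) (\<lambda>V. V None j ^ d) y = (1 / V None j ^ d) * A (V None)"
      using qfun_eq[OF wfY mf_None[OF A] mf_None[OF cd] y(1) V] by simp
  qed
  thus ?thesis using yW fr j
    by (intro exI[of _ W] exI[of _ "sec (\<lambda>v. v j ^ d) W"] exI[of _ "1 / V None j ^ d"]) auto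
qed

text \<open>Near the exceptional curve over \<open>p\<close>, a family \<open>V\<close> of coordinate vectors may be replaced by
  \<open>normalize p V\<close>, which only depends on the blocks \<open>None\<close> and \<open>Some p\<close>.\<close>

definition normalize :: "ppoint \<Rightarrow> (ppoint option \<Rightarrow> cvec) \<Rightarrow> ppoint option \<Rightarrow> cvec" where
  "normalize p V = (\<lambda>i. case i of None \<Rightarrow> V None
     | Some q \<Rightarrow> if q = p then V (Some p) else crs (R q) (V None))"

text \<open>The block of \<open>p\<close> stays itself under \<open>normalize\<close>, while every
  other block becomes linear in the plane block, to which its degree is therefore
  transferred.\<close>

definition ndegree :: "ppoint \<Rightarrow> ppoint option \<Rightarrow> ppoint option \<Rightarrow> nat" where
  "ndegree p j i = (if (if j = Some p then Some p else None) = i then 1 else 0)"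

lemma mf_normalize:
  assumes F: "mf Y \<delta> F" and p: "p \<in> S"
  shows "mf Y (\<lambda>i. \<Sum>j\<in>blocks Y. \<delta> j * ndegree p j i) (\<lambda>V. F (normalize p V))"
proof -
  have "mf Y (\<lambda>i. \<Sum>j\<in>blocks Y. \<delta> j * ndegree p j i) (\<lambda>V. F (\<lambda>j l. normalize p V j l))"
  proof (rule multiform_comp[OF _ _ F])
    fix j l assume j: "j \<in> blocks Y" and "l \<le> pdim Y j"
    hence l: "l \<le> 2" by simp
    show "mf Y (ndegree p j) (\<lambda>V. normalize p V j l)"
    proof (cases j)
      case None
      hence e: "(\<lambda>V. normalize p V j l) = (\<lambda>V. V None l)" by (simp add: normalize_def)
      show ?thesis unfolding e
        by (rule multiform_degree_cong[OF mf_None[OF form_coord[OF l]]]) (auto simp: ndegree_def None)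
    next
      case (Some q)
      show ?thesis
      proof (cases "q = p")
        case True
        hence e: "(\<lambda>V. normalize p V j l) = (\<lambda>V. V (Some p) l)" using Some by (simp add: normalize_def)
        show ?thesis unfolding e
          by (rule multiform_degree_cong[OF mf_Some[OF p form_coord[OF l]]]) (auto simp: ndegree_def Some True)
      next
        case False
        hence e: "(\<lambda>V. normalize p V j l) = (\<lambda>V. crs (R q) (V None) l)" using Some by (simp add: normalize_def)
        show ?thesis unfolding e
          by (rule multiform_degree_cong[OF mf_None[OF form_crs[OF l]]]) (auto simp: ndegree_def Some False)
      qed
    qed
  qed auto
  thus ?thesis by simp
qed

text \<open>Away from the other centres \<open>normalize\<close> rescales each line block by a
  nonzero factor and leaves the plane block alone. Numerator and denominator differ in degree only
  in the plane block, so they change by the same factor.\<close>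

lemma normalize_quotient:
  assumes y: "y \<in> points Y" "V \<in> reps Y y" "y None \<notin> S - {p}" and p: "p \<in> S"
    and FG: "mf Y (\<lambda>i. \<delta> i + (if i = None then d else 0)) F" "mf Y \<delta> G"
  shows "F (normalize p V) / G (normalize p V) = F V / G V" "G (normalize p V) \<noteq> 0 \<longleftrightarrow> G V \<noteq> 0"
proof -
  have "\<exists>c. c \<noteq> 0 \<and> normalize p V (Some q) = (\<lambda>l. c * V (Some q) l)" if q: "q \<in> S" for q
  proof (cases "q = p")
    case True thus ?thesis by (intro exI[of _ 1]) (simp add: normalize_def)
  next
    case False
    then obtain c where c: "c \<noteq> 0" "V (Some q) = (\<lambda>l. c * crs (R q) (V None) l)"
      using reps_Some_scale[OF y(1,2) q] y(3) q by blast
    thus ?thesis using False by (intro exI[of _ "1 / c"]) (simp add: normalize_def)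
  qed
  then obtain c where c: "\<And>q. q \<in> S \<Longrightarrow> c q \<noteq> 0 \<and> normalize p V (Some q) = (\<lambda>l. c q * V (Some q) l)" by metis
  define k where "k = (\<lambda>i. case i of None \<Rightarrow> 1 | Some q \<Rightarrow> c q)"
  have k: "normalize p V i l = k i * V i l" if "i \<in> blocks Y" for i l
  proof (cases i)
    case None thus ?thesis by (simp add: normalize_def k_def)
  next
    case (Some q)
    hence "q \<in> S" using that by auto
    from c[OF this] show ?thesis by (simp add: k_def Some)
  qed
  define K where "K = (\<Prod>i\<in>blocks Y. k i ^ \<delta> i)"
  have k0: "K \<noteq> 0" using c by (auto simp: k_def K_def)
  have kN: "k None = 1" by (simp add: k_def)
  have "(\<Prod>i\<in>blocks Y. k i ^ (\<delta> i + (if i = None then d else 0))) = (\<Prod>i\<in>blocks Y. k i ^ \<delta> i)"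
    by (intro prod.cong) (auto simp: kN)
  hence "F (normalize p V) = K * F V" unfolding K_def
    using multiform_homog[OF FG(1), of "normalize p V" k V] k by metis
  moreover have "G (normalize p V) = K * G V" unfolding K_def
    using multiform_homog[OF FG(2), of "normalize p V" k V] k by metis
  ultimately show "F (normalize p V) / G (normalize p V) = F V / G V" "G (normalize p V) \<noteq> 0 \<longleftrightarrow> G V \<noteq> 0"
    using k0 by simp_all
qed

text \<open>The exceptional curve is irreducible, so vanishing near one of its points propagates to all
  of it.\<close>

lemma numerator_vanishes:
  assumes t: "t \<in> L d U" and p: "p \<in> S"
    and FG: "mf Y (\<lambda>i. \<delta> i + (if i = None then d else 0)) F" "mf Y \<delta> G"
      "basic Y G \<subseteq> U" "\<And>y' V. y' \<in> basic Y G \<Longrightarrow> V \<in> reps Y y' \<Longrightarrow> t V = F V / G V"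
    and y: "y \<in> basic Y G" "y None = p" and w: "vec2 w" "dot w (R p) = 0"
  shows "F (normalize p (\<lambda>i. if i = None then R p else w)) = 0"
proof -
  have yp: "y \<in> points Y" using y basic_subset by auto
  obtain V where V: "V \<in> reps Y y" using reps_nonempty[OF wfY yp] by blast
  define w0 where "w0 = V (Some p)"
  have w0: "w0 \<in> nonzero_vecs 2" "dot w0 (R p) = 0" using reps_Some[OF yp V p] by (simp_all add: w0_def)
  obtain c where c: "c \<noteq> 0" "V None = (\<lambda>l. c * R p l)"
    using multiple_of_R[OF p V] y by auto
  \<comment> \<open>The segment of lines through \<open>p\<close> from a known point of the curve to
    \<open>w\<close>. The denominator is nonzero at \<open>s = 0\<close>, so the numerator vanishes
    for all but finitely many \<open>s\<close>, hence also at \<open>s = 1\<close>, where the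
    denominator may be zero.\<close>
  define ws where "ws = (\<lambda>s l. w0 l + s * (w l - w0 l))"
  define U where "U = (\<lambda>s. \<lambda>i\<in>blocks Y. normalize p (\<lambda>i. if i = None then R p else ws s) i)"
  have Us: "U s None = R p" "U s (Some p) = ws s" "q \<in> S \<Longrightarrow> q \<noteq> p \<Longrightarrow> U s (Some q) = crs (R q) (R p)" for s q
    using p by (auto simp: U_def normalize_def)
  have Uext: "U s \<in> extensional (blocks Y)" for s by (simp add: U_def)
  have poly: "is_poly (\<lambda>s. U s i l)" if "i \<in> blocks Y" for i l
  proof (cases i)
    case (Some q)
    have "is_poly (\<lambda>s. ws s l)" unfolding ws_def by (intro is_poly_add is_poly_mult) auto
    thus ?thesis using Some that Us(2) Us(3)[of q] by (cases "q = p") auto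
  qed (simp add: Us)
  have pF: "is_poly (\<lambda>s. F (U s))" and pG: "is_poly (\<lambda>s. G (U s))"
    by (rule multiform_is_poly[OF FG(1)] multiform_is_poly[OF FG(2)]; use poly in auto)+
  have crsp: "crs (R q) (R p) \<in> nonzero_vecs 2" if "q \<in> S" "q \<noteq> p" for q
    by (rule crs_R_nonzero) (use that R_in[OF p] in auto)
  have U0: "U 0 \<in> reps Y y"
  proof (rule PiE_I)
    fix i assume i: "i \<in> blocks Y"
    show "U 0 i \<in> y i"
    proof (cases i)
      case None thus ?thesis using y R_in(1)[OF p] by (simp add: Us)
    next
      case (Some q)
      hence q: "q \<in> S" using i by auto
      show ?thesis
      proof (cases "q = p")
        case True
        have "U 0 (Some p) = V (Some p)" by (simp add: Us ws_def w0_def)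
        thus ?thesis using Some True V q by auto
      next
        case False
        obtain c' where c': "c' \<noteq> 0" "V (Some q) = (\<lambda>l. c' * crs (R q) (V None) l)"
          using reps_Some_scale[OF yp V q] y False by blast
        have e: "V (Some q) = (\<lambda>l. (c' * c) * U 0 (Some q) l)"
        proof -
          have crs1: "crs (R q) (\<lambda>l. c * R p l) = (\<lambda>l. c * crs (R q) (R p) l)"
            using crs_scale[of 1 "R q" c "R p"] by simp
          show ?thesis
          proof
            fix l
            have "V (Some q) l = c' * crs (R q) (V None) l" by (rule fun_cong[OF c'(2)])
            also have "crs (R q) (V None) = (\<lambda>l. c * crs (R q) (R p) l)" by (simp only: c(2) crs1)
            finally show "V (Some q) l = c' * c * U 0 (Some q) l"
              by (simp only: Us(3)[OF q False] mult.assoc)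
          qed
        qed
        have "U 0 (Some q) = (\<lambda>l. (1 / (c' * c)) * V (Some q) l)"
          by (subst e) (use c c' in simp)
        thus ?thesis using reps_Some(2)[OF yp V q] Some c c'
          unfolding pt_iff by (auto simp: pt_iff intro!: exI[of _ "1 / (c' * c)"])
      qed
    qed
  qed (auto simp: U_def)
  have G0: "G (U 0) \<noteq> 0" by (rule basicD[OF y(1) U0])
  obtain l0 where l0: "l0 \<le> 2" "w0 l0 \<noteq> 0" using w0 by (auto simp: nonzero_vecs2)
  have pw: "is_poly (\<lambda>s. ws s l0)" unfolding ws_def by (intro is_poly_add is_poly_mult) auto
  have fin: "finite ({s. ws s l0 = 0} \<union> {s. G (U s) = 0})"
    using is_poly_finite_zeros[OF pw, of 0] is_poly_finite_zeros[OF pG, of 0] G0 l0 by (simp add: ws_def)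
  have z: "F (U s) = 0" if s: "s \<notin> {s. ws s l0 = 0} \<union> {s. G (U s) = 0}" for s
  proof -
    have wn: "ws s \<in> nonzero_vecs 2"
      using s l0 w w0 unfolding nonzero_vecs2 by (auto simp: ws_def vec2_def)
    have wd: "dot (ws s) (R p) = 0"
    proof -
      have "dot (ws s) (R p) = dot w0 (R p) + s * (dot w (R p) - dot w0 (R p))"
        by (simp add: dot_eq ws_def algebra_simps)
      thus ?thesis using w w0 by simp
    qed
    have A: "U s (Some q) \<in> nonzero_vecs 2 \<and> dot (U s (Some q)) (R q) = 0 \<and> dot (U s (Some q)) (U s None) = 0"
      if q: "q \<in> S" for q
      using wn wd crsp[OF q] Us(1)[of s] Us(2)[of s] Us(3)[OF q, of s] by (cases "q = p") auto
    have P: "pnt (U s) \<in> points Y" "U s \<in> reps Y (pnt (U s))"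
      by (rule pntI; use A Us R_in[OF p] Uext in simp)+
    \<comment> \<open>This point lies over \<open>p\<close> and in the domain of the quotient, so
      the section vanishes there and with it the numerator.\<close>
    have b: "pnt (U s) \<in> basic Y G" using basic_iff[OF wfY FG(2) P] s by simp
    have "pnt (U s) None = p" using R_in[OF p] by (simp add: pnt_def Us)
    hence "t (U s) = 0" using L_exceptional[OF t _ P(1) _ P(2)] b FG(3) p by auto
    thus ?thesis using FG(4)[OF b P(2)] s by simp
  qed
  have "F (U 1) = 0" by (rule is_poly_zeroI[OF pF fin z])
  moreover have "F (U 1) = F (normalize p (\<lambda>i. if i = None then R p else w))"
  proof (rule multiform_cong[OF FG(1)])
    have w1: "ws 1 = w" by (simp add: ws_def)
    show "U 1 i l = normalize p (\<lambda>i. if i = None then R p else w) i l" if "i \<in> blocks Y" for i l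
      using that unfolding U_def w1 by simp
  qed
  ultimately show ?thesis by simp
qed

text \<open>After normalisation the numerator vanishes when the plane point is moved to
  \<open>p\<close>, so it is a combination of the components of the cross product. These are
  proportional to the line coordinates, and multiplication by the nonzero coordinate
  \<open>V (Some p) k\<close> makes all of them multiples of the \<open>k\<close>-th
  component.\<close>

lemma exceptional_division:
  assumes p: "p \<in> S" and d: "d \<ge> 1" and j: "j \<le> 2" "R p j \<noteq> 0" and k: "k \<le> 2"
    and W: "W = {y \<in> points Y. y None \<notin> S - {p}} \<inter> basic Y (\<lambda>V. V None j) \<inter> basic Y (\<lambda>V. V (Some p) k)"
    and W': "W' \<subseteq> W" "t \<in> L d W'" "y \<in> W'" "y None \<in> S"
  shows "\<exists>\<delta> F G. mf Y \<delta> F \<and> mf Y \<delta> G \<and> y \<in> basic Y G \<and> basic Y G \<subseteq> W' \<and>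
    (\<forall>y'\<in>basic Y G. \<forall>V\<in>reps Y y'. t V = F V / G V * (crs (R p) (V None) k * V None j ^ (d - 1)))"
proof -
  have yp: "y \<in> points Y" "y None = p" using W' W by auto
  obtain V1 where V1: "V1 \<in> reps Y y" using reps_nonempty[OF wfY yp(1)] by blast
  obtain \<delta> F G where FG: "mf Y (\<lambda>i. \<delta> i + (if i = None then d else 0)) F" "mf Y \<delta> G"
      "y \<in> basic Y G" "basic Y G \<subseteq> W'"
      "\<And>y' V. y' \<in> basic Y G \<Longrightarrow> V \<in> reps Y y' \<Longrightarrow> t V = F V / G V"
    using L_rep[OF W'(2,3)] by blast
  define F1 G1 where "F1 = (\<lambda>V. F (normalize p V))" and "G1 = (\<lambda>V. G (normalize p V))"
  define D where "D = (\<lambda>i. \<Sum>j\<in>blocks Y. \<delta> j * ndegree p j i)"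
  have G1: "mf Y D G1" unfolding D_def G1_def by (rule mf_normalize[OF FG(2) p])
  have F1: "mf Y (\<lambda>i. D i + (if i = None then d else 0)) F1"
  proof -
    have "(\<Sum>j\<in>blocks Y. (\<delta> j + (if j = None then d else 0)) * ndegree p j i) =
        D i + (\<Sum>j\<in>blocks Y. if j = None then d * ndegree p None i else 0)" for i
      unfolding D_def sum.distrib[symmetric] by (intro sum.cong) (auto simp: algebra_simps)
    hence "(\<Sum>j\<in>blocks Y. (\<delta> j + (if j = None then d else 0)) * ndegree p j i) =
        D i + (if i = None then d else 0)" for i
      by (simp add: ndegree_def)
    thus ?thesis using mf_normalize[OF FG(1) p] unfolding F1_def by simp
  qed
  let ?D1 = "(\<lambda>i. D i + (if i = None then d else 0))(None := D None + d - 1)"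
  have ge: "1 \<le> D None + (if (None::ppoint option) = None then d else 0)" using d by simp
  obtain B where B: "\<And>l. mf Y ?D1 (B l)"
    "\<And>V. F1 V = (V None j / R p j) ^ (D None + d) * F1 (V(None := R p)) +
       (\<Sum>l\<le>2. crs (R p) (V None) l * B l V)"
    using multiform_reduces[where p = "R p" and j = j, OF F1 _ _ _ ge j(2,1)] finite_blocks by auto
  \<comment> \<open>The extra factor \<open>G\<close> on both sides confines the new denominator to
    the region where the original representation of \<open>t\<close> holds; the power of
    \<open>V None j\<close> balances the degrees.\<close>
  let ?F = "\<lambda>V. (\<Sum>l\<le>2. V (Some p) l * B l V) * G V"
  let ?G = "\<lambda>V. V (Some p) k * G1 V * V None j ^ (d - 1) * G V"
  let ?D = "\<lambda>i. D i + (if i = None then d - 1 else 0) + (if i = Some p then 1 else 0) + \<delta> i"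
  have mF: "mf Y ?D ?F"
    by (intro multiform_mult'[OF multiform_sum[OF multiform_mult[OF mf_Some[OF p form_coord] B(1)]] FG(2)])
       (use d in auto)
  have cd: "form 2 (d - 1) (\<lambda>v. v j ^ (d - 1))" by (rule form_power'[OF form_coord[OF j(1)]]) simp
  have mG: "mf Y ?D ?G"
    by (rule multiform_mult'[OF multiform_mult[OF multiform_mult[OF mf_Some[OF p form_coord[OF k]] G1] mf_None[OF cd]] FG(2)]) auto
  have sub: "y' \<in> basic Y G" if y': "y' \<in> basic Y ?G" for y'
  proof -
    have "y' \<in> points Y" using y' basic_subset by auto
    thus ?thesis using y' unfolding basic_def by auto
  qed
  have "t V = ?F V / ?G V * (crs (R p) (V None) k * V None j ^ (d - 1))"
    if y': "y' \<in> basic Y ?G" "V \<in> reps Y y'" for y' V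
  proof -
    have b: "y' \<in> basic Y G" "y' \<in> W" using sub[OF y'(1)] FG(4) W' by auto
    have y'p: "y' \<in> points Y" "y' None \<notin> S - {p}" using b W by auto
    have nz: "V (Some p) k \<noteq> 0" "G1 V \<noteq> 0" "V None j ^ (d - 1) \<noteq> 0" "G V \<noteq> 0"
      using basicD[OF y'] by auto
    have w: "V (Some p) \<in> nonzero_vecs 2" "dot (V (Some p)) (R p) = 0" "dot (V (Some p)) (V None) = 0"
      using reps_Some[OF y'p(1) y'(2) p] by auto
    \<comment> \<open>The point \<open>y'\<close> need not lie over \<open>p\<close>: keeping its
      line through \<open>p\<close> and moving the plane point to \<open>p\<close> lands on the
      exceptional curve.\<close>
    have "F1 (V(None := R p)) = F (normalize p (\<lambda>i. if i = None then R p else V (Some p)))"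
      unfolding F1_def by (rule multiform_cong[OF FG(1)]) (auto simp: normalize_def split: option.split)
    also have "\<dots> = 0"
      by (rule numerator_vanishes[OF W'(2) p FG(1,2,4,5) FG(3) yp(2)]) (use w in \<open>auto simp: nonzero_vecs2\<close>)
    finally have F1V: "F1 V = (\<Sum>l\<le>2. crs (R p) (V None) l * B l V)" using B(2)[of V] by simp
    have par: "crs (R p) (V None) l * V (Some p) k = crs (R p) (V None) k * V (Some p) l" if "l \<le> 2" for l
      by (rule crs_parallel[OF w(2,3) that k])
    have "V (Some p) k * F1 V = (\<Sum>l\<le>2. (crs (R p) (V None) l * V (Some p) k) * B l V)"
      unfolding F1V sum_distrib_left by (simp add: mult_ac)
    also have "\<dots> = (\<Sum>l\<le>2. (crs (R p) (V None) k * V (Some p) l) * B l V)"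
      by (intro sum.cong refl) (use par in auto)
    also have "\<dots> = crs (R p) (V None) k * (\<Sum>l\<le>2. V (Some p) l * B l V)"
      unfolding sum_distrib_left by (simp add: mult_ac)
    finally have e: "V (Some p) k * F1 V = crs (R p) (V None) k * (\<Sum>l\<le>2. V (Some p) l * B l V)" .
    have "t V = F1 V / G1 V"
      using FG(5)[OF b(1) y'(2)] normalize_quotient(1)[OF y'p(1) y'(2) y'p(2) p FG(1,2)]
      by (simp add: F1_def G1_def)
    also have "\<dots> = (V (Some p) k * F1 V) / (V (Some p) k * G1 V)" using nz by simp
    also have "\<dots> = ?F V / ?G V * (crs (R p) (V None) k * V None j ^ (d - 1))"
      unfolding e using nz by (simp add: field_simps)
    finally show ?thesis .
  qed
  moreover have "y \<in> basic Y ?G"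
  proof -
    have "V1 None j \<noteq> 0" "V1 (Some p) k \<noteq> 0"
      using W' W basicD[of y Y "\<lambda>V. V None j" V1] basicD[of y Y "\<lambda>V. V (Some p) k" V1] V1 by auto
    moreover have "G V1 \<noteq> 0" by (rule basicD[OF FG(3) V1])
    moreover have "G1 V1 \<noteq> 0" unfolding G1_def
      using normalize_quotient(2)[OF yp(1) V1 _ p FG(1,2)] yp(2) \<open>G V1 \<noteq> 0\<close> by simp
    ultimately show ?thesis using basic_iff[OF wfY mG yp(1) V1] by simp
  qed
  moreover have "basic Y ?G \<subseteq> W'" using sub FG(4) by (intro subsetI) (rule subsetD)
  ultimately show ?thesis using mF mG
    by (intro exI[of _ ?D] exI[of _ ?F] exI[of _ ?G] conjI ballI)
qed

text \<open>Where the \<open>k\<close>-th line coordinate is nonzero, the \<open>k\<close>-th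
  component of the cross product is an equation of the exceptional curve, and a power of
  \<open>v j\<close> completes the degree. Dividing by it replaces the cross product by the line
  coordinates, that is, takes the first order part of the form at \<open>p\<close>.\<close>

lemma exceptional_frame:
  assumes p: "p \<in> S" and d: "d \<ge> 1" and y: "y \<in> points Y" "y None = p" and V: "V \<in> reps Y y"
  shows "\<exists>W e \<kappa>. y \<in> W \<and> frame Y (L d) W e \<and> \<kappa> \<noteq> 0 \<and>
    (\<forall>A C. (\<forall>l\<le>2. form 2 (d - 1) (C l)) \<longrightarrow> (\<forall>v. A v = (\<Sum>l\<le>2. crs (R p) v l * C l v)) \<longrightarrow>
      (\<exists>g. quotient_on Y W (sec A (points Y)) e g \<and> g y = \<kappa> * (\<Sum>l\<le>2. V (Some p) l * C l (R p))))"
proof -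
  obtain j where j: "j \<le> 2" "R p j \<noteq> 0" using R_in(2)[OF p] by (auto simp: nonzero_vecs2)
  obtain k where k: "k \<le> 2" "V (Some p) k \<noteq> 0" using reps_Some(1)[OF y(1) V p] by (auto simp: nonzero_vecs2)
  obtain c where c: "c \<noteq> 0" "V None = (\<lambda>l. c * R p l)"
    using multiple_of_R[OF p V] y by auto
  define W where "W = {y \<in> points Y. y None \<notin> S - {p}} \<inter> basic Y (\<lambda>V. V None j) \<inter> basic Y (\<lambda>V. V (Some p) k)"
  define \<epsilon> where "\<epsilon> = (\<lambda>v. crs (R p) v k * v j ^ (d - 1))"
  have cd: "form 2 (d - 1) (\<lambda>v. v j ^ (d - 1))" by (rule form_power'[OF form_coord[OF j(1)]]) simp
  have \<epsilon>: "form 2 d \<epsilon>" unfolding \<epsilon>_def by (rule form_mult'[OF form_crs[OF k(1)] cd]) (use d in simp)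
  have W: "openin (zariski Y) W"
    unfolding W_def by (intro openin_Int open_avoid openin_zariski_basic[OF mf_None[OF form_coord[OF j(1)]]]
      openin_zariski_basic[OF mf_Some[OF p form_coord[OF k(1)]]]) auto
  have Wnz: "y' \<in> points Y" "y' None \<notin> S - {p}" "V' None j \<noteq> 0" "V' (Some p) k \<noteq> 0"
    if "y' \<in> W" "V' \<in> reps Y y'" for y' V'
    using that basicD[of y' Y "\<lambda>V. V None j" V'] basicD[of y' Y "\<lambda>V. V (Some p) k" V'] by (auto simp: W_def)
  have yW: "y \<in> W" using y j k c basic_None_iff[OF form_coord[OF j(1)] y(1) V]
      basic_Some_iff[OF p form_coord[OF k(1)] y(1) V] by (simp add: W_def)
  have fr: "frame Y (L d) W (sec \<epsilon> W)"
  proof (rule frame_secI[OF W \<epsilon>])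
    fix y' V' assume a: "y' \<in> W" "V' \<in> reps Y y'"
    show "\<epsilon> (V' None) = 0" if "y' None \<in> S"
    proof -
      have "y' None = p" using that Wnz(2)[OF a] by auto
      then obtain c' where "V' None = (\<lambda>l. c' * R p l)"
        using multiple_of_R[OF p a(2)] by auto
      thus ?thesis using crs_scale[of 1 "R p" c' "R p"] by (simp add: \<epsilon>_def)
    qed
    show "\<epsilon> (V' None) \<noteq> 0" if ns: "y' None \<notin> S"
    proof -
      obtain c' where "V' (Some p) = (\<lambda>l. c' * crs (R p) (V' None) l)"
        using reps_Some_scale[OF Wnz(1)[OF a] a(2) p] ns p by auto
      thus ?thesis using Wnz(3,4)[OF a] by (auto simp: \<epsilon>_def)
    qed
  next
    fix W' t y assume a: "W' \<subseteq> W" "t \<in> L d W'" "y \<in> W'" "y None \<in> S"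
    show "\<exists>\<delta> F G. mf Y \<delta> F \<and> mf Y \<delta> G \<and> y \<in> basic Y G \<and> basic Y G \<subseteq> W' \<and>
        (\<forall>y'\<in>basic Y G. \<forall>V\<in>reps Y y'. t V = F V / G V * \<epsilon> (V None))"
      unfolding \<epsilon>_def by (rule exceptional_division[OF p d j k(1) W_def a])
  qed
  \<comment> \<open>The power of \<open>c\<close> arises from evaluating forms of degree
    \<open>d - 1\<close> at \<open>V None\<close> instead of \<open>R p\<close>; the denominator is
    that of the quotient at \<open>V\<close>.\<close>
  define \<kappa> where "\<kappa> = c ^ (d - 1) / (V (Some p) k * V None j ^ (d - 1))"
  have "\<exists>g. quotient_on Y W (sec A (points Y)) (sec \<epsilon> W) g \<and>
      g y = \<kappa> * (\<Sum>l\<le>2. V (Some p) l * C l (R p))"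
    if C: "\<forall>l\<le>2. form 2 (d - 1) (C l)" and A: "\<forall>v. A v = (\<Sum>l\<le>2. crs (R p) v l * C l v)" for A C
  proof -
    let ?F = "\<lambda>V. \<Sum>l\<le>2. V (Some p) l * C l (V None)" and ?G = "\<lambda>V. V (Some p) k * V None j ^ (d - 1)"
    let ?\<delta> = "\<lambda>i. (if i = Some p then 1 else 0) + (if i = None then d - 1 else 0)"
    have mF: "mf Y ?\<delta> ?F"
      by (intro multiform_sum multiform_mult[OF mf_Some[OF p form_coord] mf_None]) (use C in auto)
    have mG: "mf Y ?\<delta> ?G" by (rule multiform_mult[OF mf_Some[OF p form_coord[OF k(1)]] mf_None[OF cd]])
    show ?thesis
    proof (intro exI conjI)
      show "quotient_on Y W (sec A (points Y)) (sec \<epsilon> W) (qfun Y ?F ?G)"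
      proof (rule quotient_on_qfun[OF mF mG W])
        fix y' V' assume a: "y' \<in> W" "V' \<in> reps Y y'"
        have w: "dot (V' (Some p)) (R p) = 0" "dot (V' (Some p)) (V' None) = 0"
          using reps_Some[OF Wnz(1)[OF a] a(2) p] by auto
        have "V' (Some p) k * A (V' None) = (\<Sum>l\<le>2. (crs (R p) (V' None) l * V' (Some p) k) * C l (V' None))"
          unfolding A[rule_format] sum_distrib_left by (simp add: mult_ac)
        also have "\<dots> = (\<Sum>l\<le>2. (crs (R p) (V' None) k * V' (Some p) l) * C l (V' None))"
          by (intro sum.cong refl) (use crs_parallel[OF w _ k(1)] in auto)
        also have "\<dots> = crs (R p) (V' None) k * ?F V'"
          unfolding sum_distrib_left by (simp add: mult_ac)
        finally have e: "V' (Some p) k * A (V' None) = crs (R p) (V' None) k * ?F V'" .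
        have nz: "V' (Some p) k \<noteq> 0" "V' None j \<noteq> 0" using Wnz[OF a] by auto
        have fld: "a = f / (w * z) * (x * z)" if "w * a = x * f" "w \<noteq> 0" "z \<noteq> 0" for a f w x z :: complex
          using that by (simp add: field_simps)
        have "A (V' None) = ?F V' / ?G V' * \<epsilon> (V' None)"
          unfolding \<epsilon>_def by (rule fld[OF e]) (use nz in auto)
        thus "?G V' \<noteq> 0 \<and> sec A (points Y) V' = ?F V' / ?G V' * sec \<epsilon> W V'"
          using nz sec_eq[OF a] sec_eq[OF Wnz(1)[OF a] a(2)] by simp
      qed
      have "C l (V None) = c ^ (d - 1) * C l (R p)" if "l \<le> 2" for l
        unfolding c(2) by (rule form_homog) (use C that in auto)
      hence "?F V = c ^ (d - 1) * (\<Sum>l\<le>2. V (Some p) l * C l (R p))"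
        unfolding sum_distrib_left by (intro sum.cong) auto
      thus "qfun Y ?F ?G y = \<kappa> * (\<Sum>l\<le>2. V (Some p) l * C l (R p))"
        unfolding qfun_eq[OF wfY mF mG y(1) V] \<kappa>_def by simp
    qed
  qed
  moreover have "\<kappa> \<noteq> 0" using c j k by (simp add: \<kappa>_def)
  ultimately show ?thesis using yW fr by (intro exI[of _ W] exI[of _ "sec \<epsilon> W"] exI[of _ \<kappa>]) blast
qed

end

section \<open>Global sections as forms, and the map given by a basis\<close>

section \<open>Global sections\<close>

text \<open>Coordinates with respect to the points \<open>(1,1,1)\<close>, \<open>(1,-1,1)\<close>
  and \<open>(1,1,-1)\<close>. All three lie in the torus, hence off the centres, so almost all
  lines through them miss \<open>S\<close>; the usual coordinate points would not do, since lines
  through them may start in a centre.\<close>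

definition comb :: "complex \<Rightarrow> complex \<Rightarrow> complex \<Rightarrow> cvec" where
  "comb x y z = (\<lambda>l. if l = 0 then x + y + z else if l = 1 then x - y + z else if l = 2 then x + y - z else 0)"

lemma vec2_comb [simp, intro]: "vec2 (comb x y z)"
  by (simp add: vec2_def comb_def)

lemma comb_coords:
  assumes "vec2 v" shows "v = comb ((v 1 + v 2) / 2) ((v 0 - v 1) / 2) ((v 0 - v 2) / 2)"
  by (rule vec2_eqI[OF assms vec2_comb]) (auto simp: comb_def le2_cases field_simps)

lemma coords_comb [simp]:
  "(comb x y z 1 + comb x y z 2) / 2 = x" "(comb x y z 0 - comb x y z 1) / 2 = y"
  "(comb x y z 0 - comb x y z 2) / 2 = z"
  by (simp_all add: comb_def)

lemma comb_scale: "(\<lambda>l. k * comb x y z l) = comb (k * x) (k * y) (k * z)"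
proof
  fix l show "k * comb x y z l = comb (k * x) (k * y) (k * z) l"
    by (cases "l = 0"; cases "l = 1"; cases "l = 2") (simp_all add: comb_def algebra_simps)
qed

lemma comb_eq_iff: "comb x y z = comb x' y' z' \<longleftrightarrow> x = x' \<and> y = y' \<and> z = z'"
  using coords_comb by metis

context blown_up_plane
begin

definition good :: "cvec \<Rightarrow> bool" where
  "good v \<longleftrightarrow> v \<in> nonzero_vecs 2 \<and> pt v \<notin> S"

text \<open>The section as a function on coordinate vectors of the plane. The value 0 at vectors of
  centres and at the zero vector makes homogeneity hold without side conditions on the
  vector.\<close>

definition descend :: "ppoint option sect \<Rightarrow> cvec \<Rightarrow> complex" where
  "descend t v = (if good v then t (lift_vec v) else 0)"

lemma good_scale: assumes "k \<noteq> 0" shows "good (\<lambda>l. k * v l) \<longleftrightarrow> good v"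
  using pt_scale[OF assms] assms unfolding good_def nonzero_vecs_def by (auto simp: fun_eq_iff)

lemma lift_vec_scale:
  assumes "good v" "k \<noteq> 0"
  shows "lift_vec (\<lambda>l. k * v l) \<in> reps Y (lift v)"
    "i \<in> blocks Y \<Longrightarrow> lift_vec (\<lambda>l. k * v l) i l = k * lift_vec v i l"
proof -
  show e: "lift_vec (\<lambda>l. k * v l) i l = k * lift_vec v i l" if "i \<in> blocks Y" for i l
    using that crs_scale[of 1 _ k v] by auto
  show "lift_vec (\<lambda>l. k * v l) \<in> reps Y (lift v)"
  proof (rule PiE_I)
    fix i assume i: "i \<in> blocks Y"
    have "lift_vec (\<lambda>l. k * v l) i = (\<lambda>l. k * lift_vec v i l)" using e[OF i] by auto
    moreover have "lift v i = pt (lift_vec v i)" using i by (simp add: lift_def pnt_def)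
    ultimately show "lift_vec (\<lambda>l. k * v l) i \<in> lift v i" using assms(2) by (auto simp: pt_iff)
  qed (auto simp: lift_vec_def restrict_def)
qed

lemma descend_homog:
  assumes t: "t \<in> L d (points Y)" and k: "k \<noteq> 0"
  shows "descend t (\<lambda>l. k * v l) = k ^ d * descend t v"
proof (cases "good v")
  case True
  hence v: "v \<in> nonzero_vecs 2" "pt v \<notin> S" by (auto simp: good_def)
  obtain \<delta> F G where FG: "mf Y (\<lambda>i. \<delta> i + (if i = None then d else 0)) F" "mf Y \<delta> G"
    "lift v \<in> basic Y G" "\<And>y' V. y' \<in> basic Y G \<Longrightarrow> V \<in> reps Y y' \<Longrightarrow> t V = F V / G V"
    by (rule L_rep[OF t lift_in(1)[OF v]]) (rule that)
  define P where "P = (\<Prod>i\<in>blocks Y. k ^ \<delta> i)"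
  have P0: "P \<noteq> 0" using k by (simp add: P_def)
  have "(\<Prod>i\<in>blocks Y. k ^ (\<delta> i + (if i = None then d else 0))) = P * (\<Prod>i\<in>blocks Y. k ^ (if i = None then d else 0))"
    unfolding P_def by (simp only: power_add prod.distrib)
  also have "(\<Prod>i\<in>blocks Y. k ^ (if i = None then d else 0)) = (\<Prod>i\<in>blocks Y. if i = None then k ^ d else 1)"
    by (intro prod.cong) auto
  also have "\<dots> = k ^ d" by simp
  finally have "F (lift_vec (\<lambda>l. k * v l)) = P * k ^ d * F (lift_vec v)"
    using multiform_homog[OF FG(1), of "lift_vec (\<lambda>l. k * v l)" "\<lambda>_. k" "lift_vec v"]
      lift_vec_scale(2)[OF True k] by simp
  moreover have "G (lift_vec (\<lambda>l. k * v l)) = P * G (lift_vec v)"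
    using multiform_homog[OF FG(2), of "lift_vec (\<lambda>l. k * v l)" "\<lambda>_. k" "lift_vec v"]
      lift_vec_scale(2)[OF True k] unfolding P_def by simp
  moreover have "t (lift_vec (\<lambda>l. k * v l)) = F (lift_vec (\<lambda>l. k * v l)) / G (lift_vec (\<lambda>l. k * v l))"
    by (rule FG(4)[OF FG(3) lift_vec_scale(1)[OF True k]])
  moreover have "t (lift_vec v) = F (lift_vec v) / G (lift_vec v)"
    by (rule FG(4)[OF FG(3) lift_in(2)[OF v]])
  ultimately show ?thesis using True good_scale[OF k, of v] P0 by (simp add: descend_def)
next
  case False thus ?thesis using good_scale[OF k, of v] by (simp add: descend_def)
qed

text \<open>Along an affine line the coordinates of \<open>lift_vec\<close> are polynomials in the
  parameter, so the local quotients of the section become local rational functions without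
  poles.\<close>

lemma descend_line:
  assumes t: "t \<in> L d (points Y)" and g: "\<And>s. good (\<lambda>l. a l + s * b l)"
  shows "is_poly (\<lambda>s. descend t (\<lambda>l. a l + s * b l))"
proof (rule locally_rational_is_poly)
  fix s0
  let ?v = "\<lambda>s l. a l + s * b l"
  have v: "?v s \<in> nonzero_vecs 2" "pt (?v s) \<notin> S" for s using g[of s] by (auto simp: good_def)
  obtain \<delta> F G where FG: "mf Y (\<lambda>i. \<delta> i + (if i = None then d else 0)) F" "mf Y \<delta> G"
    "lift (?v s0) \<in> basic Y G" "\<And>y' V. y' \<in> basic Y G \<Longrightarrow> V \<in> reps Y y' \<Longrightarrow> t V = F V / G V"
    by (rule L_rep[OF t lift_in(1)[OF v[of s0]]]) (rule that)
  have p: "is_poly (\<lambda>s. lift_vec (?v s) i l)" if "i \<in> blocks Y" "l \<le> 2" for i l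
  proof (cases i)
    case None thus ?thesis by (auto intro!: is_poly_add is_poly_mult)
  next
    case (Some q)
    have "is_poly (\<lambda>s. crs (R q) (?v s) l)"
      by (rule form_is_poly[OF form_crs[OF that(2)]]) (auto intro!: is_poly_add is_poly_mult)
    thus ?thesis using Some that by auto
  qed
  show "\<exists>A B. is_poly A \<and> is_poly B \<and> B s0 \<noteq> 0 \<and> (\<forall>s. B s \<noteq> 0 \<longrightarrow> descend t (?v s) = A s / B s)"
  proof (intro exI conjI allI impI)
    show "is_poly (\<lambda>s. F (lift_vec (?v s)))" by (rule multiform_is_poly[OF FG(1)]) (use p in auto)
    show "is_poly (\<lambda>s. G (lift_vec (?v s)))" by (rule multiform_is_poly[OF FG(2)]) (use p in auto)
    show "G (lift_vec (?v s0)) \<noteq> 0" by (rule basicD[OF FG(3) lift_in(2)[OF v]])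
    fix s assume "G (lift_vec (?v s)) \<noteq> 0"
    hence "lift (?v s) \<in> basic Y G" using basic_iff[OF wfY FG(2) lift_in(1,2)[OF v]] by simp
    from FG(4)[OF this lift_in(2)[OF v]] g[of s]
    show "descend t (?v s) = F (lift_vec (?v s)) / G (lift_vec (?v s))" by (simp add: descend_def)
  qed
qed

text \<open>If the whole projective line avoids the centres, both charts are polynomial and
  homogeneity bounds the degree.\<close>

lemma descend_line_degree:
  assumes t: "t \<in> L d (points Y)" and g: "\<And>r s. r \<noteq> 0 \<or> s \<noteq> 0 \<Longrightarrow> good (\<lambda>l. r * a l + s * b l)"
  shows "\<exists>p. degree p \<le> d \<and> (\<forall>s. descend t (\<lambda>l. a l + s * b l) = poly p s)"
proof (rule poly_degree_bound_reflect)
  show "is_poly (\<lambda>s. descend t (\<lambda>l. a l + s * b l))" by (rule descend_line[OF t]) (use g[of 1] in simp)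
  show "is_poly (\<lambda>s. descend t (\<lambda>l. b l + s * a l))"
    by (rule descend_line[OF t]) (use g[of _ 1] in \<open>simp add: add.commute\<close>)
  fix s :: complex assume s: "s \<noteq> 0"
  have "(\<lambda>l. a l + s * b l) = (\<lambda>l. s * (b l + (1 / s) * a l))" using s by (auto simp: field_simps)
  thus "descend t (\<lambda>l. a l + s * b l) = s ^ d * descend t (\<lambda>l. b l + (1 / s) * a l)"
    using descend_homog[OF t s, of "\<lambda>l. b l + (1 / s) * a l"] by simp
qed

lemma comb_bad:
  assumes "x \<noteq> 0 \<or> y \<noteq> 0 \<or> z \<noteq> 0" "\<not> good (comb x y z)"
  obtains p k where "p \<in> S" "k \<noteq> 0" "R p = comb (k * x) (k * y) (k * z)"
proof -
  have "comb x y z \<noteq> (\<lambda>_. 0)"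
  proof
    assume e: "comb x y z = (\<lambda>_. 0)"
    have "comb 0 0 0 = (\<lambda>_. 0)" by (simp add: comb_def fun_eq_iff)
    hence "comb x y z = comb 0 0 0" using e by simp
    thus False using assms(1) by (simp only: comb_eq_iff) simp
  qed
  hence "comb x y z \<in> nonzero_vecs 2" using vec2_comb[of x y z] by (simp add: nonzero_vecs_def vec2_def)
  hence "pt (comb x y z) \<in> S" using assms(2) by (simp add: good_def)
  from R_in(1)[OF this] obtain k where "k \<noteq> 0" "R (pt (comb x y z)) = (\<lambda>l. k * comb x y z l)"
    by (auto simp: pt_iff)
  thus ?thesis using that \<open>pt (comb x y z) \<in> S\<close> by (simp add: comb_scale)
qed

lemma good_corner: "good (comb 1 0 0)" "good (comb 0 1 0)" "good (comb 0 0 1)"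
proof -
  have "good (comb x y z)" if "comb x y z 0 * comb x y z 1 * comb x y z 2 \<noteq> 0" for x y z
  proof -
    have "comb x y z \<in> nonzero_vecs 2" unfolding nonzero_vecs2 using that by (auto intro!: exI[of _ 0])
    thus ?thesis using S_axes that by (auto simp: good_def)
  qed
  thus "good (comb 1 0 0)" "good (comb 0 1 0)" "good (comb 0 0 1)" by (auto simp: comb_def)
qed

lemma not_good_R: "p \<in> S \<Longrightarrow> \<not> good (R p)"
  using R_in by (simp add: good_def)

text \<open>The three families of lines pass through the three corners of \<open>comb\<close>. A
  line of such a family is unusable only if it contains a centre, which excludes finitely many
  parameters.\<close>

lemma descend_interpolation:
  assumes t: "t \<in> L d (points Y)"
  obtains B c where "finite B" "\<And>x y. y \<notin> B \<Longrightarrow> descend t (comb x y 1) =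
    (\<Sum>i\<le>d. \<Sum>j\<le>d. if i + j \<le> d then c i j * x ^ i * y ^ j else 0)"
proof -
  define ca cb cc where "ca = (\<lambda>p. (R p 1 + R p 2) / 2)" and "cb = (\<lambda>p. (R p 0 - R p 1) / 2)"
    and "cc = (\<lambda>p. (R p 0 - R p 2) / 2)"
  \<comment> \<open>Parameters of the lines that hit a centre. A centre with denominator zero
    contributes the default quotient 0, which merely excludes one more parameter.\<close>
  define A where "A = (\<lambda>p. ca p / cc p) ` S"
  define B where "B = (\<lambda>p. cb p / cc p) ` S"
  define D where "D = (\<lambda>p. cb p / ca p) ` S"
  have co: "ca p = x" "cb p = y" "cc p = z" if "R p = comb x y z" for p x y z
    using coords_comb[of x y z] that by (simp_all add: ca_def cb_def cc_def)
  have lin: "(\<lambda>l. r * comb x y z l + s * comb x' y' z' l) = comb (r * x + s * x') (r * y + s * y') (r * z + s * z')"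
    for r s x y z x' y' z'
  proof
    fix l show "r * comb x y z l + s * comb x' y' z' l = comb (r * x + s * x') (r * y + s * y') (r * z + s * z') l"
      by (cases "l = 0"; cases "l = 1"; cases "l = 2") (simp_all add: comb_def algebra_simps)
  qed
  have lin1: "(\<lambda>l. comb x y z l + s * comb x' y' z' l) = comb (x + s * x') (y + s * y') (z + s * z')"
    for s x y z x' y' z' using lin[of 1 x y z s x' y' z'] by simp
  have "\<exists>c. \<forall>x y. y \<notin> B \<longrightarrow> descend t (comb x y 1) =
      (\<Sum>i\<le>d. \<Sum>j\<le>d. if i + j \<le> d then c i j * x ^ i * y ^ j else 0)"
  proof (rule homogeneous_interpolation[where A = A and D = D and h = "\<lambda>x y z. descend t (comb x y z)"])
    show "descend t (comb (k * x) (k * y) (k * z)) = k ^ d * descend t (comb x y z)" if "k \<noteq> 0" for k x y z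
      using descend_homog[OF t that, of "comb x y z"] by (simp add: comb_scale)
    show "finite A" "finite B" "finite D" using finite_S by (simp_all add: A_def B_def D_def)
  next
    fix x assume x: "x \<notin> A"
    have g: "good (\<lambda>l. r * comb x 0 1 l + s * comb 0 1 0 l)" if rs: "r \<noteq> 0 \<or> s \<noteq> 0" for r s
    proof (rule ccontr)
      assume "\<not> good (\<lambda>l. r * comb x 0 1 l + s * comb 0 1 0 l)"
      hence "\<not> good (comb (r * x) s r)" by (simp add: lin)
      from comb_bad[OF _ this] rs obtain p k where p: "p \<in> S" "k \<noteq> 0" "R p = comb (k * (r * x)) (k * s) (k * r)" by blast
      show False
      proof (cases "r = 0")
        case True
        hence "R p = (\<lambda>l. (k * s) * comb 0 1 0 l)" using p by (simp add: comb_scale)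
        thus False using good_scale[of "k * s" "comb 0 1 0"] good_corner(2) not_good_R[OF p(1)] p(2) rs True by simp
      next
        case False
        have "x = ca p / cc p" using co[OF p(3)] False p(2) by simp
        thus False using x p(1) by (auto simp: A_def)
      qed
    qed
    from descend_line_degree[OF t this]
    show "\<exists>p. degree p \<le> d \<and> (\<forall>y. descend t (comb x y 1) = poly p y)" by (simp add: lin1)
  next
    fix y assume y: "y \<notin> B"
    have g: "good (\<lambda>l. r * comb 0 y 1 l + s * comb 1 0 0 l)" if rs: "r \<noteq> 0 \<or> s \<noteq> 0" for r s
    proof (rule ccontr)
      assume "\<not> good (\<lambda>l. r * comb 0 y 1 l + s * comb 1 0 0 l)"
      hence "\<not> good (comb s (r * y) r)" by (simp add: lin)
      from comb_bad[OF _ this] rs obtain p k where p: "p \<in> S" "k \<noteq> 0" "R p = comb (k * s) (k * (r * y)) (k * r)" by blast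
      show False
      proof (cases "r = 0")
        case True
        hence "R p = (\<lambda>l. (k * s) * comb 1 0 0 l)" using p by (simp add: comb_scale)
        thus False using good_scale[of "k * s" "comb 1 0 0"] good_corner(1) not_good_R[OF p(1)] p(2) rs True by simp
      next
        case False
        have "y = cb p / cc p" using co[OF p(3)] False p(2) by simp
        thus False using y p(1) by (auto simp: B_def)
      qed
    qed
    from descend_line_degree[OF t this]
    show "\<exists>p. degree p \<le> d \<and> (\<forall>x. descend t (comb x y 1) = poly p x)" by (simp add: lin1)
  next
    fix y assume y: "y \<notin> D"
    have g: "good (\<lambda>l. comb 1 y 0 l + s * comb 0 0 1 l)" for s
    proof (rule ccontr)
      assume "\<not> good (\<lambda>l. comb 1 y 0 l + s * comb 0 0 1 l)"
      hence "\<not> good (comb 1 y s)" by (simp add: lin1)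
      from comb_bad[OF _ this] obtain p k where p: "p \<in> S" "k \<noteq> 0" "R p = comb (k * 1) (k * y) (k * s)" by auto
      have "y = cb p / ca p" using co[OF p(3)] p(2) by simp
      thus False using y p(1) by (auto simp: D_def)
    qed
    from descend_line[OF t this] show "is_poly (\<lambda>z. descend t (comb 1 y z))" by (simp add: lin1)
  qed
  moreover have "finite B" using finite_S by (simp add: B_def)
  ultimately show ?thesis using that by blast
qed

text \<open>A point of the fibre over a centre is the line joining it to a point of the torus. It
  lets vanishing on the exceptional curves be read as vanishing of the form at the centres.\<close>

lemma exists_over:
  assumes "v \<in> nonzero_vecs 2" "pt v \<in> S"
  obtains V where "pnt V \<in> points Y" "V \<in> reps Y (pnt V)" "V None = v"
proof -
  define p where "p = pt v"
  obtain k where k: "v = (\<lambda>l. k * R p l)" "k \<noteq> 0"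
  proof -
    have "v \<in> pt (R p)" using R_in(3)[OF assms(2)] by (simp add: p_def)
    thus ?thesis using that by (auto simp: pt_iff)
  qed
  define V where "V = (\<lambda>i\<in>blocks Y. case i of None \<Rightarrow> v
    | Some q \<Rightarrow> if q = p then crs (R p) (comb 1 0 0) else crs (R q) v)"
  have "good (comb 1 0 0)" by (rule good_corner)
  hence w: "crs (R p) (comb 1 0 0) \<in> nonzero_vecs 2"
    by (intro crs_R_nonzero) (use assms in \<open>auto simp: good_def p_def\<close>)
  have c: "crs (R q) v \<in> nonzero_vecs 2" if "q \<in> S" "q \<noteq> p" for q
    by (rule crs_R_nonzero) (use assms that in \<open>auto simp: p_def\<close>)
  have dv: "dot (crs (R p) u) v = 0" for u
  proof -
    have "dot (crs (R p) u) v = k * dot (crs (R p) u) (R p)" unfolding k(1) by (simp add: dot_eq algebra_simps)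
    thus ?thesis by simp
  qed
  have VN: "V None = v" by (simp add: V_def)
  have VS: "V (Some q) \<in> nonzero_vecs 2 \<and> dot (V (Some q)) (R q) = 0 \<and> dot (V (Some q)) v = 0" if "q \<in> S" for q
    using that w c dv by (cases "q = p") (simp_all add: V_def)
  have "pnt V \<in> points Y" "V \<in> reps Y (pnt V)"
    by (rule pntI; use VS VN assms in \<open>simp add: V_def\<close>)+
  thus ?thesis using that VN by blast
qed

text \<open>Interpolation yields a form that agrees with the section off finitely many lines;
  density of the remaining points extends the agreement to the blow-up, including the exceptional
  curves.\<close>

lemma global_section_form:
  assumes t: "t \<in> L d (points Y)"
  obtains A where "form 2 d A" "\<And>v. v \<in> nonzero_vecs 2 \<Longrightarrow> pt v \<in> S \<Longrightarrow> A v = 0" "t = sec A (points Y)"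
proof -
  obtain B c where B: "finite B" "\<And>x y. y \<notin> B \<Longrightarrow> descend t (comb x y 1) =
    (\<Sum>i\<le>d. \<Sum>j\<le>d. if i + j \<le> d then c i j * x ^ i * y ^ j else 0)"
    using descend_interpolation[OF t] by blast
  define la lb lc :: "cvec \<Rightarrow> complex" where "la = (\<lambda>v. (1/2) * (v 1 + v 2))" and "lb = (\<lambda>v. (1/2) * (v 0 - v 1))"
    and "lc = (\<lambda>v. (1/2) * (v 0 - v 2))"
  have fl: "form 2 1 la" "form 2 1 lb" "form 2 1 lc"
    using form_coord[of 0 2] form_coord[of 1 2] form_coord[of 2 2] unfolding la_def lb_def lc_def
    by (intro form_cmult form_add form_diff; simp)+
  define A where "A = (\<lambda>v. \<Sum>i\<le>d. \<Sum>j\<le>d. (if i + j \<le> d then c i j else 0) * (la v ^ i * lb v ^ j * lc v ^ (d - i - j)))"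
  have fA: "form 2 d A"
  proof -
    have "form 2 d (\<lambda>v. (if i + j \<le> d then c i j else 0) * (la v ^ i * lb v ^ j * lc v ^ (d - i - j)))" for i j
    proof (cases "i + j \<le> d")
      case True
      have "form 2 (i * 1 + j * 1 + (d - i - j) * 1) (\<lambda>v. la v ^ i * lb v ^ j * lc v ^ (d - i - j))"
        by (intro form_mult form_power fl)
      moreover have "i * 1 + j * 1 + (d - i - j) * 1 = d" using True by simp
      ultimately have "form 2 d (\<lambda>v. la v ^ i * lb v ^ j * lc v ^ (d - i - j))" by metis
      thus ?thesis by (rule form_cmult)
    qed simp
    thus ?thesis unfolding A_def by (intro form_sum)
  qed
  have gA: "descend t v = A v" if v: "vec2 v" "lc v \<noteq> 0" "lb v / lc v \<notin> B" for v
  proof -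
    have "v = comb (la v) (lb v) (lc v)" using comb_coords[OF v(1)] by (simp add: la_def lb_def lc_def)
    also have "\<dots> = (\<lambda>l. lc v * comb (la v / lc v) (lb v / lc v) 1 l)" using v(2) by (simp add: comb_scale)
    finally have "descend t v = lc v ^ d * descend t (comb (la v / lc v) (lb v / lc v) 1)"
      using descend_homog[OF t v(2)] by metis
    also have "\<dots> = (\<Sum>i\<le>d. \<Sum>j\<le>d. lc v ^ d * (if i + j \<le> d then c i j * (la v / lc v) ^ i * (lb v / lc v) ^ j else 0))"
      unfolding B(2)[OF v(3)] sum_distrib_left ..
    also have "\<dots> = A v" unfolding A_def
    proof (intro sum.cong refl)
      fix i j
      show "lc v ^ d * (if i + j \<le> d then c i j * (la v / lc v) ^ i * (lb v / lc v) ^ j else 0) =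
        (if i + j \<le> d then c i j else 0) * (la v ^ i * lb v ^ j * lc v ^ (d - i - j))"
      proof (cases "i + j \<le> d")
        case True
        hence "lc v ^ d = lc v ^ i * lc v ^ j * lc v ^ (d - i - j)"
          by (simp flip: power_add)
        thus ?thesis using True v(2) by (simp add: power_divide)
      qed simp
    qed
    finally show ?thesis .
  qed
  \<comment> \<open>Nonvanishing of this form means that the point is in the torus, is not at
    infinity in the chart of the interpolation, and is off the excluded lines.\<close>
  define P where "P = (\<lambda>v. v 0 * v 1 * v 2 * lc v * (\<Prod>\<beta>\<in>B. lb v - \<beta> * lc v))"
  have fP: "form 2 (4 + (\<Sum>\<beta>\<in>B. 1)) P" unfolding P_def
    using form_coord[of 0 2] form_coord[of 1 2] form_coord[of 2 2] fl
    by (intro form_mult[of _ 4] form_mult'[of _ 3 _ 1] form_mult'[of _ 2 _ 1] form_mult'[of _ 1 _ 1]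
        form_prod form_diff form_cmult) auto
  obtain b0 where b0: "b0 \<notin> B" using finite_avoid[OF B(1)] by blast
  \<comment> \<open>The three excluded values are those at which a coordinate of
    \<open>comb a0 b0 1\<close> vanishes.\<close>
  obtain a0 where "a0 \<notin> {- b0 - 1, b0 - 1, 1 - b0}" using finite_avoid[of "{- b0 - 1, b0 - 1, 1 - b0}"] by auto
  hence a0: "a0 + b0 + 1 \<noteq> 0" "a0 - b0 + 1 \<noteq> 0" "a0 + b0 - 1 \<noteq> 0"
    by (auto simp: algebra_simps eq_neg_iff_add_eq_0)
  have Pn: "P (comb a0 b0 1) \<noteq> 0"
  proof -
    have "lc (comb a0 b0 1) = 1" "lb (comb a0 b0 1) = b0" by (simp_all add: lc_def lb_def comb_def)
    thus ?thesis using a0 b0 B(1) by (auto simp: P_def comb_def)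
  qed
  have tA: "t V = A (V None)" if y: "y \<in> points Y" "V \<in> reps Y y" for y V
  proof (rule ccontr)
    assume ne: "t V \<noteq> A (V None)"
    obtain \<delta> F G where FG: "mf Y (\<lambda>i. \<delta> i + (if i = None then d else 0)) F" "mf Y \<delta> G"
      "y \<in> basic Y G" "\<And>y' V. y' \<in> basic Y G \<Longrightarrow> V \<in> reps Y y' \<Longrightarrow> t V = F V / G V"
      by (rule L_rep[OF t y(1)]) (rule that)
    \<comment> \<open>A disagreement at \<open>V\<close> would make this polynomial nonzero on a
      nonempty open set, and hence at a lifted point where the form is known to agree.\<close>
    let ?K = "\<lambda>V. F V - G V * A (V None)"
    have K: "mf Y (\<lambda>i. \<delta> i + (if i = None then d else 0)) ?K"
      by (rule multiform_diff[OF _ _ FG(1) multiform_mult[OF FG(2) mf_None[OF fA]]]) auto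
    have "G V \<noteq> 0" by (rule basicD[OF FG(3) y(2)])
    hence "?K V \<noteq> 0" using ne FG(4)[OF FG(3) y(2)] by auto
    hence "y \<in> basic Y ?K" using basic_iff[OF wfY K y] by simp
    hence yI: "y \<in> basic Y ?K \<inter> basic Y G" using FG(3) by simp
    have op: "openin (zariski Y) (basic Y ?K \<inter> basic Y G)" using K FG(2) by (auto simp del: Y_simps)
    have "\<exists>v. v \<in> nonzero_vecs 2 \<and> P v \<noteq> 0 \<and> lift v \<in> basic Y ?K \<inter> basic Y G"
    proof (rule dense_lift[OF fP _ vec2_comb Pn _ op yI])
      show "pt v \<notin> S" if "v \<in> nonzero_vecs 2" "P v \<noteq> 0" for v
        by (rule S_axes) (use that in \<open>auto simp: P_def\<close>)
    qed simp
    then obtain v where v: "v \<in> nonzero_vecs 2" "P v \<noteq> 0" "lift v \<in> basic Y ?K" "lift v \<in> basic Y G" by blast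
    have vS: "pt v \<notin> S" by (rule S_axes) (use v in \<open>auto simp: P_def\<close>)
    have "lb v / lc v \<notin> B"
    proof
      assume "lb v / lc v \<in> B"
      moreover have "lb v - (lb v / lc v) * lc v = 0" using v(2) by (simp add: P_def)
      ultimately have "(\<Prod>\<beta>\<in>B. lb v - \<beta> * lc v) = 0" using B(1) by (intro prod_zero) blast+
      thus False using v(2) by (simp add: P_def)
    qed
    hence "descend t v = A v" using v by (intro gA) (auto simp: P_def nonzero_vecs2)
    hence "t (lift_vec v) = A v" using v vS by (simp add: descend_def good_def)
    moreover have "t (lift_vec v) = F (lift_vec v) / G (lift_vec v)"
      by (rule FG(4)[OF v(4) lift_in(2)[OF v(1) vS]])
    moreover have "G (lift_vec v) \<noteq> 0" by (rule basicD[OF v(4) lift_in(2)[OF v(1) vS]])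
    ultimately have "?K (lift_vec v) = 0" by (simp add: field_simps)
    thus False using basicD[OF v(3) lift_in(2)[OF v(1) vS]] by simp
  qed
  have "t V = sec A (points Y) V" for V
  proof (cases "V \<in> cone Y (points Y)")
    case True thus ?thesis using tA by (auto simp: sec_def cone_iff simp del: Y_simps)
  next
    case False thus ?thesis using L_off_cone[OF t] by (simp add: sec_def)
  qed
  moreover have "A v = 0" if v: "v \<in> nonzero_vecs 2" "pt v \<in> S" for v
  proof -
    obtain V where V: "pnt V \<in> points Y" "V \<in> reps Y (pnt V)" "V None = v" using exists_over[OF v] by blast
    have "pnt V None = pt v" using V(3) by (simp add: pnt_def)
    hence "t V = 0" using L_exceptional[OF t V(1,1) _ V(2)] v by simp
    thus ?thesis using tA[OF V(1,2)] V(3) by simp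
  qed
  ultimately show ?thesis using that[OF fA] by blast
qed

lemma L_points_eq:
  "L d (points Y) = {sec A (points Y) | A. form 2 d A \<and> (\<forall>v\<in>nonzero_vecs 2. pt v \<in> S \<longrightarrow> A v = 0)}"
proof (intro set_eqI iffI)
  fix t assume "t \<in> L d (points Y)"
  then obtain A where "form 2 d A" "\<And>v. v \<in> nonzero_vecs 2 \<Longrightarrow> pt v \<in> S \<Longrightarrow> A v = 0" "t = sec A (points Y)"
    by (rule global_section_form) (rule that)
  thus "t \<in> {sec A (points Y) | A. form 2 d A \<and> (\<forall>v\<in>nonzero_vecs 2. pt v \<in> S \<longrightarrow> A v = 0)}" by blast
next
  fix t assume "t \<in> {sec A (points Y) | A. form 2 d A \<and> (\<forall>v\<in>nonzero_vecs 2. pt v \<in> S \<longrightarrow> A v = 0)}"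
  then obtain A where A: "t = sec A (points Y)" "form 2 d A" "\<forall>v\<in>nonzero_vecs 2. pt v \<in> S \<longrightarrow> A v = 0" by blast
  show "t \<in> L d (points Y)" unfolding A(1)
    by (rule sec_in_L[OF openin_points[OF wfY] A(2)]) (use A(3) reps_None in auto)
qed


section \<open>The map given by a linear system\<close>

lemma L_cmult:
  assumes U: "openin (zariski Y) U" and s: "s \<in> L d U" shows "(\<lambda>V. c * s V) \<in> L d U"
proof (rule L_memI[OF U])
  fix y assume "y \<in> U"
  then obtain \<delta> F G where *: "mf Y (\<lambda>i. \<delta> i + (if i = None then d else 0)) F" "mf Y \<delta> G"
    "y \<in> basic Y G" "basic Y G \<subseteq> U" "\<And>y' V. y' \<in> basic Y G \<Longrightarrow> V \<in> reps Y y' \<Longrightarrow> s V = F V / G V"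
    by (rule L_rep[OF s]) (rule that)
  show "\<exists>\<delta> F G. mf Y (\<lambda>i. \<delta> i + (if i = None then d else 0)) F \<and> mf Y \<delta> G \<and>
      y \<in> basic Y G \<and> basic Y G \<subseteq> U \<and> (\<forall>y'\<in>basic Y G. \<forall>V\<in>reps Y y'. c * s V = F V / G V)"
  proof (intro exI conjI ballI)
    show "mf Y (\<lambda>i. \<delta> i + (if i = None then d else 0)) (\<lambda>V. c * F V)"
      by (rule multiform_cmult[OF _ _ *(1)]) auto
    fix y' V assume "y' \<in> basic Y G" "V \<in> reps Y y'"
    thus "c * s V = c * F V / G V" using *(5) by simp
  qed (use * in auto)
next
  fix y V assume a: "y \<in> U" "V \<in> reps Y y" "y None \<in> S"
  have "s V = 0" by (rule L_exceptional[OF s a(1) _ a(3,2)]) (use a openin_zariski_subset[OF wfY U] in auto)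
  thus "c * s V = 0" by simp
qed (use L_off_cone[OF s] in auto)

lemma quotient_on_subset:
  assumes "quotient_on Y W s e g" "openin (zariski Y) W'" "W' \<subseteq> W"
  shows "quotient_on Y W' s e g"
  using assms regular_subset[OF wfY _ assms(2,3)] unfolding quotient_on_def by blast

lemma quotient_on_cong:
  assumes "quotient_on Y W s e g" "\<And>y V. y \<in> W \<Longrightarrow> V \<in> reps Y y \<Longrightarrow> s V = s' V"
    "\<And>y V. y \<in> W \<Longrightarrow> V \<in> reps Y y \<Longrightarrow> e V = e' V"
  shows "quotient_on Y W s' e' g"
  using assms unfolding quotient_on_def by metis

lemma frame_unique:
  assumes f: "frame Y (L d) W e" and W': "openin (zariski Y) W'" "W' \<subseteq> W"
    and g: "regular Y W' g" "regular Y W' g'"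
    and eq: "\<And>y V. y \<in> W' \<Longrightarrow> V \<in> reps Y y \<Longrightarrow> g y * e V = g' y * e V" and y: "y \<in> W'"
  shows "g y = g' y"
proof -
  have "quotient_on Y W' (\<lambda>_. 0) e (\<lambda>y. g y - g' y)"
    unfolding quotient_on_def using regular_diff[OF wfY g] eq by (simp add: left_diff_distrib)
  hence "g y - g' y = 0" using f W' y unfolding frame_def by blast
  thus ?thesis by simp
qed

lemma frame_open: "frame Y (L d) W e \<Longrightarrow> openin (zariski Y) W"
  by (simp add: frame_def)

lemma frame_quotient:
  assumes f: "frame Y (L d) W e" and s: "s \<in> L d U" and W': "openin (zariski Y) W'" "W' \<subseteq> W" "W' \<subseteq> U"
  obtains g where "quotient_on Y W' s e g"
proof -
  have "(\<lambda>V. if V \<in> cone Y W' then s V else 0) \<in> L d W'" by (rule L_restrict[OF W'(1,3) s])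
  then obtain g where g: "quotient_on Y W' (\<lambda>V. if V \<in> cone Y W' then s V else 0) e g"
    using f W' unfolding frame_def by blast
  have "quotient_on Y W' s e g" by (rule quotient_on_cong[OF g]) (auto simp: cone_iff)
  thus ?thesis using that by blast
qed

lemma frame_scale:
  assumes f: "frame Y (L d) W e" and c: "c \<noteq> 0"
  shows "frame Y (L d) W (\<lambda>V. c * e V)"
  unfolding frame_def
proof (intro conjI allI impI ballI)
  show W: "openin (zariski Y) W" by (rule frame_open[OF f])
  show "(\<lambda>V. c * e V) \<in> L d W" by (rule L_cmult[OF W]) (use f in \<open>simp add: frame_def\<close>)
  fix W' assume W': "openin (zariski Y) W' \<and> W' \<subseteq> W"
  show "\<exists>g. quotient_on Y W' t (\<lambda>V. c * e V) g" if t: "t \<in> L d W'" for t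
  proof -
    obtain g where "quotient_on Y W' t e g" using frame_quotient[OF f t] W' by blast
    hence g: "regular Y W' g" "\<And>y V. y \<in> W' \<Longrightarrow> V \<in> reps Y y \<Longrightarrow> t V = g y * e V"
      unfolding quotient_on_def by blast+
    have "quotient_on Y W' t (\<lambda>V. c * e V) (\<lambda>y. (1 / c) * g y)"
      unfolding quotient_on_def
    proof (intro conjI ballI)
      show "regular Y W' (\<lambda>y. (1 / c) * g y)" by (rule regular_cmult[OF wfY g(1)])
      fix y V assume "y \<in> W'" "V \<in> reps Y y"
      from g(2)[OF this] show "t V = (1 / c) * g y * (c * e V)" using c by simp
    qed
    thus ?thesis by blast
  qed
  fix g y assume g: "quotient_on Y W' (\<lambda>_. 0) (\<lambda>V. c * e V) g" and y: "y \<in> W'"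
  show "g y = 0"
  proof (rule frame_unique[OF f _ _ _ regular_const[OF wfY], where g = g])
    show "regular Y W' g" using g by (simp add: quotient_on_def)
    show "g y * e V = 0 * e V" if "y \<in> W'" "V \<in> reps Y y" for y V
    proof -
      have "0 = g y * (c * e V)" using g that unfolding quotient_on_def by blast
      thus ?thesis using c by auto
    qed
  qed (use W' y in auto)
qed

text \<open>Two frames differ near \<open>y\<close> by an invertible regular function, so their
  coordinate vectors are proportional; conversely, scaling one frame by constants reaches every
  nonzero multiple.\<close>

lemma linear_system_map_eq:
  assumes f: "frame Y (L d) W e" and y: "y \<in> W"
    and g: "\<And>j. j \<le> N \<Longrightarrow> quotient_on Y W (s j) e (g j)"
  shows "linear_system_map Y (L d) N s y = (\<lambda>_. pt (\<lambda>j. if j \<le> N then g j y else 0))"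
proof
  fix a :: unit
  show "linear_system_map Y (L d) N s y a = pt (\<lambda>j. if j \<le> N then g j y else 0)"
  proof (intro set_eqI iffI)
    fix z assume "z \<in> linear_system_map Y (L d) N s y a"
    then obtain W' e' g' where *: "z = (\<lambda>j. if j \<le> N then g' j y else 0)" "y \<in> W'" "frame Y (L d) W' e'"
      "\<And>j. j \<le> N \<Longrightarrow> quotient_on Y W' (s j) e' (g' j)"
      unfolding linear_system_map_def by blast
    let ?I = "W \<inter> W'"
    have I: "openin (zariski Y) ?I" "?I \<subseteq> W" "?I \<subseteq> W'" "y \<in> ?I"
      using frame_open[OF f] frame_open[OF *(3)] y *(2) by auto
    have "e \<in> L d W" "e' \<in> L d W'" using f *(3) by (auto simp: frame_def)
    then obtain u u' where u: "quotient_on Y ?I e e' u" "quotient_on Y ?I e' e u'"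
      using frame_quotient[OF *(3) _ I(1,3,2)] frame_quotient[OF f _ I(1,2,3)] by metis
    have ru: "regular Y ?I u" "regular Y ?I u'" using u by (auto simp: quotient_on_def)
    have eu: "e V = u x * e' V" "e' V = u' x * e V" if "x \<in> ?I" "V \<in> reps Y x" for x V
      using u that unfolding quotient_on_def by blast+
    \<comment> \<open>Each frame is expressed through the other, and uniqueness of quotients makes
      the two factors inverse to each other.\<close>
    have "u y * u' y = 1"
    proof (rule frame_unique[OF f I(1,2) regular_mult[OF wfY ru] regular_const[OF wfY I(1)] _ I(4)])
      show "u x * u' x * e V = 1 * e V" if "x \<in> ?I" "V \<in> reps Y x" for x V
        using eu[OF that] by (metis mult.assoc mult.left_neutral)
    qed
    hence u0: "u y \<noteq> 0" by auto
    have "g' j y = u y * g j y" if j: "j \<le> N" for j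
    proof (rule frame_unique[OF *(3) I(1,3) _ _ _ I(4)])
      have 1: "quotient_on Y ?I (s j) e' (g' j)" by (rule quotient_on_subset[OF *(4)[OF j] I(1,3)])
      have 2: "quotient_on Y ?I (s j) e (g j)" by (rule quotient_on_subset[OF g[OF j] I(1,2)])
      show "regular Y ?I (g' j)" using 1 by (simp add: quotient_on_def)
      show "regular Y ?I (\<lambda>y. u y * g j y)"
        by (rule regular_mult[OF wfY ru(1)]) (use 2 in \<open>simp add: quotient_on_def\<close>)
      fix x V assume x: "x \<in> ?I" "V \<in> reps Y x"
      have "s j V = g' j x * e' V" "s j V = g j x * e V" using 1 2 x unfolding quotient_on_def by blast+
      hence "g' j x * e' V = g j x * (u x * e' V)" using eu(1)[OF x] by metis
      thus "g' j x * e' V = u x * g j x * e' V" by (simp only: mult_ac)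
    qed
    hence "z = (\<lambda>j. u y * (if j \<le> N then g j y else 0))" unfolding *(1) by auto
    thus "z \<in> pt (\<lambda>j. if j \<le> N then g j y else 0)" using u0 by (auto simp: pt_iff)
  next
    fix z assume "z \<in> pt (\<lambda>j. if j \<le> N then g j y else 0)"
    then obtain c where c: "c \<noteq> 0" "z = (\<lambda>j. c * (if j \<le> N then g j y else 0))" by (auto simp: pt_iff)
    have "frame Y (L d) W (\<lambda>V. (1 / c) * e V)" by (rule frame_scale[OF f]) (use c in simp)
    moreover have "quotient_on Y W (s j) (\<lambda>V. (1 / c) * e V) (\<lambda>y. c * g j y)" if "j \<le> N" for j
      using g[OF that] c(1) regular_cmult[OF wfY] unfolding quotient_on_def by auto
    moreover have "z = (\<lambda>j. if j \<le> N then c * g j y else 0)" using c by auto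
    ultimately show "z \<in> linear_system_map Y (L d) N s y a"
      unfolding linear_system_map_def using y
      by (intro CollectI exI[of _ W] exI[of _ "\<lambda>V. (1 / c) * e V"] exI[of _ "\<lambda>j y. c * g j y"]) auto
  qed
qed

end

section \<open>The Fermat configuration and a basis of its linear system\<close>

section \<open>The dual points of the Fermat arrangement\<close>

definition sg :: "nat \<Rightarrow> complex" where "sg m = (- 1) ^ m"

lemma sg_mult [simp]: "sg m * sg m = 1" "sg m * (sg m * x) = x"
  by (simp_all add: sg_def power_mult_distrib[symmetric] mult.assoc[symmetric])

lemma sg_nonzero [simp]: "sg m \<noteq> 0"
  by (simp add: sg_def)

lemma sg_power: "(- x) ^ m = sg m * x ^ m"
  unfolding sg_def by (rule power_minus)

text \<open>The form does not involve \<open>v i\<close> and is divisible by the other two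
  coordinates. Hence it vanishes on the other two coordinate lines, and on the \<open>i\<close>-th
  one exactly at the points of the configuration.\<close>

definition bq :: "nat \<Rightarrow> nat \<Rightarrow> cvec \<Rightarrow> complex" where
  "bq m i v = (if i = 0 then v 1 * v 2 * (v 1 ^ m - sg m * v 2 ^ m)
     else if i = 1 then v 2 * v 0 * (v 2 ^ m - sg m * v 0 ^ m)
     else v 0 * v 1 * (v 0 ^ m - sg m * v 1 ^ m))"

lemma bq_cyc: "cyc i j k \<Longrightarrow> bq m i v = v j * v k * (v j ^ m - sg m * v k ^ m)"
  by (auto simp: cyc_def bq_def)

lemma form_bq: assumes "i \<le> 2" shows "form 2 (m + 2) (bq m i)"
proof -
  obtain j k where c: "cyc i j k" using cyc_ex[OF assms] by blast
  hence jk: "j \<le> 2" "k \<le> 2" using cyc_le by auto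
  have "form 2 (1 + 1 + m) (\<lambda>v. v j * v k * (v j ^ m - sg m * v k ^ m))"
    by (intro form_mult form_coord form_diff form_cmult form_power'[where d = 1]) (use jk in auto)
  moreover have "bq m i = (\<lambda>v. v j * v k * (v j ^ m - sg m * v k ^ m))" using bq_cyc[OF c] by auto
  ultimately show ?thesis by (simp add: add.commute)
qed

lemma F3_cyc:
  "cyc i j k \<Longrightarrow> F3 m v = v i * v j * v k * ((v i ^ m - v j ^ m) * (v j ^ m - v k ^ m) * (v k ^ m - v i ^ m))"
  by (auto simp: cyc_def F3_def F0_def ac_simps)

text \<open>The configuration described as a zero set of generators of the system itself. This
  avoids naming roots of unity, and its negation immediately supplies a nonvanishing
  section.\<close>

definition on_dual :: "nat \<Rightarrow> cvec \<Rightarrow> bool" where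
  "on_dual m w \<longleftrightarrow> w 0 * w 1 * w 2 = 0 \<and> (\<forall>i\<le>2. bq m i w = 0)"

lemma on_dual_scale:
  assumes "on_dual m w" shows "on_dual m (\<lambda>l. c * w l)"
  using assms form_homog[OF form_bq] unfolding on_dual_def by auto

lemma on_dual_edge:
  assumes c: "cyc i j k" and "w i = 0" "w j * w k * (w j ^ m - sg m * w k ^ m) = 0"
  shows "on_dual m w"
  unfolding on_dual_def
proof (intro conjI allI impI)
  show "w 0 * w 1 * w 2 = 0" using cyc_prod[OF c, of w] assms(2) by simp
  fix l :: nat assume "l \<le> 2"
  thus "bq m l w = 0"
    using cyc_cases[OF c, of l] bq_cyc[OF c] bq_cyc[OF cyc_rot[OF c]] bq_cyc[OF cyc_rot[OF cyc_rot[OF c]]]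
      assms(2,3) by auto
qed

lemma on_dual_zero_coord:
  assumes "on_dual m w" obtains i j k where "cyc i j k" "w i = 0"
proof -
  have "w 0 = 0 \<or> w 1 = 0 \<or> w 2 = 0" using assms by (auto simp: on_dual_def)
  hence "\<exists>i. i \<le> 2 \<and> w i = 0"
    by (elim disjE) (rule exI, rule conjI[rotated], assumption, simp)+
  then obtain i where "i \<le> 2" "w i = 0" by blast
  thus ?thesis using cyc_ex[of i] that by blast
qed

text \<open>If \<open>w\<close> divides \<open>F3\<close>, then \<open>F3\<close> vanishes on the
  dual line. A line with all coefficients nonzero has points outside every factor, so some
  \<open>w i\<close> is zero; points with free \<open>i\<close>-th coordinate then isolate the
  factor in the other two variables.\<close>

lemma dual_imp_on_dual:
  assumes m: "m \<ge> 1" and w: "w \<in> nonzero_vecs 2"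
    and F: "F3 m = (\<lambda>v. (\<Sum>i\<le>2. w i * v i) * G v)"
  shows "on_dual m w"
proof -
  have F0: "F3 m v = 0" if "w 0 * v 0 + w 1 * v 1 + w 2 * v 2 = 0" for v
    using that F unfolding sum_le2 by simp
  have "w 0 * w 1 * w 2 = 0"
  proof (rule ccontr)
    assume nz: "w 0 * w 1 * w 2 \<noteq> 0"
    \<comment> \<open>\<open>(1, t, z t)\<close> parametrises the dual line. Every factor of
      \<open>F3\<close> is a nonzero polynomial in \<open>t\<close> along it, as seen at
      \<open>t = 0\<close> or at the root of \<open>z\<close>.\<close>
    define z where "z = (\<lambda>t. (- 1 / w 2) * (w 0 + w 1 * t))"
    have pz: "is_poly z" unfolding z_def by (intro is_poly_mult is_poly_add) auto
    have z0: "z 0 \<noteq> 0" "z (- w 0 / w 1) = 0" using nz by (simp_all add: z_def)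
    have "finite {t. z t = 0}" "finite {t :: complex. t = 0}"
      using is_poly_finite_zeros[OF pz z0(1)] by auto
    moreover have "finite {t :: complex. 1 - t ^ m = 0}"
      by (rule is_poly_finite_zeros[of _ 0], intro is_poly_diff is_poly_power is_poly_const is_poly_ident) (use m in \<open>auto simp: power_0_left\<close>)
    moreover have "finite {t. t ^ m - z t ^ m = 0}"
      by (rule is_poly_finite_zeros[of _ 0], intro is_poly_diff is_poly_power is_poly_ident pz) (use m z0 in \<open>auto simp: power_0_left\<close>)
    moreover have "finite {t. z t ^ m - 1 = 0}"
      by (rule is_poly_finite_zeros[of _ "- w 0 / w 1"], intro is_poly_diff is_poly_power is_poly_const pz) (use m z0 in \<open>auto simp: power_0_left\<close>)
    ultimately have "finite ({t. z t = 0} \<union> {t. t = 0} \<union> {t. 1 - t ^ m = 0} \<union> {t. t ^ m - z t ^ m = 0} \<union>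
        {t. z t ^ m - 1 = 0})" by simp
    from finite_avoid[OF this] obtain t where t: "z t \<noteq> 0" "t \<noteq> 0" "1 - t ^ m \<noteq> 0" "t ^ m - z t ^ m \<noteq> 0"
      "z t ^ m - 1 \<noteq> 0" by auto
    define v where "v = (\<lambda>l::nat. if l = 0 then 1 else if l = 1 then t else z t)"
    have "w 0 * v 0 + w 1 * v 1 + w 2 * v 2 = 0" using nz by (simp add: v_def z_def field_simps)
    from F0[OF this] t show False by (simp add: F3_def F0_def v_def)
  qed
  then obtain i j k where c: "cyc i j k" and wi: "w i = 0"
    using cyc_ex[of 0] cyc_ex[of 1] cyc_ex[of 2] by auto
  have "w j * w k * (w j ^ m - sg m * w k ^ m) = 0"
  proof (cases "w j = 0 \<or> w k = 0")
    case False
    have "finite {t :: complex. t ^ m - w k ^ m = 0}"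
      by (rule is_poly_finite_zeros[of _ 0], intro is_poly_diff is_poly_power is_poly_const is_poly_ident) (use m False in \<open>auto simp: power_0_left\<close>)
    moreover have "finite {t :: complex. t ^ m - (- w j) ^ m = 0}"
      by (rule is_poly_finite_zeros[of _ 0], intro is_poly_diff is_poly_power is_poly_const is_poly_ident) (use m False in \<open>auto simp: power_0_left\<close>)
    ultimately have "finite ({t. t = 0} \<union> {t. t ^ m - w k ^ m = 0} \<union> {t. t ^ m - (- w j) ^ m = 0})" by simp
    from finite_avoid[OF this] obtain t where t: "t \<noteq> 0" "t ^ m - w k ^ m \<noteq> 0" "t ^ m - (- w j) ^ m \<noteq> 0" by auto
    \<comment> \<open>As \<open>w i = 0\<close>, this point lies on the dual line for every
      \<open>t\<close>, and \<open>t\<close> is chosen so that no factor involving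
      \<open>v i\<close> vanishes.\<close>
    define v where "v = (\<lambda>l. if l = i then t else if l = j then w k else - w j)"
    have v: "v i = t" "v j = w k" "v k = - w j" using cyc_le[OF c] by (auto simp: v_def)
    have "w 0 * v 0 + w 1 * v 1 + w 2 * v 2 = 0"
      using cyc_sum[OF c, of "\<lambda>l. w l * v l"] v wi by simp
    from F0[OF this] have "t * w k * (- w j) * ((t ^ m - w k ^ m) * (w k ^ m - (- w j) ^ m) * ((- w j) ^ m - t ^ m)) = 0"
      unfolding F3_cyc[OF c] v .
    hence "w k ^ m = (- w j) ^ m" using t False by auto
    hence "w k ^ m = sg m * w j ^ m" by (simp only: sg_power)
    hence "sg m * w k ^ m = w j ^ m" by simp
    thus ?thesis by simp
  qed auto
  from on_dual_edge[OF c wi this] show ?thesis .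
qed

text \<open>Either \<open>w\<close> is a multiple of a coordinate form, visible in
  \<open>F3\<close>, or it is a form in two variables dividing a difference of \<open>m\<close>-th
  powers.\<close>

lemma on_dual_imp_factor:
  assumes m: "m \<ge> 1" and w: "w \<in> nonzero_vecs 2" and d: "on_dual m w"
  shows "\<exists>k G. form 2 k G \<and> F3 m = (\<lambda>v. (\<Sum>i\<le>2. w i * v i) * G v)"
proof -
  have single: ?thesis if c: "cyc i j k" and z: "w j = 0" "w k = 0" for i j k
  proof -
    have wi: "w i \<noteq> 0" using w z cyc_cases[OF c] by (auto simp: nonzero_vecs2)
    define G where "G = (\<lambda>v. (1 / w i) * (v j * v k * ((v i ^ m - v j ^ m) * (v j ^ m - v k ^ m) * (v k ^ m - v i ^ m))))"
    have "form 2 (1 + 1 + (m + m + m)) G" unfolding G_def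
      by (intro form_mult form_coord form_diff form_cmult form_power'[where d = 1]) (use cyc_le[OF c] in auto)
    moreover have "F3 m v = (\<Sum>i\<le>2. w i * v i) * G v" for v
      using cyc_sum[OF c, of "\<lambda>l. w l * v l"] z wi unfolding F3_cyc[OF c] sum_le2 by (simp add: G_def)
    ultimately show ?thesis by blast
  qed
  obtain i j k where c: "cyc i j k" and wi: "w i = 0" using on_dual_zero_coord[OF d] by blast
  show ?thesis
  proof (cases "w j = 0 \<or> w k = 0")
    case True
    thus ?thesis using single[OF cyc_rot[OF c]] single[OF cyc_rot[OF cyc_rot[OF c]]] wi by auto
  next
    case False
    have "bq m i w = 0" using d cyc_le[OF c] by (simp add: on_dual_def)
    hence e: "w j ^ m = (- w k) ^ m" using False by (simp add: bq_cyc[OF c] sg_power)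
    \<comment> \<open>The cofactor of \<open>w j * v j + w k * v k\<close> in a difference of
      \<open>m\<close>-th powers, from the geometric sum.\<close>
    define Q where "Q = (\<lambda>v. \<Sum>l<m. (- (w k * v k)) ^ (m - Suc l) * (w j * v j) ^ l)"
    have Q: "w j ^ m * (v j ^ m - v k ^ m) = (w j * v j + w k * v k) * Q v" for v
    proof -
      have "(- (w k * v k)) ^ m = (- w k) ^ m * v k ^ m" by (metis minus_mult_left power_mult_distrib)
      hence "w j ^ m * (v j ^ m - v k ^ m) = (w j * v j) ^ m - (- (w k * v k)) ^ m"
        unfolding power_mult_distrib e[symmetric] by (simp add: algebra_simps)
      also have "\<dots> = (w j * v j - - (w k * v k)) * Q v" unfolding Q_def by (rule power_diff_sumr2)
      finally show ?thesis by simp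
    qed
    have fQ: "form 2 (m - 1) Q" unfolding Q_def
    proof (intro form_sum)
      fix l assume "l \<in> {..<m}"
      thus "form 2 (m - 1) (\<lambda>v. (- (w k * v k)) ^ (m - Suc l) * (w j * v j) ^ l)"
        by (intro form_mult'[of _ "m - Suc l" _ l] form_power'[where d = 1] form_minus form_cmult form_coord)
           (use cyc_le[OF c] in auto)
    qed
    define G where "G = (\<lambda>v. (1 / w j ^ m) * (v i * v j * v k * ((v i ^ m - v j ^ m) * Q v * (v k ^ m - v i ^ m))))"
    have "form 2 (1 + 1 + 1 + (m + (m - 1) + m)) G" unfolding G_def
      by (intro form_mult form_coord form_diff form_cmult fQ form_power'[where d = 1]) (use cyc_le[OF c] in auto)
    moreover have "F3 m v = (\<Sum>i\<le>2. w i * v i) * G v" for v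
    proof -
      have dt: "(\<Sum>i\<le>2. w i * v i) = w j * v j + w k * v k"
        using cyc_sum[OF c, of "\<lambda>l. w l * v l"] wi unfolding sum_le2 by simp
      have "v j ^ m - v k ^ m = (1 / w j ^ m) * ((w j * v j + w k * v k) * Q v)"
        using Q[of v] False by (simp add: field_simps)
      thus ?thesis unfolding F3_cyc[OF c] dt G_def by (simp only: mult_ac)
    qed
    ultimately show ?thesis by blast
  qed
qed

lemma dual_points_iff:
  assumes m: "m \<ge> 1" and w: "w \<in> nonzero_vecs 2"
  shows "pt w \<in> dual_points (F3 m) \<longleftrightarrow> on_dual m w"
proof
  assume "pt w \<in> dual_points (F3 m)"
  then obtain w' k G where *: "pt w = pt w'" "w' \<in> nonzero_vecs 2" "F3 m = (\<lambda>v. (\<Sum>i\<le>2. w' i * v i) * G v)"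
    by (auto simp: dual_points_def)
  have "w \<in> pt w'" using *(1) pt_self[of w] by simp
  then obtain c where "w = (\<lambda>l. c * w' l)" by (auto simp: pt_iff)
  thus "on_dual m w" using on_dual_scale[OF dual_imp_on_dual[OF m *(2,3)]] by simp
next
  assume "on_dual m w"
  from on_dual_imp_factor[OF m w this] w show "pt w \<in> dual_points (F3 m)" by (auto simp: dual_points_def)
qed

lemma finite_nth_roots_sg: "m \<ge> 1 \<Longrightarrow> finite {t :: complex. t ^ m = sg m}"
  using is_poly_finite_zeros[of "\<lambda>t. t ^ m - sg m" 0, OF is_poly_diff[OF is_poly_power[OF is_poly_ident] is_poly_const]]
  by (auto simp: power_0_left)

text \<open>Normalising one nonzero coordinate to 1 leaves a parameter that is 0 or an
  \<open>m\<close>-th root of the sign \<open>sg m\<close>.\<close>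

lemma finite_dual_points:
  assumes m: "m \<ge> 1" shows "finite (dual_points (F3 m))"
proof (rule finite_subset)
  let ?E = "(\<lambda>(j, k, t). pt (edge_vec j k t)) ` ({..2} \<times> {..2} \<times> insert 0 {t. t ^ m = sg m})"
  show "finite ?E" using finite_nth_roots_sg[OF m] by simp
  show "dual_points (F3 m) \<subseteq> ?E"
  proof
    fix p assume p: "p \<in> dual_points (F3 m)"
    then obtain w where w: "p = pt w" "w \<in> nonzero_vecs 2" by (auto simp: dual_points_def)
    have d: "on_dual m w" using p w dual_points_iff[OF m w(2)] by simp
    obtain i j k where c: "cyc i j k" and wi: "w i = 0" using on_dual_zero_coord[OF d] by blast
    have v: "vec2 w" using w by (simp add: nonzero_vecs2)
    have le: "i \<le> 2" "j \<le> 2" "k \<le> 2" "i \<noteq> j" "j \<noteq> k" "i \<noteq> k" using cyc_le[OF c] by auto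
    have b: "w j * w k * (w j ^ m - sg m * w k ^ m) = 0"
      using d le bq_cyc[OF c, of m w] by (simp add: on_dual_def)
    have ev: "w = (\<lambda>l. a * edge_vec j' k' t l)" if "vec2 (edge_vec j' k' t)" "\<And>l. l \<in> {i, j, k} \<Longrightarrow> w l = a * edge_vec j' k' t l" for a j' k' t
      by (rule vec2_eqI[OF v]) (use that cyc_cases[OF c] in \<open>auto simp: vec2_def\<close>)
    show "p \<in> ?E"
    proof (cases "w k = 0")
      case True
      hence wj: "w j \<noteq> 0" using w wi cyc_cases[OF c] by (auto simp: nonzero_vecs2)
      have "w = (\<lambda>l. w j * edge_vec k j 0 l)"
        by (rule ev) (use True wi le in \<open>auto simp: edge_vec_def vec2_def\<close>)
      hence "p = pt (edge_vec k j 0)" using w pt_scale[OF wj] by metis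
      thus ?thesis using le by (force intro!: image_eqI[of _ _ "(k, j, 0)"])
    next
      case False
      have "w = (\<lambda>l. w k * edge_vec j k (w j / w k) l)"
        by (rule ev) (use False wi le in \<open>auto simp: edge_vec_def vec2_def\<close>)
      hence "p = pt (edge_vec j k (w j / w k))" using w pt_scale[OF False] by metis
      moreover have "w j / w k = 0 \<or> (w j / w k) ^ m = sg m" using b False by (auto simp: power_divide)
      ultimately show ?thesis using le by (force intro!: image_eqI[of _ _ "(j, k, w j / w k)"])
    qed
  qed
qed

lemma blown_up_plane_dual_points:
  assumes m: "m \<ge> 1" shows "blown_up_plane (dual_points (F3 m))"
proof
  show "finite (dual_points (F3 m))" by (rule finite_dual_points[OF m])
  show "dual_points (F3 m) \<subseteq> PP 2" by (auto simp: dual_points_def)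
  show "pt v \<notin> dual_points (F3 m)" if "v \<in> nonzero_vecs 2" "v 0 * v 1 * v 2 \<noteq> 0" for v
    using dual_points_iff[OF m that(1)] that(2) by (simp add: on_dual_def)
qed


section \<open>The linear system through the dual points\<close>

definition adm :: "nat \<Rightarrow> (cvec \<Rightarrow> complex) \<Rightarrow> bool" where
  "adm m A \<longleftrightarrow> form 2 (m + 2) A \<and> (\<forall>v\<in>nonzero_vecs 2. on_dual m v \<longrightarrow> A v = 0)"

definition xyz :: "(cvec \<Rightarrow> complex) \<Rightarrow> cvec \<Rightarrow> complex" where
  "xyz N v = v 0 * v 1 * v 2 * N v"

lemma adm_bq: "i \<le> 2 \<Longrightarrow> adm m (bq m i)"
  using form_bq by (auto simp: adm_def on_dual_def)

lemma adm_xyz: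
  assumes m: "m \<ge> 1" and N: "form 2 (m - 1) N" shows "adm m (xyz N)"
proof -
  have "form 2 (1 + 1 + 1 + (m - 1)) (xyz N)" unfolding xyz_def
    by (intro form_mult form_coord N) auto
  thus ?thesis using m by (auto simp: adm_def xyz_def on_dual_def)
qed

text \<open>On a coordinate line the form becomes a polynomial of degree at most m + 1, because it
  vanishes at the point at infinity. After subtracting a multiple of the restricted
  \<open>bq\<close>, the degree is at most m, while m + 1 roots remain.\<close>

lemma adm_edge:
  assumes m: "m \<ge> 1" and A: "adm m A" and c: "cyc i j k"
  shows "\<exists>\<delta>. \<forall>t. A (edge_vec j k t) = \<delta> * bq m i (edge_vec j k t)"
proof -
  have le: "i \<le> 2" "j \<le> 2" "k \<le> 2" "i \<noteq> j" "j \<noteq> k" "i \<noteq> k" using cyc_le[OF c] by auto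
  have fA: "form 2 (m + 2) A" using A by (simp add: adm_def)
  obtain co where co: "\<And>v. A v = (\<Sum>a\<in>exponents 2 (m + 2). co a * (\<Prod>l\<le>2. v l ^ a l))"
    using formE[OF fA] by blast
  have pr: "(\<Prod>l\<le>2. edge_vec j k t l ^ a l) = (if a i = 0 then t ^ a j else 0)" for a t
    using cyc_prod[OF c, of "\<lambda>l. edge_vec j k t l ^ a l"] le unfolding prod_le2
    by (simp add: edge_vec_def power_0_left)
  define P where "P = (\<Sum>a\<in>exponents 2 (m + 2). if a i = 0 then monom (co a) (a j) else 0)"
  have P: "poly P t = A (edge_vec j k t)" for t
    unfolding co pr P_def poly_sum by (intro sum.cong) (auto simp: poly_monom)
  have ed: "edge_vec j k t \<in> nonzero_vecs 2" for t
    using le unfolding nonzero_vecs2 by (auto simp: edge_vec_def vec2_def intro!: exI[of _ k])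
  have root: "poly P t = 0" if "t = 0 \<or> t ^ m = sg m" for t
  proof -
    have "on_dual m (edge_vec j k t)" by (rule on_dual_edge[OF c]) (use that le in \<open>auto simp: edge_vec_def\<close>)
    thus ?thesis using A ed unfolding P adm_def by blast
  qed
  have aj: "a j \<le> m + 2" if "a \<in> exponents 2 (m + 2)" for a
    using that le by (auto simp: exponents2 le2_cases)
  have "poly.coeff P n = 0" if n: "n \<ge> m + 2" for n
  proof -
    \<comment> \<open>The exponent of the pure power of \<open>v j\<close>; its coefficient is the
      value at the coordinate point that \<open>edge_vec\<close> misses.\<close>
    define a0 where "a0 = (\<lambda>l. if l = j then m + 2 else 0 :: nat)"
    have a0: "a0 \<in> exponents 2 (m + 2)" using le by (auto simp: exponents2 a0_def le2_cases)
    define ej where "ej = (\<lambda>l. if l = j then 1 else 0 :: complex)"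
    have "ej \<in> nonzero_vecs 2" using le unfolding nonzero_vecs2 by (auto simp: ej_def vec2_def intro!: exI[of _ j])
    moreover have "on_dual m ej" by (rule on_dual_edge[OF c]) (use le in \<open>auto simp: ej_def\<close>)
    ultimately have "0 = A ej" using A by (simp add: adm_def)
    also have "\<dots> = (\<Sum>a\<in>exponents 2 (m + 2). if a = a0 then co a0 else 0)"
      unfolding co
    proof (intro sum.cong refl)
      fix a assume a: "a \<in> exponents 2 (m + 2)"
      have "(\<Prod>l\<le>2. ej l ^ a l) = (if a i = 0 \<and> a k = 0 then 1 else 0)"
        using cyc_prod[OF c, of "\<lambda>l. ej l ^ a l"] le unfolding prod_le2
        by (simp add: ej_def power_0_left)
      moreover have "a i = 0 \<and> a k = 0 \<longleftrightarrow> a = a0"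
      proof
        assume "a i = 0 \<and> a k = 0"
        thus "a = a0"
          by (intro exponents2_eqI[OF a a0 cyc_rot[OF cyc_rot[OF c]]]) (use le in \<open>auto simp: a0_def\<close>)
      qed (use le in \<open>auto simp: a0_def\<close>)
      ultimately show "co a * (\<Prod>l\<le>2. ej l ^ a l) = (if a = a0 then co a0 else 0)" by simp
    qed
    finally have ca: "co a0 = 0" using a0 by simp
    have "poly.coeff (if a i = 0 then monom (co a) (a j) else 0) n = 0" if a: "a \<in> exponents 2 (m + 2)" for a
    proof (cases "a i = 0 \<and> a j = n")
      case True
      hence "a = a0" using aj[OF a] n
        by (intro exponents2_eqI[OF a a0 c]) (use le in \<open>auto simp: a0_def\<close>)
      thus ?thesis using ca by auto
    qed auto
    thus ?thesis unfolding P_def coeff_sum by (intro sum.neutral) blast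
  qed
  hence degP: "degree P \<le> m + 1" by (intro degree_le) auto
  \<comment> \<open>The restriction of \<open>bq m i\<close>. It is monic of degree m + 1, so the
    coefficient of \<open>P\<close> at m + 1 is the required multiple.\<close>
  define q :: "complex poly" where "q = monom 1 (m + 1) - monom (sg m) 1"
  have degq: "degree q \<le> m + 1"
    unfolding q_def by (intro degree_diff_le order_trans[OF degree_monom_le]) auto
  have q: "poly q t = bq m i (edge_vec j k t)" for t
    using le unfolding bq_cyc[OF c] q_def by (simp add: edge_vec_def poly_monom algebra_simps)
  let ?\<delta> = "poly.coeff P (m + 1)"
  have z: "poly.coeff (P - smult ?\<delta> q) n = 0" if "n \<ge> m + 1" for n
  proof (cases "n = m + 1")
    case True thus ?thesis using m by (simp add: q_def coeff_monom)
  next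
    case False
    hence "n > m + 1" using that by simp
    thus ?thesis using degP degq by (simp add: coeff_eq_0)
  qed
  have "degree (P - smult ?\<delta> q) \<le> m"
  proof (rule degree_le, intro allI impI)
    fix n assume "m < n"
    hence "m + 1 \<le> n" by simp
    thus "poly.coeff (P - smult ?\<delta> q) n = 0" by (rule z)
  qed
  hence "degree (P - smult ?\<delta> q) < m + 1" by (rule le_imp_less_Suc[unfolded Suc_eq_plus1])
  moreover have "card (insert 0 {t :: complex. t ^ m = sg m}) = m + 1"
    using card_nth_roots[of "sg m" m] m finite_nth_roots_sg[OF m] by (simp add: power_0_left)
  ultimately have "P - smult ?\<delta> q = 0"
    using root by (intro poly_eqI_degree[where A = "insert 0 {t :: complex. t ^ m = sg m}"])
      (auto simp: q_def poly_monom power_add)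
  hence "poly P t = ?\<delta> * poly q t" for t by (metis eq_iff_diff_eq_0 poly_smult)
  thus ?thesis unfolding P q by blast
qed

text \<open>Since \<open>bq m i\<close> vanishes on the other two coordinate lines, the three lines
  can be corrected independently. What is left vanishes on all of them, so every monomial in it
  contains all three variables.\<close>

lemma adm_decompose:
  assumes m: "m \<ge> 1" and A: "adm m A"
  obtains c \<delta> where "\<And>v. A v = (\<Sum>a\<in>exponents 2 (m - 1). c a * xyz (\<lambda>v. \<Prod>l\<le>2. v l ^ a l) v) +
    (\<Sum>i\<le>2. \<delta> i * bq m i v)"
proof -
  have "\<forall>i. \<exists>\<delta>. i \<le> 2 \<longrightarrow> (\<forall>j k t. cyc i j k \<longrightarrow> A (edge_vec j k t) = \<delta> * bq m i (edge_vec j k t))"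
  proof
    fix i
    show "\<exists>\<delta>. i \<le> 2 \<longrightarrow> (\<forall>j k t. cyc i j k \<longrightarrow> A (edge_vec j k t) = \<delta> * bq m i (edge_vec j k t))"
    proof (cases "i \<le> 2")
      case True
      then obtain j k where c: "cyc i j k" using cyc_ex by blast
      have "j' = j \<and> k' = k" if "cyc i j' k'" for j' k' using c that by (auto simp: cyc_def)
      thus ?thesis using adm_edge[OF m A c] by metis
    qed auto
  qed
  from choice[OF this] obtain \<delta> where \<delta>: "\<And>i j k t. i \<le> 2 \<Longrightarrow> cyc i j k \<Longrightarrow>
      A (edge_vec j k t) = \<delta> i * bq m i (edge_vec j k t)" by blast
  define A' where "A' = (\<lambda>v. A v - (\<Sum>i\<le>2. \<delta> i * bq m i v))"
  have "form 2 (m + 2) A'" unfolding A'_def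
    using A by (intro form_diff form_sum form_cmult form_bq) (auto simp: adm_def)
  then obtain co where co: "\<And>v. A' v = (\<Sum>a\<in>exponents 2 (m + 2). co a * (\<Prod>l\<le>2. v l ^ a l))"
    by (rule formE) (rule that)
  have co0: "co a = 0" if a: "a \<in> exponents 2 (m + 2)" "a i = 0" "i \<le> 2" for a i
  proof -
    obtain j k where c: "cyc i j k" using cyc_ex[OF a(3)] by blast
    have le: "i \<le> 2" "j \<le> 2" "k \<le> 2" "i \<noteq> j" "j \<noteq> k" "i \<noteq> k" using cyc_le[OF c] by auto
    have "A' (edge_vec j k t) = 0" for t
    proof -
      have "bq m j (edge_vec j k t) = 0" "bq m k (edge_vec j k t) = 0"
        using bq_cyc[OF cyc_rot[OF c], of m "edge_vec j k t"] bq_cyc[OF cyc_rot[OF cyc_rot[OF c]], of m "edge_vec j k t"] le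
        by (simp_all add: edge_vec_def)
      hence "(\<Sum>l\<le>2. \<delta> l * bq m l (edge_vec j k t)) = \<delta> i * bq m i (edge_vec j k t)"
        unfolding sum_le2 using cyc_sum[OF c, of "\<lambda>l. \<delta> l * bq m l (edge_vec j k t)"] by simp
      thus ?thesis using \<delta>[OF a(3) c] by (simp add: A'_def)
    qed
    hence "(\<Sum>a\<in>exponents 2 (m + 2). co a * (\<Prod>l\<le>2. edge_vec j k t l ^ a l)) = 0" for t
      by (simp only: co[symmetric])
    from edge_monomials_independent[OF c this a(1,2)] show ?thesis .
  qed
  \<comment> \<open>Multiplication by \<open>xyz\<close> on exponents; above index 2 they must stay
    0.\<close>
  define sh where "sh = (\<lambda>a :: nat \<Rightarrow> nat. \<lambda>l. if l \<le> 2 then a l + 1 else 0)"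
  have bij: "bij_betw sh (exponents 2 (m - 1)) {a \<in> exponents 2 (m + 2). \<forall>i\<le>2. a i \<noteq> 0}"
  proof (rule bij_betwI[where g = "\<lambda>a l. a l - 1"])
    show "sh \<in> exponents 2 (m - 1) \<rightarrow> {a \<in> exponents 2 (m + 2). \<forall>i\<le>2. a i \<noteq> 0}"
      using m by (auto simp: sh_def exponents2)
    show "(\<lambda>a l. a l - 1) \<in> {a \<in> exponents 2 (m + 2). \<forall>i\<le>2. a i \<noteq> 0} \<rightarrow> exponents 2 (m - 1)"
    proof (intro funcsetI)
      fix a assume a: "a \<in> {a \<in> exponents 2 (m + 2). \<forall>i\<le>2. a i \<noteq> 0}"
      hence "\<forall>i>2. a i = 0" "a 0 + a 1 + a 2 = m + 2" "a 0 \<noteq> 0" "a 1 \<noteq> 0" "a 2 \<noteq> 0"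
        by (auto simp: exponents2)
      thus "(\<lambda>l. a l - 1) \<in> exponents 2 (m - 1)" unfolding exponents2 by auto
    qed
    show "(\<lambda>l. sh a l - 1) = a" if "a \<in> exponents 2 (m - 1)" for a
      using that by (auto simp: sh_def exponents2 fun_eq_iff)
    show "sh (\<lambda>l. a l - 1) = a" if "a \<in> {a \<in> exponents 2 (m + 2). \<forall>i\<le>2. a i \<noteq> 0}" for a
      using that by (auto simp: sh_def exponents2 fun_eq_iff)
  qed
  have "A' v = (\<Sum>a\<in>exponents 2 (m - 1). co (sh a) * xyz (\<lambda>v. \<Prod>l\<le>2. v l ^ a l) v)" for v
  proof -
    have "A' v = (\<Sum>a\<in>{a \<in> exponents 2 (m + 2). \<forall>i\<le>2. a i \<noteq> 0}. co a * (\<Prod>l\<le>2. v l ^ a l))"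
      unfolding co by (rule sum.mono_neutral_right) (use co0 in auto)
    also have "\<dots> = (\<Sum>a\<in>exponents 2 (m - 1). co (sh a) * (\<Prod>l\<le>2. v l ^ sh a l))"
      by (rule sum.reindex_bij_betw[OF bij, symmetric])
    also have "\<dots> = (\<Sum>a\<in>exponents 2 (m - 1). co (sh a) * xyz (\<lambda>v. \<Prod>l\<le>2. v l ^ a l) v)"
      by (intro sum.cong refl) (simp add: sh_def xyz_def)
    finally show ?thesis .
  qed
  hence "A v = (\<Sum>a\<in>exponents 2 (m - 1). co (sh a) * xyz (\<lambda>v. \<Prod>l\<le>2. v l ^ a l) v) + (\<Sum>i\<le>2. \<delta> i * bq m i v)" for v
    by (simp add: A'_def diff_eq_eq)
  thus ?thesis using that[of "\<lambda>a. co (sh a)" \<delta>] by blast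
qed

lemma sum_fun_apply: "(\<Sum>x\<in>T. f x) V = (\<Sum>x\<in>T. f x V :: 'b :: comm_monoid_add)"
  by (induction T rule: infinite_finite_induct) (auto simp: zero_fun_def plus_fun_def)

text \<open>Independence is available for families but needed for sets, so injectivity is derived
  along the way from a relation with coefficients 1 and -1.\<close>

lemma cfun_independent_family:
  fixes f :: "'x \<Rightarrow> 'v \<Rightarrow> complex"
  assumes fin: "finite T" and ind: "\<And>c. (\<And>V. (\<Sum>x\<in>T. c x * f x V) = 0) \<Longrightarrow> \<forall>x\<in>T. c x = 0"
  shows "inj_on f T" "cfun.independent (f ` T)"
proof -
  show inj: "inj_on f T"
  proof (rule inj_onI, rule ccontr)
    fix x y assume xy: "x \<in> T" "y \<in> T" "f x = f y" "x \<noteq> y"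
    define c where "c = (\<lambda>z. if z = x then 1 else if z = y then -1 else 0 :: complex)"
    have "(\<Sum>z\<in>T. c z * f z V) = 0" for V
    proof -
      have "(\<Sum>z\<in>T. c z * f z V) = (\<Sum>z\<in>{x, y}. c z * f z V)"
        by (rule sum.mono_neutral_right) (use fin xy in \<open>auto simp: c_def\<close>)
      thus ?thesis using xy by (simp add: c_def)
    qed
    from ind[OF this] xy(1) have "c x = 0" by blast
    thus False by (simp add: c_def)
  qed
  show "cfun.independent (f ` T)"
    unfolding cfun.independent_explicit_module
  proof (intro allI impI)
    fix t u w assume t: "finite t" "t \<subseteq> f ` T" "(\<Sum>w\<in>t. (\<lambda>V. u w * w V)) = 0" "w \<in> t"
    define c where "c = (\<lambda>x. if f x \<in> t then u (f x) else 0)"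
    have "(\<Sum>x\<in>T. c x * f x V) = 0" for V
    proof -
      have "(\<Sum>x\<in>T. c x * f x V) = (\<Sum>x\<in>{x \<in> T. f x \<in> t}. u (f x) * f x V)"
        unfolding c_def using fin by (intro sum.mono_neutral_cong_right) auto
      also have "\<dots> = (\<Sum>w\<in>f ` {x \<in> T. f x \<in> t}. u w * w V)"
        by (subst sum.reindex) (use inj in \<open>auto intro: inj_on_subset\<close>)
      also have "f ` {x \<in> T. f x \<in> t} = t" using t(2) by auto
      also have "(\<Sum>w\<in>t. u w * w V) = (\<Sum>w\<in>t. (\<lambda>V. u w * w V)) V" by (simp add: sum_fun_apply)
      finally show ?thesis using t(3) by simp
    qed
    from ind[OF this] have z: "\<forall>x\<in>T. c x = 0" .
    obtain x where "x \<in> T" "w = f x" using t by auto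
    thus "u w = 0" using z t(4) by (auto simp: c_def)
  qed
qed

locale fermat =
  fixes m :: nat assumes m2: "m \<ge> 2"

sublocale fermat \<subseteq> blown_up_plane "dual_points (F3 m)"
  using blown_up_plane_dual_points m2 by auto

context fermat
begin

abbreviation "S \<equiv> dual_points (F3 m)"
abbreviation "LL \<equiv> dH_minus_E S (m + 2)"
abbreviation "N \<equiv> (m\<^sup>2 + m) div 2 + 2"
abbreviation "sect A \<equiv> sec A (points Y)"

lemma m1: "m \<ge> 1" using m2 by simp

lemma in_S: "w \<in> nonzero_vecs 2 \<Longrightarrow> pt w \<in> S \<longleftrightarrow> on_dual m w"
  by (rule dual_points_iff[OF m1])

lemma LL_eq: "LL (points Y) = {sect A | A. adm m A}"
  unfolding L_points_eq adm_def using in_S by auto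

lemma sect_good:
  assumes "v \<in> nonzero_vecs 2" "\<not> on_dual m v" shows "sect A (lift_vec v) = A v"
  using sec_eq[OF lift_in(1,2)[OF assms(1)]] in_S[OF assms(1)] assms(2) by simp

definition gens :: "((nat \<Rightarrow> nat) + nat) set" where
  "gens = exponents 2 (m - 1) <+> {..2}"

definition gen :: "(nat \<Rightarrow> nat) + nat \<Rightarrow> cvec \<Rightarrow> complex" where
  "gen x = (case x of Inl a \<Rightarrow> xyz (\<lambda>v. \<Prod>l\<le>2. v l ^ a l) | Inr i \<Rightarrow> bq m i)"

lemma finite_gens: "finite gens" by (simp add: gens_def)

text \<open>The m(m+1)/2 monomials of degree m - 1 together with the three forms \<open>bq\<close>
  account for the dimension of the target.\<close>

lemma card_gens: "card gens = N + 1"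
proof -
  have "card gens = (m - 1 + 1) * (m - 1 + 2) div 2 + 3"
    by (simp add: gens_def card_Plus card_exponents2)
  also have "(m - 1 + 1) * (m - 1 + 2) = m\<^sup>2 + m" using m1 by (simp add: power2_eq_square algebra_simps)
  finally show ?thesis by simp
qed

lemma adm_gen: "x \<in> gens \<Longrightarrow> adm m (gen x)"
  using adm_xyz[OF m1 form_monom] adm_bq unfolding gens_def gen_def by (auto simp del: prod_le2)

lemma sum_gens: "(\<Sum>x\<in>gens. c x * gen x v) =
    (\<Sum>a\<in>exponents 2 (m - 1). c (Inl a) * xyz (\<lambda>v. \<Prod>l\<le>2. v l ^ a l) v) + (\<Sum>i\<le>2. c (Inr i) * bq m i v)"
  unfolding gens_def by (subst sum.Plus) (auto simp: gen_def)

text \<open>At a point of a coordinate line off the configuration all but one of the generators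
  vanish, which isolates the coefficient of the corresponding \<open>bq\<close>. On the torus
  \<open>xyz\<close> can then be cancelled.\<close>

lemma gens_independent:
  assumes z: "\<And>V. (\<Sum>x\<in>gens. c x * sect (gen x) V) = 0" shows "\<forall>x\<in>gens. c x = 0"
proof -
  have zv: "(\<Sum>x\<in>gens. c x * gen x v) = 0" if v: "v \<in> nonzero_vecs 2" "\<not> on_dual m v" for v
    using z[of "lift_vec v"] sect_good[OF v] by simp
  have cb: "c (Inr i) = 0" if i: "i \<le> 2" for i
  proof -
    obtain j k where cy: "cyc i j k" using cyc_ex[OF i] by blast
    have le: "i \<le> 2" "j \<le> 2" "k \<le> 2" "i \<noteq> j" "j \<noteq> k" "i \<noteq> k" using cyc_le[OF cy] by auto
    have "finite (insert 0 {t :: complex. t ^ m = sg m})" using finite_nth_roots_sg[OF m1] by simp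
    then obtain t :: complex where "t \<notin> insert 0 {t. t ^ m = sg m}" by (rule finite_avoid)
    hence t: "t \<noteq> 0" "t ^ m \<noteq> sg m" by auto
    let ?v = "edge_vec j k t"
    have ed: "?v \<in> nonzero_vecs 2"
      using le unfolding nonzero_vecs2 by (auto simp: edge_vec_def vec2_def intro!: exI[of _ k])
    have b: "bq m i ?v \<noteq> 0" "bq m j ?v = 0" "bq m k ?v = 0" "?v 0 * ?v 1 * ?v 2 = 0"
      using t le bq_cyc[OF cy, of m ?v] bq_cyc[OF cyc_rot[OF cy], of m ?v]
        bq_cyc[OF cyc_rot[OF cyc_rot[OF cy]], of m ?v] cyc_prod[OF cy, of ?v]
      by (simp_all add: edge_vec_def)
    have "\<not> on_dual m ?v" using b(1) i by (auto simp: on_dual_def)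
    have x0: "xyz M ?v = 0" for M by (simp only: xyz_def b(4) mult_zero_left)
    from zv[OF ed \<open>\<not> on_dual m ?v\<close>] have "(\<Sum>i\<le>2. c (Inr i) * bq m i ?v) = 0"
      unfolding sum_gens by (simp only: x0 mult_zero_right sum.neutral_const add_0)
    hence "c (Inr i) * bq m i ?v = 0"
      unfolding sum_le2 using cyc_sum[OF cy, of "\<lambda>i. c (Inr i) * bq m i ?v"] b(2,3) by simp
    thus ?thesis using b(1) by simp
  qed
  have "c (Inl b) = 0" if b: "b \<in> exponents 2 (m - 1)" for b
  proof (rule monomials_independent[OF _ b, where c = "\<lambda>a. c (Inl a)"])
    fix v assume v: "vec2 v" "\<And>l. l \<le> 2 \<Longrightarrow> v l \<noteq> 0"
    hence nz: "v 0 \<noteq> 0" "v 1 \<noteq> 0" "v 2 \<noteq> 0" by auto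
    have "v \<in> nonzero_vecs 2" "\<not> on_dual m v" using v nz unfolding nonzero_vecs2 on_dual_def by auto
    from zv[OF this] have "v 0 * v 1 * v 2 * (\<Sum>a\<in>exponents 2 (m - 1). c (Inl a) * (\<Prod>l\<le>2. v l ^ a l)) = 0"
      unfolding sum_gens using cb by (simp add: xyz_def sum_distrib_left mult_ac)
    thus "(\<Sum>a\<in>exponents 2 (m - 1). c (Inl a) * (\<Prod>l\<le>2. v l ^ a l)) = 0" using nz by simp
  qed
  thus ?thesis using cb by (auto simp: gens_def)
qed

lemma section_basis_exists: "\<exists>s. section_basis Y LL N s"
proof -
  obtain h where "bij_betw h {0..<card gens} gens" using ex_bij_betw_nat_finite[OF finite_gens] by blast
  moreover have "{0..<card gens} = {..N}" unfolding card_gens by auto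
  ultimately have h: "bij_betw h {..N} gens" by simp
  define s where "s = (\<lambda>n. sect (gen (h n)))"
  have "(\<Sum>n\<le>N. c n * s n V) = (\<Sum>x\<in>gens. c (inv_into {..N} h x) * sect (gen x) V)" for c V
    using sum.reindex_bij_betw[OF h, of "\<lambda>x. c (inv_into {..N} h x) * sect (gen x) V"] h
    by (simp add: s_def bij_betw_def)
  hence z: "\<forall>x\<in>gens. c (inv_into {..N} h x) = 0" if "\<And>V. (\<Sum>n\<le>N. c n * s n V) = 0" for c
    using gens_independent[of "\<lambda>x. c (inv_into {..N} h x)"] that by simp
  have "\<forall>n\<in>{..N}. c n = 0" if "\<And>V. (\<Sum>n\<le>N. c n * s n V) = 0" for c
  proof
    fix n assume n: "n \<in> {..N}"
    have "h n \<in> gens" "inv_into {..N} h (h n) = n" using h n by (auto simp: bij_betw_def)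
    thus "c n = 0" using z[OF that] by metis
  qed
  note ind = cfun_independent_family[where f = s, OF finite_atMost this]
  have im: "s ` {..N} = (\<lambda>x. sect (gen x)) ` gens" using image_image[of "\<lambda>x. sect (gen x)" h "{..N}"] bij_betw_imp_surj_on[OF h] by (simp only: s_def)
  have "cfun.span (s ` {..N}) = LL (points Y)"
  proof (intro subset_antisym cfun.span_minimal)
    show "s ` {..N} \<subseteq> LL (points Y)" unfolding im LL_eq using adm_gen by auto
    show "cfun.subspace (LL (points Y))"
    proof (rule cfun.subspaceI)
      have "0 = sect (\<lambda>_. 0)" by (auto simp: sec_def)
      thus "0 \<in> LL (points Y)" unfolding LL_eq by (auto simp: adm_def intro!: exI[of _ "\<lambda>_. 0"])
      fix x assume "x \<in> LL (points Y)"
      then obtain A where A: "x = sect A" "adm m A" unfolding LL_eq by auto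
      have "(\<lambda>V. c * x V) = sect (\<lambda>v. c * A v)" for c by (auto simp: A sec_def)
      thus "(\<lambda>V. c * x V) \<in> LL (points Y)" for c
        unfolding LL_eq using A by (auto simp: adm_def intro!: exI[of _ "\<lambda>v. c * A v"])
      fix y assume "y \<in> LL (points Y)"
      then obtain B where B: "y = sect B" "adm m B" unfolding LL_eq by auto
      have "x + y = sect (\<lambda>v. A v + B v)" by (auto simp: A B sec_def)
      thus "x + y \<in> LL (points Y)"
        unfolding LL_eq using A B by (auto simp: adm_def intro!: exI[of _ "\<lambda>v. A v + B v"])
    qed
    show "LL (points Y) \<subseteq> cfun.span (s ` {..N})"
    proof
      fix x assume "x \<in> LL (points Y)"
      then obtain A where A: "x = sect A" "adm m A" unfolding LL_eq by auto
      obtain c \<delta> where c: "\<And>v. A v = (\<Sum>a\<in>exponents 2 (m - 1). c a * xyz (\<lambda>v. \<Prod>l\<le>2. v l ^ a l) v) +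
          (\<Sum>i\<le>2. \<delta> i * bq m i v)" using adm_decompose[OF m1 A(2)] by blast
      have "A v = (\<Sum>x\<in>gens. case_sum c \<delta> x * gen x v)" for v unfolding c sum_gens by simp
      hence "x = (\<Sum>y\<in>gens. (\<lambda>V. case_sum c \<delta> y * sect (gen y) V))"
        unfolding A(1) by (auto simp: sec_def sum_fun_apply fun_eq_iff)
      also have "\<dots> \<in> cfun.span (s ` {..N})"
        unfolding im by (intro cfun.span_sum cfun.span_scale cfun.span_base) auto
      finally show "x \<in> cfun.span (s ` {..N})" .
    qed
  qed
  thus ?thesis using ind unfolding section_basis_def by blast
qed

end

section \<open>The morphism, its values over the configuration, and its inverse\<close>

section \<open>The morphism defined by the linear system\<close>

lemma wf_proj_space: "wf_var (proj_space n)"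
  by (auto simp: wf_var_def proj_space_def)

lemma proj_space_simps [simp]:
  "blocks (proj_space n) = UNIV" "pdim (proj_space n) i = n" "points (proj_space n) = UNIV \<rightarrow>\<^sub>E PP n"
  by (simp_all add: proj_space_def)

lemma mf_proj_space: "form n d H \<Longrightarrow> mf (proj_space n) (\<lambda>_. d) (\<lambda>Z. H (Z ()))"
  by (rule multiform_block) auto

lemma given_by_subvar:
  assumes "wf_var X" "U \<subseteq> points X" "given_by X \<phi> n W h"
  shows "given_by (subvar X U) \<phi> n (W \<inter> U) h"
  using assms openin_subvar[OF assms(1,2)] regular_subvar[OF assms(1,2)] unfolding given_by_def by auto

lemma xyz_cyc: "cyc i j k \<Longrightarrow> xyz M v = v i * v j * v k * M v"
  unfolding xyz_def using cyc_prod[of i j k v] by simp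

text \<open>The basis stays arbitrary, as the map is claimed to have its properties for every
  choice; coordinates of the target are accessed only through the linear forms
  \<open>lam\<close>.\<close>

locale fermat_basis = fermat +
  fixes s :: "nat \<Rightarrow> ppoint option sect" and NN :: nat
  assumes basis: "section_basis Y LL NN s"
begin

definition coef :: "(cvec \<Rightarrow> complex) \<Rightarrow> nat \<Rightarrow> complex" where
  "coef A = (SOME c. \<forall>V. sect A V = (\<Sum>j\<le>NN. c j * s j V))"

text \<open>The linear form on the target whose pullback is the section of \<open>A\<close>. Through
  it an arbitrary basis can be treated as if the explicit generators were coordinates.\<close>

definition lam :: "(cvec \<Rightarrow> complex) \<Rightarrow> cvec \<Rightarrow> complex" where
  "lam A Z = (\<Sum>j\<le>NN. coef A j * Z j)"

definition \<phi> :: "(ppoint option \<Rightarrow> ppoint) \<Rightarrow> unit \<Rightarrow> ppoint" where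
  "\<phi> = linear_system_map Y LL NN s"

lemma coef: assumes "adm m A" shows "sect A V = (\<Sum>j\<le>NN. coef A j * s j V)"
proof -
  have sp: "cfun.span (s ` {..NN}) = LL (points Y)" and inj: "inj_on s {..NN}"
    using basis unfolding section_basis_def by auto
  have "sect A \<in> LL (points Y)" using assms LL_eq by auto
  hence "sect A \<in> cfun.span (s ` {..NN})" by (simp only: sp)
  then obtain u where u: "sect A = (\<Sum>w\<in>s ` {..NN}. (\<lambda>V. u w * w V))"
    using cfun.span_finite[of "s ` {..NN}"] by auto
  have "sect A V = (\<Sum>j\<le>NN. u (s j) * s j V)" for V
    unfolding u sum_fun_apply sum.reindex[OF inj] by (simp only: o_def)
  hence "\<exists>c. \<forall>V. sect A V = (\<Sum>j\<le>NN. c j * s j V)" by (intro exI[of _ "\<lambda>j. u (s j)"]) blast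
  from someI_ex[OF this] show ?thesis unfolding coef_def by blast
qed

lemma s_in_LL: assumes "j \<le> NN" shows "s j \<in> LL (points Y)"
proof -
  have "s j \<in> cfun.span (s ` {..NN})" by (rule cfun.span_base) (use assms in auto)
  thus ?thesis using basis unfolding section_basis_def by auto
qed

lemma form_lam: "form NN 1 (lam A)"
  unfolding lam_def by (intro form_sum form_cmult form_coord) auto

lemma lam_scale: "lam A (\<lambda>j. c * Z j) = c * lam A Z"
  using form_homog[OF form_lam, of A c Z] by simp

lemma lam_cut: "lam A (\<lambda>j. if j \<le> NN then Z j else 0) = lam A Z"
  unfolding lam_def by (intro sum.cong) auto

lemma lam_zero: "lam A (\<lambda>_. 0) = 0"
  by (simp add: lam_def)

lemma frame_coords:
  assumes f: "frame Y LL W e"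
  obtains g where "\<And>j. j \<le> NN \<Longrightarrow> quotient_on Y W (s j) e (g j)"
    "\<And>y. y \<in> W \<Longrightarrow> \<phi> y = (\<lambda>_. pt (\<lambda>j. if j \<le> NN then g j y else 0))"
    "\<And>A. adm m A \<Longrightarrow> quotient_on Y W (sect A) e (\<lambda>y. lam A (\<lambda>j. g j y))"
proof -
  have W: "openin (zariski Y) W" "W \<subseteq> points Y"
    using frame_open[OF f] openin_zariski_subset[OF wfY] by auto
  have "\<forall>j. \<exists>g. j \<le> NN \<longrightarrow> quotient_on Y W (s j) e g"
  proof
    fix j show "\<exists>g. j \<le> NN \<longrightarrow> quotient_on Y W (s j) e g"
    proof (cases "j \<le> NN")
      case True
      show ?thesis by (rule frame_quotient[OF f s_in_LL[OF True] W(1) order_refl W(2)]) blast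
    qed blast
  qed
  then obtain g where g: "\<And>j. j \<le> NN \<Longrightarrow> quotient_on Y W (s j) e (g j)" by metis
  have "quotient_on Y W (sect A) e (\<lambda>y. lam A (\<lambda>j. g j y))" if A: "adm m A" for A
    unfolding quotient_on_def
  proof (intro conjI ballI)
    show "regular Y W (\<lambda>y. lam A (\<lambda>j. g j y))" unfolding lam_def
      by (intro regular_sum[OF wfY W(1)] regular_cmult[OF wfY]) (use g in \<open>auto simp: quotient_on_def\<close>)
    fix y V assume a: "y \<in> W" "V \<in> reps Y y"
    have "s j V = g j y * e V" if "j \<le> NN" for j using g[OF that] a unfolding quotient_on_def by blast
    thus "sect A V = lam A (\<lambda>j. g j y) * e V"
      unfolding coef[OF A] lam_def sum_distrib_right by (intro sum.cong) auto
  qed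
  moreover have "\<phi> y = (\<lambda>_. pt (\<lambda>j. if j \<le> NN then g j y else 0))" if "y \<in> W" for y
    unfolding \<phi>_def by (rule linear_system_map_eq[OF f that]) (rule g)
  ultimately show ?thesis using that[OF g] by blast
qed

text \<open>The scalar \<open>c\<close> relates the chosen coordinate vector to the frame and is
  therefore the same for all \<open>A\<close>.\<close>

lemma lam_value:
  assumes f: "frame Y LL W e" and y: "y \<in> W" and Z: "Z \<in> \<phi> y ()"
  shows "\<exists>c. c \<noteq> 0 \<and> (\<forall>A g. adm m A \<longrightarrow> quotient_on Y W (sect A) e g \<longrightarrow> lam A Z = c * g y)"
proof -
  have W: "openin (zariski Y) W" by (rule frame_open[OF f])
  obtain g where g: "\<And>y. y \<in> W \<Longrightarrow> \<phi> y = (\<lambda>_. pt (\<lambda>j. if j \<le> NN then g j y else 0))"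
    "\<And>A. adm m A \<Longrightarrow> quotient_on Y W (sect A) e (\<lambda>y. lam A (\<lambda>j. g j y))"
    by (rule frame_coords[OF f]) (rule that)
  obtain c where c: "c \<noteq> 0" "Z = (\<lambda>j. c * (if j \<le> NN then g j y else 0))"
    using Z g(1)[OF y] by (auto simp: pt_iff)
  have "lam A Z = c * g' y" if A: "adm m A" and g': "quotient_on Y W (sect A) e g'" for A g'
  proof -
    have "g' y = lam A (\<lambda>j. g j y)"
    proof (rule frame_unique[OF f W order_refl _ _ _ y])
      show "regular Y W g'" "regular Y W (\<lambda>y. lam A (\<lambda>j. g j y))"
        using g' g(2)[OF A] by (auto simp: quotient_on_def)
      fix x V assume "x \<in> W" "V \<in> reps Y x"
      thus "g' x * e V = lam A (\<lambda>j. g j x) * e V"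
        using g' g(2)[OF A] unfolding quotient_on_def by metis
    qed
    thus ?thesis unfolding c(2) lam_scale by (simp only: lam_cut)
  qed
  thus ?thesis using c(1) by blast
qed

lemma ordinary_value:
  assumes y: "y \<in> points Y" "y None \<notin> S" and V: "V \<in> reps Y y" and Z: "Z \<in> \<phi> y ()"
  shows "\<exists>\<kappa>. \<kappa> \<noteq> 0 \<and> (\<forall>A. adm m A \<longrightarrow> lam A Z = \<kappa> * A (V None))"
proof -
  obtain W e \<kappa> where W: "y \<in> W" "frame Y LL W e" "\<kappa> \<noteq> 0"
    "\<And>A. form 2 (m + 2) A \<Longrightarrow> \<exists>g. quotient_on Y W (sect A) e g \<and> g y = \<kappa> * A (V None)"
    using ordinary_frame[OF y V, of "m + 2"] by blast
  obtain c where c: "c \<noteq> 0" "\<And>A g. adm m A \<Longrightarrow> quotient_on Y W (sect A) e g \<Longrightarrow> lam A Z = c * g y"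
    using lam_value[OF W(2,1) Z] by blast
  have "lam A Z = (c * \<kappa>) * A (V None)" if A: "adm m A" for A
  proof -
    obtain g where "quotient_on Y W (sect A) e g" "g y = \<kappa> * A (V None)"
      using W(4)[of A] A by (auto simp: adm_def)
    thus ?thesis using c(2)[OF A] by simp
  qed
  thus ?thesis using c(1) W(3) by (intro exI[of _ "c * \<kappa>"]) simp
qed

text \<open>A single component of the cross product suffices: near each centre the generators used
  later are multiples of one component.\<close>

lemma exceptional_value:
  assumes p: "p \<in> S" and y: "y \<in> points Y" "y None = p" and V: "V \<in> reps Y y" and Z: "Z \<in> \<phi> y ()"
  shows "\<exists>\<kappa>. \<kappa> \<noteq> 0 \<and> (\<forall>A D r. adm m A \<longrightarrow> r \<le> 2 \<longrightarrow> form 2 (m + 1) D \<longrightarrow>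
    (\<forall>v. A v = crs (R p) v r * D v) \<longrightarrow> lam A Z = \<kappa> * (V (Some p) r * D (R p)))"
proof -
  have "1 \<le> m + 2" by simp
  from exceptional_frame[OF p this y V]
  obtain W e \<kappa> where W: "y \<in> W" "frame Y LL W e" "\<kappa> \<noteq> 0"
    "\<forall>A C. (\<forall>l\<le>2. form 2 (m + 2 - 1) (C l)) \<longrightarrow> (\<forall>v. A v = (\<Sum>l\<le>2. crs (R p) v l * C l v)) \<longrightarrow>
      (\<exists>g. quotient_on Y W (sect A) e g \<and> g y = \<kappa> * (\<Sum>l\<le>2. V (Some p) l * C l (R p)))"
    by (elim exE conjE) (rule that)
  obtain c where c: "c \<noteq> 0" "\<And>A g. adm m A \<Longrightarrow> quotient_on Y W (sect A) e g \<Longrightarrow> lam A Z = c * g y"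
    using lam_value[OF W(2,1) Z] by blast
  have "lam A Z = (c * \<kappa>) * (V (Some p) r * D (R p))"
    if A: "adm m A" and r: "r \<le> 2" and D: "form 2 (m + 1) D" and AD: "\<forall>v. A v = crs (R p) v r * D v" for A D r
  proof -
    define C where "C = (\<lambda>l. if l = r then D else (\<lambda>_. 0))"
    have sel: "(\<Sum>l\<le>2. f l * C l v) = f r * D v" for f v
    proof -
      have "(\<Sum>l\<le>2. f l * C l v) = (\<Sum>l\<le>2. if l = r then f r * D v else 0)"
        unfolding C_def by (intro sum.cong) auto
      also have "\<dots> = f r * D v" by (subst sum.delta) (use r in auto)
      finally show ?thesis .
    qed
    have "\<forall>l\<le>2. form 2 (m + 2 - 1) (C l)" using D by (auto simp: C_def)
    moreover have "\<forall>v. A v = (\<Sum>l\<le>2. crs (R p) v l * C l v)" unfolding sel using AD by blast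
    ultimately obtain g where "quotient_on Y W (sect A) e g" "g y = \<kappa> * (\<Sum>l\<le>2. V (Some p) l * C l (R p))"
      using W(4) by blast
    thus ?thesis using c(2)[OF A] unfolding sel by simp
  qed
  thus ?thesis using c(1) W(3) by (intro exI[of _ "c * \<kappa>"]) simp
qed

abbreviation pw :: "nat \<Rightarrow> cvec \<Rightarrow> complex" where "pw i \<equiv> \<lambda>v. v i ^ (m - 1)"

lemma form_pw: "i \<le> 2 \<Longrightarrow> form 2 (m - 1) (pw i)"
  by (intro form_power'[OF form_coord]) auto

lemma adm_pw: "i \<le> 2 \<Longrightarrow> adm m (xyz (pw i))"
  by (rule adm_xyz[OF m1 form_pw])

lemma pow_m: "x * x ^ (m - 1) = (x :: complex) ^ m"
  using m1 by (simp flip: power_Suc)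

text \<open>The cofactor of the linear form \<open>b v j - a v k\<close> in the difference of the
  \<open>m\<close>-th powers of its two terms.\<close>

definition edge_factor :: "complex \<Rightarrow> complex \<Rightarrow> nat \<Rightarrow> nat \<Rightarrow> cvec \<Rightarrow> complex" where
  "edge_factor a b j k v = (\<Sum>l<m. (a * v k) ^ (m - Suc l) * (b * v j) ^ l)"

lemma edge_factor: "(b * v j) ^ m - (a * v k) ^ m = (b * v j - a * v k) * edge_factor a b j k v"
  unfolding edge_factor_def by (rule power_diff_sumr2)

lemma form_edge_factor: "j \<le> 2 \<Longrightarrow> k \<le> 2 \<Longrightarrow> form 2 (m - 1) (edge_factor a b j k)"
  unfolding edge_factor_def
proof (intro form_sum)
  fix l assume "j \<le> 2" "k \<le> 2" "l \<in> {..<m}"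
  thus "form 2 (m - 1) (\<lambda>v. (a * v k) ^ (m - Suc l) * (b * v j) ^ l)"
    by (intro form_mult'[of _ "m - Suc l" _ l] form_power'[where d = 1] form_cmult form_coord) auto
qed

text \<open>At the root of the linear factor all \<open>m\<close> summands coincide, so the sum is
  \<open>m\<close> times a nonzero power: the root is simple.\<close>

lemma edge_factor_nonzero:
  assumes "v j \<noteq> 0" "v k \<noteq> 0" shows "edge_factor (v j) (v k) j k v \<noteq> 0"
proof -
  have "edge_factor (v j) (v k) j k v = (\<Sum>l<m. (v j * v k) ^ (m - 1))"
    unfolding edge_factor_def
  proof (intro sum.cong refl)
    fix l assume l: "l \<in> {..<m}"
    have "(v j * v k) ^ (m - Suc l) * (v k * v j) ^ l = (v j * v k) ^ (m - Suc l + l)"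
      by (simp add: power_add mult.commute)
    thus "(v j * v k) ^ (m - Suc l) * (v k * v j) ^ l = (v j * v k) ^ (m - 1)" using l by simp
  qed
  thus ?thesis using assms m1 by simp
qed

lemma R_on_dual: "p \<in> S \<Longrightarrow> on_dual m (R p)"
  using R_in[of p] in_S[of "R p"] by auto

lemma S_cases:
  assumes "p \<in> S"
  obtains (edge) i j k where "cyc i j k" "R p i = 0" "R p j \<noteq> 0" "R p k \<noteq> 0"
  | (corner) i j k where "cyc i j k" "R p i \<noteq> 0" "R p j = 0" "R p k = 0"
proof -
  obtain i j k where c: "cyc i j k" "R p i = 0" by (rule on_dual_zero_coord[OF R_on_dual[OF assms]]) (rule that)
  have nz: "\<exists>l\<le>2. R p l \<noteq> 0" using R_in(2)[OF assms] by (simp add: nonzero_vecs2)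
  show ?thesis
  proof (cases "R p j \<noteq> 0 \<and> R p k \<noteq> 0")
    case True thus ?thesis using edge c by blast
  next
    case False
    hence "R p j \<noteq> 0 \<and> R p k = 0 \<or> R p j = 0 \<and> R p k \<noteq> 0"
      using nz c cyc_cases[OF c(1)] by metis
    thus ?thesis using corner[OF cyc_rot[OF c(1)]] corner[OF cyc_rot[OF cyc_rot[OF c(1)]]] c(2) by blast
  qed
qed

lemma edge_relation:
  assumes "p \<in> S" "cyc i j k" "R p j \<noteq> 0" "R p k \<noteq> 0" shows "R p j ^ m = sg m * R p k ^ m"
proof -
  have "bq m i (R p) = 0" using R_on_dual[OF assms(1)] cyc_le[OF assms(2)] by (simp add: on_dual_def)
  thus ?thesis using assms(3,4) by (simp add: bq_cyc[OF assms(2)])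
qed

text \<open>As \<open>R p i = 0\<close>, the \<open>j\<close>-th component of the cross product is a
  multiple of \<open>v i\<close> and divides \<open>xyz\<close>, while the \<open>i\<close>-th one
  divides \<open>bq m i\<close>. The values thus detect the line coordinates \<open>j\<close> and
  \<open>i\<close>, which determine the point of the exceptional curve.\<close>

lemma edge_values:
  assumes p: "p \<in> S" and y: "y \<in> points Y" "y None = p" and V: "V \<in> reps Y y" and Z: "Z \<in> \<phi> y ()"
    and c: "cyc i j k" and R: "R p i = 0" "R p j \<noteq> 0" "R p k \<noteq> 0"
  obtains \<kappa> where "\<kappa> \<noteq> 0" "\<And>M. form 2 (m - 1) M \<Longrightarrow> lam (xyz M) Z = \<kappa> * (V (Some p) j * R p j * M (R p))"
    "lam (bq m i) Z = 0 \<longleftrightarrow> V (Some p) i = 0"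
proof -
  have le: "i \<le> 2" "j \<le> 2" "k \<le> 2" using cyc_le[OF c] by auto
  obtain \<kappa> where \<kappa>: "\<kappa> \<noteq> 0" "\<And>A D r. adm m A \<Longrightarrow> r \<le> 2 \<Longrightarrow> form 2 (m + 1) D \<Longrightarrow>
    (\<forall>v. A v = crs (R p) v r * D v) \<Longrightarrow> lam A Z = \<kappa> * (V (Some p) r * D (R p))"
    using exceptional_value[OF p y V Z] by blast
  have 1: "lam (xyz M) Z = \<kappa> * (V (Some p) j * R p j * M (R p))" if M: "form 2 (m - 1) M" for M
  proof -
    let ?D = "\<lambda>v. (1 / R p k) * (v j * (v k * M v))"
    have "form 2 (m + 1) ?D"
      by (intro form_cmult form_mult'[of _ 1 _ m] form_mult'[of _ 1 _ "m - 1"] form_coord M) (use le m1 in auto)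
    moreover have "\<forall>v. xyz M v = crs (R p) v j * ?D v"
      using xyz_cyc[OF c] crs_cyc[OF cyc_rot[OF c], of "R p"] R by simp
    ultimately have "lam (xyz M) Z = \<kappa> * (V (Some p) j * ?D (R p))"
      by (intro \<kappa>(2) adm_xyz[OF m1 M] le)
    thus ?thesis using R by simp
  qed
  let ?Q = "edge_factor (R p j) (R p k) j k"
  let ?D = "\<lambda>v. (- 1 / R p k ^ m) * (v j * (v k * ?Q v))"
  have "form 2 (m + 1) ?D"
    by (intro form_cmult form_mult'[of _ 1 _ m] form_mult'[of _ 1 _ "m - 1"] form_coord form_edge_factor)
       (use le m1 in auto)
  moreover have "bq m i v = crs (R p) v i * ?D v" for v
  proof -
    have "R p k ^ m * (v j ^ m - sg m * v k ^ m) = (R p k * v j) ^ m - (R p j * v k) ^ m"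
      unfolding power_mult_distrib edge_relation[OF p c R(2,3)] by (simp add: algebra_simps)
    also have "\<dots> = (R p k * v j - R p j * v k) * ?Q v" by (rule edge_factor)
    finally have e: "v j ^ m - sg m * v k ^ m = (1 / R p k ^ m) * ((R p k * v j - R p j * v k) * ?Q v)"
      using R(3) by (simp add: field_simps)
    show ?thesis unfolding bq_cyc[OF c] crs_cyc[OF c] e by (simp add: algebra_simps)
  qed
  ultimately have "lam (bq m i) Z = \<kappa> * (V (Some p) i * ?D (R p))"
    by (intro \<kappa>(2) adm_bq le) auto
  hence "lam (bq m i) Z = 0 \<longleftrightarrow> V (Some p) i = 0"
    using \<kappa>(1) R edge_factor_nonzero[of "R p" j k] by simp
  thus ?thesis using that \<kappa>(1) 1 by blast
qed

text \<open>At a coordinate point \<open>xyz\<close> vanishes to second order, so its multiples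
  vanish on the whole exceptional curve. Two of the \<open>bq\<close> vanish only to first order
  there and yield the two line coordinates.\<close>

lemma corner_values:
  assumes p: "p \<in> S" and y: "y \<in> points Y" "y None = p" and V: "V \<in> reps Y y" and Z: "Z \<in> \<phi> y ()"
    and c: "cyc i j k" and R: "R p i \<noteq> 0" "R p j = 0" "R p k = 0"
  shows "form 2 (m - 1) M \<Longrightarrow> lam (xyz M) Z = 0"
    "lam (bq m j) Z = 0 \<longleftrightarrow> V (Some p) j = 0" "lam (bq m k) Z = 0 \<longleftrightarrow> V (Some p) k = 0"
proof -
  have le: "i \<le> 2" "j \<le> 2" "k \<le> 2" using cyc_le[OF c] by auto
  obtain \<kappa> where \<kappa>: "\<kappa> \<noteq> 0" "\<And>A D r. adm m A \<Longrightarrow> r \<le> 2 \<Longrightarrow> form 2 (m + 1) D \<Longrightarrow>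
    (\<forall>v. A v = crs (R p) v r * D v) \<Longrightarrow> lam A Z = \<kappa> * (V (Some p) r * D (R p))"
    using exceptional_value[OF p y V Z] by blast
  note cj = crs_cyc[OF cyc_rot[OF c], of "R p"] and ck = crs_cyc[OF cyc_rot[OF cyc_rot[OF c]], of "R p"]
  have mpos: "m \<noteq> 0" using m1 by simp
  show "lam (xyz M) Z = 0" if M: "form 2 (m - 1) M"
  proof -
    let ?D = "\<lambda>v. (1 / R p i) * (v k * (v i * M v))"
    have "form 2 (m + 1) ?D"
      by (intro form_cmult form_mult'[of _ 1 _ m] form_mult'[of _ 1 _ "m - 1"] form_coord M) (use le m1 in auto)
    moreover have "\<forall>v. xyz M v = crs (R p) v k * ?D v"
      using xyz_cyc[OF c] ck R by simp
    ultimately have "lam (xyz M) Z = \<kappa> * (V (Some p) k * ?D (R p))"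
      by (intro \<kappa>(2) adm_xyz[OF m1 M] le)
    thus ?thesis using R by simp
  qed
  show "lam (bq m j) Z = 0 \<longleftrightarrow> V (Some p) j = 0"
  proof -
    let ?D = "\<lambda>v. (- 1 / R p i) * (v i * (v k ^ m - sg m * v i ^ m))"
    have "form 2 (m + 1) ?D"
      by (intro form_cmult form_mult'[of _ 1 _ m] form_diff form_power'[where d = 1] form_coord) (use le in auto)
    moreover have "\<forall>v. bq m j v = crs (R p) v j * ?D v"
      using bq_cyc[OF cyc_rot[OF c]] cj R by simp
    ultimately have "lam (bq m j) Z = \<kappa> * (V (Some p) j * ?D (R p))"
      by (intro \<kappa>(2) adm_bq le)
    thus ?thesis using R \<kappa>(1) mpos by (simp add: power_0_left)
  qed
  show "lam (bq m k) Z = 0 \<longleftrightarrow> V (Some p) k = 0"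
  proof -
    let ?D = "\<lambda>v. (1 / R p i) * (v i * (v i ^ m - sg m * v j ^ m))"
    have "form 2 (m + 1) ?D"
      by (intro form_cmult form_mult'[of _ 1 _ m] form_diff form_power'[where d = 1] form_coord) (use le in auto)
    moreover have "\<forall>v. bq m k v = crs (R p) v k * ?D v"
      using bq_cyc[OF cyc_rot[OF cyc_rot[OF c]]] ck R by simp
    ultimately have "lam (bq m k) Z = \<kappa> * (V (Some p) k * ?D (R p))"
      by (intro \<kappa>(2) adm_bq le)
    thus ?thesis using R \<kappa>(1) mpos by (simp add: power_0_left)
  qed
qed

lemma frame_exists:
  assumes y: "y \<in> points Y" shows "\<exists>W e. y \<in> W \<and> frame Y LL W e"
proof -
  obtain V where V: "V \<in> reps Y y" using reps_nonempty[OF wfY y] by blast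
  show ?thesis
  proof (cases "y None \<in> S")
    case True
    have "1 \<le> m + 2" by simp
    from exceptional_frame[OF True this y refl V] show ?thesis by (elim exE conjE) (intro exI conjI)
  next
    case False
    from ordinary_frame[OF y False V, of "m + 2"] show ?thesis by (elim exE conjE) (intro exI conjI)
  qed
qed

text \<open>Off the configuration this is the negation of \<open>on_dual\<close>. Over it, the line
  passes through the centre, so the two coordinates detected by the sections cannot both be
  zero.\<close>

lemma no_base_point:
  assumes y: "y \<in> points Y" and Z: "Z \<in> \<phi> y ()" shows "\<exists>A. adm m A \<and> lam A Z \<noteq> 0"
proof -
  obtain V where V: "V \<in> reps Y y" using reps_nonempty[OF wfY y] by blast
  show ?thesis
  proof (cases "y None \<in> S")
    case False
    have v: "V None \<in> nonzero_vecs 2" "y None = pt (V None)" using reps_None[OF y V] by auto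
    obtain \<kappa> where \<kappa>: "\<kappa> \<noteq> 0" "\<And>A. adm m A \<Longrightarrow> lam A Z = \<kappa> * A (V None)"
      using ordinary_value[OF y False V Z] by blast
    have "\<not> on_dual m (V None)" using False v in_S by simp
    hence "V None 0 * V None 1 * V None 2 \<noteq> 0 \<or> (\<exists>i\<le>2. bq m i (V None) \<noteq> 0)" by (auto simp: on_dual_def)
    thus ?thesis
    proof
      assume "V None 0 * V None 1 * V None 2 \<noteq> 0"
      hence "lam (xyz (pw 0)) Z \<noteq> 0" using \<kappa>(1) \<kappa>(2)[OF adm_pw[of 0]] by (simp add: xyz_def)
      thus ?thesis using adm_pw[of 0] by blast
    next
      assume "\<exists>i\<le>2. bq m i (V None) \<noteq> 0"
      thus ?thesis using \<kappa> adm_bq by (metis mult_eq_0_iff)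
    qed
  next
    case True
    define p where "p = y None"
    have p: "p \<in> S" "y None = p" using True by (auto simp: p_def)
    have w: "\<exists>l\<le>2. V (Some p) l \<noteq> 0" "dot (V (Some p)) (R p) = 0"
      using reps_Some[OF y V p(1)] by (auto simp: nonzero_vecs2)
    from p(1) show ?thesis
    proof (cases rule: S_cases)
      case (edge i j k)
      obtain \<kappa> where \<kappa>: "\<kappa> \<noteq> 0" "\<And>M. form 2 (m - 1) M \<Longrightarrow> lam (xyz M) Z = \<kappa> * (V (Some p) j * R p j * M (R p))"
        "lam (bq m i) Z = 0 \<longleftrightarrow> V (Some p) i = 0"
        by (rule edge_values[OF p(1) y p(2) V Z edge]) (rule that)
      have le: "i \<le> 2" "j \<le> 2" using cyc_le[OF edge(1)] by auto
      show ?thesis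
      proof (cases "V (Some p) j = 0")
        case True
        have "V (Some p) i * R p i + V (Some p) j * R p j + V (Some p) k * R p k = 0"
          using w(2) cyc_sum[OF edge(1), of "\<lambda>l. V (Some p) l * R p l"] by (simp add: dot_eq)
        hence "V (Some p) k = 0" using True edge by simp
        hence "V (Some p) i \<noteq> 0" using w(1) True cyc_cases[OF edge(1)] by metis
        thus ?thesis using \<kappa>(3) adm_bq[OF le(1)] by blast
      next
        case False
        hence "lam (xyz (pw j)) Z \<noteq> 0" using \<kappa>(1) \<kappa>(2)[OF form_pw[OF le(2)]] edge by simp
        thus ?thesis using adm_pw[OF le(2)] by blast
      qed
    next
      case (corner i j k)
      have le: "j \<le> 2" "k \<le> 2" using cyc_le[OF corner(1)] by auto
      have "V (Some p) i * R p i + V (Some p) j * R p j + V (Some p) k * R p k = 0"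
        using w(2) cyc_sum[OF corner(1), of "\<lambda>l. V (Some p) l * R p l"] by (simp add: dot_eq)
      hence "V (Some p) i = 0" using corner by simp
      hence "V (Some p) j \<noteq> 0 \<or> V (Some p) k \<noteq> 0" using w(1) cyc_cases[OF corner(1)] by metis
      thus ?thesis using corner_values(2,3)[OF p(1) y p(2) V Z corner] adm_bq le by blast
    qed
  qed
qed

lemma \<phi>_coords:
  assumes y: "y \<in> points Y"
  obtains W e g where "y \<in> W" "frame Y LL W e" "\<And>j. j \<le> NN \<Longrightarrow> regular Y W (g j)"
    "\<And>y. y \<in> W \<Longrightarrow> \<phi> y = (\<lambda>_. pt (\<lambda>j. if j \<le> NN then g j y else 0))"
    "\<And>A. adm m A \<Longrightarrow> quotient_on Y W (sect A) e (\<lambda>y. lam A (\<lambda>j. g j y))"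
proof -
  obtain W e where W: "y \<in> W" "frame Y LL W e" using frame_exists[OF y] by blast
  obtain g where g: "\<And>j. j \<le> NN \<Longrightarrow> quotient_on Y W (s j) e (g j)"
    "\<And>y. y \<in> W \<Longrightarrow> \<phi> y = (\<lambda>_. pt (\<lambda>j. if j \<le> NN then g j y else 0))"
    "\<And>A. adm m A \<Longrightarrow> quotient_on Y W (sect A) e (\<lambda>y. lam A (\<lambda>j. g j y))"
    by (rule frame_coords[OF W(2)]) (rule that)
  have "regular Y W (g j)" if "j \<le> NN" for j using g(1)[OF that] by (simp add: quotient_on_def)
  thus ?thesis using that[OF W _ g(2,3)] by blast
qed

lemma \<phi>_points: assumes y: "y \<in> points Y" shows "\<phi> y \<in> points (proj_space NN)"
proof -
  obtain W e g where W: "y \<in> W" "\<And>y. y \<in> W \<Longrightarrow> \<phi> y = (\<lambda>_. pt (\<lambda>j. if j \<le> NN then g j y else 0))"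
    by (rule \<phi>_coords[OF y]) (rule that)
  let ?Z = "\<lambda>j. if j \<le> NN then g j y else 0"
  have e: "\<phi> y = (\<lambda>_. pt ?Z)" by (rule W(2)[OF W(1)])
  hence "?Z \<in> \<phi> y ()" by simp
  from no_base_point[OF y this] obtain A where "lam A ?Z \<noteq> 0" by blast
  hence "?Z \<noteq> (\<lambda>_. 0)" using lam_zero by metis
  hence "?Z \<in> nonzero_vecs NN" unfolding nonzero_vecs_def by simp
  thus ?thesis unfolding e by (simp only: proj_space_simps) auto
qed

lemma base_point_free_LL: "base_point_free Y LL"
  unfolding base_point_free_def
proof
  fix y assume y: "y \<in> points Y"
  obtain W e g where W: "y \<in> W" "frame Y LL W e"
    "\<And>y. y \<in> W \<Longrightarrow> \<phi> y = (\<lambda>_. pt (\<lambda>j. if j \<le> NN then g j y else 0))"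
    "\<And>A. adm m A \<Longrightarrow> quotient_on Y W (sect A) e (\<lambda>y. lam A (\<lambda>j. g j y))"
    by (rule \<phi>_coords[OF y]) (rule that)
  have "(\<lambda>j. if j \<le> NN then g j y else 0) \<in> \<phi> y ()" unfolding W(3)[OF W(1)] by simp
  from no_base_point[OF y this] obtain A where A: "adm m A" "lam A (\<lambda>j. g j y) \<noteq> 0"
    unfolding lam_cut by blast
  have "sect A \<in> LL (points Y)" using A LL_eq by auto
  thus "\<exists>s\<in>LL (points Y). \<exists>W e g. y \<in> W \<and> frame Y LL W e \<and> quotient_on Y W s e g \<and> g y \<noteq> 0"
    using W(1,2) W(4)[OF A(1)] A(2) by blast
qed

lemma \<phi>_given_by:
  assumes y: "y \<in> points Y" shows "\<exists>W h. y \<in> W \<and> given_by Y (\<lambda>y. \<phi> y j) NN W h"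
proof -
  obtain W e g where W: "y \<in> W" "frame Y LL W e" "\<And>j. j \<le> NN \<Longrightarrow> regular Y W (g j)"
    "\<And>y. y \<in> W \<Longrightarrow> \<phi> y = (\<lambda>_. pt (\<lambda>j. if j \<le> NN then g j y else 0))"
    by (rule \<phi>_coords[OF y]) (rule that)
  have "given_by Y (\<lambda>y. \<phi> y j) NN W g"
    unfolding given_by_def using W(3,4) frame_open[OF W(2)] by simp
  thus ?thesis using W(1) by blast
qed

lemma morphism_\<phi>: "morphism Y (proj_space NN) \<phi>"
  by (rule morphismI[OF wfY wf_proj_space \<phi>_points]) (use \<phi>_given_by in auto)


subsection \<open>Recovering a point from its image\<close>

text \<open>The factor \<open>h\<close> is allowed to vanish, so the condition is an identity of
  polynomials on the torus; usefulness at a given point depends on some \<open>H l Z\<close> being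
  nonzero.\<close>

definition recovers :: "ppoint option \<Rightarrow> nat \<Rightarrow> (nat \<Rightarrow> cvec \<Rightarrow> complex) \<Rightarrow> bool" where
  "recovers i d H \<longleftrightarrow> (\<forall>l\<le>2. form NN d (H l)) \<and>
     (\<forall>v Z \<kappa>. v \<in> nonzero_vecs 2 \<longrightarrow> v 0 * v 1 * v 2 \<noteq> 0 \<longrightarrow> (\<forall>A. adm m A \<longrightarrow> lam A Z = \<kappa> * A v) \<longrightarrow>
        (\<exists>h. \<forall>l\<le>2. H l Z = h * lift_vec v i l))"

text \<open>It suffices to check on the torus that \<open>H\<close> recovers the block \<open>i\<close>, since parallelism is a
  closed condition.\<close>

lemma recovers_parallel:
  assumes H: "recovers i d H" and i: "i \<in> blocks Y" and y: "y \<in> points Y" and V: "V \<in> reps Y y"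
    and Z: "Z \<in> \<phi> y ()" and l: "l \<le> 2" "l' \<le> 2"
  shows "H l Z * V i l' = H l' Z * V i l"
proof -
  have fH: "\<And>l. l \<le> 2 \<Longrightarrow> form NN d (H l)" using H by (simp add: recovers_def)
  obtain W e g where W: "y \<in> W" "frame Y LL W e" "\<And>j. j \<le> NN \<Longrightarrow> regular Y W (g j)"
    "\<And>y. y \<in> W \<Longrightarrow> \<phi> y = (\<lambda>_. pt (\<lambda>j. if j \<le> NN then g j y else 0))"
    by (rule \<phi>_coords[OF y]) (rule that)
  have Vi: "V i \<in> nonzero_vecs 2" using reps_None[OF y V] reps_Some[OF y V] i by auto
  then obtain r where r: "r \<le> 2" "V i r \<noteq> 0" by (auto simp: nonzero_vecs2)
  have mc: "mf Y (\<lambda>j. if j = i then 1 else 0) (\<lambda>V. V i l)" if "l \<le> 2" for l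
    by (rule multiform_block[where i = i]) (use i that form_coord in auto)
  define W1 where "W1 = W \<inter> basic Y (\<lambda>V. V i r)"
  have op: "openin (zariski Y) W1" unfolding W1_def
    by (intro openin_Int frame_open[OF W(2)] openin_zariski_basic[OF mc[OF r(1)]])
  have yW1: "y \<in> W1" using W(1) basic_iff[OF wfY mc[OF r(1)] y V] r by (simp add: W1_def)
  define q where "q = (\<lambda>l. qfun Y (\<lambda>V. V i l) (\<lambda>V. V i r))"
  have rq: "regular Y W1 (q l)" if "l \<le> 2" for l unfolding q_def
    by (rule regular_subset[OF wfY regular_qfun[OF wfY mc[OF that] mc[OF r(1)]] op]) (simp add: W1_def)
  have rH: "regular Y W1 (\<lambda>y. H l (\<lambda>j. g j y))" if "l \<le> 2" for l
    by (intro regular_form_comp[OF wfY op fH[OF that]] regular_subset[OF wfY W(3) op]) (auto simp: W1_def)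
  \<comment> \<open>Dividing the block by its nonzero coordinate \<open>r\<close> turns
    proportionality into the vanishing of a regular function, to which density applies.\<close>
  define f where "f = (\<lambda>y. H l (\<lambda>j. g j y) * q l' y - H l' (\<lambda>j. g j y) * q l y)"
  have rf: "regular Y W1 f" unfolding f_def
    by (intro regular_diff[OF wfY] regular_mult[OF wfY] rH rq l)
  have cut: "H l (\<lambda>j. if j \<le> NN then g j y else 0) = H l (\<lambda>j. g j y)" if "l \<le> 2" for l y
    by (rule form_cong[OF fH[OF that]]) simp
  have "f y = 0"
  proof (rule regular_zero[OF rf yW1])
    fix v assume v: "v \<in> nonzero_vecs 2" "v 0 * v 1 * v 2 \<noteq> 0" "lift v \<in> W1"
    have vS: "pt v \<notin> S" by (rule S_axes[OF v(1,2)])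
    note lv = lift_in[OF v(1) vS]
    let ?Z = "\<lambda>j. if j \<le> NN then g j (lift v) else 0"
    have "?Z \<in> \<phi> (lift v) ()" using W(4)[of "lift v"] v(3) by (simp add: W1_def)
    from ordinary_value[OF lv(1) _ lv(2) this] obtain \<kappa> where "\<forall>A. adm m A \<longrightarrow> lam A ?Z = \<kappa> * A v"
      using lv(3) vS by auto
    hence "\<exists>h. \<forall>l\<le>2. H l ?Z = h * lift_vec v i l" using H v(1,2) unfolding recovers_def by blast
    then obtain h where "\<And>l. l \<le> 2 \<Longrightarrow> H l ?Z = h * lift_vec v i l" by blast
    hence h: "H l (\<lambda>j. g j (lift v)) = h * lift_vec v i l" if "l \<le> 2" for l
      using cut[OF that, of "lift v"] that by simp
    have "q l (lift v) = lift_vec v i l / lift_vec v i r" if "l \<le> 2" for l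
      unfolding q_def by (rule qfun_eq[OF wfY mc[OF that] mc[OF r(1)] lv(1,2)])
    thus "f (lift v) = 0" using h l unfolding f_def by simp
  qed
  moreover have "q l y = V i l / V i r" if "l \<le> 2" for l
    unfolding q_def by (rule qfun_eq[OF wfY mc[OF that] mc[OF r(1)] y V])
  ultimately have e: "H l (\<lambda>j. g j y) * V i l' = H l' (\<lambda>j. g j y) * V i l"
    using l r(2) by (simp add: f_def field_simps)
  obtain c where c: "c \<noteq> 0" "Z = (\<lambda>j. c * (if j \<le> NN then g j y else 0))"
    using Z W(4)[OF W(1)] by (auto simp: pt_iff)
  have "H l Z = c ^ d * H l (\<lambda>j. g j y)" if "l \<le> 2" for l
    unfolding c(2) form_homog[OF fH[OF that]] cut[OF that] ..
  thus ?thesis using e l by simp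
qed

text \<open>Proportional vectors represent the same point once one of the values of \<open>H\<close>
  is nonzero.\<close>

lemma recovers_mem:
  assumes H: "recovers i d H" and i: "i \<in> blocks Y" and y: "y \<in> points Y"
    and Z: "Z \<in> \<phi> y ()" and r: "r \<le> 2" "H r Z \<noteq> 0"
  shows "(\<lambda>l. if l \<le> 2 then H l Z else 0) \<in> y i"
proof -
  obtain V where V: "V \<in> reps Y y" using reps_nonempty[OF wfY y] by blast
  have Vi: "V i \<in> nonzero_vecs 2" "y i = pt (V i)" using reps_None[OF y V] reps_Some[OF y V] i by auto
  then obtain t where t: "t \<le> 2" "V i t \<noteq> 0" by (auto simp: nonzero_vecs2)
  let ?H = "\<lambda>l. if l \<le> 2 then H l Z else 0"
  have e: "?H = (\<lambda>l. (?H t / V i t) * V i l)"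
  proof (rule parallel_scale[where w = "V i" and u = ?H and ?l0.0 = t, OF _ _ t(2,1)])
    show "?H l * V i t = ?H t * V i l" if "l \<le> 2" for l
      using recovers_parallel[OF H i y V Z that t(1)] that t(1) by simp
  qed (use Vi in \<open>auto simp: vec2_def nonzero_vecs2\<close>)
  have "H r Z = (H t Z / V i t) * V i r" using fun_cong[OF e, of r] r t by simp
  hence "?H t / V i t \<noteq> 0" using r t by auto
  thus ?thesis unfolding Vi(2) pt_iff using e by blast
qed

text \<open>The common factor is \<open>xyz\<close> times \<open>v i ^ (m - 2)\<close>; the
  monomials have degree m - 1, which requires m >= 2.\<close>

lemma recovers_monomials:
  assumes i: "i \<le> 2" shows "recovers None 1 (\<lambda>l. lam (xyz (\<lambda>v. v l * v i ^ (m - 2))))"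
  unfolding recovers_def
proof (intro conjI allI impI)
  fix v Z \<kappa> assume a: "\<forall>A. adm m A \<longrightarrow> lam A Z = \<kappa> * A v"
  have f: "form 2 (m - 1) (\<lambda>v. v l * v i ^ (m - 2))" if "l \<le> 2" for l
    by (intro form_mult'[of _ 1 _ "m - 2"] form_power'[where d = 1] form_coord) (use i that m2 in auto)
  have "lam (xyz (\<lambda>v. v l * v i ^ (m - 2))) Z = (\<kappa> * (v 0 * v 1 * v 2 * v i ^ (m - 2))) * lift_vec v None l"
    if "l \<le> 2" for l
    using a adm_xyz[OF m1 f[OF that]] by (simp add: xyz_def)
  thus "\<exists>h. \<forall>l\<le>2. lam (xyz (\<lambda>v. v l * v i ^ (m - 2))) Z = h * lift_vec v None l" by blast
qed (rule form_lam)

text \<open>Designed for the \<open>i\<close>-th coordinate point, where all multiples of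
  \<open>xyz\<close> vanish but \<open>bq m j\<close> times \<open>bq m k\<close> does not. The
  product of the two \<open>xyz\<close> terms cancels the only summand not divisible by
  \<open>v i ^ m\<close>; all three entries then share the factor
  \<open>v j ^ m + v k ^ m - sg m * v i ^ m\<close>.\<close>

lemma recovers_quadrics:
  assumes c: "cyc i j k"
  shows "recovers None 2 (\<lambda>l Z. if l = i then lam (bq m j) Z * lam (bq m k) Z +
        sg m * (lam (xyz (pw k)) Z * lam (xyz (pw j)) Z)
      else if l = j then lam (xyz (pw i)) Z * (lam (xyz (pw k)) Z - sg m * lam (bq m k) Z)
      else lam (xyz (pw i)) Z * (lam (bq m j) Z + lam (xyz (pw j)) Z))"
    (is "recovers None 2 ?H")
  unfolding recovers_def
proof (intro conjI allI impI)
  have le: "i \<le> 2" "j \<le> 2" "k \<le> 2" "i \<noteq> j" "j \<noteq> k" "i \<noteq> k" using cyc_le[OF c] by auto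
  fix l :: nat
  have "form NN 2 (\<lambda>Z. lam (bq m j) Z * lam (bq m k) Z + sg m * (lam (xyz (pw k)) Z * lam (xyz (pw j)) Z))"
    "form NN 2 (\<lambda>Z. lam (xyz (pw i)) Z * (lam (xyz (pw k)) Z - sg m * lam (bq m k) Z))"
    "form NN 2 (\<lambda>Z. lam (xyz (pw i)) Z * (lam (bq m j) Z + lam (xyz (pw j)) Z))"
    by (intro form_add form_diff form_cmult form_mult'[of _ 1 _ 1] form_lam; simp)+
  thus "form NN 2 (?H l)" by (cases "l = i"; cases "l = j") simp_all
next
  have le: "i \<le> 2" "j \<le> 2" "k \<le> 2" "i \<noteq> j" "j \<noteq> k" "i \<noteq> k" using cyc_le[OF c] by auto
  fix v Z \<kappa> assume a: "\<forall>A. adm m A \<longrightarrow> lam A Z = \<kappa> * A v"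
  define x y z where "x = v i" and "y = v j" and "z = v k"
  define P Q R' where "P = x ^ (m - 1)" and "Q = y ^ (m - 1)" and "R' = z ^ (m - 1)"
  have pm: "v i ^ m = x * P" "v j ^ m = y * Q" "v k ^ m = z * R'"
    unfolding P_def Q_def R'_def x_def y_def z_def by (simp_all only: pow_m)
  have xyz: "v 0 * v 1 * v 2 = x * y * z" unfolding x_def y_def z_def by (rule cyc_prod[OF c])
  have val: "lam (bq m j) Z = \<kappa> * (z * x * (z * R' - sg m * (x * P)))"
    "lam (bq m k) Z = \<kappa> * (x * y * (x * P - sg m * (y * Q)))"
    "lam (xyz (pw i)) Z = \<kappa> * (x * y * z * P)" "lam (xyz (pw j)) Z = \<kappa> * (x * y * z * Q)"
    "lam (xyz (pw k)) Z = \<kappa> * (x * y * z * R')"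
    using a adm_bq adm_pw le bq_cyc[OF cyc_rot[OF c], of m v] bq_cyc[OF cyc_rot[OF cyc_rot[OF c]], of m v]
    unfolding pm by (simp_all only: xyz_def xyz x_def[symmetric] y_def[symmetric] z_def[symmetric]
      P_def[symmetric] Q_def[symmetric] R'_def[symmetric] simp_thms)
  have ss: "sg m * sg m = 1" by simp
  let ?h = "\<kappa> * \<kappa> * (x * (x * P) * y * z * (y * Q + z * R' - sg m * (x * P)))"
  have "?H l Z = ?h * lift_vec v None l" if "l \<le> 2" for l
  proof -
    have "lam (bq m j) Z * lam (bq m k) Z + sg m * (lam (xyz (pw k)) Z * lam (xyz (pw j)) Z) = ?h * x"
      unfolding val using ss by algebra
    hence hi: "?H i Z = ?h * x" by simp
    have "lam (xyz (pw i)) Z * (lam (xyz (pw k)) Z - sg m * lam (bq m k) Z) = ?h * y"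
      unfolding val using ss by algebra
    hence hj: "?H j Z = ?h * y" using le by simp
    have "lam (xyz (pw i)) Z * (lam (bq m j) Z + lam (xyz (pw j)) Z) = ?h * z"
      unfolding val by (simp add: algebra_simps)
    hence hk: "?H k Z = ?h * z" using le by simp
    have lv: "lift_vec v None i = x" "lift_vec v None j = y" "lift_vec v None k = z"
      by (simp_all add: x_def y_def z_def)
    from cyc_cases[OF c that] show ?thesis
      by (elim disjE; simp only: lv) (rule hi hj hk)+
  qed
  thus "\<exists>h. \<forall>l\<le>2. ?H l Z = h * lift_vec v None l" by blast
qed

text \<open>The line block follows from the plane point by joining it to \<open>p\<close>; this is
  informative only away from the fibre of \<open>p\<close>.\<close>

lemma recovers_crs:
  assumes H: "recovers None d H" and p: "p \<in> S"
  shows "recovers (Some p) d (\<lambda>l Z. crs (R p) (\<lambda>l. H l Z) l)"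
  unfolding recovers_def
proof (intro conjI allI impI)
  have fH: "form NN d (H 0)" "form NN d (H 1)" "form NN d (H 2)" using H by (simp_all add: recovers_def)
  fix l :: nat assume "l \<le> 2"
  thus "form NN d (\<lambda>Z. crs (R p) (\<lambda>l. H l Z) l)"
    unfolding le2_cases crs_def using fH by (auto simp del: One_nat_def intro!: form_diff form_cmult)
next
  fix v Z \<kappa> assume a: "v \<in> nonzero_vecs 2" "v 0 * v 1 * v 2 \<noteq> 0" "\<forall>A. adm m A \<longrightarrow> lam A Z = \<kappa> * A v"
  then obtain h where h: "\<And>l. l \<le> 2 \<Longrightarrow> H l Z = h * v l" using H unfolding recovers_def by (metis lift_vec_simps(1))
  have "crs (R p) (\<lambda>l. H l Z) l = h * lift_vec v (Some p) l" if "l \<le> 2" for l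
    using that h[of 0] h[of 1] h[of 2] p unfolding le2_cases by (auto simp: crs_def algebra_simps)
  thus "\<exists>h. \<forall>l\<le>2. crs (R p) (\<lambda>l. H l Z) l = h * lift_vec v (Some p) l" by blast
qed

text \<open>The entries \<open>j\<close> and \<open>k\<close> of the cross product are multiples of
  \<open>v i\<close>, hence come from \<open>xyz\<close> times the edge factor; the factorisation of
  \<open>bq m i\<close> gives the entry \<open>i\<close> with the same common factor.\<close>

lemma recovers_edge:
  assumes p: "p \<in> S" and c: "cyc i j k" and R: "R p i = 0" "R p j \<noteq> 0" "R p k \<noteq> 0"
  shows "recovers (Some p) 1 (\<lambda>l Z. if l = i then (- (R p k ^ m)) * lam (bq m i) Z
      else if l = j then R p k * lam (xyz (edge_factor (R p j) (R p k) j k)) Z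
      else (- R p j) * lam (xyz (edge_factor (R p j) (R p k) j k)) Z)"
    (is "recovers _ 1 ?H")
  unfolding recovers_def
proof (intro conjI allI impI)
  fix l :: nat
  have "form NN 1 (\<lambda>Z. (- (R p k ^ m)) * lam (bq m i) Z)"
    "form NN 1 (\<lambda>Z. R p k * lam (xyz (edge_factor (R p j) (R p k) j k)) Z)"
    "form NN 1 (\<lambda>Z. (- R p j) * lam (xyz (edge_factor (R p j) (R p k) j k)) Z)"
    by (intro form_cmult form_lam)+
  thus "form NN 1 (?H l)" by (cases "l = i"; cases "l = j") simp_all
next
  let ?Q = "edge_factor (R p j) (R p k) j k"
  have le: "i \<le> 2" "j \<le> 2" "k \<le> 2" "i \<noteq> j" "j \<noteq> k" "i \<noteq> k" using cyc_le[OF c] by auto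
  fix v Z \<kappa> assume a: "\<forall>A. adm m A \<longrightarrow> lam A Z = \<kappa> * A v"
  have "R p k ^ m * (v j ^ m - sg m * v k ^ m) = (R p k * v j) ^ m - (R p j * v k) ^ m"
    unfolding power_mult_distrib edge_relation[OF p c R(2,3)] by (simp add: algebra_simps)
  also have "\<dots> = (R p k * v j - R p j * v k) * ?Q v" by (rule edge_factor)
  finally have Q: "R p k ^ m * (v j ^ m - sg m * v k ^ m) = (R p k * v j - R p j * v k) * ?Q v" .
  have val: "lam (bq m i) Z = \<kappa> * (v j * v k * (v j ^ m - sg m * v k ^ m))"
    "lam (xyz ?Q) Z = \<kappa> * (v i * v j * v k * ?Q v)"
    using a adm_bq[OF le(1)] adm_xyz[OF m1 form_edge_factor[OF le(2,3)]] cyc_prod[OF c, of v]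
    by (simp_all add: bq_cyc[OF c] xyz_def)
  let ?h = "\<kappa> * (v j * v k * ?Q v)"
  have "?H l Z = ?h * lift_vec v (Some p) l" if "l \<le> 2" for l
  proof -
    have "?H i Z = - \<kappa> * (v j * v k) * (R p k ^ m * (v j ^ m - sg m * v k ^ m))" unfolding val by simp
    also have "\<dots> = ?h * crs (R p) v i" unfolding Q crs_cyc[OF c] by (simp add: algebra_simps)
    finally have hi: "?H i Z = ?h * crs (R p) v i" .
    have hj: "?H j Z = ?h * crs (R p) v j"
      using le R unfolding val crs_cyc[OF cyc_rot[OF c]] by simp
    have hk: "?H k Z = ?h * crs (R p) v k"
      using le R unfolding val crs_cyc[OF cyc_rot[OF cyc_rot[OF c]]] by simp
    from cyc_cases[OF c that] show ?thesis
      by (elim disjE; simp only: lift_vec_simps(2)[OF p]) (rule hi hj hk)+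
  qed
  thus "\<exists>h. \<forall>l\<le>2. ?H l Z = h * lift_vec v (Some p) l" by blast
qed

text \<open>The ratio of \<open>bq m j\<close> and \<open>bq m k\<close> is only asymptotically that
  of \<open>v k\<close> and \<open>v j\<close>. Adding multiples of \<open>xyz\<close>, which vanish
  on the exceptional curve, gives both the same factor
  \<open>v j ^ m + v k ^ m - sg m * v i ^ m\<close>, up to \<open>v i\<close>.\<close>

lemma recovers_corner:
  assumes p: "p \<in> S" and c: "cyc i j k" and R: "R p i \<noteq> 0" "R p j = 0" "R p k = 0"
  shows "recovers (Some p) 1 (\<lambda>l Z. if l = i then 0
      else if l = j then - (lam (bq m j) Z + lam (xyz (pw j)) Z)
      else lam (xyz (pw k)) Z - sg m * lam (bq m k) Z)"
    (is "recovers _ 1 ?H")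
  unfolding recovers_def
proof (intro conjI allI impI)
  fix l :: nat
  have "form NN 1 (\<lambda>Z. - (lam (bq m j) Z + lam (xyz (pw j)) Z))"
    "form NN 1 (\<lambda>Z. lam (xyz (pw k)) Z - sg m * lam (bq m k) Z)" "form NN 1 (\<lambda>_. 0)"
    by (intro form_minus form_add form_diff form_cmult form_lam form_zero)+
  thus "form NN 1 (?H l)" by (cases "l = i"; cases "l = j") simp_all
next
  have le: "i \<le> 2" "j \<le> 2" "k \<le> 2" "i \<noteq> j" "j \<noteq> k" "i \<noteq> k" using cyc_le[OF c] by auto
  fix v Z \<kappa> assume a: "\<forall>A. adm m A \<longrightarrow> lam A Z = \<kappa> * A v"
  define x y z where "x = v i" and "y = v j" and "z = v k"
  define P Q R' where "P = x ^ (m - 1)" and "Q = y ^ (m - 1)" and "R' = z ^ (m - 1)"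
  have pm: "v i ^ m = x * P" "v j ^ m = y * Q" "v k ^ m = z * R'"
    unfolding P_def Q_def R'_def x_def y_def z_def by (simp_all only: pow_m)
  have xyz: "v 0 * v 1 * v 2 = x * y * z" unfolding x_def y_def z_def by (rule cyc_prod[OF c])
  have val: "lam (bq m j) Z = \<kappa> * (z * x * (z * R' - sg m * (x * P)))"
    "lam (bq m k) Z = \<kappa> * (x * y * (x * P - sg m * (y * Q)))"
    "lam (xyz (pw j)) Z = \<kappa> * (x * y * z * Q)" "lam (xyz (pw k)) Z = \<kappa> * (x * y * z * R')"
    using a adm_bq adm_pw le bq_cyc[OF cyc_rot[OF c], of m v] bq_cyc[OF cyc_rot[OF cyc_rot[OF c]], of m v]
    unfolding pm by (simp_all only: xyz_def xyz x_def[symmetric] y_def[symmetric] z_def[symmetric]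
      P_def[symmetric] Q_def[symmetric] R'_def[symmetric] simp_thms)
  define E where "E = \<kappa> * (x * (z * R' - sg m * (x * P) + y * Q))"
  let ?h = "E / R p i"
  have "?H l Z = ?h * lift_vec v (Some p) l" if "l \<le> 2" for l
  proof -
    have hi: "?H i Z = ?h * crs (R p) v i" using R unfolding crs_cyc[OF c] by simp
    have "?H j Z = - (E * z)" using le unfolding val E_def by (simp add: algebra_simps)
    also have "\<dots> = ?h * crs (R p) v j"
      unfolding crs_cyc[OF cyc_rot[OF c]] z_def[symmetric] using R by simp
    finally have hj: "?H j Z = ?h * crs (R p) v j" .
    have "?H k Z = E * y" using le unfolding val E_def by (simp add: algebra_simps)
    also have "\<dots> = ?h * crs (R p) v k"
      unfolding crs_cyc[OF cyc_rot[OF cyc_rot[OF c]]] y_def[symmetric] using R by simp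
    finally have hk: "?H k Z = ?h * crs (R p) v k" .
    from cyc_cases[OF c that] show ?thesis
      by (elim disjE; simp only: lift_vec_simps(2)[OF p]) (rule hi hj hk)+
  qed
  thus "\<exists>h. \<forall>l\<le>2. ?H l Z = h * lift_vec v (Some p) l" by blast
qed


subsection \<open>The contracted curves\<close>

definition contracted :: "(ppoint option \<Rightarrow> ppoint) set" where
  "contracted = (\<Union>i\<le>2. proper_transform S (coordinate_line i))"

lemma proper_transformI:
  assumes "y \<in> points Y" "\<And>T. openin (zariski Y) T \<Longrightarrow> y \<in> T \<Longrightarrow>
    \<exists>y'\<in>T. y' None \<in> coordinate_line i \<and> y' None \<notin> S"
  shows "y \<in> proper_transform S (coordinate_line i)"
  unfolding proper_transform_def in_closure_of topspace_zariski[OF wfY] blowdown_def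
proof (intro conjI allI impI assms(1))
  fix T assume T: "y \<in> T \<and> openin (zariski Y) T"
  from assms(2)[of T] T obtain y' where "y' \<in> T" "y' None \<in> coordinate_line i" "y' None \<notin> S" by blast
  moreover have "y' \<in> points Y" using T \<open>y' \<in> T\<close> openin_zariski_subset[OF wfY] by blast
  ultimately show "\<exists>y'. y' \<in> {y \<in> points Y. y None \<in> coordinate_line i - S} \<and> y' \<in> T" by blast
qed

lemma contracted_ordinary:
  assumes y: "y \<in> points Y" "y None \<notin> S" and V: "V \<in> reps Y y" and i: "i \<le> 2" "V None i = 0"
  shows "y \<in> contracted"
proof -
  have "y None \<in> coordinate_line i"
    using reps_None[OF y(1) V] i(2) unfolding coordinate_line_def by blast
  hence "y \<in> proper_transform S (coordinate_line i)" using y by (intro proper_transformI) auto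
  thus ?thesis using i(1) by (auto simp: contracted_def)
qed

text \<open>The line block is the coordinate line itself, so the point is its tangent direction at
  \<open>p\<close>; moving along the line inside the blow-up shows that it is a limit of points of
  the line off the centres.\<close>

lemma contracted_exceptional:
  assumes p: "p \<in> S" and y: "y \<in> points Y" "y None = p" and V: "V \<in> reps Y y"
    and i: "i \<le> 2" "R p i = 0" and w: "\<And>l. l \<le> 2 \<Longrightarrow> l \<noteq> i \<Longrightarrow> V (Some p) l = 0"
  shows "y \<in> contracted"
proof -
  have "y \<in> proper_transform S (coordinate_line i)"
  proof (rule proper_transformI[OF y(1)])
    fix T assume T: "openin (zariski Y) T" "y \<in> T"
    obtain d F where F: "mf Y d F" "y \<in> basic Y F" "basic Y F \<subseteq> T"
      using T by (auto simp: openin_zariski_iff[OF wfY])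
    \<comment> \<open>No quadratic term this time: the arc has to remain on the coordinate line
      rather than leave it.\<close>
    let ?v = "V None" and ?n = "\<lambda>_::nat. 0::complex"
    obtain u where u: "vec2 u" "y None \<in> S \<Longrightarrow> crs (R (y None)) u = V (Some (y None))"
      "\<And>n. vec2 n \<Longrightarrow> \<exists>Vt. lifted_arc V u n Vt" by (rule arc_lift[OF y(1) V]) (rule that)
    have cu: "crs (R p) u = V (Some p)" using u(2) p y by simp
    obtain Vt where "lifted_arc V u ?n Vt" using u(3)[of ?n] by (auto simp: vec2_def)
    hence Vt: "\<And>i l. i \<in> blocks Y \<Longrightarrow> is_poly (\<lambda>t. Vt t i l)" "Vt 0 = V"
      "\<And>t. t \<noteq> 0 \<Longrightarrow> arc ?v u ?n t \<in> nonzero_vecs 2 \<Longrightarrow> pt (arc ?v u ?n t) \<notin> S \<Longrightarrow>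
          Vt t \<in> reps Y (lift (arc ?v u ?n t))" unfolding lifted_arc_def by blast+
    obtain c where c: "c \<noteq> 0" "?v = (\<lambda>l. c * R p l)" using multiple_of_R[OF p V y(2)] by auto
    have Vp: "V (Some p) \<in> nonzero_vecs 2" by (rule reps_Some(1)[OF y(1) V p])
    obtain j k where cy: "cyc i j k" using cyc_ex[OF i(1)] by blast
    have le: "j \<le> 2" "k \<le> 2" "i \<noteq> j" "i \<noteq> k" using cyc_le[OF cy] by auto
    have wi: "V (Some p) i \<noteq> 0" using Vp w by (auto simp: nonzero_vecs2)
    have ui: "u i = 0"
    proof -
      have "dot (V (Some p)) u = 0" using dot_crs(2)[of "R p" u] cu by simp
      hence "V (Some p) i * u i + V (Some p) j * u j + V (Some p) k * u k = 0"
        using cyc_sum[OF cy, of "\<lambda>l. V (Some p) l * u l"] by (simp add: dot_eq)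
      thus ?thesis using wi w[of j] w[of k] le by simp
    qed
    let ?a = "arc ?v u ?n"
    have ai: "?a t i = 0" for t using c(2) i(2) ui by (simp add: arc_def)
    have va: "vec2 (?a t)" for t
      by (rule vec2_arc) (use reps_None[OF y(1) V] u in \<open>auto simp: nonzero_vecs2 vec2_def\<close>)
    have crsa: "crs (R q) (?a t) l = crs (R q) ?v l + t * crs (R q) u l" for q t l
      by (simp add: crs_arc) (simp add: crs_def)
    \<comment> \<open>If this cross product vanished identically, \<open>V None\<close> and
      \<open>u\<close> would both be multiples of \<open>R q\<close>, and their cross product, a
      nonzero multiple of \<open>V (Some p)\<close>, would be zero.\<close>
    have fin: "finite {t. crs (R q) (?a t) = (\<lambda>_. 0)}" if q: "q \<in> S" for q
    proof -
      have "\<exists>l\<le>2. crs (R q) ?v l \<noteq> 0 \<or> crs (R q) u l \<noteq> 0"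
      proof (rule ccontr)
        assume "\<not> (\<exists>l\<le>2. crs (R q) ?v l \<noteq> 0 \<or> crs (R q) u l \<noteq> 0)"
        hence n: "crs (R q) ?v l = 0" "crs (R q) u l = 0" if "l \<le> 2" for l using that by blast+
        have zz: "crs (R q) w = (\<lambda>_. 0)" if "\<And>l. l \<le> 2 \<Longrightarrow> crs (R q) w l = 0" for w
          by (rule vec2_eqI[OF vec2_crs]) (use that in \<open>simp_all add: vec2_def\<close>)
        have z: "crs (R q) ?v = (\<lambda>_. 0)" "crs (R q) u = (\<lambda>_. 0)" by (rule zz, rule n, assumption)+
        obtain l0 where l0: "l0 \<le> 2" "R q l0 \<noteq> 0" "vec2 (R q)" using R_in(2)[OF q] by (auto simp: nonzero_vecs2)
        have "?v = (\<lambda>l. (?v l0 / R q l0) * R q l)"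
          by (rule crs_zero_imp[OF z(1) l0(3) _ l0(2,1)]) (use reps_None[OF y(1) V] in \<open>simp add: nonzero_vecs2\<close>)
        then obtain b where b: "?v = (\<lambda>l. b * R q l)" by (rule that)
        obtain b' where b': "u = (\<lambda>l. b' * R q l)" using crs_zero_imp[OF z(2) l0(3) u(1) l0(2,1)] by blast
        have "crs ?v u = (\<lambda>_. 0)" unfolding b b' crs_scale by simp
        moreover have "crs ?v u = (\<lambda>l. c * V (Some p) l)"
          using crs_scale[of c "R p" 1 u] unfolding c(2) cu by simp
        ultimately have "c * V (Some p) i = 0" by metis
        thus False using wi c(1) by simp
      qed
      then obtain l where l: "crs (R q) ?v l \<noteq> 0 \<or> crs (R q) u l \<noteq> 0" by blast
      have sub: "{t. crs (R q) (?a t) = (\<lambda>_. 0)} \<subseteq> {t. crs (R q) ?v l + t * crs (R q) u l = 0}"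
      proof
        fix t assume "t \<in> {t. crs (R q) (?a t) = (\<lambda>_. 0)}"
        hence "crs (R q) (?a t) l = 0" by simp
        thus "t \<in> {t. crs (R q) ?v l + t * crs (R q) u l = 0}" unfolding crsa by simp
      qed
      have pl: "is_poly (\<lambda>t. crs (R q) ?v l + t * crs (R q) u l)" by (intro is_poly_add is_poly_mult) auto
      have "\<exists>t. crs (R q) ?v l + t * crs (R q) u l \<noteq> 0"
      proof (cases "crs (R q) ?v l = 0")
        case True thus ?thesis using l by (intro exI[of _ 1]) simp
      qed (intro exI[of _ 0], simp)
      then obtain t0 where "crs (R q) ?v l + t0 * crs (R q) u l \<noteq> 0" by blast
      from finite_subset[OF sub is_poly_finite_zeros[OF pl this]] show ?thesis .
    qed
    have pF: "is_poly (\<lambda>t. F (Vt t))" by (rule multiform_is_poly[OF F(1)]) (use Vt in auto)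
    have F0: "F (Vt 0) \<noteq> 0" using Vt(2) F(2) V basicD by blast
    have "finite (insert 0 ({t. F (Vt t) = 0} \<union> (\<Union>q\<in>S. {t. crs (R q) (?a t) = (\<lambda>_. 0)})))"
      using is_poly_finite_zeros[OF pF F0] fin finite_S by auto
    then obtain t where "t \<notin> insert 0 ({t. F (Vt t) = 0} \<union> (\<Union>q\<in>S. {t. crs (R q) (?a t) = (\<lambda>_. 0)}))"
      by (rule finite_avoid)
    hence t: "t \<noteq> 0" "F (Vt t) \<noteq> 0" "\<And>q. q \<in> S \<Longrightarrow> crs (R q) (?a t) \<noteq> (\<lambda>_. 0)" by auto
    have a: "?a t \<in> nonzero_vecs 2"
    proof -
      have "?a t \<noteq> (\<lambda>_. 0)"
      proof
        assume e: "?a t = (\<lambda>_. 0)"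
        have "crs (R p) (?a t) = (\<lambda>_. 0)" unfolding e by (auto simp: crs_def)
        thus False using t(3)[OF p] by simp
      qed
      thus ?thesis using va[of t] by (simp add: nonzero_vecs_def vec2_def)
    qed
    have aS: "pt (?a t) \<notin> S"
    proof
      assume q: "pt (?a t) \<in> S"
      have "?a t \<in> pt (R (pt (?a t)))" using R_in(3)[OF q] by simp
      then obtain b where "?a t = (\<lambda>l. b * R (pt (?a t)) l)" by (auto simp: pt_iff)
      hence "crs (R (pt (?a t))) (?a t) = (\<lambda>_. 0)"
        using crs_scale[of 1 "R (pt (?a t))" b "R (pt (?a t))"] by simp
      thus False using t(3)[OF q] by simp
    qed
    have "lift (?a t) \<in> basic Y F"
      using basic_iff[OF wfY F(1) lift_in(1)[OF a aS] Vt(3)[OF t(1) a aS]] t(2) by simp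
    hence "lift (?a t) \<in> T" using F(3) by blast
    moreover have "lift (?a t) None \<in> coordinate_line i"
      unfolding lift_in(3)[OF a aS] coordinate_line_def using a ai by blast
    moreover have "lift (?a t) None \<notin> S" unfolding lift_in(3)[OF a aS] by (rule aS)
    ultimately show "\<exists>y'\<in>T. y' None \<in> coordinate_line i \<and> y' None \<notin> S" by blast
  qed
  thus ?thesis using i(1) by (auto simp: contracted_def)
qed

text \<open>The union of the contracted curves is the preimage of the common zero set of these forms.\<close>

definition tests :: "(cvec \<Rightarrow> complex) set" where
  "tests = {lam (xyz (pw i)) | i. i \<le> 2} \<union>
     {\<lambda>Z. lam (bq m i) Z * lam (bq m j) Z | i j. i \<le> 2 \<and> j \<le> 2 \<and> i \<noteq> j}"

lemma tests_pw: "i \<le> 2 \<Longrightarrow> lam (xyz (pw i)) \<in> tests"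
  unfolding tests_def by blast

lemma tests_bq: "i \<le> 2 \<Longrightarrow> j \<le> 2 \<Longrightarrow> i \<noteq> j \<Longrightarrow> (\<lambda>Z. lam (bq m i) Z * lam (bq m j) Z) \<in> tests"
  unfolding tests_def by blast

lemma form_tests: "r \<in> tests \<Longrightarrow> \<exists>d. form NN d r"
  unfolding tests_def using form_lam form_mult[OF form_lam form_lam] by fastforce

text \<open>If this coordinate vanished, incidence with the centre would kill the
  \<open>k\<close>-th one too, and the line would be the coordinate line.\<close>

lemma not_contracted_edge:
  assumes p: "p \<in> S" and y: "y \<in> points Y" "y None = p" "y \<notin> contracted" and V: "V \<in> reps Y y"
    and c: "cyc i j k" and R: "R p i = 0" "R p j \<noteq> 0" "R p k \<noteq> 0"
  shows "V (Some p) j \<noteq> 0"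
proof
  assume wj: "V (Some p) j = 0"
  have "dot (V (Some p)) (R p) = 0" by (rule reps_Some(3)[OF y(1) V p])
  hence "V (Some p) i * R p i + V (Some p) j * R p j + V (Some p) k * R p k = 0"
    using cyc_sum[OF c, of "\<lambda>l. V (Some p) l * R p l"] by (simp add: dot_eq)
  hence "V (Some p) k = 0" using wj R by simp
  hence "y \<in> contracted" using wj cyc_cases[OF c] cyc_le[OF c] by (intro contracted_exceptional[OF p y(1,2) V _ R(1)]) auto
  thus False using y(3) by simp
qed

lemma not_contracted_corner:
  assumes p: "p \<in> S" and y: "y \<in> points Y" "y None = p" "y \<notin> contracted" and V: "V \<in> reps Y y"
    and c: "cyc i j k" and R: "R p i \<noteq> 0" "R p j = 0" "R p k = 0"
  shows "V (Some p) j \<noteq> 0" "V (Some p) k \<noteq> 0"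
proof -
  have "dot (V (Some p)) (R p) = 0" by (rule reps_Some(3)[OF y(1) V p])
  hence "V (Some p) i * R p i + V (Some p) j * R p j + V (Some p) k * R p k = 0"
    using cyc_sum[OF c, of "\<lambda>l. V (Some p) l * R p l"] by (simp add: dot_eq)
  hence wi: "V (Some p) i = 0" using R by simp
  show "V (Some p) j \<noteq> 0"
  proof
    assume "V (Some p) j = 0"
    hence "y \<in> contracted" using wi cyc_cases[OF c] cyc_le[OF c] by (intro contracted_exceptional[OF p y(1,2) V _ R(3)]) auto
    thus False using y(3) by simp
  qed
  show "V (Some p) k \<noteq> 0"
  proof
    assume "V (Some p) k = 0"
    hence "y \<in> contracted" using wi cyc_cases[OF c] cyc_le[OF c] by (intro contracted_exceptional[OF p y(1,2) V _ R(2)]) auto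
    thus False using y(3) by simp
  qed
qed

lemma not_contracted_test:
  assumes y: "y \<in> points Y" "y \<notin> contracted" and Z: "Z \<in> \<phi> y ()"
  shows "\<exists>r\<in>tests. r Z \<noteq> 0"
proof -
  obtain V where V: "V \<in> reps Y y" using reps_nonempty[OF wfY y(1)] by blast
  show ?thesis
  proof (cases "y None \<in> S")
    case False
    have nz: "V None i \<noteq> 0" if "i \<le> 2" for i using contracted_ordinary[OF y(1) False V that] y(2) by blast
    obtain \<kappa> where \<kappa>: "\<kappa> \<noteq> 0" "\<And>A. adm m A \<Longrightarrow> lam A Z = \<kappa> * A (V None)"
      using ordinary_value[OF y(1) False V Z] by blast
    have "lam (xyz (pw 0)) Z \<noteq> 0" using \<kappa>(1) \<kappa>(2)[OF adm_pw[of 0]] nz by (simp add: xyz_def)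
    thus ?thesis using tests_pw[of 0] by blast
  next
    case True
    define p where "p = y None"
    have p: "p \<in> S" "y None = p" using True by (auto simp: p_def)
    from p(1) show ?thesis
    proof (cases rule: S_cases)
      case (edge i j k)
      have le: "j \<le> 2" using cyc_le[OF edge(1)] by auto
      obtain \<kappa> where \<kappa>: "\<kappa> \<noteq> 0" "\<And>M. form 2 (m - 1) M \<Longrightarrow> lam (xyz M) Z = \<kappa> * (V (Some p) j * R p j * M (R p))"
        by (rule edge_values[OF p(1) y(1) p(2) V Z edge]) (rule that)
      have "lam (xyz (pw j)) Z \<noteq> 0"
        using \<kappa>(1) \<kappa>(2)[OF form_pw[OF le]] edge not_contracted_edge[OF p(1) y(1) p(2) y(2) V edge] by simp
      thus ?thesis using tests_pw[OF le] by blast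
    next
      case (corner i j k)
      have le: "j \<le> 2" "k \<le> 2" "j \<noteq> k" using cyc_le[OF corner(1)] by auto
      have "lam (bq m j) Z * lam (bq m k) Z \<noteq> 0"
        using corner_values(2,3)[OF p(1) y(1) p(2) V Z corner] not_contracted_corner[OF p(1) y(1) p(2) y(2) V corner] by simp
      thus ?thesis by (intro bexI[OF _ tests_bq[OF le]])
    qed
  qed
qed

lemma preimage_open:
  assumes "openin (zariski (proj_space NN)) U" shows "openin (zariski Y) {y \<in> points Y. \<phi> y \<in> U}"
  using morphism_\<phi> assms unfolding morphism_def continuous_map_def topspace_zariski[OF wfY] by blast

lemma reps_proj_space: "Z \<in> reps (proj_space n) z \<longleftrightarrow> Z () \<in> z ()"
  by (auto simp: PiE_def extensional_def)

lemma \<phi>_basic_iff: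
  assumes "y \<in> points Y" "Z \<in> \<phi> y ()" "form NN d r"
  shows "\<phi> y \<in> basic (proj_space NN) (\<lambda>Z. r (Z ())) \<longleftrightarrow> r Z \<noteq> 0"
  using basic_iff[OF wf_proj_space mf_proj_space[OF assms(3)] \<phi>_points[OF assms(1)], of "\<lambda>_. Z"]
    assms(2) reps_proj_space by simp

lemma \<phi>_nonempty: "y \<in> points Y \<Longrightarrow> \<exists>Z. Z \<in> \<phi> y ()"
  using \<phi>_points[of y] PP_nonempty[of "\<phi> y ()" NN] by (auto simp: PiE_def)

text \<open>On a coordinate line off the configuration \<open>xyz\<close> and two of the
  \<open>bq\<close> vanish, so every test does. A nonzero test holds on an open set, which would
  meet that part of the line if the point were in its closure.\<close>

lemma test_not_contracted:
  assumes y: "y \<in> points Y" and Z: "Z \<in> \<phi> y ()" and r: "r \<in> tests" "r Z \<noteq> 0"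
  shows "y \<notin> contracted"
proof
  assume "y \<in> contracted"
  then obtain i where i: "i \<le> 2" "y \<in> proper_transform S (coordinate_line i)" by (auto simp: contracted_def)
  obtain d where fr: "form NN d r" using form_tests[OF r(1)] by blast
  let ?B = "basic (proj_space NN) (\<lambda>Z. r (Z ()))"
  have op: "openin (zariski Y) {y \<in> points Y. \<phi> y \<in> ?B}"
    by (rule preimage_open) (rule openin_zariski_basic[OF mf_proj_space[OF fr]])
  have yB: "y \<in> {y \<in> points Y. \<phi> y \<in> ?B}" using \<phi>_basic_iff[OF y Z fr] r y by simp
  have cl: "\<forall>T. y \<in> T \<and> openin (zariski Y) T \<longrightarrow>
      (\<exists>y'. y' \<in> {y \<in> points Y. y None \<in> coordinate_line i - S} \<and> y' \<in> T)"
    using i(2) unfolding proper_transform_def in_closure_of blowdown_def by (elim CollectE conjE)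
  from cl[rule_format, OF conjI[OF yB op]]
  obtain y' where y': "y' \<in> points Y" "y' None \<in> coordinate_line i" "y' None \<notin> S" "\<phi> y' \<in> ?B"
    by auto
  obtain V where V: "V \<in> reps Y y'" using reps_nonempty[OF wfY y'(1)] by blast
  obtain Z' where Z': "Z' \<in> \<phi> y' ()" using \<phi>_nonempty[OF y'(1)] by blast
  have r': "r Z' \<noteq> 0" using \<phi>_basic_iff[OF y'(1) Z' fr] y'(4) by simp
  obtain v' where v': "y' None = pt v'" "v' i = 0" using y'(2) by (auto simp: coordinate_line_def)
  have "V None \<in> pt v'" using reps_None[OF y'(1) V] v' pt_self[of "V None"] by simp
  hence vi: "V None i = 0" using v'(2) by (auto simp: pt_iff)
  obtain \<kappa> where \<kappa>: "\<And>A. adm m A \<Longrightarrow> lam A Z' = \<kappa> * A (V None)"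
    using ordinary_value[OF y'(1,3) V Z'] by blast
  obtain j k where c: "cyc i j k" using cyc_ex[OF i(1)] by blast
  have bz: "bq m j (V None) = 0" "bq m k (V None) = 0"
    using bq_cyc[OF cyc_rot[OF c], of m "V None"] bq_cyc[OF cyc_rot[OF cyc_rot[OF c]], of m "V None"] vi by simp_all
  have xz: "xyz M (V None) = 0" for M using cyc_prod[OF c, of "V None"] vi by (simp add: xyz_def)
  from r(1) consider a where "a \<le> 2" "r = lam (xyz (pw a))"
    | a b where "a \<le> 2" "b \<le> 2" "a \<noteq> b" "r = (\<lambda>Z. lam (bq m a) Z * lam (bq m b) Z)"
    unfolding tests_def by blast
  thus False
  proof cases
    case 1
    thus ?thesis using r' \<kappa>[OF adm_pw[OF 1(1)]] xz by simp
  next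
    case 2
    have "bq m a (V None) = 0 \<or> bq m b (V None) = 0"
      using cyc_cases[OF c 2(1)] cyc_cases[OF c 2(2)] 2(3) bz by auto
    thus ?thesis using r' \<kappa>[OF adm_bq[OF 2(1)]] \<kappa>[OF adm_bq[OF 2(2)]] 2(4) by auto
  qed
qed

text \<open>Monomials work whenever some \<open>xyz\<close> value is nonzero, that is, off the
  configuration and over its edge points; over coordinate points the quadrics take over through
  their entry \<open>i\<close>.\<close>

lemma inverse_None:
  assumes y: "y \<in> points Y" "y \<notin> contracted" and Z: "Z \<in> \<phi> y ()"
  shows "\<exists>d H r. recovers None d H \<and> r \<le> 2 \<and> H r Z \<noteq> 0"
proof -
  obtain V where V: "V \<in> reps Y y" using reps_nonempty[OF wfY y(1)] by blast
  have pow2: "x * x ^ (m - 2) = (x :: complex) ^ (m - 1)" for x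
  proof -
    have "Suc (m - 2) = m - 1" using m2 by simp
    thus ?thesis by (metis power_Suc)
  qed
  show ?thesis
  proof (cases "y None \<in> S")
    case False
    have nz: "V None i \<noteq> 0" if "i \<le> 2" for i using contracted_ordinary[OF y(1) False V that] y(2) by blast
    obtain \<kappa> where \<kappa>: "\<kappa> \<noteq> 0" "\<And>A. adm m A \<Longrightarrow> lam A Z = \<kappa> * A (V None)"
      using ordinary_value[OF y(1) False V Z] by blast
    have "lam (xyz (pw 0)) Z \<noteq> 0" using \<kappa>(1) \<kappa>(2)[OF adm_pw[of 0]] nz by (simp add: xyz_def)
    hence "lam (xyz (\<lambda>v. v 0 * v 0 ^ (m - 2))) Z \<noteq> 0" unfolding pow2 .
    thus ?thesis using recovers_monomials[of 0]
      by (intro exI[of _ 1] exI[of _ "\<lambda>l. lam (xyz (\<lambda>v. v l * v 0 ^ (m - 2)))"] exI[of _ 0] conjI) simp_all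
  next
    case True
    define p where "p = y None"
    have p: "p \<in> S" "y None = p" using True by (auto simp: p_def)
    from p(1) show ?thesis
    proof (cases rule: S_cases)
      case (edge i j k)
      have le: "j \<le> 2" using cyc_le[OF edge(1)] by auto
      obtain \<kappa> where \<kappa>: "\<kappa> \<noteq> 0" "\<And>M. form 2 (m - 1) M \<Longrightarrow> lam (xyz M) Z = \<kappa> * (V (Some p) j * R p j * M (R p))"
        by (rule edge_values[OF p(1) y(1) p(2) V Z edge]) (rule that)
      have "lam (xyz (pw j)) Z \<noteq> 0"
        using \<kappa>(1) \<kappa>(2)[OF form_pw[OF le]] edge not_contracted_edge[OF p(1) y(1) p(2) y(2) V edge] by simp
      hence "lam (xyz (\<lambda>v. v j * v j ^ (m - 2))) Z \<noteq> 0" unfolding pow2 .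
      thus ?thesis using recovers_monomials[of j] le
        by (intro exI[of _ 1] exI[of _ "\<lambda>l. lam (xyz (\<lambda>v. v l * v j ^ (m - 2)))"] exI[of _ j] conjI) simp_all
    next
      case (corner i j k)
      have le: "i \<le> 2" "j \<le> 2" "k \<le> 2" using cyc_le[OF corner(1)] by auto
      have v: "lam (bq m j) Z \<noteq> 0" "lam (bq m k) Z \<noteq> 0" "lam (xyz (pw k)) Z = 0"
        using corner_values[OF p(1) y(1) p(2) V Z corner] not_contracted_corner[OF p(1) y(1) p(2) y(2) V corner]
          form_pw[OF le(3)] by auto
      show ?thesis
        by (intro exI conjI, rule recovers_quadrics[OF corner(1)], rule le(1)) (use v in simp)
    qed
  qed
qed

text \<open>A line block away from its own centre is recovered by joining with the plane point; over
  its own centre the edge or corner formula is used.\<close>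

lemma inverse_formula:
  assumes y: "y \<in> points Y" "y \<notin> contracted" and Z: "Z \<in> \<phi> y ()" and i: "i \<in> blocks Y"
  shows "\<exists>d H r. recovers i d H \<and> r \<le> 2 \<and> H r Z \<noteq> 0"
proof (cases i)
  case None
  thus ?thesis using inverse_None[OF y Z] by simp
next
  case (Some p)
  hence p: "p \<in> S" using i by auto
  obtain V where V: "V \<in> reps Y y" using reps_nonempty[OF wfY y(1)] by blast
  show ?thesis
  proof (cases "y None = p")
    case False
    obtain d H r where H: "recovers None d H" "r \<le> 2" "H r Z \<noteq> 0" using inverse_None[OF y Z] by blast
    let ?H = "\<lambda>l. if l \<le> 2 then H l Z else 0"
    have "?H \<in> y None" by (rule recovers_mem[OF H(1) _ y(1) Z H(2,3)]) simp
    moreover have "y None \<in> PP 2" using reps_None[OF y(1) V] by auto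
    ultimately have "?H \<in> nonzero_vecs 2" "pt ?H = y None" using PP_rep by auto
    hence "crs (R p) ?H \<in> nonzero_vecs 2" using False p by (intro crs_R_nonzero) auto
    then obtain l where l: "l \<le> 2" "crs (R p) ?H l \<noteq> 0" by (auto simp: nonzero_vecs2)
    have "crs (R p) ?H = crs (R p) (\<lambda>l. H l Z)" by (auto simp: crs_def)
    thus ?thesis using recovers_crs[OF H(1) p] l Some by metis
  next
    case True
    from p show ?thesis
    proof (cases rule: S_cases)
      case (edge i' j k)
      have le: "i' \<le> 2" "j \<le> 2" "k \<le> 2" "i' \<noteq> j" using cyc_le[OF edge(1)] by auto
      obtain \<kappa> where \<kappa>: "\<kappa> \<noteq> 0" "\<And>M. form 2 (m - 1) M \<Longrightarrow> lam (xyz M) Z = \<kappa> * (V (Some p) j * R p j * M (R p))"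
        by (rule edge_values[OF p y(1) True V Z edge]) (rule that)
      have nz: "lam (xyz (edge_factor (R p j) (R p k) j k)) Z \<noteq> 0"
        using \<kappa>(1) \<kappa>(2)[OF form_edge_factor[OF le(2,3)]] edge not_contracted_edge[OF p y(1) True y(2) V edge]
          edge_factor_nonzero[OF edge(3,4)] by simp
      show ?thesis unfolding Some
        by (intro exI conjI, rule recovers_edge[OF p edge], rule le(2)) (use nz edge le in simp)
    next
      case (corner i' j k)
      have le: "i' \<le> 2" "j \<le> 2" "k \<le> 2" "i' \<noteq> j" using cyc_le[OF corner(1)] by auto
      have nz: "lam (bq m j) Z \<noteq> 0" "lam (xyz (pw j)) Z = 0"
        using corner_values[OF p y(1) True V Z corner] not_contracted_corner[OF p y(1) True y(2) V corner]
          form_pw[OF le(2)] by auto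
      show ?thesis unfolding Some
        by (intro exI conjI, rule recovers_corner[OF p corner], rule le(2)) (use nz le in simp)
    qed
  qed
qed


subsection \<open>The isomorphism away from the contracted curves\<close>

abbreviation "XX \<equiv> image_var Y (proj_space NN) \<phi>"

lemma XX_simps [simp]:
  "blocks XX = UNIV" "pdim XX i = NN" "points XX = \<phi> ` points Y"
  by (simp_all add: image_var_def)

lemma wf_XX: "wf_var XX"
  unfolding image_var_def using \<phi>_points by (intro wf_subvar[OF wf_proj_space]) blast

lemma contracted_subset: "contracted \<subseteq> points Y"
  unfolding contracted_def proper_transform_def using closure_of_subset_topspace[of "zariski Y"] wfY by fastforce

text \<open>The tests are functions on the target, so a point outside the contracted curves never
  shares its image with a point on them.\<close>

lemma image_minus: "points XX - \<phi> ` contracted = \<phi> ` (points Y - contracted)"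
proof -
  have n: "y \<notin> contracted" if a: "y \<in> points Y" "y' \<in> points Y - contracted" "\<phi> y = \<phi> y'" for y y'
  proof -
    obtain Z where Z: "Z \<in> \<phi> y' ()" using \<phi>_nonempty[of y'] a by blast
    obtain r where r: "r \<in> tests" "r Z \<noteq> 0" using not_contracted_test[OF _ _ Z] a by blast
    show ?thesis by (rule test_not_contracted[OF a(1) _ r]) (use Z a in simp)
  qed
  show ?thesis unfolding XX_simps
  proof (intro subset_antisym subsetI)
    fix z assume "z \<in> \<phi> ` points Y - \<phi> ` contracted"
    thus "z \<in> \<phi> ` (points Y - contracted)" by blast
  next
    fix z assume "z \<in> \<phi> ` (points Y - contracted)"
    then obtain y' where y': "y' \<in> points Y - contracted" "z = \<phi> y'" by blast
    have "z \<noteq> \<phi> y" if "y \<in> contracted" for y using n[OF _ y'(1), of y] that contracted_subset y'(2) by auto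
    thus "z \<in> \<phi> ` points Y - \<phi> ` contracted" using y' by blast
  qed
qed

lemma open_minus_contracted: "openin (zariski Y) (points Y - contracted)"
proof -
  have "closedin (zariski Y) contracted" unfolding contracted_def proper_transform_def
    by (intro closedin_Union) auto
  thus ?thesis using openin_diff[OF openin_points[OF wfY]] by blast
qed

text \<open>The image of the complement is cut out in the whole image by the nonvanishing of some
  test.\<close>

lemma open_image: "openin (zariski XX) (points XX - \<phi> ` contracted)"
proof -
  let ?U = "\<Union>r\<in>tests. basic (proj_space NN) (\<lambda>Z. r (Z ()))"
  have "openin (zariski (proj_space NN)) ?U"
  proof (intro openin_Union ballI)
    fix T assume "T \<in> (\<lambda>r. basic (proj_space NN) (\<lambda>Z. r (Z ()))) ` tests"
    then obtain r where r: "r \<in> tests" "T = basic (proj_space NN) (\<lambda>Z. r (Z ()))" by blast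
    obtain d where "form NN d r" using form_tests[OF r(1)] by blast
    from openin_zariski_basic[OF mf_proj_space[OF this]] show "openin (zariski (proj_space NN)) T" by (simp only: r(2))
  qed
  hence "openin (zariski XX) (?U \<inter> \<phi> ` points Y)"
    unfolding image_var_def using \<phi>_points by (intro openin_subvar[OF wf_proj_space]) auto
  moreover have "?U \<inter> \<phi> ` points Y = \<phi> ` (points Y - contracted)"
  proof -
    have "(\<exists>r\<in>tests. \<phi> y \<in> basic (proj_space NN) (\<lambda>Z. r (Z ()))) \<longleftrightarrow> y \<notin> contracted" if y: "y \<in> points Y" for y
    proof -
      obtain Z where Z: "Z \<in> \<phi> y ()" using \<phi>_nonempty[OF y] by blast
      show ?thesis
        using not_contracted_test[OF y _ Z] test_not_contracted[OF y Z] \<phi>_basic_iff[OF y Z] form_tests by metis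
    qed
    thus ?thesis by blast
  qed
  ultimately show ?thesis by (simp only: image_minus)
qed

lemma morphism_subvar:
  assumes "U \<subseteq> points Y" "wf_var X'" "blocks X' = UNIV" "\<And>j. pdim X' j = NN" "\<phi> ` U \<subseteq> points X'"
  shows "morphism (subvar Y U) X' \<phi>"
proof (rule morphismI[OF wf_subvar[OF wfY assms(1)] assms(2)])
  fix x j assume x: "x \<in> points (subvar Y U)"
  then obtain W h where W: "x \<in> W" "given_by Y (\<lambda>y. \<phi> y j) NN W h" using \<phi>_given_by[of x j] assms(1) by auto
  show "\<exists>W h. x \<in> W \<and> given_by (subvar Y U) (\<lambda>y. \<phi> y j) (pdim X' j) W h"
    unfolding assms(4) using given_by_subvar[OF wfY assms(1) W(2)] W(1) x by auto
qed (use assms in auto)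

lemma iso_minus_contracted:
  "isomorphism (subvar Y (points Y - contracted)) (subvar XX (points XX - \<phi> ` contracted)) \<phi>"
proof -
  let ?U = "points Y - contracted" and ?X = "subvar XX (points XX - \<phi> ` contracted)"
  have wfX: "wf_var ?X" by (rule wf_subvar[OF wf_XX]) auto
  have px: "points ?X = \<phi> ` ?U" by (simp only: subvar_simps image_minus)
  show ?thesis
  proof (rule isomorphismI[OF wf_subvar[OF wfY] wfX])
    show "morphism (subvar Y ?U) ?X \<phi>"
      by (rule morphism_subvar[OF _ wfX]) (use px in auto)
    show "\<phi> ` points (subvar Y ?U) = points ?X" by (simp only: subvar_simps image_minus)
    show "points (subvar Y ?U) \<subseteq> extensional (blocks (subvar Y ?U))"
      using points_extensional by auto
    fix y0 i assume a: "y0 \<in> points (subvar Y ?U)" "i \<in> blocks (subvar Y ?U)"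
    hence y0: "y0 \<in> points Y" "y0 \<notin> contracted" and i: "i \<in> blocks Y" by auto
    obtain Z0 where Z0: "Z0 \<in> \<phi> y0 ()" using \<phi>_nonempty[OF y0(1)] by blast
    obtain d H r where H: "recovers i d H" "r \<le> 2" "H r Z0 \<noteq> 0" using inverse_formula[OF y0 Z0 i] by blast
    have fH: "form NN d (H l)" if "l \<le> 2" for l using H(1) that by (simp add: recovers_def)
    have mH: "mf ?X (\<lambda>_. d) (\<lambda>Z. H l (Z ()))" if "l \<le> 2" for l
      using mf_proj_space[OF fH[OF that]] by (simp add: image_var_def)
    have memX: "\<phi> y0 \<in> points ?X" unfolding px using y0 by auto
    have b: "\<phi> y0 \<in> basic ?X (\<lambda>Z. H r (Z ()))"
      using basic_iff[OF wfX mH[OF H(2)] memX, of "\<lambda>_. Z0"] H(3) Z0 by (simp add: PiE_def extensional_def)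
    have "(\<lambda>l. if l \<le> 2 then H l (Z ()) else 0) \<in> y i"
      if "y \<in> points Y" "Z \<in> reps ?X (\<phi> y)" "H r (Z ()) \<noteq> 0" for y Z
    proof (rule recovers_mem[OF H(1) i that(1) _ H(2) that(3)])
      show "Z () \<in> \<phi> y ()" using that(2) by auto
    qed
    thus "\<exists>d H r. (\<forall>l\<le>pdim (subvar Y ?U) i. mf ?X d (H l)) \<and> mf ?X d r \<and> \<phi> y0 \<in> basic ?X r \<and>
        (\<forall>x\<in>points (subvar Y ?U). \<forall>Z\<in>reps ?X (\<phi> x). r Z \<noteq> 0 \<longrightarrow>
          (\<lambda>l. if l \<le> pdim (subvar Y ?U) i then H l Z else 0) \<in> x i)"
      using mH mH[OF H(2)] b
      by (intro exI[of _ "\<lambda>_. d"] exI[of _ "\<lambda>l Z. H l (Z ())"] exI[of _ "\<lambda>Z. H r (Z ())"]) simp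
  qed auto
qed

lemma iso_away: "isomorphism_away_from Y XX \<phi> contracted"
  unfolding isomorphism_away_from_def using open_minus_contracted open_image iso_minus_contracted by blast

lemma meets_minus_contracted:
  assumes "openin (zariski Y) T" "y \<in> T" shows "\<exists>y'\<in>T. y' \<in> points Y - contracted"
proof -
  obtain v where v: "v \<in> nonzero_vecs 2" "v 0 * v 1 * v 2 \<noteq> 0" "lift v \<in> T" using dense_torus[OF assms] by blast
  have vS: "pt v \<notin> S" by (rule S_axes[OF v(1,2)])
  note lv = lift_in[OF v(1) vS]
  obtain Z where Z: "Z \<in> \<phi> (lift v) ()" using \<phi>_nonempty[OF lv(1)] by blast
  obtain \<kappa> where \<kappa>: "\<kappa> \<noteq> 0" "\<And>A. adm m A \<Longrightarrow> lam A Z = \<kappa> * A v"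
    using ordinary_value[OF lv(1) _ lv(2) Z] lv(3) vS by auto
  have "lam (xyz (pw 0)) Z \<noteq> 0" using \<kappa>(1) \<kappa>(2)[OF adm_pw[of 0]] v(2) by (simp add: xyz_def)
  hence "lift v \<notin> contracted" by (intro test_not_contracted[OF lv(1) Z tests_pw]) auto
  thus ?thesis using v(3) lv(1) by blast
qed

lemma dense_open_Y: "dense_open Y (points Y - contracted)"
  unfolding dense_open_def
proof (intro conjI open_minus_contracted subset_antisym)
  show "zariski Y closure_of (points Y - contracted) \<subseteq> points Y"
    using closure_of_subset_topspace[of "zariski Y"] wfY by simp
  show "points Y \<subseteq> zariski Y closure_of (points Y - contracted)"
    unfolding in_closure_of subset_iff using meets_minus_contracted wfY by auto
qed

lemma morphism_XX: "morphism Y XX \<phi>"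
proof (rule morphismI[OF wfY wf_XX])
  fix x j assume "x \<in> points Y"
  thus "\<exists>W h. x \<in> W \<and> given_by Y (\<lambda>y. \<phi> y j) (pdim XX j) W h" unfolding XX_simps by (rule \<phi>_given_by)
qed auto

text \<open>The preimage of a neighbourhood is a nonempty open subset of the blow-up and therefore
  leaves the contracted curves.\<close>

lemma dense_open_XX: "dense_open XX (points XX - \<phi> ` contracted)"
  unfolding dense_open_def
proof (intro conjI open_image subset_antisym)
  show "zariski XX closure_of (points XX - \<phi> ` contracted) \<subseteq> points XX"
    using closure_of_subset_topspace[of "zariski XX"] topspace_zariski[OF wf_XX] by simp
  show "points XX \<subseteq> zariski XX closure_of (points XX - \<phi> ` contracted)"
  proof (rule subsetI, unfold in_closure_of image_minus topspace_zariski[OF wf_XX], intro conjI allI impI)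
    fix z T assume z: "z \<in> points XX" and T: "z \<in> T \<and> openin (zariski XX) T"
    then obtain y where y: "y \<in> points Y" "z = \<phi> y" by auto
    have "openin (zariski Y) {y \<in> points Y. \<phi> y \<in> T}"
      using morphism_XX T unfolding morphism_def continuous_map_def topspace_zariski[OF wfY] by blast
    from meets_minus_contracted[OF this, of y] obtain y' where "y' \<in> points Y - contracted" "\<phi> y' \<in> T" using y T by blast
    thus "\<exists>z'. z' \<in> \<phi> ` (points Y - contracted) \<and> z' \<in> T" by blast
  qed
qed

lemma birational: "birational_morphism Y XX \<phi>"
  unfolding birational_morphism_def
  using morphism_XX dense_open_Y dense_open_XX iso_minus_contracted by blast

end

theorem theorem5p6:
  fixes m N :: nat and S :: "ppoint set" and Y :: "ppoint option variety"
    and L :: "(ppoint option \<Rightarrow> ppoint) set \<Rightarrow> ppoint option sect set"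
  assumes "m \<ge> 2"
    and "S = dual_points (F3 m)"
    and "Y = blowup S"
    and "L = dH_minus_E S (m + 2)"
    and "N = (m\<^sup>2 + m) div 2 + 2"
  shows "base_point_free Y L \<and>
    (\<exists>s. section_basis Y L N s) \<and>
    (\<forall>s \<phi> X. section_basis Y L N s \<and> \<phi> = linear_system_map Y L N s \<and>
        X = image_var Y (proj_space N) \<phi> \<longrightarrow>
      morphism Y (proj_space N) \<phi> \<and>
      birational_morphism Y X \<phi> \<and>
      isomorphism_away_from Y X \<phi> (\<Union>i\<le>2. proper_transform S (coordinate_line i)))"
proof -
  interpret fermat m by unfold_locales (rule assms(1))
  have B: "fermat_basis m s N" if "section_basis Y L N s" for s
    by unfold_locales (use that assms in simp)
  \<comment> \<open>Freeness from base points does not mention a basis, but is derived through the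
    coordinates of one.\<close>
  obtain s where s: "section_basis Y L N s" using section_basis_exists unfolding assms(2-5) by blast
  have "base_point_free Y L" using fermat_basis.base_point_free_LL[OF B[OF s]] unfolding assms(2-4) .
  moreover have "morphism Y (proj_space N) \<phi> \<and> birational_morphism Y X \<phi> \<and>
      isomorphism_away_from Y X \<phi> (\<Union>i\<le>2. proper_transform S (coordinate_line i))"
    if s: "section_basis Y L N s" and \<phi>: "\<phi> = linear_system_map Y L N s"
      and X: "X = image_var Y (proj_space N) \<phi>" for s \<phi> X
  proof -
    interpret fb: fermat_basis m s N by (rule B[OF s])
    have e: "\<phi> = fb.\<phi>" unfolding \<phi> fb.\<phi>_def assms(2-4) ..
    show ?thesis
      using fb.morphism_\<phi> fb.birational fb.iso_away unfolding X e fb.contracted_def assms(2-4) by blast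
  qed
  ultimately show ?thesis using s by blast
qed

end
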